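(* Let $n\ge 2$, let $\mathsf M$ be a real analytic manifold of dimension $n$, let $\mathsf p\in\mathsf M$, and let $L$ be a real analytic $\mathrm{gl}$-regular operator (i.e. $(1,1)$-tensor field) defined in a sufficiently small neighbourhood of $\mathsf p$, with characteristic polynomial $$\chi_L(\lambda)=\det(\lambda\cdot\mathrm{Id}-L)=\lambda^n-f_1\lambda^{n-1}-\dots-f_n .$$ Then the following are equivalent. (i) $L$ is a Nijenhuis operator. (ii) There exists a local coordinate system $x=(x^1,\dots,x^n)$ in which $L$ takes the form $$L_{\mathsf{comp1}}(x)=\begin{pmatrix} f_1&1&0&\dots&0\\ f_2&0&1&\ddots&\vdots\\ \vdots&\vdots&\ddots&\ddots&0\\ f_{n-1}&0&\dots&0&1\\ f_n&0&\dots&0&0\end{pmatrix},$$ where $f_i=f_i(x)$ are the coefficients of the characteristic polynomial in this coordinate system, and these coefficients satisfy, for all $1\le i,j\le n-1$, the system of PDEs $$\frac{\partial f_i}{\partial x^j}=f_i\frac{\partial f_1}{\partial x^{j+1}}+\frac{\partial f_{i+1}}{\partial x^{j+1}},\qquad \frac{\partial f_n}{\partial x^j}=f_n\frac{\partial f_1}{\partial x^{j+1}} .$$ (iii) There exists a local coordinate system $x=(x^1,\dots,x^n)$ in which $L$ takes the form $$L_{\mathsf{comp2}}(x)=\begin{pmatrix}0&1&0&\dots&0\\0&0&1&\ddots&\vdots\\ \vdots&\vdots&\ddots&\ddots&0\\0&0&\dots&0&1\\ f_n&f_{n-1}&\dots&f_2&f_1\end{pmatrix},$$ where $f_i=f_i(x)$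 are the coefficients of the characteristic polynomial in this coordinate system, and these coefficients satisfy the system of PDEs $$\mathrm d\omega=0,\qquad \mathrm d(L^*\omega)=0,\qquad\text{where }\ \omega=f_n\,\mathrm dx^1+\dots+f_1\,\mathrm dx^n .$$
   Context: All objects (manifolds, tensor fields, functions, coordinate systems) are real analytic. The Nijenhuis torsion of a $(1,1)$-tensor field $L$ is $\mathcal N_L(\xi,\eta)=L^2[\xi,\eta]-L[L\xi,\eta]-L[\xi,L\eta]+[L\xi,L\eta]$ for vector fields $\xi,\eta$; $L$ is a Nijenhuis operator if $\mathcal N_L\equiv0$. A linear operator $L$ on an $n$-dimensional real vector space is $\mathrm{gl}$-regular if $\mathrm{Id},L,\dots,L^{n-1}$ are linearly independent (equivalently, its minimal and characteristic polynomials coincide; equivalently, each complex eigenvalue has exactly one Jordan block). A $(1,1)$-tensor field is $\mathrm{gl}$-regular if it is $\mathrm{gl}$-regular at every point. For a $1$-form $\omega$, $L^*\omega$ is the $1$-form $(L^*\omega)(\xi)=\omega(L\xi)$. The matrix $(L^i_j)$ of $L$ in coordinates $x$ is defined by $L\,\partial_{x^j}=\sum_i L^i_j\,\partial_{x^i}$, with $i$ the row index. *)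

theory Defs
  imports "HOL-Analysis.Analysis"
begin

section \<open>Real analytic manifolds\<close>

text \<open>Local representability by a convergent power series in several variables. A multi-index
  is a function \<open>'n \<Rightarrow> nat\<close>; \<open>has_sum\<close> is unconditional summation over all multi-indices.\<close>

definition real_analytic_at :: "(real^'n \<Rightarrow> 'b::real_normed_vector) \<Rightarrow> real^'n \<Rightarrow> bool" where
  "real_analytic_at f a \<longleftrightarrow>
     (\<exists>r>0. \<exists>c :: ('n \<Rightarrow> nat) \<Rightarrow> 'b. \<forall>u\<in>ball a r.
        ((\<lambda>\<alpha>. (\<Prod>i\<in>UNIV. (u $ i - a $ i) ^ \<alpha> i) *\<^sub>R c \<alpha>) has_sum f u) UNIV)"

definition real_analytic_on :: "(real^'n \<Rightarrow> 'b::real_normed_vector) \<Rightarrow> (real^'n) set \<Rightarrow> bool" where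
  "real_analytic_on f S \<longleftrightarrow> (\<forall>a\<in>S. real_analytic_at f a)"

text \<open>A chart is a pair of an open domain and a coordinate map; the values of the coordinate
  map outside the domain are irrelevant.\<close>

type_synonym ('m, 'n) chart = "'m set \<times> ('m \<Rightarrow> real^'n)"

abbreviation dom_of :: "('m, 'n) chart \<Rightarrow> 'm set" where
  "dom_of x \<equiv> fst x"

abbreviation coord :: "('m, 'n) chart \<Rightarrow> 'm \<Rightarrow> real^'n" where
  "coord x \<equiv> snd x"

abbreviation point_at :: "('m, 'n) chart \<Rightarrow> real^'n \<Rightarrow> 'm" where
  "point_at x \<equiv> inv_into (dom_of x) (coord x)"

definition is_chart :: "('m::topological_space, 'n::finite) chart \<Rightarrow> bool" where
  "is_chart x \<longleftrightarrow> open (dom_of x) \<and> open (coord x ` dom_of x) \<and>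
     homeomorphism (dom_of x) (coord x ` dom_of x) (coord x) (point_at x)"

definition transition :: "('m, 'n) chart \<Rightarrow> ('m, 'n) chart \<Rightarrow> real^'n \<Rightarrow> real^'n" where
  "transition x y = (\<lambda>u. coord y (point_at x u))"

definition compatible :: "('m, 'n::finite) chart \<Rightarrow> ('m, 'n) chart \<Rightarrow> bool" where
  "compatible x y \<longleftrightarrow>
     real_analytic_on (transition x y) (coord x ` (dom_of x \<inter> dom_of y)) \<and>
     real_analytic_on (transition y x) (coord y ` (dom_of x \<inter> dom_of y))"

text \<open>The manifold is the whole (Hausdorff, second countable) type \<open>'m\<close>, its dimension
  is \<open>CARD('n)\<close>.\<close>

definition analytic_atlas ::
    "('m::{t2_space, second_countable_topology}, 'n::finite) chart set \<Rightarrow> bool" where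
  "analytic_atlas A \<longleftrightarrow>
     (\<forall>x\<in>A. is_chart x) \<and> (\<Union>x\<in>A. dom_of x) = UNIV \<and> (\<forall>x\<in>A. \<forall>y\<in>A. compatible x y)"

text \<open>The local coordinate systems are the members of the maximal atlas generated by \<open>A\<close>.\<close>

definition coordinate_systems ::
    "('m::topological_space, 'n::finite) chart set \<Rightarrow> ('m, 'n) chart set" where
  "coordinate_systems A = {x. is_chart x \<and> (\<forall>y\<in>A. compatible x y)}"

section \<open>Tensor fields\<close>

text \<open>A tensor field is given by its components in every local coordinate system, subject to
  the transformation law under changes of coordinates. In particular \<open>L x q\<close> is the matrix
  of \<open>L\<close> at the point \<open>q\<close> in the coordinates \<open>x\<close>: the rows carry the upper index and
  \<open>L x q *v \<xi>\<close> are the components of \<open>L\<close> applied to the vector with components \<open>\<xi>\<close>.\<close>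

type_synonym ('m, 'n) vfield = "('m, 'n) chart \<Rightarrow> 'm \<Rightarrow> real^'n"
type_synonym ('m, 'n) opfield = "('m, 'n) chart \<Rightarrow> 'm \<Rightarrow> real^'n^'n"

definition in_coords :: "('m, 'n) chart \<Rightarrow> ('m \<Rightarrow> 'b) \<Rightarrow> real^'n \<Rightarrow> 'b" where
  "in_coords x g = (\<lambda>u. g (point_at x u))"

definition jacobian :: "('m, 'n::finite) chart \<Rightarrow> ('m, 'n) chart \<Rightarrow> 'm \<Rightarrow> real^'n \<Rightarrow> real^'n" where
  "jacobian x y q = frechet_derivative (transition x y) (at (coord x q))"

definition vector_field_on ::
    "('m::topological_space, 'n::finite) chart set \<Rightarrow> 'm set \<Rightarrow> ('m, 'n) vfield \<Rightarrow> bool" where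
  "vector_field_on A U \<xi> \<longleftrightarrow>
     (\<forall>x\<in>coordinate_systems A. real_analytic_on (in_coords x (\<xi> x)) (coord x ` (U \<inter> dom_of x))) \<and>
     (\<forall>x\<in>coordinate_systems A. \<forall>y\<in>coordinate_systems A. \<forall>q \<in> U \<inter> dom_of x \<inter> dom_of y.
        \<xi> y q = jacobian x y q (\<xi> x q))"

definition operator_field_on ::
    "('m::topological_space, 'n::finite) chart set \<Rightarrow> 'm set \<Rightarrow> ('m, 'n) opfield \<Rightarrow> bool" where
  "operator_field_on A U L \<longleftrightarrow>
     (\<forall>x\<in>coordinate_systems A. real_analytic_on (in_coords x (L x)) (coord x ` (U \<inter> dom_of x))) \<and>
     (\<forall>x\<in>coordinate_systems A. \<forall>y\<in>coordinate_systems A. \<forall>q \<in> U \<inter> dom_of x \<inter> dom_of y.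
        \<forall>v. L y q *v jacobian x y q v = jacobian x y q (L x q *v v))"

definition apply_op :: "('m, 'n::finite) opfield \<Rightarrow> ('m, 'n) vfield \<Rightarrow> ('m, 'n) vfield" where
  "apply_op L \<xi> = (\<lambda>x q. L x q *v \<xi> x q)"

definition lie_bracket :: "('m, 'n::finite) vfield \<Rightarrow> ('m, 'n) vfield \<Rightarrow> ('m, 'n) vfield" where
  "lie_bracket \<xi> \<eta> = (\<lambda>x q.
     frechet_derivative (in_coords x (\<eta> x)) (at (coord x q)) (\<xi> x q) -
     frechet_derivative (in_coords x (\<xi> x)) (at (coord x q)) (\<eta> x q))"

definition nijenhuis_torsion ::
    "('m, 'n::finite) opfield \<Rightarrow> ('m, 'n) vfield \<Rightarrow> ('m, 'n) vfield \<Rightarrow> ('m, 'n) vfield" where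
  "nijenhuis_torsion L \<xi> \<eta> = (\<lambda>x q.
     apply_op L (apply_op L (lie_bracket \<xi> \<eta>)) x q
     - apply_op L (lie_bracket (apply_op L \<xi>) \<eta>) x q
     - apply_op L (lie_bracket \<xi> (apply_op L \<eta>)) x q
     + lie_bracket (apply_op L \<xi>) (apply_op L \<eta>) x q)"

text \<open>The test vector fields may be defined on smaller open sets only, so that the notion does
  not depend on the existence of analytic vector fields on all of \<open>U\<close>.\<close>

definition nijenhuis_operator_on ::
    "('m::topological_space, 'n::finite) chart set \<Rightarrow> 'm set \<Rightarrow> ('m, 'n) opfield \<Rightarrow> bool" where
  "nijenhuis_operator_on A U L \<longleftrightarrow>
     (\<forall>V \<xi> \<eta>. open V \<longrightarrow> V \<subseteq> U \<longrightarrow> vector_field_on A V \<xi> \<longrightarrow> vector_field_on A V \<eta> \<longrightarrow>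
        (\<forall>x\<in>coordinate_systems A. \<forall>q \<in> V \<inter> dom_of x. nijenhuis_torsion L \<xi> \<eta> x q = 0))"

definition mat_power :: "real^'n^'n \<Rightarrow> nat \<Rightarrow> real^'n^'n" where
  "mat_power B k = ((\<lambda>C. B ** C) ^^ k) (mat 1)"

definition gl_regular :: "real^'n^'n \<Rightarrow> bool" where
  "gl_regular B \<longleftrightarrow>
     (\<forall>c :: nat \<Rightarrow> real. (\<Sum>k<CARD('n). c k *\<^sub>R mat_power B k) = 0 \<longrightarrow> (\<forall>k<CARD('n). c k = 0))"

definition gl_regular_on ::
    "('m::topological_space, 'n::finite) chart set \<Rightarrow> 'm set \<Rightarrow> ('m, 'n) opfield \<Rightarrow> bool" where
  "gl_regular_on A U L \<longleftrightarrow>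
     (\<forall>x\<in>coordinate_systems A. \<forall>q \<in> U \<inter> dom_of x. gl_regular (L x q))"

section \<open>Calculus in a coordinate system\<close>

text \<open>The coordinates are numbered from \<open>1\<close> to \<open>CARD('n)\<close> by an enumeration \<open>e\<close> of
  the index type, i.e. the \<open>i\<close>-th coordinate function of a chart \<open>x\<close> is
  \<open>\<lambda>q. coord x q $ e i\<close>.\<close>

definition partial_deriv ::
    "(nat \<Rightarrow> 'n::finite) \<Rightarrow> ('m, 'n) chart \<Rightarrow> nat \<Rightarrow> ('m \<Rightarrow> real) \<Rightarrow> 'm \<Rightarrow> real" where
  "partial_deriv e x j g q = deriv (\<lambda>t. in_coords x g (coord x q + t *\<^sub>R axis (e j) 1)) 0"

text \<open>In a chart, a 1-form is a function of a point (given by its coordinates) and a vector,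
  linear in the vector.\<close>

type_synonym 'n form1 = "real^'n \<Rightarrow> real^'n \<Rightarrow> real"

definition pullback_op :: "('m, 'n::finite) opfield \<Rightarrow> ('m, 'n) chart \<Rightarrow> 'n form1 \<Rightarrow> 'n form1" where
  "pullback_op L x \<omega> = (\<lambda>u v. \<omega> u (in_coords x (L x) u *v v))"

text \<open>The usual formula \<open>d\<omega>(v,w) = v(\<omega>(w)) - w(\<omega>(v)) - \<omega>([v,w])\<close> for constant vector
  fields \<open>v\<close> and \<open>w\<close>.\<close>

definition ext_deriv :: "'n::finite form1 \<Rightarrow> real^'n \<Rightarrow> real^'n \<Rightarrow> real^'n \<Rightarrow> real" where
  "ext_deriv \<omega> u v w =
     frechet_derivative (\<lambda>u'. \<omega> u' w) (at u) v - frechet_derivative (\<lambda>u'. \<omega> u' v) (at u) w"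

definition closed_form_on :: "'n::finite form1 \<Rightarrow> (real^'n) set \<Rightarrow> bool" where
  "closed_form_on \<omega> S \<longleftrightarrow> (\<forall>u\<in>S. \<forall>v w. ext_deriv \<omega> u v w = 0)"

section \<open>The two companion forms\<close>

text \<open>Entries in row \<open>i\<close> and column \<open>j\<close>, both numbered from \<open>1\<close> to \<open>n\<close>.\<close>

definition comp1_entry :: "(nat \<Rightarrow> real) \<Rightarrow> nat \<Rightarrow> nat \<Rightarrow> real" where
  "comp1_entry f i j = (if j = 1 then f i else if j = i + 1 then 1 else 0)"

definition comp2_entry :: "nat \<Rightarrow> (nat \<Rightarrow> real) \<Rightarrow> nat \<Rightarrow> nat \<Rightarrow> real" where
  "comp2_entry n f i j = (if i = n then f (n + 1 - j) else if j = i + 1 then 1 else 0)"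

text \<open>\<open>\<omega> = f\<^sub>n dx\<^sup>1 + \<dots> + f\<^sub>1 dx\<^sup>n\<close>.\<close>

definition omega_form ::
    "(nat \<Rightarrow> 'n::finite) \<Rightarrow> ('m, 'n) chart \<Rightarrow> (nat \<Rightarrow> 'm \<Rightarrow> real) \<Rightarrow> 'n form1" where
  "omega_form e x f =
     (\<lambda>u v. \<Sum>i=1..CARD('n). in_coords x (f (CARD('n) + 1 - i)) u * v $ e i)"

end

theory Submission
  imports Defs "HOL-Library.Function_Algebras" "HOL-Computational_Algebra.Field_as_Ring"
    "HOL-Computational_Algebra.Polynomial_Factorial"
begin

text \<open>Power series with a weighted \<open>\<ell>\<^sup>1\<close>-norm form a Banach algebra, in which both the analytic inverse
  function theorem and a linear Cauchy-Kovalevskaya theorem are fixed point problems for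
  contractions.

  In a chart where \<open>L\<close> is a companion matrix, the torsion involves only the differentials of the
  \<open>f\<^sub>i\<close>, and its vanishing is equivalent, point by point, to the PDE system respectively to the
  closedness of the two forms. If it vanishes near \<open>p\<close>, then it vanishes on a whole coordinate ball
  by analyticity.

  Conversely, let \<open>L\<close> be Nijenhuis. Choose coordinates such that \<open>\<xi> = \<partial>\<^sub>1\<close> is a cyclic vector at \<open>p\<close> and
  let \<open>C\<close> be the companion matrix of the functions \<open>f\<^sub>i\<close>. There is a unique matrix-valued 1-form \<open>A\<close> with
  values in the polynomials in \<open>C\<close> such that \<open>A(\<xi>) = 1\<close> and \<open>A(Lv) = C A(v)\<close>. A map \<open>H\<close> with
  \<open>dH = A \<partial>\<^sub>1H\<close> satisfies \<open>dH \<circ> L = C dH\<close>, that is, it transforms \<open>L\<close> into \<open>C\<close>. This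
  overdetermined system is integrable: differentiating the Cayley-Hamilton identity gives
  \<open>L\<^sup>*df\<^sub>i = f\<^sub>i df\<^sub>1 + df\<^sub>i\<^sub>+\<^sub>1\<close>, which together with the vanishing of the torsion yields the
  compatibility conditions. It is solved by solving the single equation obtained by contraction with
  the radial field \<open>\<Sum>\<^sub>j y\<^sub>j \<partial>\<^sub>j\<close> of the remaining variables. The image of \<open>dH\<close> at \<open>p\<close> is
  invariant under \<open>C\<close>; prescribing \<open>\<partial>\<^sub>1H\<close> at \<open>p\<close> to be a cyclic vector of \<open>C\<close> makes \<open>H\<close> a chart.\<close>

text \<open>The radial equation
  \<open>R H = \<Sum>\<^sub>j y\<^sub>j A\<^sub>j \<partial>\<^sub>1H\<close> loses one derivative,
  so a fixed point argument in one Banach space works only if inverting \<open>R\<close> regains it.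
  On monomials, \<open>R\<^sup>-\<^sup>1 y\<^sub>j \<partial>\<^sub>1\<close> trades one factor
  \<open>y\<^sub>1\<close> for \<open>y\<^sub>j\<close> and multiplies by a quotient of two degrees.
  This is the quotient of neighbouring binomial coefficients, and weighting by their reciprocals
  makes the operator a contraction in a single norm. Squeezing only the variables other than the
  first then makes the coefficients small.

  One equation yields the whole system through uniqueness: the defects \<open>E\<^sub>j =
  \<partial>\<^sub>jH - A\<^sub>j \<partial>\<^sub>1H\<close> satisfy
  \<open>\<Sum>\<^sub>j y\<^sub>j E\<^sub>j = 0\<close>, and integrability turns each
  \<open>y\<^sub>j E\<^sub>j\<close> into a solution of the same radial equation with zero data on
  the first axis.

  The linear algebra rests on one device: a condition that cuts out an invariant subspace containing
  a cyclic vector holds for all vectors.\<close>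

section \<open>A Banach algebra of power series\<close>

text \<open>As a simplification rule, \<open>zero_fun_apply\<close> eta-expands the multi-index \<open>0\<close>.\<close>

declare zero_fun_apply [simp del] plus_fun_apply [simp del]

lemmas fun_algebra_apply = zero_fun_apply plus_fun_apply

section \<open>Multi-indices, monomials and the weight\<close>

definition mdeg :: "('n::finite \<Rightarrow> nat) \<Rightarrow> nat" where
  "mdeg \<alpha> = (\<Sum>i\<in>UNIV. \<alpha> i)"

definition mpow :: "('n::finite \<Rightarrow> 'a::comm_monoid_mult) \<Rightarrow> ('n \<Rightarrow> nat) \<Rightarrow> 'a" where
  "mpow b \<alpha> = (\<Prod>i\<in>UNIV. b i ^ \<alpha> i)"

text \<open>A bare finite type has no distinguished element, so one is chosen once and for all. It
  plays the role of the first variable of the overview; charts are later adapted so that the cyclic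
  vector at \<open>p\<close> becomes the axis \<open>piv\<close>.\<close>

definition piv :: "'n::finite" where
  "piv = (SOME i. True)"

text \<open>Vandermonde's identity makes the weighted \<open>\<ell>\<^sup>1\<close>-norm submultiplicative, and \<open>wt \<alpha> \<ge> 2\<^sup>-\<^sup>d\<^sup>e\<^sup>g\<close>
  makes the series converge for \<open>\<bar>w\<^sub>i\<bar> \<le> 1/2\<close>. The dependence on the distinguished variable
  \<open>piv\<close> matters only for the Cauchy-Kovalevskaya theorem.\<close>

definition wt :: "('n::finite \<Rightarrow> nat) \<Rightarrow> real" where
  "wt \<alpha> = 1 / real (mdeg \<alpha> choose \<alpha> piv)"

definition unit_idx :: "'n::finite \<Rightarrow> 'n \<Rightarrow> nat" where
  "unit_idx i = (\<lambda>j. if j = i then 1 else 0)"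

lemma mdeg_0 [simp]: "mdeg 0 = 0" and mdeg_add: "mdeg (\<alpha> + \<beta>) = mdeg \<alpha> + mdeg \<beta>"
  by (simp_all add: mdeg_def sum.distrib fun_algebra_apply)

lemma mdeg_unit [simp]: "mdeg (unit_idx i) = 1"
  by (simp add: mdeg_def unit_idx_def)

lemma le_mdeg: "\<alpha> i \<le> mdeg \<alpha>"
  unfolding mdeg_def by (rule member_le_sum) auto

lemma mdeg_eq_0: "mdeg \<alpha> = 0 \<longleftrightarrow> \<alpha> = 0"
  by (auto simp: mdeg_def fun_eq_iff fun_algebra_apply)

lemma mpow_0 [simp]: "mpow b 0 = 1"
  by (simp add: mpow_def fun_algebra_apply)

lemma mpow_add: "mpow b (\<alpha> + \<beta>) = mpow b \<alpha> * mpow b \<beta>"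
  by (simp add: mpow_def power_add prod.distrib fun_algebra_apply)

lemma mpow_unit [simp]: "mpow b (unit_idx i) = b i"
proof -
  have "mpow b (unit_idx i) = (\<Prod>j\<in>UNIV. if j = i then b j else 1)"
    unfolding mpow_def unit_idx_def by (rule prod.cong) auto
  then show ?thesis by simp
qed

lemma mpow_mult: "mpow (\<lambda>i. a i * b i) \<alpha> = mpow a \<alpha> * mpow b \<alpha>"
  by (simp add: mpow_def power_mult_distrib prod.distrib)

lemma mpow_const: "mpow (\<lambda>i. c) \<alpha> = c ^ mdeg \<alpha>"
  by (simp add: mpow_def mdeg_def power_sum)

lemma norm_mpow_le:
  fixes b :: "'n::finite \<Rightarrow> 'a::{real_normed_algebra_1,comm_ring_1}"
  assumes "\<And>i. norm (b i) \<le> s"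
  shows "norm (mpow b \<alpha>) \<le> s ^ mdeg \<alpha>"
proof -
  have "norm (mpow b \<alpha>) \<le> (\<Prod>i\<in>UNIV. norm (b i ^ \<alpha> i))"
    unfolding mpow_def by (rule norm_prod_le)
  also have "\<dots> \<le> (\<Prod>i\<in>UNIV. s ^ \<alpha> i)"
    by (rule prod_mono) (auto intro: order_trans[OF norm_power_ineq power_mono[OF assms]])
  also have "\<dots> = s ^ mdeg \<alpha>" by (simp add: mdeg_def power_sum)
  finally show ?thesis .
qed

lemma wt_pos: "wt \<alpha> > 0"
  by (simp add: wt_def le_mdeg)

lemma wt_nonneg [simp]: "wt \<alpha> \<ge> 0" using wt_pos[of \<alpha>] by linarith

lemma wt_le_1: "wt \<alpha> \<le> 1"
proof -
  have "mdeg \<alpha> choose \<alpha> piv > 0" by (rule zero_less_binomial[OF le_mdeg])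
  then have "1 \<le> real (mdeg \<alpha> choose \<alpha> piv)" by linarith
  then show ?thesis unfolding wt_def by (subst divide_le_eq_1) linarith
qed

lemma wt_0 [simp]: "wt 0 = 1" by (simp add: wt_def fun_algebra_apply)

lemma wt_ge: "(1/2) ^ mdeg \<alpha> \<le> wt \<alpha>"
proof -
  have "real (mdeg \<alpha> choose \<alpha> piv) \<le> 2 ^ mdeg \<alpha>"
    using binomial_le_pow2[of "mdeg \<alpha>" "\<alpha> piv"] by (metis of_nat_le_iff of_nat_numeral of_nat_power)
  moreover have "real (mdeg \<alpha> choose \<alpha> piv) > 0" by (simp add: le_mdeg)
  ultimately show ?thesis by (simp add: wt_def power_one_over divide_left_mono)
qed

text \<open>A single summand of Vandermonde's identity is at most the whole sum.\<close>

lemma binomial_mult_le: "(a choose b) * (c choose d) \<le> (a + c) choose (b + d)"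
proof -
  have "(a choose b) * (c choose d) = (a choose b) * (c choose (b + d - b))" by simp
  also have "\<dots> \<le> (\<Sum>k\<le>b+d. (a choose k) * (c choose (b + d - k)))"
    by (rule member_le_sum) auto
  finally show ?thesis by (simp add: vandermonde)
qed

lemma wt_add_le: "wt (\<alpha> + \<beta>) \<le> wt \<alpha> * wt \<beta>"
proof -
  have p: "real (mdeg \<alpha> choose \<alpha> piv) > 0" "real (mdeg \<beta> choose \<beta> piv) > 0" by (simp_all add: le_mdeg)
  have "real (mdeg \<alpha> choose \<alpha> piv) * real (mdeg \<beta> choose \<beta> piv) \<le> real (mdeg (\<alpha> + \<beta>) choose (\<alpha> + \<beta>) piv)"
    unfolding mdeg_add plus_fun_apply of_nat_mult[symmetric] of_nat_le_iff by (rule binomial_mult_le)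
  then have "1 / real (mdeg (\<alpha> + \<beta>) choose (\<alpha> + \<beta>) piv) \<le>
      1 / (real (mdeg \<alpha> choose \<alpha> piv) * real (mdeg \<beta> choose \<beta> piv))"
    using p zero_less_binomial[OF le_mdeg[of "\<alpha> + \<beta>" piv]]
    by (intro divide_left_mono mult_pos_pos) auto
  then show ?thesis by (simp add: wt_def fun_algebra_apply)
qed

section \<open>Cauchy products of coefficient families\<close>

definition splits :: "('n::finite \<Rightarrow> nat) \<Rightarrow> (('n \<Rightarrow> nat) \<times> ('n \<Rightarrow> nat)) set" where
  "splits \<gamma> = {p. fst p + snd p = \<gamma>}"

lemma finite_splits [simp]: "finite (splits \<gamma>)"
proof -
  have "finite (Pi\<^sub>E UNIV (\<lambda>i. {..\<gamma> i}))" by (rule finite_PiE) auto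
  moreover have "{\<alpha>. \<forall>i. \<alpha> i \<le> \<gamma> i} \<subseteq> Pi\<^sub>E UNIV (\<lambda>i. {..\<gamma> i})" by auto
  ultimately have *: "finite {\<alpha>. \<forall>i. \<alpha> i \<le> \<gamma> i}" by (rule rev_finite_subset)
  have "splits \<gamma> \<subseteq> {\<alpha>. \<forall>i. \<alpha> i \<le> \<gamma> i} \<times> {\<alpha>. \<forall>i. \<alpha> i \<le> \<gamma> i}"
    by (auto simp: splits_def fun_algebra_apply)
  then show ?thesis by (rule finite_subset) (use * in simp)
qed

definition conv :: "(('n::finite \<Rightarrow> nat) \<Rightarrow> real) \<Rightarrow> (('n \<Rightarrow> nat) \<Rightarrow> real) \<Rightarrow> ('n \<Rightarrow> nat) \<Rightarrow> real" where
  "conv a b \<gamma> = (\<Sum>p\<in>splits \<gamma>. a (fst p) * b (snd p))"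

lemma conv_commute: "conv a b = conv b a"
proof
  fix \<gamma>
  show "conv a b \<gamma> = conv b a \<gamma>"
    unfolding conv_def
    by (rule sum.reindex_bij_witness[where i=prod.swap and j=prod.swap])
       (auto simp: splits_def add.commute mult.commute)
qed

text \<open>Both sides sum over triples of multi-indices adding up to \<open>\<gamma>\<close>; the
  bijection merely regroups the nested splittings.\<close>

lemma conv_assoc: "conv (conv a b) c = conv a (conv b c)"
proof
  fix \<gamma>
  have "conv (conv a b) c \<gamma> = (\<Sum>p\<in>splits \<gamma>. \<Sum>q\<in>splits (fst p). a (fst q) * b (snd q) * c (snd p))"
    by (simp add: conv_def sum_distrib_right)
  also have "\<dots> = (\<Sum>(p,q)\<in>Sigma (splits \<gamma>) (\<lambda>p. splits (fst p)). a (fst q) * b (snd q) * c (snd p))"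
    by (rule sum.Sigma) auto
  also have "\<dots> = (\<Sum>(p,q)\<in>Sigma (splits \<gamma>) (\<lambda>p. splits (snd p)). a (fst p) * (b (fst q) * c (snd q)))"
    by (rule sum.reindex_bij_witness[where
          i="\<lambda>(p,q). ((fst p + fst q, snd q), (fst p, fst q))" and
          j="\<lambda>(p,q). ((fst q, snd q + snd p), (snd q, snd p))"])
       (auto simp: splits_def add.assoc mult.assoc)
  also have "\<dots> = (\<Sum>p\<in>splits \<gamma>. \<Sum>q\<in>splits (snd p). a (fst p) * (b (fst q) * c (snd q)))"
    by (rule sum.Sigma[symmetric]) auto
  also have "\<dots> = conv a (conv b c) \<gamma>"
    by (simp add: conv_def sum_distrib_left)
  finally show "conv (conv a b) c \<gamma> = conv a (conv b c) \<gamma>" .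
qed

text \<open>The family of all products is absolutely summable over pairs of indices. Summed by rows
  it gives the product of the sums; summed along the finite fibres of addition it gives the Cauchy
  product.\<close>

lemma conv_has_sum:
  fixes a b :: "('n::finite \<Rightarrow> nat) \<Rightarrow> real"
  assumes a: "(\<lambda>x. norm (a x)) summable_on UNIV" and b: "(\<lambda>x. norm (b x)) summable_on UNIV"
  shows "(conv a b has_sum (infsum a UNIV * infsum b UNIV)) UNIV"
    and "(\<lambda>x. norm (conv a b x)) summable_on UNIV"
proof -
  have sa: "a summable_on UNIV" and sb: "b summable_on UNIV"
    using a b by (auto intro: abs_summable_summable)
  define F where "F = (\<lambda>p. a (fst p) * b (snd p))"
  have "(\<lambda>x. norm (F x)) summable_on UNIV \<times> UNIV"
    unfolding Infinite_Sum.abs_summable_on_Sigma_iff F_def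
    using a b by (auto simp: abs_mult infsum_cmult_right' intro!: summable_on_cmult_right summable_on_cmult_left)
  then have F: "F summable_on UNIV \<times> UNIV" by (rule abs_summable_summable)
  have "((\<lambda>x. a x * infsum b UNIV) has_sum infsum F (UNIV \<times> UNIV)) UNIV"
    by (rule has_sum_SigmaD[OF has_sum_infsum[OF F]])
       (auto simp: F_def intro!: has_sum_cmult_right has_sum_infsum sb)
  moreover have "((\<lambda>x. a x * infsum b UNIV) has_sum (infsum a UNIV * infsum b UNIV)) UNIV"
    by (intro has_sum_cmult_left has_sum_infsum sa)
  ultimately have eq: "infsum F (UNIV \<times> UNIV) = infsum a UNIV * infsum b UNIV"
    by (rule has_sum_unique)
  have bij: "bij_betw snd (Sigma UNIV splits) (UNIV \<times> UNIV :: (('n \<Rightarrow> nat) \<times> ('n \<Rightarrow> nat)) set)"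
    by (rule bij_betwI[where g="\<lambda>p. (fst p + snd p, p)"]) (auto simp: splits_def)
  have "(F has_sum (infsum a UNIV * infsum b UNIV)) (UNIV \<times> UNIV)"
    using has_sum_infsum[OF F] eq by simp
  then have "((\<lambda>x. F (snd x)) has_sum (infsum a UNIV * infsum b UNIV)) (Sigma UNIV splits)"
    using has_sum_reindex_bij_betw[OF bij, of F] by blast
  then show *: "(conv a b has_sum (infsum a UNIV * infsum b UNIV)) UNIV"
    by (rule has_sum_SigmaD) (auto simp: conv_def F_def)
  show "(\<lambda>x. norm (conv a b x)) summable_on UNIV"
    using has_sum_imp_summable[OF *] summable_on_iff_abs_summable_on_real by blast
qed

text \<open>Made a type so that class-based results apply to it: the geometric series in a Banach
  algebra and the contraction principle.\<close>

typedef (overloaded) 'n pseries = "{c :: ('n::finite \<Rightarrow> nat) \<Rightarrow> real. (\<lambda>\<alpha>. norm (c \<alpha> * wt \<alpha>)) summable_on UNIV}"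
  morphisms pcoeff Pseries
  by (rule exI[of _ "\<lambda>_. 0"]) auto

setup_lifting type_definition_pseries

lemma pcoeff_summable: "(\<lambda>\<alpha>. norm (pcoeff C \<alpha> * wt \<alpha>)) summable_on UNIV"
  using pcoeff[of C] by simp

lemma pcoeff_summable': "(\<lambda>\<alpha>. \<bar>pcoeff C \<alpha>\<bar> * wt \<alpha>) summable_on UNIV"
  using pcoeff_summable[of C] by (simp add: abs_mult)

lemma pcoeff_Pseries: "(\<lambda>\<alpha>. \<bar>c \<alpha>\<bar> * wt \<alpha>) summable_on UNIV \<Longrightarrow> pcoeff (Pseries c) = c"
  by (rule Pseries_inverse) (simp add: abs_mult)

lemma pseries_eqI: "(\<And>\<alpha>. pcoeff C \<alpha> = pcoeff D \<alpha>) \<Longrightarrow> C = D"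
  by (metis pcoeff_inject ext)

text \<open>Submultiplicativity of the weight distributes \<open>wt \<gamma>\<close> over the two
  factors of each summand, which is all that the algebra norm inequality needs.\<close>

lemma conv_wt_bound: "\<bar>conv a b \<gamma>\<bar> * wt \<gamma> \<le> conv (\<lambda>\<alpha>. \<bar>a \<alpha>\<bar> * wt \<alpha>) (\<lambda>\<alpha>. \<bar>b \<alpha>\<bar> * wt \<alpha>) \<gamma>"
proof -
  have "\<bar>conv a b \<gamma>\<bar> * wt \<gamma> \<le> (\<Sum>p\<in>splits \<gamma>. \<bar>a (fst p) * b (snd p)\<bar>) * wt \<gamma>"
    unfolding conv_def by (intro mult_right_mono sum_abs) auto
  also have "\<dots> = (\<Sum>p\<in>splits \<gamma>. \<bar>a (fst p)\<bar> * \<bar>b (snd p)\<bar> * wt \<gamma>)"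
    by (simp add: sum_distrib_right abs_mult)
  also have "\<dots> \<le> (\<Sum>p\<in>splits \<gamma>. \<bar>a (fst p)\<bar> * \<bar>b (snd p)\<bar> * (wt (fst p) * wt (snd p)))"
    by (intro sum_mono mult_left_mono) (auto simp: splits_def intro: wt_add_le)
  also have "\<dots> = conv (\<lambda>\<alpha>. \<bar>a \<alpha>\<bar> * wt \<alpha>) (\<lambda>\<alpha>. \<bar>b \<alpha>\<bar> * wt \<alpha>) \<gamma>"
    unfolding conv_def by (intro sum.cong) (auto simp: algebra_simps)
  finally show ?thesis .
qed

lemma conv_wt_summable:
  assumes "(\<lambda>\<alpha>. \<bar>a \<alpha>\<bar> * wt \<alpha>) summable_on UNIV" "(\<lambda>\<alpha>. \<bar>b \<alpha>\<bar> * wt \<alpha>) summable_on UNIV"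
  shows "(\<lambda>\<alpha>. \<bar>conv a b \<alpha>\<bar> * wt \<alpha>) summable_on UNIV"
    and "infsum (\<lambda>\<alpha>. \<bar>conv a b \<alpha>\<bar> * wt \<alpha>) UNIV \<le>
      infsum (\<lambda>\<alpha>. \<bar>a \<alpha>\<bar> * wt \<alpha>) UNIV * infsum (\<lambda>\<alpha>. \<bar>b \<alpha>\<bar> * wt \<alpha>) UNIV"
proof -
  note cv = conv_has_sum[of "\<lambda>\<alpha>. \<bar>a \<alpha>\<bar> * wt \<alpha>" "\<lambda>\<alpha>. \<bar>b \<alpha>\<bar> * wt \<alpha>"]
  have h: "(conv (\<lambda>\<alpha>. \<bar>a \<alpha>\<bar> * wt \<alpha>) (\<lambda>\<alpha>. \<bar>b \<alpha>\<bar> * wt \<alpha>) has_sum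
     (infsum (\<lambda>\<alpha>. \<bar>a \<alpha>\<bar> * wt \<alpha>) UNIV * infsum (\<lambda>\<alpha>. \<bar>b \<alpha>\<bar> * wt \<alpha>) UNIV)) UNIV"
    by (rule cv) (use assms in \<open>simp_all add: abs_mult\<close>)
  show s: "(\<lambda>\<alpha>. \<bar>conv a b \<alpha>\<bar> * wt \<alpha>) summable_on UNIV"
    by (rule summable_on_comparison_test[OF has_sum_imp_summable[OF h]])
       (auto intro: conv_wt_bound)
  show "infsum (\<lambda>\<alpha>. \<bar>conv a b \<alpha>\<bar> * wt \<alpha>) UNIV \<le>
      infsum (\<lambda>\<alpha>. \<bar>a \<alpha>\<bar> * wt \<alpha>) UNIV * infsum (\<lambda>\<alpha>. \<bar>b \<alpha>\<bar> * wt \<alpha>) UNIV"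
    by (rule has_sum_mono[OF has_sum_infsum[OF s] h]) (auto intro: conv_wt_bound)
qed

section \<open>Ring structure, norm and completeness\<close>

instantiation pseries :: (finite) comm_ring_1
begin

lift_definition zero_pseries :: "'a pseries" is "\<lambda>_. 0" by simp

lift_definition one_pseries :: "'a pseries" is "\<lambda>\<alpha>. if \<alpha> = 0 then 1 else 0"
  by (rule finite_nonzero_values_imp_summable_on, rule finite_subset[of _ "{0}"]) auto

lift_definition plus_pseries :: "'a pseries \<Rightarrow> 'a pseries \<Rightarrow> 'a pseries" is "\<lambda>c d \<alpha>. c \<alpha> + d \<alpha>"
proof -
  fix c d :: "('a \<Rightarrow> nat) \<Rightarrow> real"
  assume "(\<lambda>\<alpha>. norm (c \<alpha> * wt \<alpha>)) summable_on UNIV" "(\<lambda>\<alpha>. norm (d \<alpha> * wt \<alpha>)) summable_on UNIV"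
  then have "(\<lambda>\<alpha>. norm (c \<alpha> * wt \<alpha>) + norm (d \<alpha> * wt \<alpha>)) summable_on UNIV" by (rule summable_on_add)
  then show "(\<lambda>\<alpha>. norm ((c \<alpha> + d \<alpha>) * wt \<alpha>)) summable_on UNIV"
    by (rule Infinite_Sum.abs_summable_on_comparison_test') (auto simp: algebra_simps)
qed

lift_definition uminus_pseries :: "'a pseries \<Rightarrow> 'a pseries" is "\<lambda>c \<alpha>. - c \<alpha>"
  by simp

definition minus_pseries :: "'a pseries \<Rightarrow> 'a pseries \<Rightarrow> 'a pseries" where
  "minus_pseries c d = c + (- d)"

lift_definition times_pseries :: "'a pseries \<Rightarrow> 'a pseries \<Rightarrow> 'a pseries" is conv
  using conv_wt_summable(1) by (simp add: abs_mult)

lemma conv_one: "conv (\<lambda>\<alpha>. if \<alpha> = 0 then 1 else 0) a = a"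
proof
  fix \<gamma> :: "'b::finite \<Rightarrow> nat"
  have "conv (\<lambda>\<alpha>. if \<alpha> = 0 then 1 else 0) a \<gamma> = (\<Sum>p\<in>splits \<gamma>. if p = (0,\<gamma>) then a \<gamma> else 0)"
    unfolding conv_def by (rule sum.cong) (auto simp: splits_def)
  also have "\<dots> = a \<gamma>" by (subst sum.delta[OF finite_splits]) (auto simp: splits_def)
  finally show "conv (\<lambda>\<alpha>. if \<alpha> = 0 then 1 else 0) a \<gamma> = a \<gamma>" .
qed

instance
proof
  fix a b c :: "'a pseries"
  show "a * b * c = a * (b * c)" by transfer (rule conv_assoc)
  show "a * b = b * a" by transfer (rule conv_commute)
  show "1 * a = a" by transfer (rule conv_one)
  show "a + b + c = a + (b + c)" by transfer (simp add: add.assoc)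
  show "a + b = b + a" by transfer (simp add: add.commute)
  show "0 + a = a" by transfer simp
  show "- a + a = 0" by transfer simp
  show "a - b = a + - b" by (simp add: minus_pseries_def)
  show "(a + b) * c = a * c + b * c"
    by transfer (simp add: conv_def fun_eq_iff sum.distrib distrib_right)
  show "(0::'a pseries) \<noteq> 1" by transfer (auto simp: fun_eq_iff)
qed

end

lemma pcoeff_add [simp]: "pcoeff (C + D) \<alpha> = pcoeff C \<alpha> + pcoeff D \<alpha>"
  by transfer simp
lemma pcoeff_uminus [simp]: "pcoeff (- C) \<alpha> = - pcoeff C \<alpha>"
  by transfer simp
lemma pcoeff_diff [simp]: "pcoeff (C - D) \<alpha> = pcoeff C \<alpha> - pcoeff D \<alpha>"
  by (simp only: minus_pseries_def pcoeff_add pcoeff_uminus diff_conv_add_uminus)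
lemma pcoeff_0 [simp]: "pcoeff 0 \<alpha> = 0"
  by transfer simp
lemma pcoeff_1: "pcoeff 1 \<alpha> = (if \<alpha> = 0 then 1 else 0)"
  by transfer simp
lemma pcoeff_mult: "pcoeff (C * D) = conv (pcoeff C) (pcoeff D)"
  by transfer simp

instantiation pseries :: (finite) scaleR
begin

lift_definition scaleR_pseries :: "real \<Rightarrow> 'a pseries \<Rightarrow> 'a pseries" is "\<lambda>r c \<alpha>. r * c \<alpha>"
  by (simp add: abs_mult mult.assoc summable_on_cmult_right)

instance ..

end

lemma pcoeff_scaleR [simp]: "pcoeff (r *\<^sub>R C) \<alpha> = r * pcoeff C \<alpha>"
  by transfer simp

instantiation pseries :: (finite) real_normed_algebra_1
begin

definition norm_pseries :: "'a pseries \<Rightarrow> real" where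
  "norm_pseries C = infsum (\<lambda>\<alpha>. \<bar>pcoeff C \<alpha>\<bar> * wt \<alpha>) UNIV"

definition dist_pseries :: "'a pseries \<Rightarrow> 'a pseries \<Rightarrow> real" where
  "dist_pseries C D = norm (C - D)"

definition sgn_pseries :: "'a pseries \<Rightarrow> 'a pseries" where
  "sgn_pseries C = C /\<^sub>R norm C"

definition uniformity_pseries :: "('a pseries \<times> 'a pseries) filter" where
  "uniformity_pseries = (INF e\<in>{0 <..}. principal {(x, y). dist x y < e})"

definition open_pseries :: "'a pseries set \<Rightarrow> bool" where
  "open_pseries U \<longleftrightarrow> (\<forall>x\<in>U. \<forall>\<^sub>F (x', y) in uniformity. x' = x \<longrightarrow> y \<in> U)"

instance
proof
  fix a b c :: "'a pseries" and r s :: real and U :: "'a pseries set"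
  show "r *\<^sub>R (a + b) = r *\<^sub>R a + r *\<^sub>R b" by (rule pseries_eqI) (simp add: algebra_simps)
  show "(r + s) *\<^sub>R a = r *\<^sub>R a + s *\<^sub>R a" by (rule pseries_eqI) (simp add: algebra_simps)
  show "r *\<^sub>R s *\<^sub>R a = (r * s) *\<^sub>R a" by (rule pseries_eqI) (simp add: algebra_simps)
  show "1 *\<^sub>R a = a" by (rule pseries_eqI) simp
  show "r *\<^sub>R a * b = r *\<^sub>R (a * b)"
    by (rule pseries_eqI) (simp add: pcoeff_mult conv_def sum_distrib_left mult.assoc)
  show "a * r *\<^sub>R b = r *\<^sub>R (a * b)"
    by (rule pseries_eqI) (simp add: pcoeff_mult conv_def sum_distrib_left algebra_simps)
  show "dist a b = norm (a - b)" by (rule dist_pseries_def)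
  show "sgn a = a /\<^sub>R norm a" by (rule sgn_pseries_def)
  show "uniformity = (INF e\<in>{0 <..}. principal {(x, y :: 'a pseries). dist x y < e})"
    by (rule uniformity_pseries_def)
  show "open U = (\<forall>x\<in>U. \<forall>\<^sub>F (x', y) in uniformity. x' = x \<longrightarrow> y \<in> U)"
    by (rule open_pseries_def)
  have n0: "a = 0" if "norm a = 0"
  proof (rule pseries_eqI)
    fix \<alpha>
    have "\<bar>pcoeff a \<alpha>\<bar> * wt \<alpha> = 0"
      by (rule nonneg_infsum_le_0D[of "\<lambda>\<alpha>. \<bar>pcoeff a \<alpha>\<bar> * wt \<alpha>" UNIV])
         (use that pcoeff_summable'[of a] in \<open>auto simp: norm_pseries_def\<close>)
    then show "pcoeff a \<alpha> = pcoeff 0 \<alpha>" using wt_pos[of \<alpha>] by auto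
  qed
  moreover have "norm (0::'a pseries) = 0" by (simp add: norm_pseries_def)
  ultimately show "norm a = 0 \<longleftrightarrow> a = 0" by auto
  show "norm (a + b) \<le> norm a + norm b"
  proof -
    have "norm (a + b) \<le> infsum (\<lambda>\<alpha>. \<bar>pcoeff a \<alpha>\<bar> * wt \<alpha> + \<bar>pcoeff b \<alpha>\<bar> * wt \<alpha>) UNIV"
      unfolding norm_pseries_def
      by (rule infsum_mono[OF pcoeff_summable' summable_on_add[OF pcoeff_summable' pcoeff_summable']])
         (simp add: distrib_right[symmetric] mult_right_mono)
    also have "\<dots> = norm a + norm b"
      unfolding norm_pseries_def by (rule infsum_add[OF pcoeff_summable' pcoeff_summable'])
    finally show ?thesis .
  qed
  show "norm (r *\<^sub>R a) = \<bar>r\<bar> * norm a"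
    by (simp add: norm_pseries_def abs_mult mult.assoc infsum_cmult_right')
  show "norm (a * b) \<le> norm a * norm b"
    unfolding norm_pseries_def pcoeff_mult by (rule conv_wt_summable(2)[OF pcoeff_summable' pcoeff_summable'])
  have "norm (1::'a pseries) = infsum (\<lambda>\<alpha>. if \<alpha> = 0 then 1 else 0) (UNIV :: ('a \<Rightarrow> nat) set)"
    unfolding norm_pseries_def by (rule infsum_cong) (simp add: pcoeff_1)
  also have "\<dots> = infsum (\<lambda>\<alpha>. 1) {0 :: 'a \<Rightarrow> nat}"
    by (rule infsum_cong_neutral) auto
  finally show "norm (1::'a pseries) = 1" by simp
qed

end

lemma pcoeff_le_norm: "\<bar>pcoeff C \<alpha>\<bar> * wt \<alpha> \<le> norm C"
  using finite_sum_le_infsum[OF pcoeff_summable', of "{\<alpha>}" C] by (simp add: norm_pseries_def)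

text \<open>All terms are nonnegative, so bounds on finite partial sums suffice. In limits and under
  operators only finitely many coefficients can be controlled at a time.\<close>

lemma norm_pseries_le:
  assumes "\<And>F. finite F \<Longrightarrow> (\<Sum>\<alpha>\<in>F. \<bar>c \<alpha>\<bar> * wt \<alpha>) \<le> K"
  shows "(\<lambda>\<alpha>. \<bar>c \<alpha>\<bar> * wt \<alpha>) summable_on UNIV" "norm (Pseries c) \<le> K"
proof -
  show *: "(\<lambda>\<alpha>. \<bar>c \<alpha>\<bar> * wt \<alpha>) summable_on UNIV"
    by (rule nonneg_bounded_partial_sums_imp_summable_on[where C=K])
       (auto intro: assms eventually_finite_subsets_at_top_weakI)
  show "norm (Pseries c) \<le> K"
    unfolding norm_pseries_def pcoeff_Pseries[OF *]
    by (rule infsum_le_finite_sums[OF *]) (use assms in auto)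
qed

lemma finite_sum_le_norm: "finite F \<Longrightarrow> (\<Sum>\<alpha>\<in>F. \<bar>pcoeff C \<alpha>\<bar> * wt \<alpha>) \<le> norm C"
  unfolding norm_pseries_def by (rule finite_sum_le_infsum[OF pcoeff_summable']) auto

text \<open>The completeness proof for \<open>\<ell>\<^sup>1\<close>: coefficients converge because
  each weight is positive, and the Cauchy bound on finite partial sums, uniform in the finite set,
  survives the coefficientwise limit.\<close>

instance pseries :: (finite) banach
proof
  fix X :: "nat \<Rightarrow> 'a pseries"
  assume X: "Cauchy X"
  have "\<exists>l. (\<lambda>m. pcoeff (X m) \<alpha>) \<longlonglongrightarrow> l" for \<alpha>
  proof -
    have "Cauchy (\<lambda>m. pcoeff (X m) \<alpha>)"
    proof (rule metric_CauchyI)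
      fix e :: real assume "e > 0"
      then have "e * wt \<alpha> > 0" using wt_pos[of \<alpha>] by simp
      then obtain M where M: "\<And>m k. m \<ge> M \<Longrightarrow> k \<ge> M \<Longrightarrow> dist (X m) (X k) < e * wt \<alpha>"
        using X unfolding Cauchy_def by meson
      have "dist (pcoeff (X m) \<alpha>) (pcoeff (X k) \<alpha>) < e" if "m \<ge> M" "k \<ge> M" for m k
      proof -
        have "\<bar>pcoeff (X m) \<alpha> - pcoeff (X k) \<alpha>\<bar> * wt \<alpha> < e * wt \<alpha>"
          using pcoeff_le_norm[of "X m - X k" \<alpha>] M[OF that] by (simp add: dist_norm)
        then show ?thesis using wt_pos[of \<alpha>] by (simp add: dist_real_def)
      qed
      then show "\<exists>M. \<forall>m\<ge>M. \<forall>k\<ge>M. dist (pcoeff (X m) \<alpha>) (pcoeff (X k) \<alpha>) < e" by blast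
    qed
    then show ?thesis using real_Cauchy_convergent convergent_def by blast
  qed
  then obtain c where c: "\<And>\<alpha>. (\<lambda>m. pcoeff (X m) \<alpha>) \<longlonglongrightarrow> c \<alpha>" by metis
  have key: "\<exists>M. \<forall>m\<ge>M. \<forall>F. finite F \<longrightarrow> (\<Sum>\<alpha>\<in>F. \<bar>pcoeff (X m) \<alpha> - c \<alpha>\<bar> * wt \<alpha>) \<le> e" if "e > 0" for e
  proof -
    obtain M where M: "\<And>m k. m \<ge> M \<Longrightarrow> k \<ge> M \<Longrightarrow> dist (X m) (X k) < e"
      using X \<open>e > 0\<close> unfolding Cauchy_def by meson
    have "(\<Sum>\<alpha>\<in>F. \<bar>pcoeff (X m) \<alpha> - c \<alpha>\<bar> * wt \<alpha>) \<le> e" if "m \<ge> M" "finite F" for m F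
    proof (rule tendsto_upperbound)
      show "(\<lambda>k. \<Sum>\<alpha>\<in>F. \<bar>pcoeff (X m) \<alpha> - pcoeff (X k) \<alpha>\<bar> * wt \<alpha>) \<longlonglongrightarrow> (\<Sum>\<alpha>\<in>F. \<bar>pcoeff (X m) \<alpha> - c \<alpha>\<bar> * wt \<alpha>)"
        by (intro tendsto_intros c)
      show "\<forall>\<^sub>F k in sequentially. (\<Sum>\<alpha>\<in>F. \<bar>pcoeff (X m) \<alpha> - pcoeff (X k) \<alpha>\<bar> * wt \<alpha>) \<le> e"
        using eventually_ge_at_top[of M]
      proof eventually_elim
        case (elim k)
        then show ?case
          using finite_sum_le_norm[OF \<open>finite F\<close>, of "X m - X k"] M[OF \<open>m \<ge> M\<close> elim] by (simp add: dist_norm)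
      qed
    qed auto
    then show ?thesis by blast
  qed
  obtain M where M: "\<And>F. finite F \<Longrightarrow> (\<Sum>\<alpha>\<in>F. \<bar>pcoeff (X M) \<alpha> - c \<alpha>\<bar> * wt \<alpha>) \<le> 1"
    using key[of 1] by auto
  have sc: "(\<lambda>\<alpha>. \<bar>c \<alpha>\<bar> * wt \<alpha>) summable_on UNIV"
  proof -
    have "(\<lambda>\<alpha>. \<bar>pcoeff (X M) \<alpha> - c \<alpha>\<bar> * wt \<alpha> + \<bar>pcoeff (X M) \<alpha>\<bar> * wt \<alpha>) summable_on UNIV"
      by (intro summable_on_add pcoeff_summable' norm_pseries_le(1)[where K=1]) (use M in auto)
    then show ?thesis
    proof (rule summable_on_comparison_test)
      fix \<alpha>
      have "\<bar>c \<alpha>\<bar> \<le> \<bar>pcoeff (X M) \<alpha> - c \<alpha>\<bar> + \<bar>pcoeff (X M) \<alpha>\<bar>" by linarith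
      then show "\<bar>c \<alpha>\<bar> * wt \<alpha> \<le> \<bar>pcoeff (X M) \<alpha> - c \<alpha>\<bar> * wt \<alpha> + \<bar>pcoeff (X M) \<alpha>\<bar> * wt \<alpha>"
        by (metis distrib_right mult_right_mono wt_nonneg)
    qed auto
  qed
  have "X \<longlonglongrightarrow> Pseries c"
  proof (rule metric_LIMSEQ_I)
    fix e :: real assume "e > 0"
    then obtain M where M: "\<And>m F. m \<ge> M \<Longrightarrow> finite F \<Longrightarrow> (\<Sum>\<alpha>\<in>F. \<bar>pcoeff (X m) \<alpha> - c \<alpha>\<bar> * wt \<alpha>) \<le> e / 2"
      using key[of "e/2"] by (meson half_gt_zero)
    have "dist (X m) (Pseries c) < e" if "m \<ge> M" for m
    proof -
      have "X m - Pseries c = Pseries (\<lambda>\<alpha>. pcoeff (X m) \<alpha> - c \<alpha>)"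
        by (rule pseries_eqI) (simp add: pcoeff_Pseries[OF sc] pcoeff_Pseries norm_pseries_le(1)[OF M[OF that]])
      then have "norm (X m - Pseries c) \<le> e / 2"
        using norm_pseries_le(2)[OF M[OF that]] by simp
      then show ?thesis using \<open>e > 0\<close> by (simp add: dist_norm)
    qed
    then show "\<exists>M. \<forall>m\<ge>M. dist (X m) (Pseries c) < e" by blast
  qed
  then show "convergent X" by (auto simp: convergent_def)
qed

section \<open>Evaluation of a series on the cube of half-width 1/2\<close>

definition qbox :: "(real^'n) set" where
  "qbox = {w. \<forall>i. \<bar>w $ i\<bar> \<le> 1/2}"

text \<open>Outside \<open>qbox\<close> the family need not be summable and \<open>infsum\<close>
  may take its default value 0; hence the membership hypothesis of most rules below.\<close>

definition ev :: "'n::finite pseries \<Rightarrow> real^'n \<Rightarrow> real" where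
  "ev C w = infsum (\<lambda>\<alpha>. pcoeff C \<alpha> * mpow (($) w) \<alpha>) UNIV"

lemma qbox_0 [simp]: "0 \<in> qbox" by (simp add: qbox_def)

lemma mpow_qbox: "w \<in> qbox \<Longrightarrow> \<bar>mpow (($) w) \<alpha>\<bar> \<le> (1/2) ^ mdeg \<alpha>"
  using norm_mpow_le[of "($) w" "1/2" \<alpha>] by (simp add: qbox_def)

lemma ev_abs_summable:
  assumes "w \<in> qbox"
  shows "(\<lambda>\<alpha>. norm (pcoeff C \<alpha> * mpow (($) w) \<alpha>)) summable_on UNIV"
  by (rule summable_on_comparison_test[OF pcoeff_summable'[of C]])
     (auto simp: abs_mult intro!: mult_left_mono order_trans[OF mpow_qbox[OF assms] wt_ge])

lemma ev_has_sum:
  assumes "w \<in> qbox"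
  shows "((\<lambda>\<alpha>. pcoeff C \<alpha> * mpow (($) w) \<alpha>) has_sum ev C w) UNIV"
  unfolding ev_def by (rule has_sum_infsum[OF abs_summable_summable[OF ev_abs_summable[OF assms]]])

lemma ev_norm:
  assumes "w \<in> qbox"
  shows "\<bar>ev C w\<bar> \<le> norm C"
proof -
  have "norm (ev C w) \<le> infsum (\<lambda>\<alpha>. norm (pcoeff C \<alpha> * mpow (($) w) \<alpha>)) UNIV"
    unfolding ev_def by (rule norm_infsum_bound[OF ev_abs_summable[OF assms]])
  also have "\<dots> \<le> norm C"
    unfolding norm_pseries_def
    by (rule infsum_mono[OF ev_abs_summable[OF assms] pcoeff_summable'])
       (auto simp: abs_mult intro!: mult_left_mono order_trans[OF mpow_qbox[OF assms] wt_ge])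
  finally show ?thesis by simp
qed

lemma ev_add: "w \<in> qbox \<Longrightarrow> ev (C + D) w = ev C w + ev D w"
  by (rule has_sum_unique[OF ev_has_sum])
     (auto simp: distrib_right intro: has_sum_add ev_has_sum)

lemma ev_scaleR: "w \<in> qbox \<Longrightarrow> ev (r *\<^sub>R C) w = r * ev C w"
  by (rule has_sum_unique[OF ev_has_sum])
     (auto simp: mult.assoc intro: has_sum_cmult_right ev_has_sum)

lemma ev_0 [simp]: "ev 0 w = 0" by (simp add: ev_def)

lemma ev_uminus: "w \<in> qbox \<Longrightarrow> ev (- C) w = - ev C w"
  using ev_scaleR[of w "-1" C] by simp

lemma ev_diff: "w \<in> qbox \<Longrightarrow> ev (C - D) w = ev C w - ev D w"
  using ev_add[of w C "- D"] by (simp add: ev_uminus)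

lemma ev_1: "ev 1 w = 1"
proof -
  have "ev 1 w = infsum (\<lambda>\<alpha>. 1) {0 :: 'a \<Rightarrow> nat}"
    unfolding ev_def by (rule infsum_cong_neutral) (auto simp: pcoeff_1)
  then show ?thesis by simp
qed

lemma ev_mult:
  assumes "w \<in> qbox"
  shows "ev (C * D) w = ev C w * ev D w"
proof (rule has_sum_unique[OF ev_has_sum[OF assms]])
  have "conv (\<lambda>\<alpha>. pcoeff C \<alpha> * mpow (($) w) \<alpha>) (\<lambda>\<alpha>. pcoeff D \<alpha> * mpow (($) w) \<alpha>) =
      (\<lambda>\<gamma>. pcoeff (C * D) \<gamma> * mpow (($) w) \<gamma>)"
    unfolding pcoeff_mult conv_def sum_distrib_right
    by (intro ext sum.cong) (auto simp: splits_def mpow_add)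
  with conv_has_sum(1)[OF ev_abs_summable[OF assms, of C] ev_abs_summable[OF assms, of D]]
  show "((\<lambda>\<gamma>. pcoeff (C * D) \<gamma> * mpow (($) w) \<gamma>) has_sum ev C w * ev D w) UNIV"
    by (simp add: ev_def)
qed

lemma bounded_linear_ev: "w \<in> qbox \<Longrightarrow> bounded_linear (\<lambda>C. ev C w)"
  by (rule bounded_linear_intro[where K=1]) (auto simp: ev_add ev_scaleR ev_norm)

text \<open>Continuity of the coefficient functionals permits computing a coefficient of an infinite
  sum of series, such as a composition, term by term.\<close>

lemma bounded_linear_coeff: "bounded_linear (\<lambda>C. pcoeff C \<alpha>)"
proof (rule bounded_linear_intro[where K="1 / wt \<alpha>"])
  fix C :: "'a pseries"
  show "norm (pcoeff C \<alpha>) \<le> norm C * (1 / wt \<alpha>)"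
    using pcoeff_le_norm[of C \<alpha>] wt_pos[of \<alpha>] by (simp add: field_simps)
qed auto

lemma ev_power: "w \<in> qbox \<Longrightarrow> ev (C ^ k) w = ev C w ^ k"
  by (induction k) (auto simp: ev_1 ev_mult)

lemma ev_prod: "w \<in> qbox \<Longrightarrow> ev (prod b I) w = (\<Prod>i\<in>I. ev (b i) w)"
  by (induction I rule: infinite_finite_induct) (auto simp: ev_1 ev_mult)

lemma ev_sum: "w \<in> qbox \<Longrightarrow> ev (sum b I) w = (\<Sum>i\<in>I. ev (b i) w)"
  by (induction I rule: infinite_finite_induct) (auto simp: ev_add)

lemma ev_mpow: "w \<in> qbox \<Longrightarrow> ev (mpow b \<alpha>) w = mpow (\<lambda>i. ev (b i) w) \<alpha>"
  by (simp add: mpow_def ev_prod ev_power)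

abbreviation cst :: "real \<Rightarrow> 'n::finite pseries" where "cst c \<equiv> c *\<^sub>R 1"

lemma ev_cst: "w \<in> qbox \<Longrightarrow> ev (cst c) w = c"
  by (simp add: ev_scaleR ev_1)

definition var :: "'n::finite \<Rightarrow> 'n pseries" where
  "var i = Pseries (\<lambda>\<alpha>. if \<alpha> = unit_idx i then 1 else 0)"

lemma pcoeff_var: "pcoeff (var i) \<alpha> = (if \<alpha> = unit_idx i then 1 else 0)"
  unfolding var_def
  by (subst pcoeff_Pseries)
     (auto intro!: finite_nonzero_values_imp_summable_on finite_subset[of _ "{unit_idx i}"] split: if_splits)

lemma ev_var [simp]: "ev (var i) w = w $ i"
proof -
  have "ev (var i) w = infsum (\<lambda>\<alpha>. w $ i) {unit_idx i}"
    unfolding ev_def by (rule infsum_cong_neutral) (auto simp: pcoeff_var)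
  then show ?thesis by simp
qed

lemma norm_var: "norm (var i) \<le> 1"
proof -
  have "norm (var i) = infsum (\<lambda>\<alpha>. wt (unit_idx i)) {unit_idx i}"
    unfolding norm_pseries_def by (rule infsum_cong_neutral) (auto simp: pcoeff_var)
  then show ?thesis by (simp add: wt_le_1)
qed

lemma pcoeff_norm_summable:
  assumes "0 \<le> s" "s \<le> 1/2"
  shows "(\<lambda>\<alpha>. \<bar>pcoeff C \<alpha>\<bar> * s ^ mdeg \<alpha>) summable_on UNIV"
  by (rule summable_on_comparison_test[OF pcoeff_summable'[of C]])
     (use assms in \<open>auto intro!: mult_left_mono order_trans[OF power_mono wt_ge]\<close>)

section \<open>Composition\<close>

text \<open>The outer argument is a bare coefficient family: what matters is summability against
  \<open>s ^ mdeg \<alpha>\<close> for a bound \<open>s\<close> on the inner norms, not membership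
  in the weighted space.\<close>

definition pcomp :: "(('m::finite \<Rightarrow> nat) \<Rightarrow> real) \<Rightarrow> ('m \<Rightarrow> 'n::finite pseries) \<Rightarrow> 'n pseries" where
  "pcomp c b = infsum (\<lambda>\<alpha>. c \<alpha> *\<^sub>R mpow b \<alpha>) UNIV"

lemma pcomp_abs_summable:
  fixes b :: "'m::finite \<Rightarrow> 'n::finite pseries"
  assumes "(\<lambda>\<alpha>. \<bar>c \<alpha>\<bar> * s ^ mdeg \<alpha>) summable_on UNIV" and "\<And>i. norm (b i) \<le> s"
  shows "(\<lambda>\<alpha>. norm (c \<alpha> *\<^sub>R mpow b \<alpha>)) summable_on UNIV"
  by (rule summable_on_comparison_test[OF assms(1)])
     (auto intro!: mult_left_mono norm_mpow_le[of b s, OF assms(2)])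

lemma pcomp_has_sum:
  assumes "(\<lambda>\<alpha>. \<bar>c \<alpha>\<bar> * s ^ mdeg \<alpha>) summable_on UNIV" and "\<And>i. norm (b i) \<le> s"
  shows "((\<lambda>\<alpha>. c \<alpha> *\<^sub>R mpow b \<alpha>) has_sum pcomp c b) UNIV"
  unfolding pcomp_def by (rule has_sum_infsum[OF abs_summable_summable[OF pcomp_abs_summable[OF assms]]])

lemma norm_comp:
  assumes "(\<lambda>\<alpha>. \<bar>c \<alpha>\<bar> * s ^ mdeg \<alpha>) summable_on UNIV" and "\<And>i. norm (b i) \<le> s"
  shows "norm (pcomp c b) \<le> infsum (\<lambda>\<alpha>. \<bar>c \<alpha>\<bar> * s ^ mdeg \<alpha>) UNIV"
  by (rule norm_infsum_le[OF pcomp_has_sum[OF assms] has_sum_infsum[OF assms(1)]])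
     (auto intro!: mult_left_mono norm_mpow_le[of b s, OF assms(2)])

lemma ev_comp:
  assumes "(\<lambda>\<alpha>. \<bar>c \<alpha>\<bar> * s ^ mdeg \<alpha>) summable_on UNIV" and "\<And>i. norm (b i) \<le> s" and w: "w \<in> qbox"
  shows "((\<lambda>\<alpha>. c \<alpha> * mpow (\<lambda>i. ev (b i) w) \<alpha>) has_sum ev (pcomp c b) w) UNIV"
  using has_sum_bounded_linear[OF bounded_linear_ev[OF w] pcomp_has_sum[OF assms(1,2)]] w
  by (simp add: ev_scaleR ev_mpow)

text \<open>Evaluation is bounded by the norm, so inner series of norm at most 1/2 map the cube into
  itself.\<close>

lemma ev_comp_coeff:
  assumes "\<And>i. norm (b i) \<le> 1/2" and w: "w \<in> qbox"
  shows "ev (pcomp (pcoeff C) b) w = ev C (\<chi> i. ev (b i) w)" "(\<chi> i. ev (b i) w) \<in> qbox"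
proof -
  show q: "(\<chi> i. ev (b i) w) \<in> qbox"
    unfolding qbox_def vec_lambda_beta mem_Collect_eq
    by (intro allI order_trans[OF ev_norm[OF w] assms(1)])
  have eq: "(($) (\<chi> i. ev (b i) w)) = (\<lambda>i. ev (b i) w)" by auto
  have h1: "((\<lambda>\<alpha>. pcoeff C \<alpha> * mpow (\<lambda>i. ev (b i) w) \<alpha>) has_sum ev (pcomp (pcoeff C) b) w) UNIV"
    by (rule ev_comp[where s="1/2"]) (use assms pcoeff_norm_summable[of "1/2" C] in auto)
  have h2: "((\<lambda>\<alpha>. pcoeff C \<alpha> * mpow (\<lambda>i. ev (b i) w) \<alpha>) has_sum ev C (\<chi> i. ev (b i) w)) UNIV"
    using ev_has_sum[OF q, of C] unfolding eq .
  from h1 h2 show "ev (pcomp (pcoeff C) b) w = ev C (\<chi> i. ev (b i) w)" by (rule has_sum_unique)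
qed

section \<open>Rescaling\<close>

text \<open>Each variable has its own factor, because the Cauchy-Kovalevskaya theorem squeezes only
  the variables other than \<open>piv\<close>; the factor 0 on these restricts a series to the pivot
  axis.\<close>

definition dsc :: "('n::finite \<Rightarrow> real) \<Rightarrow> 'n pseries \<Rightarrow> 'n pseries" where
  "dsc s C = Pseries (\<lambda>\<alpha>. mpow s \<alpha> * pcoeff C \<alpha>)"

lemma mpow_01:
  fixes s :: "'n::finite \<Rightarrow> real"
  assumes "\<And>i. 0 \<le> s i \<and> s i \<le> 1"
  shows "0 \<le> mpow s \<alpha>" "mpow s \<alpha> \<le> 1"
  unfolding mpow_def using assms by (auto intro!: prod_nonneg prod_le_1 power_le_one)

lemma dsc_bound:
  fixes s :: "'n::finite \<Rightarrow> real"
  assumes "\<And>i. 0 \<le> s i \<and> s i \<le> 1"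
  shows "\<bar>mpow s \<alpha> * pcoeff C \<alpha>\<bar> * wt \<alpha> \<le> \<bar>pcoeff C \<alpha>\<bar> * wt \<alpha>"
  using mpow_01[of s \<alpha>, OF assms]
  by (auto simp: abs_mult mult.assoc intro!: mult_left_le_one_le)

lemma pcoeff_dsc:
  fixes s :: "'n::finite \<Rightarrow> real"
  assumes "\<And>i. 0 \<le> s i \<and> s i \<le> 1"
  shows "pcoeff (dsc s C) \<alpha> = mpow s \<alpha> * pcoeff C \<alpha>"
proof -
  have "(\<lambda>\<alpha>. \<bar>mpow s \<alpha> * pcoeff C \<alpha>\<bar> * wt \<alpha>) summable_on UNIV"
    by (rule summable_on_comparison_test[OF pcoeff_summable'[of C]]) (use assms in \<open>auto intro!: dsc_bound\<close>)
  then show ?thesis unfolding dsc_def by (simp add: pcoeff_Pseries)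
qed

lemma norm_dsc:
  fixes s :: "'n::finite \<Rightarrow> real"
  assumes "\<And>i. 0 \<le> s i \<and> s i \<le> 1"
  shows "norm (dsc s C) \<le> norm C"
  unfolding norm_pseries_def
  by (rule infsum_mono[OF pcoeff_summable' pcoeff_summable'])
     (simp add: pcoeff_dsc[of s, OF assms] dsc_bound[of s, OF assms])

lemma ev_dsc:
  fixes s :: "'n::finite \<Rightarrow> real"
  assumes "\<And>i. 0 \<le> s i \<and> s i \<le> 1"
  shows "ev (dsc s C) w = ev C (\<chi> i. s i * w $ i)"
proof -
  have "(($) (\<chi> i. s i * w $ i)) = (\<lambda>i. s i * w $ i)" by auto
  then show ?thesis by (simp add: ev_def pcoeff_dsc[of s, OF assms] mpow_mult algebra_simps)
qed

text \<open>Every coefficient of positive degree picks up at least one factor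
  \<open>t\<close>.\<close>

lemma norm_dsc_const:
  fixes C :: "'n::finite pseries"
  assumes "0 \<le> t" "t \<le> 1"
  shows "norm (dsc (\<lambda>_. t) C - cst (pcoeff C 0)) \<le> t * norm C"
proof -
  have "norm (dsc (\<lambda>_. t) C - cst (pcoeff C 0)) \<le> infsum (\<lambda>\<alpha>. t * (\<bar>pcoeff C \<alpha>\<bar> * wt \<alpha>)) UNIV"
    unfolding norm_pseries_def
  proof (rule infsum_mono[OF pcoeff_summable' summable_on_cmult_right[OF pcoeff_summable']])
    fix \<alpha> :: "'n \<Rightarrow> nat"
    show "\<bar>pcoeff (dsc (\<lambda>_. t) C - cst (pcoeff C 0)) \<alpha>\<bar> * wt \<alpha> \<le> t * (\<bar>pcoeff C \<alpha>\<bar> * wt \<alpha>)"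
    proof (cases "\<alpha> = 0")
      case True
      then show ?thesis using assms by (simp add: pcoeff_dsc pcoeff_1)
    next
      case False
      then have "mdeg \<alpha> > 0" using mdeg_eq_0[of \<alpha>] by simp
      then have "t ^ mdeg \<alpha> \<le> t" using assms power_decreasing[of 1 "mdeg \<alpha>" t] by simp
      then have "t ^ mdeg \<alpha> * (\<bar>pcoeff C \<alpha>\<bar> * wt \<alpha>) \<le> t * (\<bar>pcoeff C \<alpha>\<bar> * wt \<alpha>)"
        by (rule mult_right_mono) simp
      then show ?thesis using False assms by (simp add: pcoeff_dsc pcoeff_1 mpow_const abs_mult mult.assoc)
    qed
  qed
  also have "\<dots> = t * norm C" by (simp add: norm_pseries_def infsum_cmult_right')
  finally show ?thesis .
qed

lemma ev_at_0: "ev C 0 = pcoeff C 0"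
proof -
  have "ev C 0 = infsum (\<lambda>\<alpha>. pcoeff C 0) {0 :: 'a \<Rightarrow> nat}"
    unfolding ev_def
  proof (rule infsum_cong_neutral)
    fix \<alpha> :: "'a \<Rightarrow> nat"
    assume "\<alpha> \<in> UNIV - {0}"
    then obtain i where "\<alpha> i > 0" by (auto simp: fun_eq_iff fun_algebra_apply)
    then show "pcoeff C \<alpha> * mpow (($) 0) \<alpha> = 0" by (auto simp: mpow_def prod_zero_iff)
  qed auto
  then show ?thesis by simp
qed

section \<open>Analytic functions as evaluations\<close>

text \<open>The bridge between the pointwise notion and the Banach algebra: analyticity at
  \<open>a\<close> means that, at some scale \<open>r\<close>, the function is the evaluation of an
  element of the algebra.\<close>

lemma real_analytic_at_ev:
  fixes f :: "real^'n \<Rightarrow> real"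
  shows "real_analytic_at f a \<longleftrightarrow> (\<exists>r>0. \<exists>C. \<forall>w\<in>qbox. f (a + r *\<^sub>R w) = ev C w)"
proof
  assume "real_analytic_at f a"
  then obtain R c where R: "R > 0" and c: "\<And>u. u \<in> ball a R \<Longrightarrow>
      ((\<lambda>\<alpha>. (\<Prod>i\<in>UNIV. (u $ i - a $ i) ^ \<alpha> i) *\<^sub>R c \<alpha>) has_sum f u) UNIV"
    unfolding real_analytic_at_def by blast
  \<comment> \<open>A vector with entries of modulus at most 1 has Euclidean norm at most
    \<open>CARD('n)\<close>, so \<open>r\<close> times the whole unit cube fits into the ball of
    convergence.\<close>
  define r where "r = R / (real CARD('n) + 1)"
  have r: "r > 0" using R by (simp add: r_def)
  have rR: "r * real CARD('n) < R" using R by (simp add: r_def field_simps)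
  have inb: "a + r *\<^sub>R w \<in> ball a R" if "\<And>i. \<bar>w $ i\<bar> \<le> 1" for w :: "real^'n"
  proof -
    have "norm w \<le> (\<Sum>i\<in>UNIV. \<bar>w $ i\<bar>)" by (rule norm_le_l1_cart)
    also have "\<dots> \<le> (\<Sum>i\<in>(UNIV::'n set). 1)" by (rule sum_mono) (use that in auto)
    finally have "norm w \<le> real CARD('n)" by simp
    then have "r * norm w \<le> r * real CARD('n)" using r by simp
    moreover have "dist a (a + r *\<^sub>R w) = r * norm w" using r by (simp add: dist_norm)
    ultimately show ?thesis using rR by simp
  qed
  have eq: "(\<Prod>i\<in>UNIV. ((a + r *\<^sub>R w) $ i - a $ i) ^ \<alpha> i) = r ^ mdeg \<alpha> * mpow (($) w) \<alpha>" for w :: "real^'n" and \<alpha>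
    by (simp add: mpow_def power_mult_distrib prod.distrib mdeg_def power_sum)
  \<comment> \<open>At the corner \<open>(1,...,1)\<close> all monomials equal 1. Unconditional
    convergence there is absolute summability of the rescaled coefficients.\<close>
  have "(\<lambda>\<alpha>. r ^ mdeg \<alpha> * c \<alpha>) summable_on UNIV"
    using has_sum_imp_summable[OF c[OF inb[of "\<chi> i. 1"]]]
    unfolding eq by (simp add: mpow_def)
  then have s: "(\<lambda>\<alpha>. \<bar>r ^ mdeg \<alpha> * c \<alpha>\<bar>) summable_on UNIV"
    using summable_on_iff_abs_summable_on_real by fastforce
  have sw: "(\<lambda>\<alpha>. \<bar>r ^ mdeg \<alpha> * c \<alpha>\<bar> * wt \<alpha>) summable_on UNIV"
    by (rule summable_on_comparison_test[OF s]) (auto intro: mult_right_le_one_le wt_le_1)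
  have "f (a + r *\<^sub>R w) = ev (Pseries (\<lambda>\<alpha>. r ^ mdeg \<alpha> * c \<alpha>)) w" if "w \<in> qbox" for w
  proof (rule has_sum_unique)
    show "((\<lambda>\<alpha>. pcoeff (Pseries (\<lambda>\<alpha>. r ^ mdeg \<alpha> * c \<alpha>)) \<alpha> * mpow (($) w) \<alpha>) has_sum
        ev (Pseries (\<lambda>\<alpha>. r ^ mdeg \<alpha> * c \<alpha>)) w) UNIV"
      by (rule ev_has_sum[OF that])
    have "\<bar>w $ i\<bar> \<le> 1" for i
      by (rule order_trans[where y="1/2"]) (use that in \<open>auto simp: qbox_def\<close>)
    from c[OF inb[OF this]]
    show "((\<lambda>\<alpha>. pcoeff (Pseries (\<lambda>\<alpha>. r ^ mdeg \<alpha> * c \<alpha>)) \<alpha> * mpow (($) w) \<alpha>) has_sum f (a + r *\<^sub>R w)) UNIV"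
      unfolding eq pcoeff_Pseries[OF sw] by (simp add: mult_ac)
  qed
  then show "\<exists>r>0. \<exists>C. \<forall>w\<in>qbox. f (a + r *\<^sub>R w) = ev C w" using r by blast
next
  assume "\<exists>r>0. \<exists>C. \<forall>w\<in>qbox. f (a + r *\<^sub>R w) = ev C w"
  then obtain r C where r: "r > 0" and C: "\<And>w. w \<in> qbox \<Longrightarrow> f (a + r *\<^sub>R w) = ev C w" by blast
  have "((\<lambda>\<alpha>. (\<Prod>i\<in>UNIV. (u $ i - a $ i) ^ \<alpha> i) *\<^sub>R (pcoeff C \<alpha> / r ^ mdeg \<alpha>)) has_sum f u) UNIV"
    if u: "u \<in> ball a (r / 2)" for u
  proof -
    define w where "w = (1 / r) *\<^sub>R (u - a)"
    have w: "w \<in> qbox"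
    proof -
      have "\<bar>w $ i\<bar> \<le> 1/2" for i
      proof -
        have "\<bar>(u - a) $ i\<bar> \<le> norm (u - a)" by (rule component_le_norm_cart)
        also have "\<dots> < r / 2" using u by (simp add: dist_norm norm_minus_commute)
        finally show ?thesis using r by (simp add: w_def field_simps)
      qed
      then show ?thesis by (simp add: qbox_def)
    qed
    have uw: "u = a + r *\<^sub>R w" using r by (simp add: w_def)
    have "(\<Prod>i\<in>UNIV. (u $ i - a $ i) ^ \<alpha> i) *\<^sub>R (pcoeff C \<alpha> / r ^ mdeg \<alpha>) = pcoeff C \<alpha> * mpow (($) w) \<alpha>" for \<alpha>
      using r unfolding uw by (simp add: mpow_def power_mult_distrib prod.distrib mdeg_def power_sum)
    then show ?thesis using ev_has_sum[OF w, of C] C[OF w] uw by simp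
  qed
  then show "real_analytic_at f a"
    unfolding real_analytic_at_def
    by (intro exI[of _ "r/2"] conjI exI[of _ "\<lambda>\<alpha>. pcoeff C \<alpha> / r ^ mdeg \<alpha>"] ballI) (use r in simp)
qed

text \<open>Phrased for all sufficiently small scales so that finitely many functions can be
  expanded at a common scale. The norm bound says that only the constant term survives as the scale
  shrinks.\<close>

lemma real_analytic_at_ev_small:
  fixes f :: "real^'n \<Rightarrow> real"
  assumes "real_analytic_at f a" and "\<epsilon> > 0"
  shows "\<forall>\<^sub>F r in at_right 0. \<exists>C. (\<forall>w\<in>qbox. f (a + r *\<^sub>R w) = ev C w) \<and> norm (C - cst (f a)) < \<epsilon>"
proof -
  obtain R C where R: "R > 0" and C: "\<And>w. w \<in> qbox \<Longrightarrow> f (a + R *\<^sub>R w) = ev C w"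
    using assms(1) unfolding real_analytic_at_ev by blast
  have fa: "f a = pcoeff C 0" using C[of 0] by (simp add: ev_at_0)
  define d where "d = min R (R * \<epsilon> / (norm C + 1))"
  have np: "norm C + 1 > 0" using norm_ge_zero[of C] by linarith
  have d: "d > 0" using R assms(2) np by (simp add: d_def)
  have "\<exists>C. (\<forall>w\<in>qbox. f (a + r *\<^sub>R w) = ev C w) \<and> norm (C - cst (f a)) < \<epsilon>" if r: "r > 0" "r < d" for r
  proof (intro exI[of _ "dsc (\<lambda>_. r / R) C"] conjI ballI)
    have rR: "0 \<le> r / R" "r / R \<le> 1" using r R by (auto simp: d_def)
    show "f (a + r *\<^sub>R w) = ev (dsc (\<lambda>_. r / R) C) w" if w: "w \<in> qbox" for w
    proof -
      have "(\<chi> i. r / R * w $ i) \<in> qbox"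
      proof -
        have "\<bar>r / R * w $ i\<bar> \<le> 1/2" for i
        proof -
          have "\<bar>r / R * w $ i\<bar> \<le> 1 * \<bar>w $ i\<bar>"
            unfolding abs_mult by (rule mult_right_mono) (use rR in auto)
          also have "\<dots> \<le> 1/2" using w by (simp add: qbox_def)
          finally show ?thesis .
        qed
        then show ?thesis by (simp add: qbox_def)
      qed
      from C[OF this] have "f (a + R *\<^sub>R (\<chi> i. r / R * w $ i)) = ev (dsc (\<lambda>_. r / R) C) w"
        using rR by (simp add: ev_dsc)
      moreover have "R *\<^sub>R (\<chi> i. r / R * w $ i) = r *\<^sub>R w" using R by (simp add: vec_eq_iff)
      ultimately show ?thesis by simp
    qed
    have "norm (dsc (\<lambda>_. r / R) C - cst (f a)) \<le> r / R * norm C"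
      unfolding fa by (rule norm_dsc_const[OF rR])
    also have "\<dots> \<le> r / R * (norm C + 1)" using rR by (intro mult_left_mono) auto
    also have "\<dots> < \<epsilon>"
    proof -
      have "r < R * \<epsilon> / (norm C + 1)" using r by (simp add: d_def)
      then have "r * (norm C + 1) < R * \<epsilon>" using np by (simp add: pos_less_divide_eq)
      then show ?thesis using R by (simp add: field_simps)
    qed
    finally show "norm (dsc (\<lambda>_. r / R) C - cst (f a)) < \<epsilon>" .
  qed
  then show ?thesis unfolding eventually_at_right_field using d by (intro exI[of _ d]) auto
qed

lemma real_analytic_at_ev_ex:
  fixes f :: "real^'n \<Rightarrow> real"
  assumes "\<forall>\<^sub>F r in at_right 0. \<exists>C. \<forall>w\<in>qbox. f (a + r *\<^sub>R w) = ev C w"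
  shows "real_analytic_at f a"
proof -
  have "\<forall>\<^sub>F r in at_right (0::real). r > 0" by (simp add: eventually_at_right_less)
  with assms have "\<forall>\<^sub>F r in at_right 0. r > 0 \<and> (\<exists>C. \<forall>w\<in>qbox. f (a + r *\<^sub>R w) = ev C w)"
    by eventually_elim auto
  then have "\<exists>r. r > 0 \<and> (\<exists>C. \<forall>w\<in>qbox. f (a + r *\<^sub>R w) = ev C w)"
    by (intro eventually_happens') simp_all
  then show ?thesis unfolding real_analytic_at_ev by blast
qed

section \<open>Stability of analyticity under algebraic operations and composition\<close>

lemma real_analytic_at_cong:
  assumes f: "real_analytic_at f a" and eq: "\<forall>\<^sub>F u in nhds a. f u = g u"
  shows "real_analytic_at g a"
proof -
  obtain r c where r: "r > 0" and c: "\<And>u. u \<in> ball a r \<Longrightarrow>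
      ((\<lambda>\<alpha>. (\<Prod>i\<in>UNIV. (u $ i - a $ i) ^ \<alpha> i) *\<^sub>R c \<alpha>) has_sum f u) UNIV"
    using f unfolding real_analytic_at_def by blast
  obtain d where d: "d > 0" "\<And>u. dist u a < d \<Longrightarrow> f u = g u"
    using eq unfolding eventually_nhds_metric by blast
  show ?thesis unfolding real_analytic_at_def
    by (rule exI[of _ "min r d"], use r d in simp, rule exI[of _ c])
       (use c d(2) in \<open>force simp: dist_commute\<close>)
qed

lemma has_sum_vec_iff:
  fixes f :: "'a \<Rightarrow> 'b::real_normed_vector^'m"
  shows "(f has_sum s) A \<longleftrightarrow> (\<forall>i. ((\<lambda>x. f x $ i) has_sum s $ i) A)"
proof
  assume "(f has_sum s) A"
  then show "\<forall>i. ((\<lambda>x. f x $ i) has_sum s $ i) A"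
    using has_sum_bounded_linear[OF bounded_linear_vec_nth] by blast
next
  assume "\<forall>i. ((\<lambda>x. f x $ i) has_sum s $ i) A"
  then have "((\<lambda>F. (\<Sum>x\<in>F. f x) $ i) \<longlongrightarrow> s $ i) (finite_subsets_at_top A)" for i
    by (simp add: has_sum_def)
  then show "(f has_sum s) A" unfolding has_sum_def by (rule vec_tendstoI)
qed

lemma real_analytic_at_vec:
  fixes f :: "real^'n \<Rightarrow> 'b::real_normed_vector^'m"
  shows "real_analytic_at f a \<longleftrightarrow> (\<forall>i. real_analytic_at (\<lambda>u. f u $ i) a)"
proof
  assume "real_analytic_at f a"
  then obtain r c where r: "r > 0" and c: "\<And>u. u \<in> ball a r \<Longrightarrow>
      ((\<lambda>\<alpha>. (\<Prod>i\<in>UNIV. (u $ i - a $ i) ^ \<alpha> i) *\<^sub>R c \<alpha>) has_sum f u) UNIV"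
    unfolding real_analytic_at_def by blast
  show "\<forall>i. real_analytic_at (\<lambda>u. f u $ i) a"
  proof
    fix i
    have "((\<lambda>\<alpha>. (\<Prod>i\<in>UNIV. (u $ i - a $ i) ^ \<alpha> i) *\<^sub>R (c \<alpha> $ i)) has_sum f u $ i) UNIV" if "u \<in> ball a r" for u
      using c[OF that] unfolding has_sum_vec_iff vector_scaleR_component by (rule spec)
    then show "real_analytic_at (\<lambda>u. f u $ i) a"
      unfolding real_analytic_at_def
      by (intro exI[of _ r] conjI r exI[of _ "\<lambda>\<alpha>. c \<alpha> $ i"] ballI)
  qed
next
  assume "\<forall>i. real_analytic_at (\<lambda>u. f u $ i) a"
  then obtain r where "\<forall>i. r i > 0 \<and> (\<exists>c. \<forall>u \<in> ball a (r i).
      ((\<lambda>\<alpha>. (\<Prod>j\<in>UNIV. (u $ j - a $ j) ^ \<alpha> j) *\<^sub>R c \<alpha>) has_sum f u $ i) UNIV)"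
    unfolding real_analytic_at_def choice_iff by (rule exE)
  then have r: "\<And>i. r i > 0" and "\<forall>i. \<exists>c. \<forall>u \<in> ball a (r i).
      ((\<lambda>\<alpha>. (\<Prod>j\<in>UNIV. (u $ j - a $ j) ^ \<alpha> j) *\<^sub>R c \<alpha>) has_sum f u $ i) UNIV"
    by simp_all
  then obtain c where c: "\<forall>i. \<forall>u \<in> ball a (r i).
      ((\<lambda>\<alpha>. (\<Prod>j\<in>UNIV. (u $ j - a $ j) ^ \<alpha> j) *\<^sub>R c i \<alpha>) has_sum f u $ i) UNIV"
    unfolding choice_iff by blast
  define R where "R = Min (range r)"
  have "R > 0" unfolding R_def using r by (subst Min_gr_iff) auto
  have Ri: "R \<le> r i" for i unfolding R_def by (rule Min_le) auto
  have "((\<lambda>\<alpha>. ((\<Prod>j\<in>UNIV. (u $ j - a $ j) ^ \<alpha> j) *\<^sub>R (\<chi> i. c i \<alpha>)) $ i) has_sum f u $ i) UNIV"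
    if u: "u \<in> ball a R" for u i
  proof -
    have "u \<in> ball a (r i)" using u Ri[of i] by auto
    with c show ?thesis by simp
  qed
  with \<open>R > 0\<close> show "real_analytic_at f a"
    unfolding real_analytic_at_def has_sum_vec_iff
    by (intro exI[of _ R] conjI exI[of _ "\<lambda>\<alpha>. \<chi> i. c i \<alpha>"] ballI allI)
qed

lemma real_analytic_at_const_real: "real_analytic_at (\<lambda>u::real^'n. c::real) a"
  unfolding real_analytic_at_ev by (intro exI[of _ 1] conjI exI[of _ "cst c"]) (auto simp: ev_cst)

lemma real_analytic_at_nth: "real_analytic_at (\<lambda>u::real^'n. u $ i) a"
  unfolding real_analytic_at_ev
  by (intro exI[of _ 1] conjI exI[of _ "cst (a $ i) + var i"]) (auto simp: ev_cst ev_add)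

lemma real_analytic_at_add_real:
  fixes f g :: "real^'n \<Rightarrow> real"
  assumes "real_analytic_at f a" "real_analytic_at g a"
  shows "real_analytic_at (\<lambda>u. f u + g u) a"
  using real_analytic_at_ev_small[OF assms(1), of 1, simplified] real_analytic_at_ev_small[OF assms(2), of 1, simplified]
  by (intro real_analytic_at_ev_ex, eventually_elim) (metis ev_add)

lemma real_analytic_at_mult:
  fixes f g :: "real^'n \<Rightarrow> real"
  assumes "real_analytic_at f a" "real_analytic_at g a"
  shows "real_analytic_at (\<lambda>u. f u * g u) a"
  using real_analytic_at_ev_small[OF assms(1), of 1, simplified] real_analytic_at_ev_small[OF assms(2), of 1, simplified]
  by (intro real_analytic_at_ev_ex, eventually_elim) (metis ev_mult)

lemma real_analytic_at_sum_real:
  fixes f :: "'i \<Rightarrow> real^'n \<Rightarrow> real"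
  assumes "\<And>i. i \<in> I \<Longrightarrow> real_analytic_at (f i) a"
  shows "real_analytic_at (\<lambda>u. \<Sum>i\<in>I. f i u) a"
  using assms
  by (induction I rule: infinite_finite_induct) (auto intro: real_analytic_at_const_real real_analytic_at_add_real)

lemma real_analytic_at_prod:
  fixes f :: "'i \<Rightarrow> real^'n \<Rightarrow> real"
  assumes "\<And>i. i \<in> I \<Longrightarrow> real_analytic_at (f i) a"
  shows "real_analytic_at (\<lambda>u. \<Prod>i\<in>I. f i u) a"
  using assms
  by (induction I rule: infinite_finite_induct) (auto intro: real_analytic_at_const_real real_analytic_at_mult)

text \<open>Neumann series, stated as an equation in the ring.\<close>

lemma one_minus_invertible:
  fixes x :: "'a::{real_normed_algebra_1,comm_ring_1,banach}"
  assumes "norm x < 1"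
  obtains y where "(1 - x) * y = 1"
proof -
  have s: "summable (\<lambda>k. x ^ k)"
    by (rule summable_comparison_test'[where g="\<lambda>k. norm x ^ k" and N=0])
       (use assms in \<open>auto intro: norm_power_ineq summable_geometric\<close>)
  have "(\<Sum>k. x ^ k) = x ^ 0 + (\<Sum>k. x ^ Suc k)"
    using suminf_split_head[OF s] by simp
  also have "(\<Sum>k. x ^ Suc k) = x * (\<Sum>k. x ^ k)"
    using suminf_mult[OF s, of x] by simp
  finally show ?thesis by (intro that[of "\<Sum>k. x ^ k"]) (simp add: algebra_simps)
qed

text \<open>At a small scale the expansion of \<open>f\<close> is \<open>f a\<close> times
  \<open>1 - x\<close> with \<open>norm x < 1\<close>, hence invertible in the algebra; evaluation
  is multiplicative.\<close>

lemma real_analytic_at_inverse: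
  fixes f :: "real^'n \<Rightarrow> real"
  assumes f: "real_analytic_at f a" and nz: "f a \<noteq> 0"
  shows "real_analytic_at (\<lambda>u. inverse (f u)) a"
proof -
  have "\<forall>\<^sub>F r in at_right 0. \<exists>C. (\<forall>w\<in>qbox. f (a + r *\<^sub>R w) = ev C w) \<and> norm (C - cst (f a)) < \<bar>f a\<bar>"
    using real_analytic_at_ev_small[OF f] nz by simp
  then show ?thesis
  proof (intro real_analytic_at_ev_ex, eventually_elim)
    case (elim r)
    then obtain C where C: "\<And>w. w \<in> qbox \<Longrightarrow> f (a + r *\<^sub>R w) = ev C w" and n: "norm (C - cst (f a)) < \<bar>f a\<bar>"
      by blast
    define x where "x = 1 - inverse (f a) *\<^sub>R C"
    have "x = - (inverse (f a) *\<^sub>R (C - cst (f a)))" using nz by (simp add: x_def algebra_simps)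
    then have "norm x = inverse \<bar>f a\<bar> * norm (C - cst (f a))" by (simp only: norm_minus_cancel norm_scaleR abs_inverse)
    also have "\<dots> < 1" using n nz by (simp add: field_simps)
    finally obtain y where y: "(1 - x) * y = 1" by (rule one_minus_invertible)
    have "inverse (f (a + r *\<^sub>R w)) = ev (inverse (f a) *\<^sub>R y) w" if w: "w \<in> qbox" for w
    proof -
      have "ev ((inverse (f a) *\<^sub>R C) * y) w = 1" using y by (simp add: x_def ev_1)
      then have "ev C w * (inverse (f a) * ev y w) = 1" using w by (simp add: ev_mult ev_scaleR mult_ac)
      then have "inverse (ev C w) = inverse (f a) * ev y w" by (rule inverse_unique)
      then show ?thesis using w by (simp add: C ev_scaleR)
    qed
    then show ?case by blast
  qed
qed

lemma real_analytic_at_divide: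
  fixes f g :: "real^'n \<Rightarrow> real"
  assumes "real_analytic_at f a" "real_analytic_at g a" "g a \<noteq> 0"
  shows "real_analytic_at (\<lambda>u. f u / g u) a"
  unfolding divide_inverse by (intro real_analytic_at_mult real_analytic_at_inverse assms)

text \<open>After subtracting the value at \<open>a\<close> and dividing by the outer scale
  \<open>s\<close>, the inner expansions have norm at most 1/2 once the inner scale is small, which
  is the range where substitution is defined.\<close>

lemma real_analytic_at_compose_real:
  fixes f :: "real^'m \<Rightarrow> real" and g :: "real^'n \<Rightarrow> real^'m"
  assumes f: "real_analytic_at f (g a)" and g: "real_analytic_at g a"
  shows "real_analytic_at (\<lambda>u. f (g u)) a"
proof -
  obtain s C where s: "s > 0" and C: "\<And>v. v \<in> qbox \<Longrightarrow> f (g a + s *\<^sub>R v) = ev C v"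
    using f unfolding real_analytic_at_ev by blast
  have "\<forall>\<^sub>F r in at_right 0. \<forall>i. \<exists>G. (\<forall>w\<in>qbox. g (a + r *\<^sub>R w) $ i = ev G w) \<and> norm (G - cst (g a $ i)) < s / 2"
    using g s unfolding real_analytic_at_vec
    by (intro eventually_all_finite real_analytic_at_ev_small) auto
  then show ?thesis
  proof (intro real_analytic_at_ev_ex, eventually_elim)
    case (elim r)
    then obtain G where "\<forall>i. (\<forall>w\<in>qbox. g (a + r *\<^sub>R w) $ i = ev (G i) w) \<and> norm (G i - cst (g a $ i)) < s / 2"
      unfolding choice_iff by blast
    then have G: "\<And>i w. w \<in> qbox \<Longrightarrow> g (a + r *\<^sub>R w) $ i = ev (G i) w"
      and n: "\<And>i. norm (G i - cst (g a $ i)) < s / 2" by blast+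
    define b where "b = (\<lambda>i. (1/s) *\<^sub>R (G i - cst (g a $ i)))"
    have b: "norm (b i) \<le> 1/2" for i using n[of i] s unfolding b_def norm_scaleR by (simp add: field_simps)
    have "f (g (a + r *\<^sub>R w)) = ev (pcomp (pcoeff C) b) w" if w: "w \<in> qbox" for w
    proof -
      have "g a + s *\<^sub>R (\<chi> i. ev (b i) w) = g (a + r *\<^sub>R w)"
        using w s by (simp add: vec_eq_iff b_def ev_scaleR ev_diff ev_cst ev_1 G)
      then show ?thesis
        using C[OF ev_comp_coeff(2)[of b, OF b w]] ev_comp_coeff(1)[of b, OF b w, of C] by simp
    qed
    then show ?case by blast
  qed
qed

lemma small_qbox: "norm w \<le> 1/2 \<Longrightarrow> w \<in> qbox"
  unfolding qbox_def by (blast intro: order_trans[OF component_le_norm_cart])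

section \<open>Coefficients of order one and differentiability at the centre\<close>

lemma splits_0: "splits 0 = {(0, 0)}"
  by (auto simp: splits_def fun_eq_iff fun_algebra_apply)

lemma splits_unit: "splits (unit_idx i) = {(unit_idx i, 0), (0, unit_idx i)}"
proof -
  have "p = (unit_idx i, 0) \<or> p = (0, unit_idx i)" if p: "fst p + snd p = unit_idx i" for p
  proof -
    have s: "fst p j + snd p j = unit_idx i j" for j using p by (metis plus_fun_apply)
    have z: "fst p j = 0 \<and> snd p j = 0" if "j \<noteq> i" for j
      using that s[of j] by (simp add: unit_idx_def)
    have "fst p i + snd p i = 1" using s[of i] by (simp add: unit_idx_def)
    then consider "fst p i = 1" "snd p i = 0" | "fst p i = 0" "snd p i = 1" by linarith
    then show ?thesis
    proof cases
      case 1
      then have "fst p j = unit_idx i j" "snd p j = 0" for j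
        using z[of j] by (cases "j = i"; simp add: unit_idx_def)+
      then have "fst p = unit_idx i" "snd p = 0" by (auto simp: fun_eq_iff fun_algebra_apply)
      then show ?thesis by (metis prod.collapse)
    next
      case 2
      then have "fst p j = 0" "snd p j = unit_idx i j" for j
        using z[of j] by (cases "j = i"; simp add: unit_idx_def)+
      then have "fst p = 0" "snd p = unit_idx i" by (auto simp: fun_eq_iff fun_algebra_apply)
      then show ?thesis by (metis prod.collapse)
    qed
  qed
  then show ?thesis by (auto simp: splits_def)
qed

lemma unit_idx_neq_0 [simp]: "unit_idx i \<noteq> 0" "0 \<noteq> unit_idx i"
  by (metis mdeg_0 mdeg_unit zero_neq_one)+

lemma unit_idx_inj [simp]: "unit_idx i = unit_idx j \<longleftrightarrow> i = j"
proof
  assume "unit_idx i = unit_idx j"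
  then have "unit_idx i i = unit_idx j i" by simp
  then show "i = j" by (simp add: unit_idx_def split: if_splits)
qed simp

lemma mdeg_eq_1: "mdeg \<alpha> = 1 \<Longrightarrow> \<exists>i. \<alpha> = unit_idx i"
proof -
  assume d: "mdeg \<alpha> = 1"
  then obtain i where i: "\<alpha> i > 0" using mdeg_eq_0[of \<alpha>] by (auto simp: fun_eq_iff fun_algebra_apply)
  have "mdeg \<alpha> = \<alpha> i + (\<Sum>j\<in>UNIV - {i}. \<alpha> j)" unfolding mdeg_def by (simp add: sum.remove)
  with d i have "\<alpha> i = 1" "(\<Sum>j\<in>UNIV - {i}. \<alpha> j) = 0" by linarith+
  then have "\<alpha> = unit_idx i" by (auto simp: fun_eq_iff fun_algebra_apply unit_idx_def)
  then show ?thesis ..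
qed

lemma pcoeff_mult_0: "pcoeff (C * D) 0 = pcoeff C 0 * pcoeff D 0"
  by (simp add: pcoeff_mult conv_def splits_0)

lemma pcoeff_mult_unit: "pcoeff (C * D) (unit_idx i) = pcoeff C (unit_idx i) * pcoeff D 0 + pcoeff C 0 * pcoeff D (unit_idx i)"
  by (simp add: pcoeff_mult conv_def splits_unit)

lemma pcoeff_power_0: "pcoeff (C ^ k) 0 = pcoeff C 0 ^ k"
  by (induction k) (auto simp: pcoeff_1 pcoeff_mult_0)

lemma pcoeff_power_unit: "pcoeff (C ^ k) (unit_idx i) = real k * pcoeff C 0 ^ (k - 1) * pcoeff C (unit_idx i)"
proof (induction k)
  case (Suc k)
  then show ?case
    by (cases k) (auto simp: pcoeff_mult_unit pcoeff_mult_0 pcoeff_power_0 algebra_simps)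
qed (simp add: pcoeff_1)

lemma pcoeff_prod_0: "pcoeff (prod b I) 0 = (\<Prod>j\<in>I. pcoeff (b j) 0)"
  by (induction I rule: infinite_finite_induct) (auto simp: pcoeff_1 pcoeff_mult_0)

lemma pcoeff_prod_unit:
  "finite I \<Longrightarrow> pcoeff (prod b I) (unit_idx i) = (\<Sum>j\<in>I. pcoeff (b j) (unit_idx i) * (\<Prod>l\<in>I - {j}. pcoeff (b l) 0))"
proof (induction I rule: finite_induct)
  case (insert x F)
  have "(\<Sum>j\<in>F. pcoeff (b j) (unit_idx i) * (\<Prod>l\<in>insert x F - {j}. pcoeff (b l) 0)) =
      (\<Sum>j\<in>F. pcoeff (b x) 0 * (pcoeff (b j) (unit_idx i) * (\<Prod>l\<in>F - {j}. pcoeff (b l) 0)))"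
  proof (rule sum.cong)
    fix j assume j: "j \<in> F"
    then have "insert x F - {j} = insert x (F - {j})" using insert by auto
    then show "pcoeff (b j) (unit_idx i) * (\<Prod>l\<in>insert x F - {j}. pcoeff (b l) 0) =
       pcoeff (b x) 0 * (pcoeff (b j) (unit_idx i) * (\<Prod>l\<in>F - {j}. pcoeff (b l) 0))"
      using insert by simp
  qed simp
  moreover have "insert x F - {x} = F" using insert by auto
  ultimately show ?case
    using insert by (simp add: pcoeff_mult_unit pcoeff_prod_0 sum_distrib_left)
qed (simp add: pcoeff_1)

text \<open>A monomial of degree \<open>d\<close> is at most
  \<open>(2 * norm w) ^ d * (1/2) ^ d\<close>. The second factor is below the weight, the first
  below its square when \<open>d\<close> is at least 2; this is the origin of the constant
  4.\<close>

lemma ev_quadratic: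
  fixes C :: "'n::finite pseries"
  assumes z: "\<And>\<alpha>. mdeg \<alpha> < 2 \<Longrightarrow> pcoeff C \<alpha> = 0" and w: "norm w \<le> 1/2"
  shows "\<bar>ev C w\<bar> \<le> 4 * (norm w)\<^sup>2 * norm C"
proof -
  have wq: "w \<in> qbox"
    by (rule small_qbox[OF w])
  have b: "\<bar>pcoeff C \<alpha> * mpow (($) w) \<alpha>\<bar> \<le> 4 * (norm w)\<^sup>2 * (\<bar>pcoeff C \<alpha>\<bar> * wt \<alpha>)" for \<alpha>
  proof (cases "mdeg \<alpha> < 2")
    case False
    have "\<bar>mpow (($) w) \<alpha>\<bar> \<le> norm w ^ mdeg \<alpha>"
      using norm_mpow_le[of "($) w" "norm w" \<alpha>] component_le_norm_cart[of w] by simp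
    also have "\<dots> = (2 * norm w) ^ mdeg \<alpha> * (1/2) ^ mdeg \<alpha>"
      by (subst power_mult_distrib[symmetric]) simp
    also have "\<dots> \<le> (2 * norm w)\<^sup>2 * wt \<alpha>"
    proof (rule mult_mono[OF _ wt_ge])
      show "(2 * norm w) ^ mdeg \<alpha> \<le> (2 * norm w)\<^sup>2"
        by (rule power_decreasing) (use False w in simp_all)
    qed simp_all
    finally have "\<bar>mpow (($) w) \<alpha>\<bar> \<le> (2 * norm w)\<^sup>2 * wt \<alpha>" .
    then have "\<bar>pcoeff C \<alpha>\<bar> * \<bar>mpow (($) w) \<alpha>\<bar> \<le> \<bar>pcoeff C \<alpha>\<bar> * ((2 * norm w)\<^sup>2 * wt \<alpha>)"
      by (rule mult_left_mono) simp
    then show ?thesis by (simp add: abs_mult power_mult_distrib mult_ac)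
  qed (simp add: z)
  have "norm (ev C w) \<le> infsum (\<lambda>\<alpha>. norm (pcoeff C \<alpha> * mpow (($) w) \<alpha>)) UNIV"
    unfolding ev_def by (rule norm_infsum_bound[OF ev_abs_summable[OF wq]])
  also have "\<dots> \<le> infsum (\<lambda>\<alpha>. 4 * (norm w)\<^sup>2 * (\<bar>pcoeff C \<alpha>\<bar> * wt \<alpha>)) UNIV"
    by (rule infsum_mono[OF ev_abs_summable[OF wq] summable_on_cmult_right[OF pcoeff_summable']])
       (use b in auto)
  also have "\<dots> = 4 * (norm w)\<^sup>2 * norm C"
    unfolding norm_pseries_def by (rule infsum_cmult_right')
  finally show ?thesis by simp
qed

text \<open>Subtracting the affine part leaves a series without terms of degree below 2, whose
  values are of order \<open>(norm h)\<^sup>2\<close>.\<close>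

lemma ev_has_derivative_0:
  fixes C :: "'n::finite pseries"
  shows "(ev C has_derivative (\<lambda>v. \<Sum>i\<in>UNIV. pcoeff C (unit_idx i) * v $ i)) (at 0)"
proof -
  define D where "D = C - cst (pcoeff C 0) - (\<Sum>i\<in>UNIV. pcoeff C (unit_idx i) *\<^sub>R var i)"
  have cs: "pcoeff (\<Sum>i\<in>I. F i) \<alpha> = (\<Sum>i\<in>I. pcoeff (F i) \<alpha>)" for I :: "'n set" and F :: "'n \<Rightarrow> 'n pseries" and \<alpha>
    by (induction I rule: infinite_finite_induct) auto
  have D0: "pcoeff D \<alpha> = 0" if "mdeg \<alpha> < 2" for \<alpha>
  proof -
    have "mdeg \<alpha> = 0 \<or> mdeg \<alpha> = 1" using that by linarith
    then consider "\<alpha> = 0" | i where "\<alpha> = unit_idx i" using mdeg_eq_0 mdeg_eq_1 by blast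
    then show ?thesis
    proof cases
      case 1
      then show ?thesis by (simp add: D_def cs pcoeff_var pcoeff_1)
    next
      case (2 i)
      have "(\<Sum>j\<in>UNIV. pcoeff C (unit_idx j) * (if i = j then 1 else 0)) = pcoeff C (unit_idx i)"
        by (simp add: if_distrib cong: if_cong)
      then show ?thesis using 2 by (simp add: D_def cs pcoeff_var pcoeff_1)
    qed
  qed
  define l where "l = (\<lambda>v::real^'n. \<Sum>i\<in>UNIV. pcoeff C (unit_idx i) * v $ i)"
  have evC: "ev C w = pcoeff C 0 + l w + ev D w" if "w \<in> qbox" for w
    using that by (simp add: D_def l_def ev_diff ev_sum ev_scaleR ev_cst ev_1)
  have lin: "bounded_linear l"
    unfolding l_def
    by (intro bounded_linear_sum bounded_linear_compose[OF bounded_linear_mult_right] bounded_linear_vec_nth)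
  have "((\<lambda>h. norm (ev C (0 + h) - ev C 0 - l h) / norm h) \<longlongrightarrow> 0) (at 0)"
  proof (rule tendsto_sandwich[of "\<lambda>_. 0" _ _ "\<lambda>h. 4 * norm h * norm D"])
    show "\<forall>\<^sub>F h in at 0. norm (ev C (0 + h) - ev C 0 - l h) / norm h \<le> 4 * norm h * norm D"
      unfolding eventually_at
    proof (intro exI[of _ "1/2"] conjI ballI impI)
      fix h :: "real^'n"
      assume h: "h \<noteq> 0 \<and> dist h 0 < 1/2"
      then have hn: "norm h \<le> 1/2" "norm h > 0" by auto
      have hq: "h \<in> qbox"
        by (rule small_qbox[OF hn(1)])
      have "norm (ev C (0 + h) - ev C 0 - l h) = \<bar>ev D h\<bar>"
        using evC[OF hq] by (simp add: ev_at_0)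
      also have "\<dots> \<le> 4 * (norm h)\<^sup>2 * norm D" by (rule ev_quadratic[OF D0 hn(1)])
      finally show "norm (ev C (0 + h) - ev C 0 - l h) / norm h \<le> 4 * norm h * norm D"
        using hn by (simp add: divide_le_eq power2_eq_square mult_ac)
    qed simp
    show "((\<lambda>h::real^'n. 4 * norm h * norm D) \<longlongrightarrow> 0) (at 0)"
      by (auto intro!: tendsto_eq_intros)
  qed auto
  then show ?thesis unfolding has_derivative_at using lin by (simp add: l_def)
qed

section \<open>Re-expansion and termwise differentiation\<close>

text \<open>Taylor re-expansion at \<open>w0\<close>, at a quarter of the scale: with entries of
  \<open>w0\<close> bounded by 1/4 the inner series have norm at most 1/4 + 1/4.\<close>

definition shift :: "'n::finite pseries \<Rightarrow> real^'n \<Rightarrow> 'n pseries" where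
  "shift C w0 = pcomp (pcoeff C) (\<lambda>i. cst (w0 $ i) + (1/4) *\<^sub>R var i)"

text \<open>Formal differentiation does not preserve the weighted space, so it is combined with a
  dilation by 1/4: the \<open>i\<close>-th partial derivative at \<open>w\<close> is
  \<open>ev (dps i C) (4 *\<^sub>R w)\<close>.\<close>

definition dps :: "'n::finite \<Rightarrow> 'n pseries \<Rightarrow> 'n pseries" where
  "dps i C = Pseries (\<lambda>\<beta>. (1/4) ^ mdeg \<beta> * (real (\<beta> i + 1) * pcoeff C (\<beta> + unit_idx i)))"

lemma shift_arg_norm:
  assumes "\<And>i. \<bar>w0 $ i\<bar> \<le> 1/4"
  shows "norm (cst (w0 $ i) + (1/4) *\<^sub>R var i) \<le> 1/2"
proof -
  have "norm (cst (w0 $ i) + (1/4) *\<^sub>R var i) \<le> norm (cst (w0 $ i) :: 'a pseries) + norm ((1/4) *\<^sub>R var i :: 'a pseries)"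
    by (rule norm_triangle_ineq)
  also have "\<dots> \<le> 1/4 + 1/4" using assms[of i] norm_var[of i] by (intro add_mono) auto
  finally show ?thesis by simp
qed

lemma ev_shift:
  assumes w0: "\<And>i. \<bar>w0 $ i\<bar> \<le> 1/4" and w: "w \<in> qbox"
  shows "ev (shift C w0) w = ev C (w0 + (1/4) *\<^sub>R w)"
proof -
  have "(\<chi> i. ev (cst (w0 $ i) + (1/4) *\<^sub>R var i) w) = w0 + (1/4) *\<^sub>R w"
    using w by (simp add: vec_eq_iff ev_add ev_cst ev_scaleR ev_1)
  then show ?thesis unfolding shift_def
    using ev_comp_coeff(1)[of "\<lambda>i. cst (w0 $ i) + (1/4) *\<^sub>R var i" w C] shift_arg_norm[of w0] w0 w by simp
qed

lemma pcoeff_dps: "pcoeff (dps i C) \<beta> = (1/4) ^ mdeg \<beta> * (real (\<beta> i + 1) * pcoeff C (\<beta> + unit_idx i))"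
proof -
  have inj: "inj (\<lambda>\<beta>. \<beta> + unit_idx i)" by (rule injI) simp
  have "(\<lambda>\<beta>. \<bar>pcoeff C \<beta>\<bar> * wt \<beta>) summable_on range (\<lambda>\<beta>. \<beta> + unit_idx i)"
    by (rule summable_on_subset_banach[OF pcoeff_summable']) auto
  then have s: "(\<lambda>\<beta>. 2 * (\<bar>pcoeff C (\<beta> + unit_idx i)\<bar> * wt (\<beta> + unit_idx i))) summable_on UNIV"
    by (intro summable_on_cmult_right) (simp add: summable_on_reindex[OF inj] o_def)
  have "(\<lambda>\<beta>. \<bar>(1/4) ^ mdeg \<beta> * (real (\<beta> i + 1) * pcoeff C (\<beta> + unit_idx i))\<bar> * wt \<beta>) summable_on UNIV"
  proof (rule summable_on_comparison_test[OF s])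
    fix \<beta> :: "'a \<Rightarrow> nat"
    \<comment> \<open>The factor \<open>(1/4) ^ mdeg \<beta>\<close> is split into two halves: one
      power of 1/2 absorbs the linear growth of \<open>\<beta> i + 1\<close>, the other is dominated
      by the weight of the shifted index.\<close>
    have "real (\<beta> i + 1) \<le> real (mdeg \<beta> + 1)" using le_mdeg[of \<beta> i] by simp
    also have "\<dots> \<le> 2 ^ mdeg \<beta>" by (metis Suc_eq_plus1 Suc_leI less_exp of_nat_le_iff of_nat_numeral of_nat_power)
    finally have 1: "real (\<beta> i + 1) * (1/2) ^ mdeg \<beta> \<le> 1" by (simp add: power_one_over divide_le_eq)
    have 2: "(1/2) ^ mdeg \<beta> \<le> 2 * wt (\<beta> + unit_idx i)"
      using wt_ge[of "\<beta> + unit_idx i"] by (simp add: mdeg_add)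
    have "\<bar>(1/4) ^ mdeg \<beta> * (real (\<beta> i + 1) * pcoeff C (\<beta> + unit_idx i))\<bar> * wt \<beta> \<le>
        \<bar>(1/4) ^ mdeg \<beta> * (real (\<beta> i + 1) * pcoeff C (\<beta> + unit_idx i))\<bar>"
      by (rule mult_right_le_one_le) (auto simp: wt_le_1)
    also have "\<dots> = (real (\<beta> i + 1) * (1/2) ^ mdeg \<beta>) * ((1/2) ^ mdeg \<beta> * \<bar>pcoeff C (\<beta> + unit_idx i)\<bar>)"
    proof -
      have "(1/4::real) ^ mdeg \<beta> = (1/2) ^ mdeg \<beta> * (1/2) ^ mdeg \<beta>"
        by (subst power_mult_distrib[symmetric]) simp
      then show ?thesis by (simp add: abs_mult)
    qed
    also have "\<dots> \<le> 1 * (2 * wt (\<beta> + unit_idx i) * \<bar>pcoeff C (\<beta> + unit_idx i)\<bar>)"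
      by (rule mult_mono[OF 1 mult_right_mono[OF 2]]) auto
    finally show "\<bar>(1/4) ^ mdeg \<beta> * (real (\<beta> i + 1) * pcoeff C (\<beta> + unit_idx i))\<bar> * wt \<beta> \<le>
        2 * (\<bar>pcoeff C (\<beta> + unit_idx i)\<bar> * wt (\<beta> + unit_idx i))" by (simp add: mult_ac)
  qed auto
  then show ?thesis unfolding dps_def by (simp add: pcoeff_Pseries)
qed

lemma dps_has_sum:
  assumes w0: "\<And>i. \<bar>w0 $ i\<bar> \<le> 1/8"
  shows "((\<lambda>\<beta>. real (\<beta> i + 1) * pcoeff C (\<beta> + unit_idx i) * mpow (($) w0) \<beta>) has_sum ev (dps i C) (4 *\<^sub>R w0)) UNIV"
proof -
  have q: "4 *\<^sub>R w0 \<in> qbox"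
    unfolding qbox_def using w0 by (simp add: abs_mult mult.commute)
  have eq: "($) (4 *\<^sub>R w0) = (\<lambda>i. 4 * w0 $ i)" by auto
  have m: "mpow (\<lambda>i. 4 * w0 $ i) \<beta> = 4 ^ mdeg \<beta> * mpow (($) w0) \<beta>" for \<beta>
    using mpow_mult[of "\<lambda>_. 4" "($) w0" \<beta>] by (simp add: mpow_const)
  have "pcoeff (dps i C) \<beta> * mpow (($) (4 *\<^sub>R w0)) \<beta> = real (\<beta> i + 1) * pcoeff C (\<beta> + unit_idx i) * mpow (($) w0) \<beta>" for \<beta>
    unfolding eq m pcoeff_dps by (simp add: power_one_over)
  then show ?thesis using ev_has_sum[OF q, of "dps i C"] by simp
qed

lemma pcoeff_mpow_unit:
  fixes b :: "'n::finite \<Rightarrow> 'n pseries"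
  shows "pcoeff (mpow b \<alpha>) (unit_idx i) =
    (\<Sum>j\<in>UNIV. real (\<alpha> j) * pcoeff (b j) 0 ^ (\<alpha> j - 1) * pcoeff (b j) (unit_idx i) * (\<Prod>l\<in>UNIV - {j}. pcoeff (b l) 0 ^ \<alpha> l))"
  unfolding mpow_def by (subst pcoeff_prod_unit) (auto simp: pcoeff_power_unit pcoeff_power_0)

text \<open>The coefficient functional is applied termwise to the composition. The linear
  coefficient of the monomial with index \<open>\<alpha>\<close> at \<open>w0 + w/4\<close> is a
  quarter of its partial derivative at \<open>w0\<close>, whence the factor 1/4.\<close>

lemma pcoeff_shift_unit:
  fixes C :: "'n::finite pseries"
  assumes w0: "\<And>i. \<bar>w0 $ i\<bar> \<le> 1/8"
  shows "pcoeff (shift C w0) (unit_idx i) = (1/4) * ev (dps i C) (4 *\<^sub>R w0)"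
proof -
  define b where "b = (\<lambda>i. cst (w0 $ i) + (1/4) *\<^sub>R var i :: 'n pseries)"
  have w0': "\<bar>w0 $ i\<bar> \<le> 1/4" for i using w0[of i] by simp
  have bn: "norm (b i) \<le> 1/2" for i unfolding b_def by (rule shift_arg_norm[OF w0'])
  have "((\<lambda>\<alpha>. pcoeff C \<alpha> *\<^sub>R mpow b \<alpha>) has_sum shift C w0) UNIV"
    unfolding shift_def b_def[symmetric]
    by (rule pcomp_has_sum[OF pcoeff_norm_summable bn]) auto
  from has_sum_bounded_linear[OF bounded_linear_coeff this]
  have h1: "((\<lambda>\<alpha>. pcoeff C \<alpha> * pcoeff (mpow b \<alpha>) (unit_idx i)) has_sum pcoeff (shift C w0) (unit_idx i)) UNIV"
    by simp
  have b0: "pcoeff (b j) 0 = w0 $ j" for j by (simp add: b_def pcoeff_1 pcoeff_var)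
  have b1: "pcoeff (b j) (unit_idx i) = (if j = i then 1/4 else 0)" for j
    by (auto simp: b_def pcoeff_1 pcoeff_var)
  have cm: "pcoeff (mpow b \<alpha>) (unit_idx i) = (1/4) * (real (\<alpha> i) * (w0 $ i) ^ (\<alpha> i - 1) * (\<Prod>l\<in>UNIV - {i}. (w0 $ l) ^ \<alpha> l))" for \<alpha>
  proof -
    have "pcoeff (mpow b \<alpha>) (unit_idx i) = (\<Sum>j\<in>UNIV. if j = i then (1/4) * (real (\<alpha> i) * (w0 $ i) ^ (\<alpha> i - 1) * (\<Prod>l\<in>UNIV - {i}. (w0 $ l) ^ \<alpha> l)) else 0)"
      unfolding pcoeff_mpow_unit b0 b1 by (rule sum.cong) auto
    then show ?thesis by simp
  qed
  have inj: "inj (\<lambda>\<beta>::'n \<Rightarrow> nat. \<beta> + unit_idx i)" by (rule injI) simp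
  \<comment> \<open>Monomials free of the variable \<open>i\<close> contribute nothing, so the sum
    may be restricted to shifted indices and then reindexed.\<close>
  have "((\<lambda>\<alpha>. pcoeff C \<alpha> * pcoeff (mpow b \<alpha>) (unit_idx i)) has_sum pcoeff (shift C w0) (unit_idx i)) (range (\<lambda>\<beta>. \<beta> + unit_idx i))"
  proof (rule has_sum_cong_neutral[THEN iffD1, OF _ _ _ h1])
    fix \<alpha> :: "'n \<Rightarrow> nat"
    assume a: "\<alpha> \<in> UNIV - range (\<lambda>\<beta>. \<beta> + unit_idx i)"
    have "\<alpha> i = 0"
    proof (rule ccontr)
      assume "\<alpha> i \<noteq> 0"
      then have "\<alpha> = (\<lambda>j. \<alpha> j - unit_idx i j) + unit_idx i" by (auto simp: fun_eq_iff fun_algebra_apply unit_idx_def)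
      then show False using a by blast
    qed
    then show "pcoeff C \<alpha> * pcoeff (mpow b \<alpha>) (unit_idx i) = 0" by (simp add: cm)
  qed auto
  then have "((\<lambda>\<beta>. pcoeff C (\<beta> + unit_idx i) * pcoeff (mpow b (\<beta> + unit_idx i)) (unit_idx i)) has_sum pcoeff (shift C w0) (unit_idx i)) UNIV"
    by (subst (asm) has_sum_reindex[OF inj]) (simp add: o_def)
  moreover have "pcoeff C (\<beta> + unit_idx i) * pcoeff (mpow b (\<beta> + unit_idx i)) (unit_idx i) =
      (1/4) * (real (\<beta> i + 1) * pcoeff C (\<beta> + unit_idx i) * mpow (($) w0) \<beta>)" for \<beta>
  proof -
    have "(\<Prod>l\<in>UNIV - {i}. (w0 $ l) ^ (\<beta> + unit_idx i) l) = (\<Prod>l\<in>UNIV - {i}. (w0 $ l) ^ \<beta> l)"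
      by (rule prod.cong) (auto simp: unit_idx_def fun_algebra_apply)
    moreover have "mpow (($) w0) \<beta> = (w0 $ i) ^ \<beta> i * (\<Prod>l\<in>UNIV - {i}. (w0 $ l) ^ \<beta> l)"
      unfolding mpow_def by (simp add: prod.remove)
    moreover have "(\<beta> + unit_idx i) i = \<beta> i + 1" by (simp add: fun_algebra_apply unit_idx_def)
    ultimately show ?thesis by (simp add: cm)
  qed
  ultimately have "((\<lambda>\<beta>. (1/4) * (real (\<beta> i + 1) * pcoeff C (\<beta> + unit_idx i) * mpow (($) w0) \<beta>)) has_sum pcoeff (shift C w0) (unit_idx i)) UNIV"
    by simp
  moreover have "((\<lambda>\<beta>. (1/4) * (real (\<beta> i + 1) * pcoeff C (\<beta> + unit_idx i) * mpow (($) w0) \<beta>)) has_sum (1/4) * ev (dps i C) (4 *\<^sub>R w0)) UNIV"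
    by (rule has_sum_cmult_right[OF dps_has_sum[OF w0]])
  ultimately show ?thesis by (rule has_sum_unique)
qed

text \<open>Re-expansion moves the point \<open>w0\<close> to the centre, where the derivative is
  known. The bound 1/8 places \<open>4 *\<^sub>R w0\<close> in the cube.\<close>

lemma ev_has_derivative:
  fixes C :: "'n::finite pseries"
  assumes w0: "\<And>i. \<bar>w0 $ i\<bar> \<le> 1/8"
  shows "(ev C has_derivative (\<lambda>v. \<Sum>i\<in>UNIV. ev (dps i C) (4 *\<^sub>R w0) * v $ i)) (at w0)"
proof -
  have w0': "\<bar>w0 $ i\<bar> \<le> 1/4" for i using w0[of i] by simp
  define g where "g = (\<lambda>u::real^'n. 4 *\<^sub>R (u - w0))"
  have g: "(g has_derivative (\<lambda>v. 4 *\<^sub>R v)) (at w0)"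
    unfolding g_def by (auto intro!: derivative_eq_intros)
  have g0: "g w0 = 0" by (simp add: g_def)
  have "((\<lambda>u. ev (shift C w0) (g u)) has_derivative (\<lambda>v. \<Sum>i\<in>UNIV. pcoeff (shift C w0) (unit_idx i) * (4 *\<^sub>R v) $ i)) (at w0)"
    by (rule has_derivative_compose[OF g]) (simp add: g0 ev_has_derivative_0)
  moreover have "(\<lambda>v::real^'n. \<Sum>i\<in>UNIV. pcoeff (shift C w0) (unit_idx i) * (4 *\<^sub>R v) $ i) =
      (\<lambda>v. \<Sum>i\<in>UNIV. ev (dps i C) (4 *\<^sub>R w0) * v $ i)"
    by (simp add: pcoeff_shift_unit[OF w0])
  ultimately have d: "((\<lambda>u. ev (shift C w0) (g u)) has_derivative (\<lambda>v. \<Sum>i\<in>UNIV. ev (dps i C) (4 *\<^sub>R w0) * v $ i)) (at w0)"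
    by simp
  show ?thesis
  proof (rule has_derivative_transform_within[OF d, of "1/8"])
    fix u assume "dist u w0 < 1/8"
    then have "norm (g u) \<le> 1/2" by (simp add: g_def dist_norm)
    then have "g u \<in> qbox"
      by (rule small_qbox)
    from ev_shift[OF w0' this] show "ev (shift C w0) (g u) = ev C u" by (simp add: g_def)
  qed auto
qed

text \<open>Induction on the degree: a series vanishing near 0 has partial derivatives vanishing
  near 0, and each coefficient of degree \<open>k + 1\<close> is, up to a nonzero factor, a
  coefficient of degree \<open>k\<close> of some \<open>dps i C\<close>.\<close>

lemma ev_eq_0_imp:
  fixes C :: "'n::finite pseries"
  assumes "\<forall>\<^sub>F w in nhds 0. ev C w = 0"
  shows "C = 0"
proof -
  have "\<forall>\<alpha>. mdeg \<alpha> = k \<longrightarrow> pcoeff C \<alpha> = 0" if "\<forall>\<^sub>F w in nhds 0. ev C w = 0" for k and C :: "'n pseries"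
    using that
  proof (induction k arbitrary: C)
    case 0
    then have "ev C 0 = 0" by (rule eventually_nhds_x_imp_x)
    then show ?case by (auto simp: ev_at_0 mdeg_eq_0)
  next
    case (Suc k)
    show ?case
    proof (intro allI impI)
      fix \<alpha> :: "'n \<Rightarrow> nat" assume a: "mdeg \<alpha> = Suc k"
      then obtain i where i: "\<alpha> i > 0" using mdeg_eq_0[of \<alpha>] by (auto simp: fun_eq_iff fun_algebra_apply)
      define \<beta> where "\<beta> = (\<lambda>j. \<alpha> j - unit_idx i j)"
      have \<alpha>: "\<alpha> = \<beta> + unit_idx i" using i by (auto simp: fun_eq_iff fun_algebra_apply unit_idx_def \<beta>_def)
      have k: "mdeg \<beta> = k" using a by (simp add: \<alpha> mdeg_add)
      obtain d where d: "d > 0" "\<And>w. dist w 0 < d \<Longrightarrow> ev C w = 0"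
        using Suc.prems unfolding eventually_nhds_metric by blast
      define e where "e = min d (1/8)"
      have z: "ev (dps i C) (4 *\<^sub>R w0) = 0" if w: "norm w0 < e" for w0
      proof -
        have w0: "\<bar>w0 $ j\<bar> \<le> 1/8" for j
          using component_le_norm_cart[of w0 j] w by (simp add: e_def)
        have "(ev C has_derivative (\<lambda>v. \<Sum>i\<in>UNIV. ev (dps i C) (4 *\<^sub>R w0) * v $ i)) (at w0)"
          by (rule ev_has_derivative[OF w0])
        moreover have "(ev C has_derivative (\<lambda>v. 0)) (at w0)"
        proof (rule has_derivative_transform_within[OF has_derivative_const[of 0], of "d - norm w0"])
          show "0 < d - norm w0" using w by (simp add: e_def)
          fix u assume "dist u w0 < d - norm w0"
          then have "dist u 0 < d" using dist_triangle[of u 0 w0] by simp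
          then show "0 = ev C u" by (simp add: d(2))
        qed auto
        ultimately have "(\<lambda>v. \<Sum>i\<in>UNIV. ev (dps i C) (4 *\<^sub>R w0) * v $ i) = (\<lambda>v. 0)"
          by (rule has_derivative_unique)
        from fun_cong[OF this, of "axis i 1"] show ?thesis
          by (simp add: axis_def if_distrib cong: if_cong)
      qed
      have "\<forall>\<^sub>F w in nhds 0. ev (dps i C) w = 0"
        unfolding eventually_nhds_metric
      proof (intro exI[of _ "4 * e"] conjI allI impI)
        show "4 * e > 0" using d by (simp add: e_def)
        fix w :: "real^'n" assume "dist w 0 < 4 * e"
        then show "ev (dps i C) w = 0" using z[of "(1/4) *\<^sub>R w"] by simp
      qed
      then have "pcoeff (dps i C) \<beta> = 0" using Suc.IH k by blast
      then show "pcoeff C \<alpha> = 0" by (simp add: pcoeff_dps \<alpha>)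
    qed
  qed
  then show ?thesis using assms by (intro pseries_eqI) auto
qed

section \<open>Derivatives of analytic functions\<close>

text \<open>The formula holds at every \<open>u\<close> near \<open>a\<close>, so the derivative is
  itself given by evaluations. Analyticity of derivatives and symmetry of second derivatives are
  read off from it.\<close>

lemma real_analytic_deriv_expansion:
  fixes f :: "real^'n \<Rightarrow> real"
  assumes r: "r > 0" and C: "\<And>w. w \<in> qbox \<Longrightarrow> f (a + r *\<^sub>R w) = ev C w" and u: "dist u a < r / 8"
  shows "(f has_derivative (\<lambda>v. \<Sum>i\<in>UNIV. (1/r) * ev (dps i C) ((4/r) *\<^sub>R (u - a)) * v $ i)) (at u)"
proof -
  define w0 where "w0 = (1/r) *\<^sub>R (u - a)"
  have nw0: "norm w0 < 1/8" using u r unfolding w0_def norm_scaleR dist_norm by (simp add: field_simps)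
  have w0: "\<bar>w0 $ j\<bar> \<le> 1/8" for j
    using component_le_norm_cart[of w0 j] nw0 by simp
  have h: "((\<lambda>u. (1/r) *\<^sub>R (u - a)) has_derivative (\<lambda>v. (1/r) *\<^sub>R v)) (at u)"
    by (auto intro!: derivative_eq_intros)
  have "((\<lambda>u. ev C ((1/r) *\<^sub>R (u - a))) has_derivative (\<lambda>v. \<Sum>i\<in>UNIV. ev (dps i C) (4 *\<^sub>R w0) * ((1/r) *\<^sub>R v) $ i)) (at u)"
    by (rule has_derivative_compose[OF h]) (use ev_has_derivative[OF w0] in \<open>simp add: w0_def\<close>)
  then have d: "((\<lambda>u. ev C ((1/r) *\<^sub>R (u - a))) has_derivative
      (\<lambda>v. \<Sum>i\<in>UNIV. (1/r) * ev (dps i C) ((4/r) *\<^sub>R (u - a)) * v $ i)) (at u)"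
    by (simp add: w0_def mult_ac)
  show ?thesis
  proof (rule has_derivative_transform_within[OF d, of "r/8"])
    fix x assume "dist x u < r / 8"
    then have "dist x a < r / 4" using u dist_triangle[of x a u] by simp
    then have "norm ((1/r) *\<^sub>R (x - a)) \<le> 1/2" using r unfolding norm_scaleR dist_norm by (simp add: field_simps)
    then have "(1/r) *\<^sub>R (x - a) \<in> qbox" by (rule small_qbox)
    from C[OF this] show "ev C ((1/r) *\<^sub>R (x - a)) = f x" using r by simp
  qed (use r in auto)
qed

lemma real_analytic_near_real:
  fixes f :: "real^'n \<Rightarrow> real"
  assumes "real_analytic_at f a"
  shows "\<forall>\<^sub>F u in nhds a. real_analytic_at f u"
proof -
  obtain r C where r: "r > 0" and C: "\<And>w. w \<in> qbox \<Longrightarrow> f (a + r *\<^sub>R w) = ev C w"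
    using assms unfolding real_analytic_at_ev by blast
  have "real_analytic_at f u" if u: "dist u a < r / 8" for u
  proof -
    define w0 where "w0 = (1/r) *\<^sub>R (u - a)"
    have nw0: "norm w0 < 1/8" using u r unfolding w0_def norm_scaleR dist_norm by (simp add: field_simps)
    have w0: "\<bar>w0 $ j\<bar> \<le> 1/4" for j
      using component_le_norm_cart[of w0 j] nw0 by simp
    have "f (u + (r/4) *\<^sub>R w) = ev (shift C w0) w" if w: "w \<in> qbox" for w
    proof -
      have "w0 + (1/4) *\<^sub>R w \<in> qbox"
        unfolding qbox_def
      proof (intro CollectI allI)
        fix i
        have "\<bar>(1/4) * w $ i\<bar> \<le> 1/8" using w by (simp add: qbox_def mult.commute)
        then show "\<bar>(w0 + (1/4) *\<^sub>R w) $ i\<bar> \<le> 1/2"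
          using w0[of i] abs_triangle_ineq[of "w0 $ i" "(1/4) * w $ i"]
          unfolding vector_add_component vector_scaleR_component real_scaleR_def by linarith
      qed
      from C[OF this] have "ev (shift C w0) w = f (a + r *\<^sub>R (w0 + (1/4) *\<^sub>R w))"
        using ev_shift[OF w0 w] by simp
      also have "a + r *\<^sub>R (w0 + (1/4) *\<^sub>R w) = u + (r/4) *\<^sub>R w" using r by (simp add: w0_def algebra_simps)
      finally show ?thesis by simp
    qed
    then show ?thesis unfolding real_analytic_at_ev using r by (intro exI[of _ "r/4"]) auto
  qed
  then show ?thesis unfolding eventually_nhds_metric using r by (intro exI[of _ "r/8"]) auto
qed

lemma real_analytic_differentiable_real:
  fixes f :: "real^'n \<Rightarrow> real"
  assumes "real_analytic_at f a"
  shows "f differentiable (at a)"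
proof -
  obtain r C where r: "r > 0" and C: "\<And>w. w \<in> qbox \<Longrightarrow> f (a + r *\<^sub>R w) = ev C w"
    using assms unfolding real_analytic_at_ev by blast
  show ?thesis unfolding differentiable_def
    using real_analytic_deriv_expansion[OF r C, of a] r by auto
qed

lemma real_analytic_deriv_real:
  fixes f :: "real^'n \<Rightarrow> real"
  assumes "real_analytic_at f a"
  shows "real_analytic_at (\<lambda>u. frechet_derivative f (at u) v) a"
proof -
  obtain r C where r: "r > 0" and C: "\<And>w. w \<in> qbox \<Longrightarrow> f (a + r *\<^sub>R w) = ev C w"
    using assms unfolding real_analytic_at_ev by blast
  define g where "g = (\<lambda>u. \<Sum>i\<in>UNIV. (1/r) * ev (dps i C) ((4/r) *\<^sub>R (u - a)) * v $ i)"
  have "real_analytic_at (\<lambda>u. ev (dps i C) ((4/r) *\<^sub>R (u - a))) a" for i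
    unfolding real_analytic_at_ev using r by (intro exI[of _ "r/4"] conjI exI[of _ "dps i C"]) auto
  then have "real_analytic_at g a"
    unfolding g_def by (intro real_analytic_at_sum_real real_analytic_at_mult real_analytic_at_const_real)
  moreover have "\<forall>\<^sub>F u in nhds a. g u = frechet_derivative f (at u) v"
    unfolding eventually_nhds_metric
  proof (intro exI[of _ "r/8"] conjI allI impI)
    fix u assume "dist u a < r/8"
    from real_analytic_deriv_expansion[OF r C this]
    show "g u = frechet_derivative f (at u) v"
      unfolding g_def by (rule fun_cong[OF frechet_derivative_at, of _ _ _ v])
  qed (use r in simp)
  ultimately show ?thesis by (rule real_analytic_at_cong)
qed

text \<open>Both orders of differentiation lead to the coefficient at
  \<open>unit_idx i + unit_idx j\<close>, with the same factor.\<close>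

lemma second_derivative_symmetric_real:
  fixes f :: "real^'n \<Rightarrow> real"
  assumes "real_analytic_at f a"
  shows "frechet_derivative (\<lambda>u. frechet_derivative f (at u) w) (at a) v =
    frechet_derivative (\<lambda>u. frechet_derivative f (at u) v) (at a) w"
proof -
  obtain r C where r: "r > 0" and C: "\<And>w. w \<in> qbox \<Longrightarrow> f (a + r *\<^sub>R w) = ev C w"
    using assms unfolding real_analytic_at_ev by blast
  have key: "frechet_derivative (\<lambda>u. frechet_derivative f (at u) w) (at a) v =
      (\<Sum>i\<in>UNIV. \<Sum>j\<in>UNIV. (4/r\<^sup>2) * pcoeff (dps i C) (unit_idx j) * (w $ i * v $ j))" for v w
  proof -
    define g where "g = (\<lambda>u. \<Sum>i\<in>UNIV. (1/r) * ev (dps i C) ((4/r) *\<^sub>R (u - a)) * w $ i)"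
    have h: "((\<lambda>u. (4/r) *\<^sub>R (u - a)) has_derivative (\<lambda>v. (4/r) *\<^sub>R v)) (at a)"
      by (auto intro!: derivative_eq_intros)
    have "((\<lambda>u. ev (dps i C) ((4/r) *\<^sub>R (u - a))) has_derivative
        (\<lambda>v. \<Sum>j\<in>UNIV. pcoeff (dps i C) (unit_idx j) * ((4/r) *\<^sub>R v) $ j)) (at a)" for i
      by (rule has_derivative_compose[OF h]) (simp add: ev_has_derivative_0)
    then have g: "(g has_derivative (\<lambda>v. \<Sum>i\<in>UNIV. (1/r) * (\<Sum>j\<in>UNIV. pcoeff (dps i C) (unit_idx j) * ((4/r) *\<^sub>R v) $ j) * w $ i)) (at a)"
      unfolding g_def by (intro has_derivative_sum has_derivative_mult_left has_derivative_mult_right)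
    have "((\<lambda>u. frechet_derivative f (at u) w) has_derivative (\<lambda>v. \<Sum>i\<in>UNIV. (1/r) * (\<Sum>j\<in>UNIV. pcoeff (dps i C) (unit_idx j) * ((4/r) *\<^sub>R v) $ j) * w $ i)) (at a)"
    proof (rule has_derivative_transform_within[OF g, of "r/8"])
      fix u assume "dist u a < r/8"
      from real_analytic_deriv_expansion[OF r C this]
      show "g u = frechet_derivative f (at u) w"
        unfolding g_def by (rule fun_cong[OF frechet_derivative_at, of _ _ _ w])
    qed (use r in auto)
    from fun_cong[OF frechet_derivative_at[OF this], of v]
    have "frechet_derivative (\<lambda>u. frechet_derivative f (at u) w) (at a) v =
       (\<Sum>i\<in>UNIV. (1/r) * (\<Sum>j\<in>UNIV. pcoeff (dps i C) (unit_idx j) * ((4/r) *\<^sub>R v) $ j) * w $ i)" by (rule sym)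
    also have "\<dots> = (\<Sum>i\<in>UNIV. \<Sum>j\<in>UNIV. (4/r\<^sup>2) * pcoeff (dps i C) (unit_idx j) * (w $ i * v $ j))"
      unfolding sum_distrib_left sum_distrib_right
      by (intro sum.cong refl) (simp add: power2_eq_square)
    finally show ?thesis .
  qed
  have sym: "pcoeff (dps i C) (unit_idx j) = pcoeff (dps j C) (unit_idx i)" for i j
  proof (cases "i = j")
    case False
    have "unit_idx j + unit_idx i = unit_idx i + unit_idx j" by (rule add.commute)
    then show ?thesis using False by (simp add: pcoeff_dps) (simp add: unit_idx_def)
  qed simp
  show ?thesis unfolding key
    by (subst sum.swap) (intro sum.cong refl, subst sym, simp add: mult_ac)
qed

section \<open>Identity theorem\<close>

text \<open>A connectedness argument: the set \<open>Z\<close> of points near which \<open>g\<close>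
  vanishes is open, and its complement in \<open>S\<close> is open because a zero expansion at a
  point close to \<open>b\<close> already covers a neighbourhood of \<open>b\<close>.\<close>

lemma real_analytic_identity:
  fixes g :: "real^'n \<Rightarrow> real"
  assumes S: "open S" "connected S" and g: "\<And>u. u \<in> S \<Longrightarrow> real_analytic_at g u"
    and p: "p \<in> S" "\<forall>\<^sub>F u in nhds p. g u = 0" and u: "u \<in> S"
  shows "g u = 0"
proof -
  define Z where "Z = {b \<in> S. \<forall>\<^sub>F u in nhds b. g u = 0}"
  have oZ: "open Z"
  proof -
    have "Z = S \<inter> {b. \<forall>\<^sub>F u in nhds b. g u = 0}" by (auto simp: Z_def)
    moreover have "open {b. \<forall>\<^sub>F u in nhds b. g u = 0}"
      unfolding eventually_nhds by (subst open_subopen) blast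
    ultimately show ?thesis using S by auto
  qed
  have oC: "open (S - Z)"
  proof (rule openI)
    fix b assume b: "b \<in> S - Z"
    obtain r C where r: "r > 0" and C: "\<And>w. w \<in> qbox \<Longrightarrow> g (b + r *\<^sub>R w) = ev C w"
      using g[of b] b unfolding real_analytic_at_ev by blast
    \<comment> \<open>The expansion at \<open>b'\<close> has scale \<open>r/4\<close>, hence is
      valid on a cube of half-width \<open>r/8\<close>; it contains the ball of radius
      \<open>r/32\<close> about \<open>b\<close> as soon as \<open>b'\<close> is within
      \<open>r/32\<close> of \<open>b\<close>.\<close>
    have "b' \<notin> Z" if b': "dist b' b < r / 32" for b'
    proof
      assume bZ: "b' \<in> Z"
      define w0 where "w0 = (1/r) *\<^sub>R (b' - b)"
      have nw0: "norm w0 < 1/32" using b' r unfolding w0_def norm_scaleR dist_norm by (simp add: field_simps)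
      have w0: "\<bar>w0 $ j\<bar> \<le> 1/4" for j
        using component_le_norm_cart[of w0 j] nw0 by simp
      have e: "g (b' + (r/4) *\<^sub>R w) = ev (shift C w0) w" if w: "w \<in> qbox" for w
      proof -
        have "w0 + (1/4) *\<^sub>R w \<in> qbox"
          unfolding qbox_def
        proof (intro CollectI allI)
          fix i
          have "\<bar>(1/4) * w $ i\<bar> \<le> 1/8" using w by (simp add: qbox_def mult.commute)
          then show "\<bar>(w0 + (1/4) *\<^sub>R w) $ i\<bar> \<le> 1/2"
          using w0[of i] abs_triangle_ineq[of "w0 $ i" "(1/4) * w $ i"]
          unfolding vector_add_component vector_scaleR_component real_scaleR_def by linarith
        qed
        from C[OF this] have "ev (shift C w0) w = g (b + r *\<^sub>R (w0 + (1/4) *\<^sub>R w))"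
          using ev_shift[OF w0 w] by simp
        also have "b + r *\<^sub>R (w0 + (1/4) *\<^sub>R w) = b' + (r/4) *\<^sub>R w" using r by (simp add: w0_def algebra_simps)
        finally show ?thesis by simp
      qed
      obtain d where d: "d > 0" "\<And>u. dist u b' < d \<Longrightarrow> g u = 0"
        using bZ unfolding Z_def eventually_nhds_metric by blast
      have "\<forall>\<^sub>F w in nhds 0. ev (shift C w0) w = 0"
        unfolding eventually_nhds_metric
      proof (intro exI[of _ "min (1/2) (4 * d / r)"] conjI allI impI)
        show "min (1/2) (4 * d / r) > 0" using d r by simp
        fix w :: "real^'n" assume w: "dist w 0 < min (1/2) (4 * d / r)"
        then have "w \<in> qbox" by (intro small_qbox) simp
        moreover have "dist (b' + (r/4) *\<^sub>R w) b' < d" using w r by (simp add: dist_norm field_simps)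
        ultimately show "ev (shift C w0) w = 0" using e d(2) by metis
      qed
      then have z: "shift C w0 = 0" by (rule ev_eq_0_imp)
      have "\<forall>\<^sub>F x in nhds b. g x = 0"
        unfolding eventually_nhds_metric
      proof (intro exI[of _ "r/32"] conjI allI impI)
        fix x assume x: "dist x b < r/32"
        define w where "w = (4/r) *\<^sub>R (x - b')"
        have "dist x b' < r / 16" using x b' dist_triangle2[of x b' b] by simp
        then have "norm w \<le> 1/2" using r unfolding w_def norm_scaleR dist_norm by (simp add: field_simps)
        then have "w \<in> qbox" by (rule small_qbox)
        from e[OF this] show "g x = 0" using r z by (simp add: w_def)
      qed (use r in simp)
      then show False using b by (simp add: Z_def)
    qed
    moreover obtain s where "s > 0" "ball b s \<subseteq> S" using b S by (meson DiffD1 open_contains_ball)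
    ultimately have "ball b (min s (r/32)) \<subseteq> S - Z" by (auto simp: dist_commute)
    then show "\<exists>e>0. ball b e \<subseteq> S - Z" using \<open>s > 0\<close> r by (intro exI[of _ "min s (r/32)"]) auto
  qed
  have "Z \<subseteq> S" by (auto simp: Z_def)
  moreover have "p \<in> Z" using p by (simp add: Z_def)
  ultimately have "S - Z = {}"
    using connectedD[OF S(2) oZ oC] p by blast
  then have "u \<in> Z" using u by blast
  then show ?thesis unfolding Z_def using eventually_nhds_x_imp_x by blast
qed

section \<open>Vector-valued analytic functions\<close>

lemma real_analytic_at_linear:
  fixes f :: "real^'n \<Rightarrow> 'b::real_normed_vector"
  assumes h: "bounded_linear h" and f: "real_analytic_at f a"
  shows "real_analytic_at (\<lambda>u. h (f u)) a"
proof -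
  obtain r c where r: "r > 0" and c: "\<And>u. u \<in> ball a r \<Longrightarrow>
      ((\<lambda>\<alpha>. (\<Prod>i\<in>UNIV. (u $ i - a $ i) ^ \<alpha> i) *\<^sub>R c \<alpha>) has_sum f u) UNIV"
    using f unfolding real_analytic_at_def by blast
  have "((\<lambda>\<alpha>. (\<Prod>i\<in>UNIV. (u $ i - a $ i) ^ \<alpha> i) *\<^sub>R h (c \<alpha>)) has_sum h (f u)) UNIV" if "u \<in> ball a r" for u
    using has_sum_bounded_linear[OF h c[OF that]] by (simp add: linear_simps(5)[OF h])
  then show ?thesis unfolding real_analytic_at_def
    by (intro exI[of _ r] conjI r exI[of _ "\<lambda>\<alpha>. h (c \<alpha>)"] ballI)
qed

lemma real_analytic_at_add:
  fixes f g :: "real^'n \<Rightarrow> 'b::real_normed_vector"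
  assumes f: "real_analytic_at f a" and g: "real_analytic_at g a"
  shows "real_analytic_at (\<lambda>u. f u + g u) a"
proof -
  obtain r c where r: "r > 0" and c: "\<And>u. u \<in> ball a r \<Longrightarrow>
      ((\<lambda>\<alpha>. (\<Prod>i\<in>UNIV. (u $ i - a $ i) ^ \<alpha> i) *\<^sub>R c \<alpha>) has_sum f u) UNIV"
    using f unfolding real_analytic_at_def by blast
  obtain s d where s: "s > 0" and d: "\<And>u. u \<in> ball a s \<Longrightarrow>
      ((\<lambda>\<alpha>. (\<Prod>i\<in>UNIV. (u $ i - a $ i) ^ \<alpha> i) *\<^sub>R d \<alpha>) has_sum g u) UNIV"
    using g unfolding real_analytic_at_def by blast
  have "((\<lambda>\<alpha>. (\<Prod>i\<in>UNIV. (u $ i - a $ i) ^ \<alpha> i) *\<^sub>R (c \<alpha> + d \<alpha>)) has_sum f u + g u) UNIV"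
    if "u \<in> ball a (min r s)" for u
    unfolding scaleR_add_right by (rule has_sum_add[OF c d]) (use that in auto)
  then show ?thesis unfolding real_analytic_at_def
    by (intro exI[of _ "min r s"] conjI exI[of _ "\<lambda>\<alpha>. c \<alpha> + d \<alpha>"] ballI) (use r s in auto)
qed

lemma real_analytic_at_const:
  "real_analytic_at (\<lambda>u::real^'n. c::'b::real_normed_vector) a"
  using real_analytic_at_linear[OF bounded_linear_scaleR_left[of c] real_analytic_at_const_real[of 1 a]] by simp

lemma real_analytic_at_sum:
  fixes f :: "'i \<Rightarrow> real^'n \<Rightarrow> 'b::real_normed_vector"
  assumes "\<And>i. i \<in> I \<Longrightarrow> real_analytic_at (f i) a"
  shows "real_analytic_at (\<lambda>u. \<Sum>i\<in>I. f i u) a"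
  using assms
  by (induction I rule: infinite_finite_induct) (auto intro: real_analytic_at_const real_analytic_at_add)

text \<open>Reduces functions with values in any Euclidean space, in particular matrices, to scalar
  functions.\<close>

lemma real_analytic_at_inner:
  fixes f :: "real^'n \<Rightarrow> 'b::euclidean_space"
  shows "real_analytic_at f a \<longleftrightarrow> (\<forall>b\<in>Basis. real_analytic_at (\<lambda>u. f u \<bullet> b) a)"
proof
  assume "real_analytic_at f a"
  then show "\<forall>b\<in>Basis. real_analytic_at (\<lambda>u. f u \<bullet> b) a"
    by (auto intro: real_analytic_at_linear[OF bounded_linear_inner_left])
next
  assume *: "\<forall>b\<in>Basis. real_analytic_at (\<lambda>u. f u \<bullet> b) a"
  have "real_analytic_at (\<lambda>u. \<Sum>b\<in>Basis. (f u \<bullet> b) *\<^sub>R b) a"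
    by (rule real_analytic_at_sum, rule real_analytic_at_linear[OF bounded_linear_scaleR_left]) (use * in blast)
  then show "real_analytic_at f a" by (simp add: euclidean_representation)
qed

lemma real_analytic_at_scaleR:
  fixes f :: "real^'n \<Rightarrow> real" and g :: "real^'n \<Rightarrow> 'b::euclidean_space"
  assumes "real_analytic_at f a" "real_analytic_at g a"
  shows "real_analytic_at (\<lambda>u. f u *\<^sub>R g u) a"
  unfolding real_analytic_at_inner[of "\<lambda>u. f u *\<^sub>R g u"] inner_scaleR_left
  using assms real_analytic_at_inner[of g] by (auto intro: real_analytic_at_mult)

lemma real_analytic_at_uminus:
  fixes f :: "real^'n \<Rightarrow> 'b::real_normed_vector"
  assumes "real_analytic_at f a"
  shows "real_analytic_at (\<lambda>u. - f u) a"
  by (rule real_analytic_at_linear[OF bounded_linear_minus[OF bounded_linear_ident] assms])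

lemma real_analytic_at_diff:
  fixes f g :: "real^'n \<Rightarrow> 'b::real_normed_vector"
  assumes "real_analytic_at f a" "real_analytic_at g a"
  shows "real_analytic_at (\<lambda>u. f u - g u) a"
  using real_analytic_at_add[OF assms(1) real_analytic_at_uminus[OF assms(2)]] by simp

lemma real_analytic_at_ident: "real_analytic_at (\<lambda>u::real^'n. u) a"
  unfolding real_analytic_at_vec by (auto intro: real_analytic_at_nth)

lemma real_analytic_at_compose_gen:
  fixes f :: "real^'m \<Rightarrow> 'b::euclidean_space" and g :: "real^'n \<Rightarrow> real^'m"
  assumes f: "real_analytic_at f (g a)" and g: "real_analytic_at g a"
  shows "real_analytic_at (\<lambda>u. f (g u)) a"
  using f real_analytic_at_compose_real[OF _ g, of "\<lambda>v. f v \<bullet> _"]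
  unfolding real_analytic_at_inner[of f] real_analytic_at_inner[of "\<lambda>u. f (g u)"] by blast

lemma real_analytic_near:
  fixes f :: "real^'n \<Rightarrow> 'b::euclidean_space"
  assumes "real_analytic_at f a"
  shows "\<forall>\<^sub>F u in nhds a. real_analytic_at f u"
proof -
  have "\<forall>\<^sub>F u in nhds a. \<forall>b\<in>Basis. real_analytic_at (\<lambda>u. f u \<bullet> b) u"
    using assms real_analytic_near_real unfolding real_analytic_at_inner[of f]
    by (intro eventually_ball_finite) auto
  then show ?thesis by eventually_elim (simp add: real_analytic_at_inner[of f])
qed

lemma real_analytic_differentiable:
  fixes f :: "real^'n \<Rightarrow> 'b::euclidean_space"
  assumes "real_analytic_at f a"
  shows "f differentiable (at a)"
  using assms real_analytic_differentiable_real
  unfolding real_analytic_at_inner[of f] differentiable_componentwise_within[of f] by auto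

lemma real_analytic_has_derivative:
  fixes f :: "real^'n \<Rightarrow> 'b::euclidean_space"
  assumes "real_analytic_at f a"
  shows "(f has_derivative frechet_derivative f (at a)) (at a)"
  using real_analytic_differentiable[OF assms] frechet_derivative_works by blast

lemma real_analytic_isCont:
  fixes f :: "real^'n \<Rightarrow> 'b::euclidean_space"
  assumes "real_analytic_at f a"
  shows "isCont f a"
  using differentiable_imp_continuous_within[OF real_analytic_differentiable[OF assms]] by simp

lemma frechet_derivative_inner:
  fixes f :: "real^'n \<Rightarrow> 'b::euclidean_space"
  assumes "f differentiable (at u)" "b \<in> Basis"
  shows "frechet_derivative (\<lambda>u. f u \<bullet> b) (at u) v = frechet_derivative f (at u) v \<bullet> b"
proof -
  have "((\<lambda>u. f u \<bullet> b) has_derivative (\<lambda>v. frechet_derivative f (at u) v \<bullet> b)) (at u)"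
    using assms frechet_derivative_works[of f "at u"] has_derivative_componentwise_within[of f _ u UNIV] by blast
  from fun_cong[OF frechet_derivative_at[OF this], of v] show ?thesis by (rule sym)
qed

text \<open>No differentiability is assumed: \<open>frechet_derivative\<close> is a choice among the
  derivatives, and the two functions have the same derivatives.\<close>

lemma frechet_derivative_cong:
  assumes "\<forall>\<^sub>F u in nhds a. f u = g u"
  shows "frechet_derivative f (at a) = frechet_derivative g (at a)"
proof -
  have "(f has_derivative D) (at a) \<longleftrightarrow> (g has_derivative D) (at a)" for D
  proof -
    have *: "(f' has_derivative D) (at a) \<Longrightarrow> (g' has_derivative D) (at a)"
      if "\<forall>\<^sub>F u in nhds a. f' u = g' u" for f' g' :: "'a \<Rightarrow> 'b"
      using that unfolding eventually_nhds by (blast intro: has_derivative_transform_within_open)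
    show ?thesis using *[of f g] *[of g f] assms by (auto simp: eq_commute)
  qed
  then show ?thesis unfolding frechet_derivative_def by simp
qed

lemma real_analytic_deriv:
  fixes f :: "real^'n \<Rightarrow> 'b::euclidean_space"
  assumes "real_analytic_at f a"
  shows "real_analytic_at (\<lambda>u. frechet_derivative f (at u) v) a"
  unfolding real_analytic_at_inner[of "\<lambda>u. frechet_derivative f (at u) v"]
proof
  fix b :: 'b assume b: "b \<in> Basis"
  have "real_analytic_at (\<lambda>u. frechet_derivative (\<lambda>u. f u \<bullet> b) (at u) v) a"
    using assms b unfolding real_analytic_at_inner[of f] by (intro real_analytic_deriv_real) blast
  moreover have "\<forall>\<^sub>F u in nhds a. frechet_derivative (\<lambda>u. f u \<bullet> b) (at u) v = frechet_derivative f (at u) v \<bullet> b"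
    using real_analytic_near[OF assms]
    by eventually_elim (rule frechet_derivative_inner[OF real_analytic_differentiable b])
  ultimately show "real_analytic_at (\<lambda>u. frechet_derivative f (at u) v \<bullet> b) a" by (rule real_analytic_at_cong)
qed

lemma second_derivative_symmetric:
  fixes f :: "real^'n \<Rightarrow> 'b::euclidean_space"
  assumes f: "real_analytic_at f a"
  shows "frechet_derivative (\<lambda>u. frechet_derivative f (at u) w) (at a) v =
    frechet_derivative (\<lambda>u. frechet_derivative f (at u) v) (at a) w"
proof (rule euclidean_eqI)
  fix b :: 'b assume b: "b \<in> Basis"
  have *: "frechet_derivative (\<lambda>u. frechet_derivative f (at u) w) (at a) v \<bullet> b =
      frechet_derivative (\<lambda>u. frechet_derivative (\<lambda>u. f u \<bullet> b) (at u) w) (at a) v" for v w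
  proof -
    have "frechet_derivative (\<lambda>u. frechet_derivative f (at u) w) (at a) v \<bullet> b =
        frechet_derivative (\<lambda>u. frechet_derivative f (at u) w \<bullet> b) (at a) v"
      by (rule frechet_derivative_inner[symmetric, OF real_analytic_differentiable[OF real_analytic_deriv[OF f]] b])
    also have "frechet_derivative (\<lambda>u. frechet_derivative f (at u) w \<bullet> b) (at a) =
        frechet_derivative (\<lambda>u. frechet_derivative (\<lambda>u. f u \<bullet> b) (at u) w) (at a)"
    proof (rule frechet_derivative_cong)
      show "\<forall>\<^sub>F u in nhds a. frechet_derivative f (at u) w \<bullet> b = frechet_derivative (\<lambda>u. f u \<bullet> b) (at u) w"
        using real_analytic_near[OF f]
        by eventually_elim (rule frechet_derivative_inner[symmetric, OF real_analytic_differentiable b])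
    qed
    finally show ?thesis .
  qed
  show "frechet_derivative (\<lambda>u. frechet_derivative f (at u) w) (at a) v \<bullet> b =
      frechet_derivative (\<lambda>u. frechet_derivative f (at u) v) (at a) w \<bullet> b"
    unfolding * using f b unfolding real_analytic_at_inner[of f]
    by (intro second_derivative_symmetric_real) blast
qed

section \<open>The analytic inverse function theorem\<close>

text \<open>Doubling all arguments brings the factors into the unit ball, where differences of
  products and powers are bounded by sums of differences. Undoing it produces
  \<open>(1/2) ^ mdeg \<alpha>\<close>.\<close>

lemma norm_mpow_diff:
  fixes b b' :: "'m::finite \<Rightarrow> 'n::finite pseries"
  assumes b: "\<And>i. norm (b i) \<le> 1/2" and b': "\<And>i. norm (b' i) \<le> 1/2" and M: "\<And>i. norm (b i - b' i) \<le> M"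
  shows "norm (mpow b \<alpha> - mpow b' \<alpha>) \<le> 2 * real (mdeg \<alpha>) * (1/2) ^ mdeg \<alpha> * M"
proof -
  have two: "mpow (\<lambda>i. 2 *\<^sub>R c i) \<alpha> = 2 ^ mdeg \<alpha> *\<^sub>R mpow c \<alpha>" for c :: "'m \<Rightarrow> 'n pseries"
    using mpow_mult[of "\<lambda>_. 2 *\<^sub>R (1 :: 'n pseries)" c \<alpha>] by (simp add: mpow_const scaleR_power)
  have "norm (mpow (\<lambda>i. 2 *\<^sub>R b i) \<alpha> - mpow (\<lambda>i. 2 *\<^sub>R b' i) \<alpha>) \<le>
      (\<Sum>i\<in>UNIV. norm ((2 *\<^sub>R b i) ^ \<alpha> i - (2 *\<^sub>R b' i) ^ \<alpha> i))"
    unfolding mpow_def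
  proof (rule norm_prod_diff)
    fix i :: 'm
    have "norm (2 *\<^sub>R b i) \<le> 1" "norm (2 *\<^sub>R b' i) \<le> 1" using b[of i] b'[of i] by simp_all
    then show "norm ((2 *\<^sub>R b i) ^ \<alpha> i) \<le> 1" "norm ((2 *\<^sub>R b' i) ^ \<alpha> i) \<le> 1"
      by (meson norm_ge_zero norm_power_ineq order_trans power_le_one)+
  qed
  also have "\<dots> \<le> (\<Sum>i\<in>UNIV. real (\<alpha> i) * (2 * M))"
  proof (rule sum_mono)
    fix i :: 'm
    have "norm ((2 *\<^sub>R b i) ^ \<alpha> i - (2 *\<^sub>R b' i) ^ \<alpha> i) \<le> real (\<alpha> i) * norm (2 *\<^sub>R b i - 2 *\<^sub>R b' i)"
      using b[of i] b'[of i] by (intro norm_power_diff) simp_all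
    also have "norm (2 *\<^sub>R b i - 2 *\<^sub>R b' i) = 2 * norm (b i - b' i)"
      by (simp flip: scaleR_diff_right)
    also have "real (\<alpha> i) * (2 * norm (b i - b' i)) \<le> real (\<alpha> i) * (2 * M)"
      using M[of i] by (intro mult_left_mono) simp_all
    finally show "norm ((2 *\<^sub>R b i) ^ \<alpha> i - (2 *\<^sub>R b' i) ^ \<alpha> i) \<le> real (\<alpha> i) * (2 * M)" .
  qed
  also have "\<dots> = 2 * real (mdeg \<alpha>) * M" by (simp add: mdeg_def sum_distrib_right[symmetric])
  finally have "2 ^ mdeg \<alpha> * norm (mpow b \<alpha> - mpow b' \<alpha>) \<le> 2 * real (mdeg \<alpha>) * M"
    unfolding two scaleR_diff_right[symmetric] by simp
  then show ?thesis by (simp add: power_one_over field_simps)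
qed

lemma pcomp_lipschitz:
  fixes b b' :: "'m::finite \<Rightarrow> 'n::finite pseries"
  assumes b: "\<And>i. norm (b i) \<le> 1/2" and b': "\<And>i. norm (b' i) \<le> 1/2" and M: "\<And>i. norm (b i - b' i) \<le> M"
    and s: "(\<lambda>\<alpha>. \<bar>c \<alpha>\<bar> * (1/2) ^ mdeg \<alpha>) summable_on UNIV"
    and s': "((\<lambda>\<alpha>. \<bar>c \<alpha>\<bar> * (real (mdeg \<alpha>) * (1/2) ^ mdeg \<alpha>)) has_sum \<eta>) UNIV"
  shows "norm (pcomp c b - pcomp c b') \<le> 2 * \<eta> * M"
proof (rule norm_infsum_le)
  show "((\<lambda>\<alpha>. c \<alpha> *\<^sub>R mpow b \<alpha> + (-1) *\<^sub>R (c \<alpha> *\<^sub>R mpow b' \<alpha>)) has_sum (pcomp c b - pcomp c b')) UNIV"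
    using has_sum_add[OF pcomp_has_sum[of c "1/2" b, OF s b]
        has_sum_bounded_linear[OF bounded_linear_scaleR_right[of "-1"] pcomp_has_sum[of c "1/2" b', OF s b']]]
    by simp
  show "((\<lambda>\<alpha>. (2 * M) * (\<bar>c \<alpha>\<bar> * (real (mdeg \<alpha>) * (1/2) ^ mdeg \<alpha>))) has_sum 2 * \<eta> * M) UNIV"
    using has_sum_cmult_right[OF s', of "2 * M"] by (simp add: mult_ac)
  fix \<alpha> :: "'m \<Rightarrow> nat"
  have "norm (c \<alpha> *\<^sub>R mpow b \<alpha> + (-1) *\<^sub>R (c \<alpha> *\<^sub>R mpow b' \<alpha>)) = \<bar>c \<alpha>\<bar> * norm (mpow b \<alpha> - mpow b' \<alpha>)"
    by (simp flip: scaleR_diff_right)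
  also have "\<dots> \<le> \<bar>c \<alpha>\<bar> * (2 * real (mdeg \<alpha>) * (1/2) ^ mdeg \<alpha> * M)"
    by (intro mult_left_mono norm_mpow_diff[of b b', OF b b' M]) auto
  finally show "norm (c \<alpha> *\<^sub>R mpow b \<alpha> + (-1) *\<^sub>R (c \<alpha> *\<^sub>R mpow b' \<alpha>)) \<le>
      (2 * M) * (\<bar>c \<alpha>\<bar> * (real (mdeg \<alpha>) * (1/2) ^ mdeg \<alpha>))" by (simp add: mult_ac)
qed

lemma pcoeff_comp_0:
  fixes b :: "'m::finite \<Rightarrow> 'n::finite pseries"
  assumes s: "(\<lambda>\<alpha>. \<bar>c \<alpha>\<bar> * (1/2) ^ mdeg \<alpha>) summable_on UNIV" and b: "\<And>i. norm (b i) \<le> 1/2"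
    and b0: "\<And>i. pcoeff (b i) 0 = 0" and c0: "c 0 = 0"
  shows "pcoeff (pcomp c b) 0 = 0"
proof -
  have "((\<lambda>\<alpha>. c \<alpha> * pcoeff (mpow b \<alpha>) 0) has_sum pcoeff (pcomp c b) 0) UNIV"
    using has_sum_bounded_linear[OF bounded_linear_coeff pcomp_has_sum[of c "1/2" b, OF s b], of 0] by simp
  moreover have "c \<alpha> * pcoeff (mpow b \<alpha>) 0 = 0" for \<alpha>
  proof (cases "\<alpha> = 0")
    case False
    then obtain i where "\<alpha> i > 0" by (auto simp: fun_eq_iff fun_algebra_apply)
    then have "pcoeff (mpow b \<alpha>) 0 = 0"
      by (auto simp: mpow_def pcoeff_prod_0 pcoeff_power_0 b0 prod_zero_iff)
    then show ?thesis by simp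
  qed (simp add: c0)
  ultimately show ?thesis using has_sum_unique[OF _ has_sum_0_simp] by simp
qed

text \<open>With \<open>\<psi> (R w) = R (w + E w)\<close> and \<open>E\<close> of order two, the fixed point equation
  \<open>w = y - E w\<close> is solved in the Banach algebra of power series; the contraction constant is
  of the order of the scaling factor.\<close>

lemma contraction_solution:
  fixes c :: "'n::finite \<Rightarrow> ('n \<Rightarrow> nat) \<Rightarrow> real"
  assumes s: "\<And>i. (\<lambda>\<alpha>. \<bar>c i \<alpha>\<bar> * (1/2) ^ mdeg \<alpha>) summable_on UNIV"
    and e: "\<And>i. infsum (\<lambda>\<alpha>. \<bar>c i \<alpha>\<bar> * (1/2) ^ mdeg \<alpha>) UNIV \<le> 1/4"
    and s': "\<And>i. ((\<lambda>\<alpha>. \<bar>c i \<alpha>\<bar> * (real (mdeg \<alpha>) * (1/2) ^ mdeg \<alpha>)) has_sum \<eta> i) UNIV"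
    and e': "\<And>i. \<eta> i \<le> 1 / (4 * real CARD('n))"
    and c0: "\<And>i. c i 0 = 0"
  obtains G :: "'n pseries ^ 'n" where "\<And>i. norm (G $ i) \<le> 1/2" "\<And>i. pcoeff (G $ i) 0 = 0"
    "\<And>i. G $ i = (1/4) *\<^sub>R var i - pcomp (c i) (($) G)"
proof -
  \<comment> \<open>The vanishing constant term is part of the closed set, so the fixed point sends
    0 to 0.\<close>
  define S where "S = {G :: 'n pseries ^ 'n. \<forall>i. norm (G $ i) \<le> 1/2 \<and> pcoeff (G $ i) 0 = 0}"
  define \<Phi> where "\<Phi> = (\<lambda>G :: 'n pseries ^ 'n. \<chi> i. (1/4) *\<^sub>R var i - pcomp (c i) (($) G))"
  have "continuous_on UNIV (\<lambda>C. pcoeff C 0 :: real)"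
    by (intro linear_continuous_on bounded_linear_coeff)
  then have cc: "continuous_on UNIV (\<lambda>G :: 'n pseries ^ 'n. pcoeff (G $ i) 0)" for i
    by (rule continuous_on_compose2) (auto intro: continuous_intros)
  have "closed S"
    unfolding S_def
    by (intro closed_Collect_all closed_Collect_conj closed_Collect_le closed_Collect_eq cc continuous_intros)
  then have S: "complete S" by (simp add: complete_eq_closed)
  have ne: "S \<noteq> {}" by (auto simp: S_def intro!: exI[of _ 0])
  have inv: "\<Phi> ` S \<subseteq> S"
  proof (rule image_subsetI)
    fix G assume G: "G \<in> S"
    then have b: "\<And>i. norm (G $ i) \<le> 1/2" and b0: "\<And>i. pcoeff (G $ i) 0 = 0" by (auto simp: S_def)
    have "norm (\<Phi> G $ i) \<le> 1/2" for i
    proof -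
      have "norm (\<Phi> G $ i) \<le> norm ((1/4) *\<^sub>R var i :: 'n pseries) + norm (pcomp (c i) (($) G))"
        unfolding \<Phi>_def vec_lambda_beta by (rule norm_triangle_ineq4)
      also have "\<dots> \<le> 1/4 + 1/4"
        using norm_var[of i] norm_comp[of "c i" "1/2" "($) G", OF s b] e[of i] by (intro add_mono) auto
      finally show ?thesis by simp
    qed
    moreover have "pcoeff (\<Phi> G $ i) 0 = 0" for i
      using pcoeff_comp_0[of "c i" "($) G", OF s b b0 c0] by (simp add: \<Phi>_def pcoeff_var)
    ultimately show "\<Phi> G \<in> S" by (simp add: S_def)
  qed
  have "dist (\<Phi> G) (\<Phi> G') \<le> 1/2 * dist G G'" if G: "G \<in> S" and G': "G' \<in> S" for G G'
  proof -
    \<comment> \<open>The Euclidean norm of the tuple is bounded by the sum over its components.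
      This costs a factor \<open>CARD('n)\<close>, which the bound on \<open>\<eta>\<close>
      anticipates.\<close>
    have "norm (\<Phi> G - \<Phi> G') \<le> (\<Sum>i\<in>UNIV. norm ((\<Phi> G - \<Phi> G') $ i))"
      unfolding norm_vec_def by (rule L2_set_le_sum) simp
    also have "\<dots> \<le> (\<Sum>i\<in>(UNIV :: 'n set). 1 / (2 * real CARD('n)) * norm (G - G'))"
    proof (rule sum_mono)
      fix i
      have M: "norm (G $ j - G' $ j) \<le> norm (G - G')" for j
        using Finite_Cartesian_Product.norm_nth_le[of "G - G'" j] by simp
      have "norm ((\<Phi> G - \<Phi> G') $ i) = norm (pcomp (c i) (($) G) - pcomp (c i) (($) G'))"
        by (simp add: \<Phi>_def norm_minus_commute)
      also have "\<dots> \<le> 2 * \<eta> i * norm (G - G')"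
        by (rule pcomp_lipschitz[OF _ _ M s s']) (use G G' in \<open>auto simp: S_def\<close>)
      also have "\<dots> \<le> 2 * (1 / (4 * real CARD('n))) * norm (G - G')"
        using e'[of i] by (intro mult_right_mono mult_left_mono) auto
      finally show "norm ((\<Phi> G - \<Phi> G') $ i) \<le> 1 / (2 * real CARD('n)) * norm (G - G')" by simp
    qed
    also have "\<dots> = 1/2 * norm (G - G')" by simp
    finally show ?thesis by (simp add: dist_norm)
  qed
  then have "\<exists>!G. G \<in> S \<and> \<Phi> G = G"
    using Banach_fix[OF S ne _ _ inv, of "1/2"] by auto
  then obtain G where G: "G \<in> S" "\<Phi> G = G" by blast
  have "G $ i = (1/4) *\<^sub>R var i - pcomp (c i) (($) G)" for i
    using arg_cong[OF G(2), of "\<lambda>H. H $ i"] by (simp add: \<Phi>_def)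
  then show ?thesis using G(1) by (intro that[of G]) (auto simp: S_def)
qed

text \<open>Absorbs the factor \<open>mdeg \<alpha>\<close> that the Lipschitz estimate of a
  monomial produces.\<close>

lemma mdeg_power_bound: "mdeg \<alpha> \<ge> 2 \<Longrightarrow> real (mdeg \<alpha>) * (1/2) ^ (mdeg \<alpha> - 2) \<le> 2"
proof -
  have "real (k + 2) \<le> 2 * 2 ^ k" for k by (induction k) auto
  moreover assume "mdeg \<alpha> \<ge> 2"
  ultimately have "real (mdeg \<alpha>) \<le> 2 * 2 ^ (mdeg \<alpha> - 2)"
    by (metis le_add_diff_inverse2)
  then show ?thesis by (simp add: power_one_over field_simps)
qed

lemma analytic_right_inverse_normalized:
  fixes \<psi> :: "real^'n \<Rightarrow> real^'n"
  assumes an: "real_analytic_at \<psi> 0" and z: "\<psi> 0 = 0" and D: "(\<psi> has_derivative (\<lambda>v. v)) (at 0)"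
  obtains G where "real_analytic_at G 0" "G 0 = 0" "\<forall>\<^sub>F y in nhds 0. \<psi> (G y) = y"
proof -
  have "\<forall>\<^sub>F r in at_right 0. \<forall>i. \<exists>C. (\<forall>w\<in>qbox. \<psi> (0 + r *\<^sub>R w) $ i = ev C w) \<and> norm (C - cst (\<psi> 0 $ i)) < 1"
    using an unfolding real_analytic_at_vec[of \<psi>]
    by (intro eventually_all_finite real_analytic_at_ev_small) auto
  moreover have "\<forall>\<^sub>F r in at_right (0::real). r > 0" by (simp add: eventually_at_right_less)
  ultimately have "\<forall>\<^sub>F r in at_right 0. r > 0 \<and> (\<forall>i. \<exists>C. \<forall>w\<in>qbox. \<psi> (r *\<^sub>R w) $ i = ev C w)"
    by eventually_elim auto
  then obtain R where R: "R > 0" and "\<forall>i. \<exists>C. \<forall>w\<in>qbox. \<psi> (R *\<^sub>R w) $ i = ev C w"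
    using eventually_happens'[OF trivial_limit_at_right_real] by blast
  then obtain C where C: "\<And>i w. w \<in> qbox \<Longrightarrow> \<psi> (R *\<^sub>R w) $ i = ev (C i) w" by metis
  have C0: "pcoeff (C i) 0 = 0" for i using C[of 0 i] z by (simp add: ev_at_0)
  have C1: "pcoeff (C i) (unit_idx j) = (if i = j then R else 0)" for i j
  proof -
    have "((\<lambda>w. R *\<^sub>R w) has_derivative (\<lambda>v. R *\<^sub>R v)) (at (0::real^'n))"
      by (auto intro!: derivative_eq_intros)
    from has_derivative_compose[OF this, of \<psi> "\<lambda>v. v"] D
    have "((\<lambda>w. \<psi> (R *\<^sub>R w)) has_derivative (\<lambda>v. R *\<^sub>R v)) (at 0)" by simp
    from bounded_linear.has_derivative[OF bounded_linear_vec_nth[of i] this]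
    have d1: "((\<lambda>w. \<psi> (R *\<^sub>R w) $ i) has_derivative (\<lambda>v. R * v $ i)) (at 0)" by simp
    have "(ev (C i) has_derivative (\<lambda>v. R * v $ i)) (at 0)"
    proof (rule has_derivative_transform_within[OF d1, of "1/2"])
      fix x :: "real^'n" assume "dist x 0 < 1/2"
      then show "\<psi> (R *\<^sub>R x) $ i = ev (C i) x" by (intro C small_qbox) simp
    qed auto
    from has_derivative_unique[OF ev_has_derivative_0 this]
    have "(\<Sum>l\<in>UNIV. pcoeff (C i) (unit_idx l) * axis j 1 $ l) = R * axis j 1 $ i" by (rule fun_cong)
    moreover have "(\<Sum>l\<in>UNIV. pcoeff (C i) (unit_idx l) * axis j 1 $ l) = (\<Sum>l\<in>UNIV. if l = j then pcoeff (C i) (unit_idx j) else 0)"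
      by (rule sum.cong) (auto simp: axis_def)
    ultimately have "pcoeff (C i) (unit_idx j) = R * axis j 1 $ i" by simp
    then show ?thesis by (auto simp: axis_def)
  qed
  define n where "n = real CARD('n)"
  \<comment> \<open>An upper bound for the component norms relative to \<open>R\<close>; the summand
    1 keeps it at least 1, so \<open>t\<close> is at most 1/8.\<close>
  define K where "K = (\<Sum>i\<in>UNIV. norm (C i)) / R + 1"
  have K: "K \<ge> 1" using R by (simp add: K_def sum_nonneg)
  have CK: "norm (C i) / R \<le> K" for i
  proof -
    have "norm (C i) \<le> (\<Sum>i\<in>UNIV. norm (C i))" by (rule member_le_sum) auto
    then show ?thesis using R by (simp add: K_def field_simps)
  qed
  have n1: "n \<ge> 1" by (simp add: n_def Suc_le_eq)
  \<comment> \<open>Chosen so that \<open>2 * t * K = 1 / (4 * n)\<close>, the contraction bound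
    required of \<open>\<eta>\<close>.\<close>
  define t where "t = 1 / (8 * n * K)"
  have nK: "n * K \<ge> 1" using n1 K mult_mono[of 1 n 1 K] by simp
  have t: "0 < t" "t \<le> 1/8"
    using nK by (simp_all add: t_def field_simps)
  \<comment> \<open>The nonlinear part of \<open>\<psi> (R * t * w)\<close> divided by
    \<open>R * t\<close>: a term of degree \<open>d\<close> keeps the power \<open>d - 1\<close> of
    \<open>t\<close>, hence at least one factor \<open>t\<close>.\<close>
  define c where "c = (\<lambda>i \<alpha>. if mdeg \<alpha> < 2 then 0 else pcoeff (C i) \<alpha> / R * t ^ (mdeg \<alpha> - 1))"
  have cb: "\<bar>c i \<alpha>\<bar> * (real (mdeg \<alpha>) * (1/2) ^ mdeg \<alpha>) \<le> 2 * t / R * (\<bar>pcoeff (C i) \<alpha>\<bar> * wt \<alpha>)" for i \<alpha>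
  proof (cases "mdeg \<alpha> < 2")
    case False
    then have d: "mdeg \<alpha> \<ge> 2" by simp
    then have tt: "t ^ (mdeg \<alpha> - 1) = t * t ^ (mdeg \<alpha> - 2)"
      by (metis Suc_diff_le Suc_1 diff_Suc_Suc power_Suc numeral_2_eq_2)
    have "real (mdeg \<alpha>) * t ^ (mdeg \<alpha> - 2) \<le> real (mdeg \<alpha>) * (1/2) ^ (mdeg \<alpha> - 2)"
      using t by (intro mult_left_mono power_mono) auto
    also have "\<dots> \<le> 2" by (rule mdeg_power_bound[OF d])
    finally have 1: "real (mdeg \<alpha>) * t ^ (mdeg \<alpha> - 2) \<le> 2" .
    have "\<bar>c i \<alpha>\<bar> * (real (mdeg \<alpha>) * (1/2) ^ mdeg \<alpha>) =
        (real (mdeg \<alpha>) * t ^ (mdeg \<alpha> - 2)) * (t / R * (\<bar>pcoeff (C i) \<alpha>\<bar> * (1/2) ^ mdeg \<alpha>))"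
      using False R t by (simp add: c_def abs_mult tt[unfolded One_nat_def])
    also have "\<dots> \<le> 2 * (t / R * (\<bar>pcoeff (C i) \<alpha>\<bar> * wt \<alpha>))"
      using R t by (intro mult_mono[OF 1] mult_left_mono wt_ge) auto
    finally show ?thesis by (simp add: mult_ac)
  qed (use R t in \<open>simp add: c_def\<close>)
  have sum1: "(\<lambda>\<alpha>. 2 * t / R * (\<bar>pcoeff (C i) \<alpha>\<bar> * wt \<alpha>)) summable_on UNIV" for i
    by (intro summable_on_cmult_right pcoeff_summable')
  have s': "(\<lambda>\<alpha>. \<bar>c i \<alpha>\<bar> * (real (mdeg \<alpha>) * (1/2) ^ mdeg \<alpha>)) summable_on UNIV" for i
    by (rule summable_on_comparison_test[OF sum1[of i]]) (use cb in auto)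
  have cle: "\<bar>c i \<alpha>\<bar> * (1/2) ^ mdeg \<alpha> \<le> \<bar>c i \<alpha>\<bar> * (real (mdeg \<alpha>) * (1/2) ^ mdeg \<alpha>)" for i \<alpha>
  proof (cases "mdeg \<alpha> < 2")
    case False
    then have "1 * (1/2) ^ mdeg \<alpha> \<le> real (mdeg \<alpha>) * (1/2::real) ^ mdeg \<alpha>" by (intro mult_right_mono) auto
    then show ?thesis by (intro mult_left_mono) auto
  qed (simp add: c_def)
  have s: "(\<lambda>\<alpha>. \<bar>c i \<alpha>\<bar> * (1/2) ^ mdeg \<alpha>) summable_on UNIV" for i
    by (rule summable_on_comparison_test[OF s'[of i]]) (use cle in auto)
  define \<eta> where "\<eta> = (\<lambda>i. infsum (\<lambda>\<alpha>. \<bar>c i \<alpha>\<bar> * (real (mdeg \<alpha>) * (1/2) ^ mdeg \<alpha>)) UNIV)"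
  have eta: "\<eta> i \<le> 1 / (4 * n)" for i
  proof -
    have "\<eta> i \<le> infsum (\<lambda>\<alpha>. 2 * t / R * (\<bar>pcoeff (C i) \<alpha>\<bar> * wt \<alpha>)) UNIV"
      unfolding \<eta>_def by (rule infsum_mono[OF s' sum1 cb])
    also have "\<dots> = 2 * t / R * norm (C i)" unfolding norm_pseries_def by (rule infsum_cmult_right')
    also have "\<dots> = 2 * t * (norm (C i) / R)" by simp
    also have "\<dots> \<le> 2 * t * K" using t by (intro mult_left_mono CK) auto
    also have "\<dots> = 1 / (4 * n)" using n1 K by (simp add: t_def field_simps)
    finally show ?thesis .
  qed
  obtain G :: "'n pseries ^ 'n" where G: "\<And>i. norm (G $ i) \<le> 1/2" "\<And>i. pcoeff (G $ i) 0 = 0"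
    "\<And>i. G $ i = (1/4) *\<^sub>R var i - pcomp (c i) (($) G)"
  proof (rule contraction_solution[of c \<eta>])
    fix i
    show "infsum (\<lambda>\<alpha>. \<bar>c i \<alpha>\<bar> * (1/2) ^ mdeg \<alpha>) UNIV \<le> 1/4"
    proof -
      have "infsum (\<lambda>\<alpha>. \<bar>c i \<alpha>\<bar> * (1/2) ^ mdeg \<alpha>) UNIV \<le> \<eta> i"
        unfolding \<eta>_def by (rule infsum_mono[OF s s' cle])
      also have "\<dots> \<le> 1 / (4 * n)" by (rule eta)
      also have "\<dots> \<le> 1/4" using n1 by (simp add: field_simps)
      finally show ?thesis .
    qed
  qed (use s s' eta in \<open>auto simp: \<eta>_def n_def c_def\<close>)
  define g where "g = (\<lambda>y. \<chi> i. ev (G $ i) y)"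
  have gq: "g y \<in> qbox" if "y \<in> qbox" for y
    using order_trans[OF ev_norm[OF that] G(1)] by (simp add: qbox_def g_def)
  \<comment> \<open>The fixed point equation says \<open>g + c(g) = y/4\<close>. Multiplied by
    \<open>R * t\<close>, its left side is the full expansion of \<open>\<psi>\<close>, because the
    linear part of \<open>C i\<close> is \<open>R\<close> times the \<open>i\<close>-th
    variable.\<close>
  have sol: "\<psi> ((R * t) *\<^sub>R g y) = (R * t / 4) *\<^sub>R y" if y: "y \<in> qbox" for y
  proof -
    have "\<psi> ((R * t) *\<^sub>R g y) $ i = (R * t / 4) * y $ i" for i
    proof -
      have tg: "t *\<^sub>R g y \<in> qbox"
        unfolding qbox_def
      proof (intro CollectI allI)
        fix j
        have "\<bar>t * g y $ j\<bar> \<le> 1 * (1/2)"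
          unfolding abs_mult using t gq[OF y] by (intro mult_mono) (auto simp: qbox_def)
        then show "\<bar>(t *\<^sub>R g y) $ j\<bar> \<le> 1/2" by simp
      qed
      have eq: "(\<lambda>j. ev (G $ j) y) = ($) (g y)" by (auto simp: g_def)
      have h0: "((\<lambda>\<alpha>. c i \<alpha> * mpow (($) (g y)) \<alpha>) has_sum ev (pcomp (c i) (($) G)) y) UNIV"
        using ev_comp[of "c i" "1/2" "($) G", OF s G(1) y] by (simp add: eq)
      have "ev (G $ i) y = (1/4) * y $ i - ev (pcomp (c i) (($) G)) y"
        by (subst G(3)) (simp add: ev_diff[OF y] ev_scaleR[OF y])
      then have h1: "ev (pcomp (c i) (($) G)) y = (1/4) * y $ i - g y $ i" by (simp add: g_def)
      have "((\<lambda>\<alpha>. R * t * (c i \<alpha> * mpow (($) (g y)) \<alpha>)) has_sum R * t * ((1/4) * y $ i - g y $ i)) UNIV"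
        using has_sum_cmult_right[OF h0, of "R * t"] unfolding h1 .
      moreover have "((\<lambda>\<alpha>. R * t * (if \<alpha> = unit_idx i then g y $ i else 0)) has_sum R * t * g y $ i) UNIV"
        by (rule has_sum_cmult_right, rule has_sum_finite_neutralI[of "{unit_idx i}"]) auto
      ultimately have "((\<lambda>\<alpha>. R * t * (c i \<alpha> * mpow (($) (g y)) \<alpha>) + R * t * (if \<alpha> = unit_idx i then g y $ i else 0))
          has_sum R * t * ((1/4) * y $ i - g y $ i) + R * t * g y $ i) UNIV" by (rule has_sum_add)
      moreover have "R * t * (c i \<alpha> * mpow (($) (g y)) \<alpha>) + R * t * (if \<alpha> = unit_idx i then g y $ i else 0) =
          pcoeff (C i) \<alpha> * mpow (($) (t *\<^sub>R g y)) \<alpha>" for \<alpha>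
      proof -
        have "($) (t *\<^sub>R g y) = (\<lambda>j. t * g y $ j)" by auto
        then have m: "mpow (($) (t *\<^sub>R g y)) \<alpha> = t ^ mdeg \<alpha> * mpow (($) (g y)) \<alpha>"
          by (simp add: mpow_mult mpow_const)
        consider "mdeg \<alpha> = 0" | "mdeg \<alpha> = 1" | "mdeg \<alpha> \<ge> 2" by linarith
        then show ?thesis
        proof cases
          case 1
          then have "\<alpha> = 0" by (simp add: mdeg_eq_0)
          then show ?thesis by (simp add: C0 c_def)
        next
          case 2
          then obtain j where "\<alpha> = unit_idx j" using mdeg_eq_1 by blast
          then show ?thesis using 2 m by (simp add: C1 c_def)
        next
          case 3
          then have "\<alpha> \<noteq> unit_idx i" by auto
          moreover have "t ^ mdeg \<alpha> = t * t ^ (mdeg \<alpha> - 1)" using 3 by (cases "mdeg \<alpha>") auto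
          ultimately show ?thesis using 3 m R by (simp add: c_def)
        qed
      qed
      ultimately have "((\<lambda>\<alpha>. pcoeff (C i) \<alpha> * mpow (($) (t *\<^sub>R g y)) \<alpha>) has_sum R * t / 4 * y $ i) UNIV"
        by (simp add: algebra_simps)
      with ev_has_sum[OF tg] have "ev (C i) (t *\<^sub>R g y) = R * t / 4 * y $ i" by (rule has_sum_unique)
      then show ?thesis using C[OF tg, of i] by simp
    qed
    then show ?thesis by (simp add: vec_eq_iff)
  qed
  define q where "q = R * t / 4"
  have q: "q > 0" using R t by (simp add: q_def)
  define H where "H = (\<lambda>y. (R * t) *\<^sub>R g ((1/q) *\<^sub>R y))"
  have "real_analytic_at (\<lambda>y. ev (G $ i) ((1/q) *\<^sub>R y)) 0" for i
    unfolding real_analytic_at_ev using q by (intro exI[of _ q] conjI exI[of _ "G $ i"]) auto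
  then have "real_analytic_at (\<lambda>y. g ((1/q) *\<^sub>R y)) 0"
    unfolding real_analytic_at_vec[of "\<lambda>y. g ((1/q) *\<^sub>R y)"] by (simp add: g_def)
  then have "real_analytic_at H 0"
    unfolding H_def by (rule real_analytic_at_linear[OF bounded_linear_scaleR_right])
  moreover have "H 0 = 0" by (simp add: H_def g_def ev_at_0 G(2) vec_eq_iff)
  moreover have "\<forall>\<^sub>F y in nhds 0. \<psi> (H y) = y"
    unfolding eventually_nhds_metric
  proof (intro exI[of _ "q/2"] conjI allI impI)
    fix y :: "real^'n" assume "dist y 0 < q/2"
    then have "norm ((1/q) *\<^sub>R y) \<le> 1/2" using q by (simp add: field_simps)
    from sol[OF small_qbox[OF this]] show "\<psi> (H y) = y" using R t by (simp add: H_def q_def)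
  qed (use q in simp)
  ultimately show ?thesis by (rule that)
qed

text \<open>Translations and the inverse of the derivative at \<open>b\<close> reduce to the case
  \<open>\<psi> 0 = 0\<close> with derivative the identity.\<close>

lemma analytic_right_inverse:
  fixes \<phi> :: "real^'n \<Rightarrow> real^'n"
  assumes an: "real_analytic_at \<phi> b" and bij: "bij (frechet_derivative \<phi> (at b))"
  obtains G where "real_analytic_at G (\<phi> b)" "G (\<phi> b) = b" "\<forall>\<^sub>F y in nhds (\<phi> b). \<phi> (G y) = y"
proof -
  define D where "D = frechet_derivative \<phi> (at b)"
  have D: "(\<phi> has_derivative D) (at b)" unfolding D_def by (rule real_analytic_has_derivative[OF an])
  have linD: "linear D" using D by (rule has_derivative_linear)
  then obtain T where T: "linear T" "\<And>x. T (D x) = x" "\<And>x. D (T x) = x"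
    using bij unfolding D_def[symmetric] bij_def
    by (metis linear_injective_left_inverse linear_inverse_left o_apply id_apply comp_apply)
  have blT: "bounded_linear T" and blD: "bounded_linear D"
    using T linD linear_conv_bounded_linear by blast+
  define \<psi> where "\<psi> = (\<lambda>u. T (\<phi> (b + u) - \<phi> b))"
  have shift: "real_analytic_at (\<lambda>u. b + u) (0 :: real^'n)"
    by (intro real_analytic_at_add real_analytic_at_const real_analytic_at_ident)
  have "real_analytic_at (\<lambda>u. \<phi> (b + u)) 0"
    by (rule real_analytic_at_compose_gen[OF _ shift]) (simp add: an)
  then have "real_analytic_at \<psi> 0"
    unfolding \<psi>_def
    by (intro real_analytic_at_linear[OF blT] real_analytic_at_diff real_analytic_at_const)
  moreover have "\<psi> 0 = 0" by (simp add: \<psi>_def linear_0[OF T(1)])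
  moreover have "(\<psi> has_derivative (\<lambda>v. v)) (at 0)"
  proof -
    have "((\<lambda>u. b + u) has_derivative (\<lambda>v. v)) (at 0)" by (auto intro!: derivative_eq_intros)
    from has_derivative_compose[OF this, of \<phi> D] D
    have "((\<lambda>u. \<phi> (b + u) - \<phi> b) has_derivative D) (at 0)" by (auto intro!: derivative_eq_intros)
    from bounded_linear.has_derivative[OF blT this] show ?thesis by (simp add: \<psi>_def T)
  qed
  ultimately obtain G where G: "real_analytic_at G 0" "G 0 = 0" "\<forall>\<^sub>F y in nhds 0. \<psi> (G y) = y"
    by (rule analytic_right_inverse_normalized)
  define k where "k = (\<lambda>y. T (y - \<phi> b))"
  have k: "real_analytic_at k (\<phi> b)" unfolding k_def
    by (intro real_analytic_at_linear[OF blT] real_analytic_at_diff real_analytic_at_const real_analytic_at_ident)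
  have k0: "k (\<phi> b) = 0" by (simp add: k_def linear_0[OF T(1)])
  show ?thesis
  proof (rule that[of "\<lambda>y. b + G (k y)"])
    show "real_analytic_at (\<lambda>y. b + G (k y)) (\<phi> b)"
      by (rule real_analytic_at_add[OF real_analytic_at_const real_analytic_at_compose_gen[OF _ k]]) (simp add: k0 G)
    show "b + G (k (\<phi> b)) = b" by (simp add: k0 G)
    have "filterlim k (nhds 0) (nhds (\<phi> b))"
      using real_analytic_isCont[OF k] k0 by (metis isCont_def tendsto_at_iff_tendsto_nhds)
    from eventually_compose_filterlim[OF G(3) this]
    show "\<forall>\<^sub>F y in nhds (\<phi> b). \<phi> (b + G (k y)) = y"
    proof eventually_elim
      case (elim y)
      then have "T (\<phi> (b + G (k y)) - \<phi> b) = T (y - \<phi> b)" by (simp add: \<psi>_def k_def)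
      then have "D (T (\<phi> (b + G (k y)) - \<phi> b)) = D (T (y - \<phi> b))" by simp
      then show ?case by (simp add: T)
    qed
  qed
qed

text \<open>The differentiable inverse function theorem supplies the homeomorphism; only analyticity
  of the inverse \<open>g\<close> remains. An analytic right inverse through the same point
  suffices: near \<open>y\<close> its values lie in \<open>W\<close>, where \<open>g\<close> inverts
  \<open>\<phi>\<close>, so it coincides with \<open>g\<close>.\<close>

theorem analytic_inverse_function:
  fixes \<phi> :: "real^'n \<Rightarrow> real^'n"
  assumes an: "real_analytic_at \<phi> a" and inj: "inj (frechet_derivative \<phi> (at a))" and S: "open S" "a \<in> S"
  obtains W W' g where "open W" "a \<in> W" "W \<subseteq> S" "open W'" "homeomorphism W W' \<phi> g"
    "\<And>u. u \<in> W \<Longrightarrow> real_analytic_at \<phi> u" "\<And>y. y \<in> W' \<Longrightarrow> real_analytic_at g y"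
    "\<And>u. u \<in> W \<Longrightarrow> bij (frechet_derivative \<phi> (at u))"
proof -
  obtain S' where S': "open S'" "a \<in> S'" "\<And>u. u \<in> S' \<Longrightarrow> real_analytic_at \<phi> u"
    using real_analytic_near[OF an] unfolding eventually_nhds by blast
  define U where "U = S \<inter> S'"
  define f' where "f' = (\<lambda>u. Blinfun (frechet_derivative \<phi> (at u)))"
  have bl: "bounded_linear (frechet_derivative \<phi> (at u))" if "u \<in> U" for u
    using real_analytic_has_derivative[OF S'(3)] that unfolding U_def by (blast intro: has_derivative_bounded_linear)
  have app: "blinfun_apply (f' u) = frechet_derivative \<phi> (at u)" if "u \<in> U" for u
    unfolding f'_def by (rule bounded_linear_Blinfun_apply[OF bl[OF that]])
  have aU: "a \<in> U" using S S' by (simp add: U_def)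
  obtain T where T: "linear T" "\<And>x. T (frechet_derivative \<phi> (at a) x) = x"
    using linear_injective_left_inverse[of "frechet_derivative \<phi> (at a)"] inj bl[OF aU]
    by (metis (no_types, opaque_lifting) bounded_linear.linear comp_eq_dest_lhs id_apply)
  have blT: "bounded_linear T" using T(1) linear_conv_bounded_linear by blast
  obtain W W' g g' where W: "open W" "W \<subseteq> U" "a \<in> W" "open W'" "\<phi> a \<in> W'" "homeomorphism W W' \<phi> g"
    and bij: "\<And>y. y \<in> W' \<Longrightarrow> bij (blinfun_apply (f' (g y)))"
  proof (rule inverse_function_theorem[of U \<phi> f' a "Blinfun T"])
    show "open U" using S S' by (auto simp: U_def)
    show "(\<phi> has_derivative blinfun_apply (f' x)) (at x)" if "x \<in> U" for x
      using real_analytic_has_derivative[OF S'(3)] that app[OF that] by (simp add: U_def)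
    show "continuous_on U f'"
    proof (rule continuous_on_blinfun_componentwise)
      fix i :: "real^'n"
      have "continuous_on U (\<lambda>u. frechet_derivative \<phi> (at u) i)"
        using real_analytic_isCont[OF real_analytic_deriv[OF S'(3)]]
        by (intro continuous_at_imp_continuous_on) (auto simp: U_def)
      then show "continuous_on U (\<lambda>x. blinfun_apply (f' x) i)" by (simp add: app cong: continuous_on_cong)
    qed
    show "Blinfun T o\<^sub>L f' a = id_blinfun"
      by (rule blinfun_eqI) (simp add: app[OF aU] bounded_linear_Blinfun_apply[OF blT] T)
  qed (use aU in auto)
  have bijW: "bij (frechet_derivative \<phi> (at u))" if "u \<in> W" for u
  proof -
    have "\<phi> u \<in> W'" "g (\<phi> u) = u" using W(6) that by (auto simp: homeomorphism_def)
    then show ?thesis using bij[of "\<phi> u"] app[of u] that W(2) by auto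
  qed
  have ang: "real_analytic_at g y" if y: "y \<in> W'" for y
  proof -
    define b where "b = g y"
    have b: "b \<in> W" "\<phi> b = y" using W(6) y by (auto simp: homeomorphism_def b_def)
    have "real_analytic_at \<phi> b" using S'(3) W(2) b by (auto simp: U_def)
    from analytic_right_inverse[OF this bijW[OF b(1)]] obtain G where
      G: "real_analytic_at G y" "G y = b" "\<forall>\<^sub>F z in nhds y. \<phi> (G z) = z" unfolding b(2) by blast
    have "filterlim G (nhds b) (nhds y)"
      using real_analytic_isCont[OF G(1)] G(2) by (metis isCont_def tendsto_at_iff_tendsto_nhds)
    moreover have "\<forall>\<^sub>F u in nhds b. u \<in> W" by (rule eventually_nhds_in_open[OF W(1) b(1)])
    ultimately have "\<forall>\<^sub>F z in nhds y. G z \<in> W" by (rule eventually_compose_filterlim[rotated])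
    with G(3) have "\<forall>\<^sub>F z in nhds y. G z = g z"
    proof eventually_elim
      case (elim z)
      have "g (\<phi> (G z)) = G z" using W(6) elim by (auto simp: homeomorphism_def)
      then show ?case using elim by simp
    qed
    with G(1) show ?thesis by (rule real_analytic_at_cong)
  qed
  show ?thesis
    by (rule that[OF W(1,3) _ W(4,6) _ ang bijW]) (use W(2) S'(3) in \<open>auto simp: U_def\<close>)
qed

section \<open>A linear Cauchy-Kovalevskaya theorem\<close>

text \<open>For the radial operator \<open>R = \<Sum>\<^sub>j y\<^sub>j \<partial>\<^sub>j\<close> in the variables other than the pivot, the operators
  \<open>radint_d j = R\<^sup>-\<^sup>1 y\<^sub>j \<partial>\<^sub>p\<^sub>i\<^sub>v\<close> and \<open>radint j = R\<^sup>-\<^sup>1 y\<^sub>j\<close> have norm at most one; this is what the weight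
  \<open>wt\<close> is made for.\<close>

definition idx_diff :: "('n::finite \<Rightarrow> nat) \<Rightarrow> 'n \<Rightarrow> 'n \<Rightarrow> nat" where
  "idx_diff \<gamma> j = (\<lambda>i. \<gamma> i - unit_idx j i)"

text \<open>The eigenvalue of the radial operator \<open>R\<close> on the monomial with index
  \<open>\<gamma>\<close>; it vanishes exactly on powers of the pivot variable.\<close>

definition rdeg :: "('n::finite \<Rightarrow> nat) \<Rightarrow> nat" where
  "rdeg \<gamma> = (\<Sum>i\<in>UNIV - {piv}. \<gamma> i)"

definition radint_d :: "'n::finite \<Rightarrow> 'n pseries \<Rightarrow> 'n pseries" where
  "radint_d j C = Pseries (\<lambda>\<gamma>. if \<gamma> j = 0 then 0 else
     real (\<gamma> piv + 1) / real (rdeg \<gamma>) * pcoeff C (idx_diff \<gamma> j + unit_idx piv))"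

definition radint :: "'n::finite \<Rightarrow> 'n pseries \<Rightarrow> 'n pseries" where
  "radint j C = Pseries (\<lambda>\<gamma>. if \<gamma> j = 0 then 0 else pcoeff C (idx_diff \<gamma> j) / real (rdeg \<gamma>))"

lemma idx_diff_add: "\<gamma> j > 0 \<Longrightarrow> idx_diff \<gamma> j + unit_idx j = \<gamma>"
  by (auto simp: fun_eq_iff fun_algebra_apply idx_diff_def unit_idx_def)

lemma mdeg_split: "mdeg \<gamma> = \<gamma> piv + rdeg \<gamma>"
  by (simp add: mdeg_def rdeg_def sum.remove[of UNIV piv])

lemma rdeg_add: "rdeg (\<alpha> + \<beta>) = rdeg \<alpha> + rdeg \<beta>"
  by (simp add: rdeg_def fun_algebra_apply sum.distrib)

lemma rdeg_unit: "rdeg (unit_idx j) = (if j = piv then 0 else 1)"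
  by (simp add: rdeg_def unit_idx_def)

lemma unit_idx_piv: "unit_idx j piv = (if j = piv then 1 else 0)"
  by (auto simp: unit_idx_def)

text \<open>For operators that send monomials to multiples of monomials, contractivity can be
  checked one monomial at a time; \<open>\<phi>\<close> gives the source index, and injectivity
  prevents a source coefficient from being counted twice.\<close>

lemma pseries_operator:
  fixes C :: "'n::finite pseries"
  assumes inj: "inj_on \<phi> {\<gamma>. c \<gamma> \<noteq> 0}"
    and le: "\<And>\<gamma>. c \<gamma> \<noteq> 0 \<Longrightarrow> \<bar>c \<gamma>\<bar> * wt \<gamma> \<le> \<bar>pcoeff C (\<phi> \<gamma>)\<bar> * wt (\<phi> \<gamma>)"
  shows "pcoeff (Pseries c) = c" "norm (Pseries c) \<le> norm C"
proof -
  have *: "(\<Sum>\<alpha>\<in>F. \<bar>c \<alpha>\<bar> * wt \<alpha>) \<le> norm C" if F: "finite F" for F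
  proof -
    define F' where "F' = F \<inter> {\<gamma>. c \<gamma> \<noteq> 0}"
    have F': "finite F'" "inj_on \<phi> F'" using F inj by (auto simp: F'_def intro: inj_on_subset)
    have "(\<Sum>\<alpha>\<in>F. \<bar>c \<alpha>\<bar> * wt \<alpha>) = (\<Sum>\<alpha>\<in>F'. \<bar>c \<alpha>\<bar> * wt \<alpha>)"
      by (rule sum.mono_neutral_right) (use F in \<open>auto simp: F'_def\<close>)
    also have "\<dots> \<le> (\<Sum>\<alpha>\<in>F'. \<bar>pcoeff C (\<phi> \<alpha>)\<bar> * wt (\<phi> \<alpha>))"
      by (rule sum_mono) (use le in \<open>auto simp: F'_def\<close>)
    also have "\<dots> = (\<Sum>\<beta>\<in>\<phi> ` F'. \<bar>pcoeff C \<beta>\<bar> * wt \<beta>)"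
      by (simp add: sum.reindex[OF F'(2)])
    also have "\<dots> \<le> norm C" by (rule finite_sum_le_norm) (use F' in simp)
    finally show ?thesis .
  qed
  show "norm (Pseries c) \<le> norm C" by (rule norm_pseries_le(2)[OF *])
  show "pcoeff (Pseries c) = c" by (rule pcoeff_Pseries[OF norm_pseries_le(1)[OF *]])
qed

lemma inj_idx_diff: "inj_on (\<lambda>\<gamma>. idx_diff \<gamma> j) {\<gamma>. \<gamma> j > 0}"
  by (rule inj_onI) (metis idx_diff_add mem_Collect_eq)

text \<open>The exact compensation behind the choice of weight: the quotient of neighbouring
  binomial coefficients equals the factor by which \<open>R\<^sup>-\<^sup>1 y\<^sub>j
  \<partial>\<^sub>p\<^sub>i\<^sub>v\<close> multiplies a monomial.\<close>

lemma wt_neighbour: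
  assumes "j \<noteq> piv"
  shows "real (\<beta> piv + 1) / real (rdeg \<beta> + 1) * wt (\<beta> + unit_idx j) = wt (\<beta> + unit_idx piv)"
proof -
  define a where "a = \<beta> piv"
  define d where "d = rdeg \<beta>"
  have m: "mdeg \<beta> = a + d" by (simp add: mdeg_split a_def d_def)
  have 1: "wt (\<beta> + unit_idx j) = 1 / real (Suc (a + d) choose a)"
    using assms by (simp add: wt_def mdeg_add m fun_algebra_apply unit_idx_piv a_def)
  have 2: "wt (\<beta> + unit_idx piv) = 1 / real (Suc (a + d) choose (a + 1))"
    by (simp add: wt_def mdeg_add m fun_algebra_apply unit_idx_piv a_def)
  have b: "real (a + 1) * real (Suc (a + d) choose (a + 1)) = real (d + 1) * real (Suc (a + d) choose a)"
    using Suc_times_binomial_add[of a d] unfolding Suc_eq_plus1 of_nat_mult[symmetric] by simp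
  have p: "real (Suc (a + d) choose a) > 0" "real (Suc (a + d) choose (a + 1)) > 0"
    by (simp_all only: of_nat_0_less_iff) (rule zero_less_binomial; simp)+
  show ?thesis unfolding 1 2 a_def[symmetric] d_def[symmetric]
    using b p by (simp add: frac_eq_eq mult_ac)
qed

lemma
  fixes C :: "'n::finite pseries"
  assumes j: "j \<noteq> piv"
  shows pcoeff_radint_d: "pcoeff (radint_d j C) \<gamma> = (if \<gamma> j = 0 then 0 else
     real (\<gamma> piv + 1) / real (rdeg \<gamma>) * pcoeff C (idx_diff \<gamma> j + unit_idx piv))"
    and norm_radint_d: "norm (radint_d j C) \<le> norm C"
proof -
  define c where "c = (\<lambda>\<gamma>. if \<gamma> j = 0 then 0 else
     real (\<gamma> piv + 1) / real (rdeg \<gamma>) * pcoeff C (idx_diff \<gamma> j + unit_idx piv))"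
  have inj: "inj_on (\<lambda>\<gamma>. idx_diff \<gamma> j + unit_idx piv) {\<gamma>. c \<gamma> \<noteq> 0}"
  proof (rule inj_on_subset[of _ "{\<gamma>. \<gamma> j > 0}"])
    show "inj_on (\<lambda>\<gamma>. idx_diff \<gamma> j + unit_idx piv) {\<gamma>. \<gamma> j > 0}"
      using inj_idx_diff[of j] by (auto simp: inj_on_def)
  qed (auto simp: c_def split: if_splits)
  have le: "\<bar>c \<gamma>\<bar> * wt \<gamma> \<le> \<bar>pcoeff C (idx_diff \<gamma> j + unit_idx piv)\<bar> * wt (idx_diff \<gamma> j + unit_idx piv)"
    if "c \<gamma> \<noteq> 0" for \<gamma>
  proof -
    define \<beta> where "\<beta> = idx_diff \<gamma> j"
    have g0: "\<gamma> j > 0" using that by (auto simp: c_def split: if_splits)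
    then have g: "\<gamma> = \<beta> + unit_idx j" by (simp add: \<beta>_def idx_diff_add)
    have gp: "\<gamma> piv = \<beta> piv" "rdeg \<gamma> = rdeg \<beta> + 1"
      using j by (simp_all add: g fun_algebra_apply unit_idx_piv rdeg_add rdeg_unit)
    have "\<bar>c \<gamma>\<bar> * wt \<gamma> = \<bar>pcoeff C (\<beta> + unit_idx piv)\<bar> * (real (\<beta> piv + 1) / real (rdeg \<beta> + 1) * wt (\<beta> + unit_idx j))"
      using g0 gp by (simp add: c_def \<beta>_def[symmetric] abs_mult g[symmetric] del: of_nat_add of_nat_Suc)
    then show ?thesis unfolding wt_neighbour[OF j] \<beta>_def by simp
  qed
  have e: "radint_d j C = Pseries c" by (simp add: radint_d_def c_def)
  show "pcoeff (radint_d j C) \<gamma> = (if \<gamma> j = 0 then 0 else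
     real (\<gamma> piv + 1) / real (rdeg \<gamma>) * pcoeff C (idx_diff \<gamma> j + unit_idx piv))"
    using fun_cong[OF pseries_operator(1)[OF inj le], of \<gamma>] unfolding e by (simp add: c_def)
  show "norm (radint_d j C) \<le> norm C" unfolding e by (rule pseries_operator(2)[OF inj le])
qed

lemma
  fixes C :: "'n::finite pseries"
  assumes j: "j \<noteq> piv"
  shows pcoeff_radint: "pcoeff (radint j C) \<gamma> = (if \<gamma> j = 0 then 0 else pcoeff C (idx_diff \<gamma> j) / real (rdeg \<gamma>))"
    and norm_radint: "norm (radint j C) \<le> norm C"
proof -
  define c where "c = (\<lambda>\<gamma>. if \<gamma> j = 0 then 0 else pcoeff C (idx_diff \<gamma> j) / real (rdeg \<gamma>))"
  have inj: "inj_on (\<lambda>\<gamma>. idx_diff \<gamma> j) {\<gamma>. c \<gamma> \<noteq> 0}"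
    by (rule inj_on_subset[OF inj_idx_diff]) (auto simp: c_def split: if_splits)
  have le: "\<bar>c \<gamma>\<bar> * wt \<gamma> \<le> \<bar>pcoeff C (idx_diff \<gamma> j)\<bar> * wt (idx_diff \<gamma> j)" if "c \<gamma> \<noteq> 0" for \<gamma>
  proof -
    define \<beta> where "\<beta> = idx_diff \<gamma> j"
    have g0: "\<gamma> j > 0" using that by (auto simp: c_def split: if_splits)
    then have g: "\<gamma> = \<beta> + unit_idx j" by (simp add: \<beta>_def idx_diff_add)
    have r: "rdeg \<gamma> = rdeg \<beta> + 1" using j by (simp add: g rdeg_add rdeg_unit)
    have "\<bar>c \<gamma>\<bar> \<le> \<bar>pcoeff C \<beta>\<bar>"
      using g0 by (simp add: c_def \<beta>_def[symmetric] r divide_le_eq mult_right_le_one_le mult_le_cancel_left1)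
    moreover have "wt \<gamma> \<le> wt \<beta>"
      using wt_add_le[of \<beta> "unit_idx j"] mult_left_le[of "wt (unit_idx j)" "wt \<beta>"] wt_le_1[of "unit_idx j"]
      by (simp add: g)
    ultimately show ?thesis unfolding \<beta>_def[symmetric] by (intro mult_mono) auto
  qed
  have e: "radint j C = Pseries c" by (simp add: radint_def c_def)
  show "pcoeff (radint j C) \<gamma> = (if \<gamma> j = 0 then 0 else pcoeff C (idx_diff \<gamma> j) / real (rdeg \<gamma>))"
    using fun_cong[OF pseries_operator(1)[OF inj le], of \<gamma>] unfolding e by (simp add: c_def)
  show "norm (radint j C) \<le> norm C" unfolding e by (rule pseries_operator(2)[OF inj le])
qed

section \<open>Partial derivatives and the radial operator on series\<close>

lemma pcoeff_var_mult: "pcoeff (var i * C) \<gamma> = (if \<gamma> i = 0 then 0 else pcoeff C (idx_diff \<gamma> i))"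
proof (cases "\<gamma> i = 0")
  case True
  have "pcoeff (var i * C) \<gamma> = 0"
    unfolding pcoeff_mult conv_def
  proof (rule sum.neutral, intro ballI)
    fix p assume "p \<in> splits \<gamma>"
    then have "fst p + snd p = \<gamma>" by (simp add: splits_def)
    then have "fst p i + snd p i = 0" using True by (metis plus_fun_apply)
    then have "fst p \<noteq> unit_idx i" by (auto simp: unit_idx_def)
    then show "pcoeff (var i) (fst p) * pcoeff C (snd p) = 0" by (simp add: pcoeff_var)
  qed
  then show ?thesis using True by simp
next
  case False
  have "pcoeff (var i * C) \<gamma> = (\<Sum>p\<in>splits \<gamma>. if p = (unit_idx i, idx_diff \<gamma> i) then pcoeff C (idx_diff \<gamma> i) else 0)"
    unfolding pcoeff_mult conv_def
  proof (rule sum.cong)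
    fix p assume "p \<in> splits \<gamma>"
    then have p: "fst p + snd p = \<gamma>" by (simp add: splits_def)
    show "pcoeff (var i) (fst p) * pcoeff C (snd p) = (if p = (unit_idx i, idx_diff \<gamma> i) then pcoeff C (idx_diff \<gamma> i) else 0)"
    proof (cases "fst p = unit_idx i")
      case True
      then have "snd p + unit_idx i = idx_diff \<gamma> i + unit_idx i"
        using p idx_diff_add[of \<gamma> i] False by (simp add: add.commute)
      then have "p = (unit_idx i, idx_diff \<gamma> i)" using True by (metis add_right_cancel prod.collapse)
      then show ?thesis by (simp add: pcoeff_var)
    qed (auto simp: pcoeff_var)
  qed simp
  also have "\<dots> = pcoeff C (idx_diff \<gamma> i)"
  proof -
    have "unit_idx i + idx_diff \<gamma> i = \<gamma>" using idx_diff_add[of \<gamma> i] False by (simp add: add.commute)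
    then show ?thesis by (subst sum.delta[OF finite_splits]) (simp add: splits_def)
  qed
  finally show ?thesis using False by simp
qed

text \<open>Hides the dilation built into \<open>dps\<close>: for \<open>w\<close> in
  \<open>small_box\<close> this is the true partial derivative at \<open>w\<close>.\<close>

definition dev :: "'n::finite \<Rightarrow> 'n pseries \<Rightarrow> real^'n \<Rightarrow> real" where
  "dev i C w = ev (dps i C) (4 *\<^sub>R w)"

definition small_box :: "(real^'n) set" where
  "small_box = {w. \<forall>i. \<bar>w $ i\<bar> \<le> 1/8}"

lemma small_box_qbox: "w \<in> small_box \<Longrightarrow> w \<in> qbox"
  unfolding small_box_def qbox_def mem_Collect_eq by (erule all_forward) linarith

lemma small_box_4: "w \<in> small_box \<Longrightarrow> 4 *\<^sub>R w \<in> qbox"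
  unfolding small_box_def qbox_def by (simp add: abs_mult mult.commute)

lemma small_box_nhds: "\<forall>\<^sub>F w in nhds 0. w \<in> small_box"
  unfolding eventually_nhds_metric
proof (intro exI[of _ "1/8"] conjI allI impI)
  fix w :: "real^'n" assume "dist w 0 < 1/8"
  then show "w \<in> small_box"
    unfolding small_box_def by (intro CollectI allI order_trans[OF component_le_norm_cart]) simp
qed simp

lemma ev_has_derivative_dev:
  "w \<in> small_box \<Longrightarrow> (ev C has_derivative (\<lambda>v. \<Sum>i\<in>UNIV. dev i C w * v $ i)) (at w)"
  unfolding dev_def by (rule ev_has_derivative) (simp add: small_box_def)

lemma dev_axis: "(\<Sum>i\<in>UNIV. dev i C w * axis j 1 $ i) = dev j C w"
proof -
  have "(\<Sum>i\<in>UNIV. dev i C w * axis j 1 $ i) = (\<Sum>i\<in>UNIV. if i = j then dev j C w else 0)"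
    by (rule sum.cong) (auto simp: axis_def)
  then show ?thesis by simp
qed

text \<open>Obtained from the product rule for functions and uniqueness of derivatives, avoiding any
  manipulation of convolutions.\<close>

lemma dev_mult:
  assumes w: "w \<in> small_box"
  shows "dev i (C * D) w = ev C w * dev i D w + dev i C w * ev D w"
proof -
  have "((\<lambda>w. ev C w * ev D w) has_derivative
      (\<lambda>v. ev C w * (\<Sum>i\<in>UNIV. dev i D w * v $ i) + (\<Sum>i\<in>UNIV. dev i C w * v $ i) * ev D w)) (at w)"
    by (rule has_derivative_mult[OF ev_has_derivative_dev[OF w] ev_has_derivative_dev[OF w]])
  then have "(ev (C * D) has_derivative
      (\<lambda>v. ev C w * (\<Sum>i\<in>UNIV. dev i D w * v $ i) + (\<Sum>i\<in>UNIV. dev i C w * v $ i) * ev D w)) (at w)"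
  proof (rule has_derivative_transform_within[where d="1/4"])
    fix u assume u: "dist u w < 1/4"
    have "\<bar>u $ i\<bar> \<le> 1/2" for i
    proof -
      have "\<bar>(u - w) $ i\<bar> \<le> 1/4" using component_le_norm_cart[of "u - w" i] u by (simp add: dist_norm)
      moreover have "\<bar>w $ i\<bar> \<le> 1/8" using w by (simp add: small_box_def)
      ultimately show ?thesis unfolding vector_minus_component by linarith
    qed
    then show "ev C u * ev D u = ev (C * D) u" by (simp add: ev_mult qbox_def)
  qed auto
  from fun_cong[OF has_derivative_unique[OF ev_has_derivative_dev[OF w] this], of "axis i 1"]
  show ?thesis by (simp only: dev_axis)
qed

lemma dps_add: "dps i (C + D) = dps i C + dps i D"
  by (rule pseries_eqI) (simp add: pcoeff_dps algebra_simps)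

lemma dps_scaleR: "dps i (r *\<^sub>R C) = r *\<^sub>R dps i C"
  by (rule pseries_eqI) (simp add: pcoeff_dps)

lemma dev_scaleR: "w \<in> small_box \<Longrightarrow> dev i (r *\<^sub>R C) w = r * dev i C w"
  unfolding dev_def dps_scaleR by (rule ev_scaleR[OF small_box_4])

lemma dev_add: "w \<in> small_box \<Longrightarrow> dev i (C + D) w = dev i C w + dev i D w"
  unfolding dev_def dps_add by (rule ev_add[OF small_box_4])

text \<open>\<open>euler C w\<close> is the value of \<open>R\<close> applied to \<open>ev C\<close> at \<open>w\<close>.\<close>

definition radial :: "'n::finite pseries \<Rightarrow> 'n pseries" where
  "radial C = (\<Sum>i\<in>UNIV - {piv}. (1/4) *\<^sub>R (var i * dps i C))"

definition euler :: "'n::finite pseries \<Rightarrow> real^'n \<Rightarrow> real" where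
  "euler C w = (\<Sum>i\<in>UNIV - {piv}. w $ i * dev i C w)"

lemma euler_radial: "w \<in> small_box \<Longrightarrow> euler C w = ev (radial C) (4 *\<^sub>R w)"
  using small_box_4[of w] by (simp add: euler_def radial_def dev_def ev_sum ev_scaleR ev_mult)

lemma pcoeff_sum: "pcoeff (sum f I) \<alpha> = (\<Sum>i\<in>I. pcoeff (f i) \<alpha>)"
  by (induction I rule: infinite_finite_induct) auto

text \<open>\<open>R\<close> is diagonal on monomials. The power of 1/4 is the dilation inherited
  from \<open>dps\<close>; coefficients with \<open>rdeg \<gamma> > 0\<close> can be recovered from
  the image.\<close>

lemma pcoeff_radial: "pcoeff (radial C) \<gamma> = (1/4) ^ mdeg \<gamma> * real (rdeg \<gamma>) * pcoeff C \<gamma>"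
proof -
  have "pcoeff ((1/4) *\<^sub>R (var i * dps i C)) \<gamma> = (1/4) ^ mdeg \<gamma> * pcoeff C \<gamma> * real (\<gamma> i)" for i
  proof (cases "\<gamma> i = 0")
    case False
    then have g: "\<gamma> = idx_diff \<gamma> i + unit_idx i" by (simp add: idx_diff_add)
    have m: "mdeg \<gamma> = Suc (mdeg (idx_diff \<gamma> i))" by (subst g) (simp add: mdeg_add)
    have i: "idx_diff \<gamma> i i + 1 = \<gamma> i" using False by (simp add: idx_diff_def unit_idx_def)
    show ?thesis using False unfolding pcoeff_scaleR pcoeff_var_mult pcoeff_dps m i g[symmetric] by simp
  qed (simp add: pcoeff_var_mult)
  then show ?thesis
    unfolding radial_def pcoeff_sum rdeg_def by (simp add: sum_distrib_left mult_ac)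
qed

lemma radial_radint_d: "j \<noteq> piv \<Longrightarrow> radial (radint_d j C) = (1/4) *\<^sub>R (var j * dps piv C)"
proof (rule pseries_eqI)
  fix \<gamma> :: "'a \<Rightarrow> nat"
  assume j: "j \<noteq> piv"
  show "pcoeff (radial (radint_d j C)) \<gamma> = pcoeff ((1/4) *\<^sub>R (var j * dps piv C)) \<gamma>"
  proof (cases "\<gamma> j = 0")
    case False
    then have g: "\<gamma> = idx_diff \<gamma> j + unit_idx j" by (simp add: idx_diff_add)
    have m: "mdeg \<gamma> = Suc (mdeg (idx_diff \<gamma> j))" by (subst g) (simp add: mdeg_add)
    have r: "rdeg \<gamma> > 0" using j by (subst g) (simp add: rdeg_add rdeg_unit)
    have p: "idx_diff \<gamma> j piv = \<gamma> piv" using j by (simp add: idx_diff_def unit_idx_def)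
    show ?thesis using False r by (simp add: pcoeff_radial pcoeff_radint_d[OF j] pcoeff_var_mult pcoeff_dps m p)
  qed (simp add: pcoeff_radial pcoeff_radint_d[OF j] pcoeff_var_mult)
qed

lemma radial_radint: "j \<noteq> piv \<Longrightarrow> pcoeff (radial (radint j C)) \<gamma> = (1/4) ^ mdeg \<gamma> * pcoeff (var j * C) \<gamma>"
proof -
  assume j: "j \<noteq> piv"
  show "pcoeff (radial (radint j C)) \<gamma> = (1/4) ^ mdeg \<gamma> * pcoeff (var j * C) \<gamma>"
  proof (cases "\<gamma> j = 0")
    case False
    then have g: "\<gamma> = idx_diff \<gamma> j + unit_idx j" by (simp add: idx_diff_add)
    have r: "rdeg \<gamma> > 0" using j by (subst g) (simp add: rdeg_add rdeg_unit)
    show ?thesis using False r by (simp add: pcoeff_radial pcoeff_radint[OF j] pcoeff_var_mult)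
  qed (simp add: pcoeff_radial pcoeff_radint[OF j] pcoeff_var_mult)
qed

lemma euler_radint_d:
  assumes "j \<noteq> piv" "w \<in> small_box"
  shows "euler (radint_d j C) w = w $ j * dev piv C w"
  using assms small_box_4[of w] by (simp add: euler_radial radial_radint_d ev_scaleR ev_mult dev_def)

lemma euler_radint:
  assumes j: "j \<noteq> piv" and w: "w \<in> small_box"
  shows "euler (radint j C) w = w $ j * ev C w"
proof -
  have "radial (radint j C) = dsc (\<lambda>_. 1/4) (var j * C)"
    by (rule pseries_eqI) (simp add: radial_radint[OF j] pcoeff_dsc mpow_const)
  moreover have "(\<chi> i. (1/4) * (4 *\<^sub>R w) $ i) = w" by (simp add: vec_eq_iff)
  ultimately show ?thesis
    using w small_box_qbox[OF w] by (simp add: euler_radial ev_dsc ev_mult)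
qed

lemma euler_add: "w \<in> small_box \<Longrightarrow> euler (C + D) w = euler C w + euler D w"
  by (simp add: euler_def dev_add sum.distrib distrib_left)

lemma euler_scaleR: "w \<in> small_box \<Longrightarrow> euler (r *\<^sub>R C) w = r * euler C w"
  by (simp add: euler_def dev_scaleR sum_distrib_left mult_ac)

lemma euler_diff: "w \<in> small_box \<Longrightarrow> euler (C - D) w = euler C w - euler D w"
  using euler_add[of w C "(-1) *\<^sub>R D"] euler_scaleR[of w "-1" D] by simp

lemma euler_0: "w \<in> small_box \<Longrightarrow> euler 0 w = 0"
  using euler_scaleR[of w 0 0] by simp

lemma euler_sum: "w \<in> small_box \<Longrightarrow> euler (sum f I) w = (\<Sum>i\<in>I. euler (f i) w)"
  by (induction I rule: infinite_finite_induct) (auto simp: euler_0 euler_add)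

text \<open>Formally \<open>R\<^sup>-\<^sup>1\<close> applied to \<open>\<Sum>\<^sub>j y\<^sub>j
  a\<^sub>j \<partial>\<^sub>p\<^sub>i\<^sub>vH\<close>. Since \<open>radint_d\<close>
  differentiates the whole product, the term \<open>a \<partial>H\<close> is written as
  \<open>\<partial>(a H) - (\<partial>a) H\<close>, with \<open>a'\<close> standing for the pivot
  derivative of \<open>a\<close>.\<close>

definition ck_op :: "('n::finite \<Rightarrow> 'm \<Rightarrow> 'm \<Rightarrow> 'n pseries) \<Rightarrow> ('n \<Rightarrow> 'm \<Rightarrow> 'm \<Rightarrow> 'n pseries) \<Rightarrow>
    'n pseries ^ 'm::finite \<Rightarrow> 'n pseries ^ 'm" where
  "ck_op a a' H = (\<chi> i. \<Sum>j\<in>UNIV - {piv}. \<Sum>l\<in>UNIV.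
     radint_d j (a j i l * H $ l) - radint j (a' j i l * H $ l))"

lemma euler_ck_op:
  assumes w: "w \<in> small_box" and a': "\<And>j i l. j \<noteq> piv \<Longrightarrow> dev piv (a j i l) w = ev (a' j i l) w"
  shows "euler (ck_op a a' H $ i) w = (\<Sum>j\<in>UNIV - {piv}. \<Sum>l\<in>UNIV. w $ j * (ev (a j i l) w * dev piv (H $ l) w))"
proof -
  have "euler (ck_op a a' H $ i) w = (\<Sum>j\<in>UNIV - {piv}. \<Sum>l\<in>UNIV.
      euler (radint_d j (a j i l * H $ l)) w - euler (radint j (a' j i l * H $ l)) w)"
    unfolding ck_op_def vec_lambda_beta by (simp add: euler_sum[OF w] euler_diff[OF w])
  also have "\<dots> = (\<Sum>j\<in>UNIV - {piv}. \<Sum>l\<in>UNIV. w $ j * (ev (a j i l) w * dev piv (H $ l) w))"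
    by (intro sum.cong refl)
       (simp add: euler_radint_d euler_radint w dev_mult a' ev_mult small_box_qbox algebra_simps)
  finally show ?thesis .
qed

lemma radint_d_diff: "j \<noteq> piv \<Longrightarrow> radint_d j (C - D) = radint_d j C - radint_d j D"
  by (rule pseries_eqI) (simp add: pcoeff_radint_d right_diff_distrib)

lemma radint_diff: "j \<noteq> piv \<Longrightarrow> radint j (C - D) = radint j C - radint j D"
  by (rule pseries_eqI) (simp add: pcoeff_radint diff_divide_distrib)

lemma ck_op_diff: "ck_op a a' (H - G) = ck_op a a' H - ck_op a a' G"
proof -
  have "ck_op a a' (H - G) $ i = (ck_op a a' H - ck_op a a' G) $ i" for i
    unfolding ck_op_def vec_lambda_beta vector_minus_component sum_subtractf[symmetric]
    by (intro sum.cong refl) (auto simp: right_diff_distrib radint_d_diff radint_diff)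
  then show ?thesis by (simp add: vec_eq_iff)
qed

text \<open>Both radial inverses have norm at most 1, so only the sizes of the coefficients enter.
  No derivative of \<open>H\<close> appears in the bound.\<close>

lemma norm_ck_op:
  fixes H :: "'n::finite pseries ^ 'm::finite"
  assumes s: "(\<Sum>i\<in>UNIV. \<Sum>j\<in>UNIV - {piv}. \<Sum>l\<in>UNIV. norm (a j i l) + norm (a' j i l)) \<le> 1/2"
  shows "norm (ck_op a a' H) \<le> 1/2 * norm H"
proof -
  have "norm (ck_op a a' H) \<le> (\<Sum>i\<in>UNIV. norm (ck_op a a' H $ i))"
    unfolding norm_vec_def by (rule L2_set_le_sum) simp
  also have "\<dots> \<le> (\<Sum>i\<in>UNIV. \<Sum>j\<in>UNIV - {piv}. \<Sum>l\<in>UNIV. (norm (a j i l) + norm (a' j i l)) * norm H)"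
    unfolding ck_op_def vec_lambda_beta
  proof (intro sum_mono sum_norm_le)
    fix i l :: 'm and j :: 'n assume "j \<in> UNIV - {piv}"
    then have j: "j \<noteq> piv" by simp
    have Hl: "norm (H $ l) \<le> norm H" by (rule Finite_Cartesian_Product.norm_nth_le)
    have "norm (radint_d j (a j i l * H $ l) - radint j (a' j i l * H $ l)) \<le>
        norm (a j i l * H $ l) + norm (a' j i l * H $ l)"
      by (rule order_trans[OF norm_triangle_ineq4 add_mono[OF norm_radint_d[OF j] norm_radint[OF j]]])
    also have "\<dots> \<le> norm (a j i l) * norm (H $ l) + norm (a' j i l) * norm (H $ l)"
      by (intro add_mono norm_mult_ineq)
    also have "\<dots> \<le> norm (a j i l) * norm H + norm (a' j i l) * norm H"
      by (intro add_mono mult_left_mono Hl norm_ge_zero)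
    finally show "norm (radint_d j (a j i l * H $ l) - radint j (a' j i l * H $ l)) \<le>
        (norm (a j i l) + norm (a' j i l)) * norm H" by (simp add: distrib_right)
  qed
  also have "\<dots> = (\<Sum>i\<in>UNIV. \<Sum>j\<in>UNIV - {piv}. \<Sum>l\<in>UNIV. norm (a j i l) + norm (a' j i l)) * norm H"
    by (simp only: sum_distrib_right)
  also have "\<dots> \<le> 1/2 * norm H" by (rule mult_right_mono[OF s]) simp
  finally show ?thesis .
qed

lemma ck_op_fixpoint:
  fixes H0 :: "'n::finite pseries ^ 'm::finite"
  assumes s: "(\<Sum>i\<in>UNIV. \<Sum>j\<in>UNIV - {piv}. \<Sum>l\<in>UNIV. norm (a j i l) + norm (a' j i l)) \<le> 1/2"
  shows "\<exists>H. H = H0 + ck_op a a' H" and "H = ck_op a a' H \<Longrightarrow> H = 0"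
proof -
  have "dist (H0 + ck_op a a' H) (H0 + ck_op a a' G) \<le> 1/2 * dist H G" for H G :: "'n pseries ^ 'm"
    using norm_ck_op[of a a' "H - G", OF s] by (simp add: dist_norm ck_op_diff)
  then have "\<exists>!H. H0 + ck_op a a' H = H"
    by (intro banach_fix_type[of "1/2"] allI) simp_all
  then show "\<exists>H. H = H0 + ck_op a a' H" by metis
  assume H: "H = ck_op a a' H"
  have "norm H \<le> 1/2 * norm H" by (subst (1) H) (rule norm_ck_op[OF s])
  then show "H = 0" by simp
qed

text \<open>The operator produces nothing on the pivot axis, so the initial data there are carried
  by the inhomogeneous term alone.\<close>

lemma pcoeff_ck_op_0: "rdeg \<gamma> = 0 \<Longrightarrow> pcoeff (ck_op a a' H $ i) \<gamma> = 0"
  unfolding ck_op_def vec_lambda_beta pcoeff_sum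
  by (intro sum.neutral ballI) (simp add: pcoeff_radint_d pcoeff_radint rdeg_def)

section \<open>Anisotropic rescaling and the radial Cauchy problem\<close>

lemma isCont_nhds: "isCont f a \<Longrightarrow> filterlim f (nhds (f a)) (nhds a)"
  by (simp add: isCont_def tendsto_at_iff_tendsto_nhds)

text \<open>The extra factor \<open>\<rho>\<close> on the variables other than the pivot leaves the
  radial derivative unchanged and multiplies the coefficients of the radial equation by
  \<open>\<rho>\<close>.\<close>

definition scl :: "real \<Rightarrow> real \<Rightarrow> real^'n::finite \<Rightarrow> real^'n" where
  "scl r \<rho> w = (\<chi> i. if i = piv then r * w $ i else r * \<rho> * w $ i)"

definition pd :: "'n::finite \<Rightarrow> (real^'n \<Rightarrow> 'b::real_normed_vector) \<Rightarrow> real^'n \<Rightarrow> 'b" where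
  "pd j f y = frechet_derivative f (at y) (axis j 1)"

lemma linear_scl: "linear (scl r \<rho>)"
  by (rule linearI) (auto simp: scl_def vec_eq_iff algebra_simps)

lemma bounded_linear_scl: "bounded_linear (scl r \<rho>)"
  using linear_scl linear_conv_bounded_linear by blast

lemma scl_inverse:
  assumes "r \<noteq> 0" "\<rho> \<noteq> 0"
  shows "scl r \<rho> (scl (1/r) (1/\<rho>) y) = y" "scl (1/r) (1/\<rho>) (scl r \<rho> y) = y"
  using assms by (auto simp: scl_def vec_eq_iff)

lemma scl_axis: "scl r \<rho> (axis j 1) = (if j = piv then r else r * \<rho>) *\<^sub>R axis j 1"
  by (auto simp: scl_def vec_eq_iff axis_def)

lemma scl_0 [simp]: "scl r \<rho> 0 = 0"
  by (rule linear_0[OF linear_scl])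

lemma scl_tendsto: "filterlim (scl r \<rho>) (nhds 0) (nhds (0 :: real^'n))"
  using isCont_nhds[OF linear_continuous_at[OF bounded_linear_scl], of r \<rho> "0 :: real^'n"] by simp

lemma eventually_scl: "\<forall>\<^sub>F y in nhds 0. P y \<Longrightarrow> \<forall>\<^sub>F w in nhds (0 :: real^'n). P (scl r \<rho> w)"
  by (rule eventually_compose_filterlim[OF _ scl_tendsto])

lemma dps_dsc:
  fixes s :: "'n::finite \<Rightarrow> real"
  assumes "\<And>i. 0 \<le> s i \<and> s i \<le> 1"
  shows "dps i (dsc s C) = s i *\<^sub>R dsc s (dps i C)"
  by (rule pseries_eqI) (simp add: pcoeff_dps pcoeff_dsc[of s, OF assms] mpow_add)

lemma pd_expansion:
  fixes f :: "real^'n \<Rightarrow> real"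
  assumes r: "r > 0" and C: "\<And>w. w \<in> qbox \<Longrightarrow> f (0 + r *\<^sub>R w) = ev C w" and w: "norm w < 1/8"
  shows "pd i f (0 + r *\<^sub>R w) = (1/r) * dev i C w"
proof -
  have "dist (0 + r *\<^sub>R w) 0 < r / 8" using r w by simp
  from fun_cong[OF frechet_derivative_at[OF real_analytic_deriv_expansion[OF r C this]], of "axis i 1"]
  have "pd i f (0 + r *\<^sub>R w) = (\<Sum>k\<in>UNIV. (1/r) * ev (dps k C) ((4/r) *\<^sub>R (0 + r *\<^sub>R w - 0)) * axis i 1 $ k)"
    unfolding pd_def by (rule sym)
  also have "\<dots> = (1/r) * (\<Sum>k\<in>UNIV. dev k C w * axis i 1 $ k)"
    using r by (simp add: sum_distrib_left dev_def)
  finally show ?thesis by (simp only: dev_axis)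
qed

text \<open>The scale \<open>r\<close> is fixed first, so that all expansions exist;
  \<open>\<rho>\<close> is then used to make the coefficients small. The pivot derivatives are
  expanded separately because \<open>dps\<close> would place them at a quarter of the scale.\<close>

lemma ck_setup:
  fixes A :: "'n::finite \<Rightarrow> real^'n \<Rightarrow> real^'m^'m::finite" and Z :: "real^'n \<Rightarrow> real^'m"
  assumes A: "\<And>j. real_analytic_at (A j) 0" and Z: "real_analytic_at Z 0"
  obtains r \<rho> a a' \<zeta> where "r > 0" "\<rho> > 0"
    "\<And>j i l w. w \<in> qbox \<Longrightarrow> ev (a j i l) w = \<rho> * A j (scl r \<rho> w) $ i $ l"
    "\<And>j i l w. norm w < 1/8 \<Longrightarrow> dev piv (a j i l) w = ev (a' j i l) w"
    "\<And>i w. w \<in> qbox \<Longrightarrow> ev (\<zeta> $ i) w = Z (scl r \<rho> w) $ i"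
    "(\<Sum>i\<in>UNIV. \<Sum>j\<in>UNIV - {piv}. \<Sum>l\<in>UNIV. norm (a j i l) + norm (a' j i l)) \<le> 1/2"
proof -
  have Ac: "real_analytic_at (\<lambda>y. A j y $ i $ l) 0" for j i l
    using A[of j] unfolding real_analytic_at_vec[of "A j"] real_analytic_at_vec[of "\<lambda>u. A j u $ _"] by blast
  have Zc: "real_analytic_at (\<lambda>y. Z y $ i) 0" for i
    using Z unfolding real_analytic_at_vec[of Z] by blast
  have e1: "\<forall>\<^sub>F r in at_right 0. \<forall>i. \<exists>C. \<forall>w\<in>qbox. Z (0 + r *\<^sub>R w) $ i = ev C w"
    by (intro eventually_all_finite eventually_mono[OF real_analytic_at_ev_small[OF Zc zero_less_one]]) blast
  have e2: "\<forall>\<^sub>F r in at_right 0. \<forall>j i l. \<exists>C. \<forall>w\<in>qbox. A j (0 + r *\<^sub>R w) $ i $ l = ev C w"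
    by (intro eventually_all_finite eventually_mono[OF real_analytic_at_ev_small[OF Ac zero_less_one]]) blast
  have e3: "\<forall>\<^sub>F r in at_right 0. \<forall>j i l. \<exists>C. \<forall>w\<in>qbox. pd piv (\<lambda>y. A j y $ i $ l) (0 + r *\<^sub>R w) = ev C w"
    unfolding pd_def
    by (intro eventually_all_finite
        eventually_mono[OF real_analytic_at_ev_small[OF real_analytic_deriv_real[OF Ac] zero_less_one]]) blast
  have e4: "\<forall>\<^sub>F r in at_right (0::real). r > 0" by (simp add: eventually_at_right_less)
  obtain r where r: "r > 0"
    and r1: "\<forall>i. \<exists>C. \<forall>w\<in>qbox. Z (0 + r *\<^sub>R w) $ i = ev C w"
    and r2: "\<forall>j i l. \<exists>C. \<forall>w\<in>qbox. A j (0 + r *\<^sub>R w) $ i $ l = ev C w"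
    and r3: "\<forall>j i l. \<exists>C. \<forall>w\<in>qbox. pd piv (\<lambda>y. A j y $ i $ l) (0 + r *\<^sub>R w) = ev C w"
    using eventually_happens'[OF trivial_limit_at_right_real
        eventually_conj[OF e4 eventually_conj[OF e1 eventually_conj[OF e2 e3]]]] by blast
  obtain c where c: "\<And>i w. w \<in> qbox \<Longrightarrow> Z (0 + r *\<^sub>R w) $ i = ev (c i) w" using r1 by metis
  obtain C where C: "\<And>j i l w. w \<in> qbox \<Longrightarrow> A j (0 + r *\<^sub>R w) $ i $ l = ev (C j i l) w" using r2 by metis
  obtain C' where C': "\<And>j i l w. w \<in> qbox \<Longrightarrow> pd piv (\<lambda>y. A j y $ i $ l) (0 + r *\<^sub>R w) = ev (C' j i l) w" using r3 by metis
  \<comment> \<open>The summand 1 makes \<open>\<rho>\<close> at most 1, as a dilation requires; the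
    total of the norms becomes at most \<open>\<rho> * (K - 1)\<close>, below 1/2.\<close>
  define K where "K = (\<Sum>i\<in>UNIV. \<Sum>j\<in>UNIV - {piv}. \<Sum>l\<in>UNIV. norm (C j i l) + r * norm (C' j i l)) + 1"
  have K: "K \<ge> 1" using r by (simp add: K_def sum_nonneg)
  define \<rho> where "\<rho> = 1 / (2 * K)"
  have \<rho>: "\<rho> > 0" "\<rho> \<le> 1" using K by (auto simp: \<rho>_def)
  define s where "s = (\<lambda>i::'n. if i = piv then 1 else \<rho>)"
  have s: "\<And>i. 0 \<le> s i \<and> s i \<le> 1" using \<rho> by (simp add: s_def)
  have sw: "r *\<^sub>R (\<chi> i. s i * w $ i) = scl r \<rho> w" for w
    by (simp add: vec_eq_iff scl_def s_def)
  have sle: "\<bar>s i * t\<bar> \<le> \<bar>t\<bar>" for i t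
    using s[of i] by (simp add: abs_mult mult_left_le_one_le)
  have sq: "(\<chi> i. s i * w $ i) \<in> qbox" if "w \<in> qbox" for w
    unfolding qbox_def
  proof (intro CollectI allI)
    fix i
    show "\<bar>(\<chi> i. s i * w $ i) $ i\<bar> \<le> 1/2"
      using order_trans[OF sle, of "w $ i" "1/2" i] that by (simp add: qbox_def)
  qed
  have sn: "norm (\<chi> i. s i * w $ i) \<le> norm w" for w
    unfolding norm_vec_def by (rule L2_set_mono) (use sle in auto)
  show ?thesis
  proof (rule that[of r \<rho> "\<lambda>j i l. \<rho> *\<^sub>R dsc s (C j i l)" "\<lambda>j i l. (\<rho> * r) *\<^sub>R dsc s (C' j i l)" "\<chi> i. dsc s (c i)"])
    show "r > 0" "\<rho> > 0" by fact+
    fix j :: 'n and i l :: 'm and w :: "real^'n"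
    show "ev (\<rho> *\<^sub>R dsc s (C j i l)) w = \<rho> * A j (scl r \<rho> w) $ i $ l" if w: "w \<in> qbox"
      using C[OF sq[OF w], of j i l] by (simp add: ev_scaleR[OF w] ev_dsc[of s, OF s] sw)
    show "ev ((\<chi> i. dsc s (c i)) $ i) w = Z (scl r \<rho> w) $ i" if w: "w \<in> qbox"
      using c[OF sq[OF w], of i] by (simp add: ev_dsc[of s, OF s] sw)
    show "dev piv (\<rho> *\<^sub>R dsc s (C j i l)) w = ev ((\<rho> * r) *\<^sub>R dsc s (C' j i l)) w" if w: "norm w < 1/8"
    proof -
      have wq: "w \<in> qbox" by (rule small_qbox) (use w in simp)
      have w4: "4 *\<^sub>R w \<in> qbox" by (rule small_qbox) (use w in simp)
      \<comment> \<open>The dilation fixes the pivot variable, so the chain rule yields no extra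
        factor for the pivot derivative.\<close>
      define w' where "w' = (\<chi> i. s i * w $ i)"
      have w': "norm w' < 1/8" using sn[of w] w by (simp add: w'_def)
      have w'q: "w' \<in> qbox" by (rule small_qbox) (use w' in simp)
      have e: "(\<chi> i. s i * (4 *\<^sub>R w) $ i) = 4 *\<^sub>R w'" by (simp add: w'_def vec_eq_iff)
      have "(1/r) * dev piv (C j i l) w' = ev (C' j i l) w'"
        using pd_expansion[of r "\<lambda>y. A j y $ i $ l" "C j i l" w' piv, OF r C w'] C'[OF w'q, of j i l] by simp
      then have "dev piv (C j i l) w' = r * ev (C' j i l) w'" using r by (simp add: field_simps)
      moreover have "dev piv (\<rho> *\<^sub>R dsc s (C j i l)) w = \<rho> * dev piv (C j i l) w'"
        unfolding dev_def dps_scaleR dps_dsc[of s, OF s]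
        by (simp add: ev_scaleR[OF w4] ev_dsc[of s, OF s] e del: vector_scaleR_component) (simp add: s_def)
      ultimately show ?thesis by (simp add: ev_scaleR[OF wq] ev_dsc[of s, OF s] w'_def)
    qed
    have "(\<Sum>i\<in>UNIV. \<Sum>j\<in>UNIV - {piv}. \<Sum>l\<in>UNIV. norm (\<rho> *\<^sub>R dsc s (C j i l)) + norm ((\<rho> * r) *\<^sub>R dsc s (C' j i l))) \<le>
       (\<Sum>i\<in>UNIV. \<Sum>j\<in>UNIV - {piv}. \<Sum>l\<in>UNIV. \<rho> * (norm (C j i l) + r * norm (C' j i l)))"
    proof (intro sum_mono)
      fix i l :: 'm and j :: 'n
      have "norm (\<rho> *\<^sub>R dsc s (C j i l)) \<le> \<rho> * norm (C j i l)"
        using \<rho> norm_dsc[of s "C j i l", OF s] by (simp add: mult_left_mono)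
      moreover have "norm ((\<rho> * r) *\<^sub>R dsc s (C' j i l)) \<le> \<rho> * r * norm (C' j i l)"
        using \<rho> r norm_dsc[of s "C' j i l", OF s] by (simp add: abs_mult mult_left_mono)
      ultimately show "norm (\<rho> *\<^sub>R dsc s (C j i l)) + norm ((\<rho> * r) *\<^sub>R dsc s (C' j i l)) \<le>
          \<rho> * (norm (C j i l) + r * norm (C' j i l))" by (simp add: distrib_left mult.assoc)
    qed
    also have "\<dots> = \<rho> * (K - 1)" by (simp add: K_def sum_distrib_left)
    also have "\<dots> \<le> \<rho> * K" using \<rho> by simp
    also have "\<dots> = 1/2" using K by (simp add: \<rho>_def)
    finally show "(\<Sum>i\<in>UNIV. \<Sum>j\<in>UNIV - {piv}. \<Sum>l\<in>UNIV. norm (\<rho> *\<^sub>R dsc s (C j i l)) + norm ((\<rho> * r) *\<^sub>R dsc s (C' j i l))) \<le> 1/2" .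
  qed
qed

lemma dev_scl:
  fixes F :: "real^'n \<Rightarrow> real^'m"
  assumes F: "\<forall>\<^sub>F y in nhds 0. F differentiable (at y)"
    and H: "\<And>i w. w \<in> qbox \<Longrightarrow> ev (H $ i) w = F (scl r \<rho> w) $ i"
  shows "\<forall>\<^sub>F w in nhds 0. \<forall>i j. dev j (H $ i) w = (if j = piv then r else r * \<rho>) * pd j F (scl r \<rho> w) $ i"
  using eventually_scl[OF F, of r \<rho>] small_box_nhds
proof eventually_elim
  case (elim w)
  show ?case
  proof (intro allI)
    fix i j
    let ?y = "scl r \<rho> w"
    have "((\<lambda>w. F (scl r \<rho> w)) has_derivative (\<lambda>v. frechet_derivative F (at ?y) (scl r \<rho> v))) (at w)"
      using has_derivative_compose[OF bounded_linear_imp_has_derivative[OF bounded_linear_scl], of F _ r \<rho> w]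
        elim(1) unfolding frechet_derivative_works by blast
    from bounded_linear.has_derivative[OF bounded_linear_vec_nth[of i] this]
    have d: "((\<lambda>w. F (scl r \<rho> w) $ i) has_derivative (\<lambda>v. frechet_derivative F (at ?y) (scl r \<rho> v) $ i)) (at w)" .
    have "(ev (H $ i) has_derivative (\<lambda>v. frechet_derivative F (at ?y) (scl r \<rho> v) $ i)) (at w)"
    proof (rule has_derivative_transform_within[OF d, of "1/4"])
      fix u assume u: "dist u w < 1/4"
      have "\<bar>u $ k\<bar> \<le> 1/2" for k
      proof -
        have "\<bar>(u - w) $ k\<bar> \<le> 1/4" using component_le_norm_cart[of "u - w" k] u by (simp add: dist_norm)
        moreover have "\<bar>w $ k\<bar> \<le> 1/8" using elim(2) by (simp add: small_box_def)
        ultimately show ?thesis unfolding vector_minus_component by linarith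
      qed
      then show "F (scl r \<rho> u) $ i = ev (H $ i) u" by (simp add: H qbox_def)
    qed auto
    from fun_cong[OF has_derivative_unique[OF ev_has_derivative_dev[OF elim(2)] this], of "axis j 1"]
    have "dev j (H $ i) w = frechet_derivative F (at ?y) (scl r \<rho> (axis j 1)) $ i" by (simp only: dev_axis)
    also have "\<dots> = (if j = piv then r else r * \<rho>) * frechet_derivative F (at ?y) (axis j 1) $ i"
      unfolding scl_axis
      by (subst linear_scale[OF linear_frechet_derivative[OF elim(1)]]) simp
    finally show "dev j (H $ i) w = (if j = piv then r else r * \<rho>) * pd j F ?y $ i" by (simp add: pd_def)
  qed
qed

definition rad :: "(real^'n::finite \<Rightarrow> real^'m::finite) \<Rightarrow> real^'n \<Rightarrow> real^'m" where
  "rad F y = (\<Sum>j\<in>UNIV - {piv}. y $ j *\<^sub>R pd j F y)"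

definition rad_op :: "('n::finite \<Rightarrow> real^'n \<Rightarrow> real^'m^'m) \<Rightarrow> (real^'n \<Rightarrow> real^'m::finite) \<Rightarrow> real^'n \<Rightarrow> real^'m" where
  "rad_op A F y = (\<Sum>j\<in>UNIV - {piv}. y $ j *\<^sub>R (A j y *v pd piv F y))"

lemma euler_scl:
  fixes F :: "real^'n \<Rightarrow> real^'m"
  assumes F: "\<forall>\<^sub>F y in nhds 0. F differentiable (at y)"
    and H: "\<And>i w. w \<in> qbox \<Longrightarrow> ev (H $ i) w = F (scl r \<rho> w) $ i"
    and a: "\<And>j i l w. w \<in> qbox \<Longrightarrow> ev (a j i l) w = \<rho> * A j (scl r \<rho> w) $ i $ l"
    and a': "\<And>j i l w. norm w < 1/8 \<Longrightarrow> dev piv (a j i l) w = ev (a' j i l) w"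
  shows "\<forall>\<^sub>F w in nhds 0. \<forall>i. euler (H $ i) w = rad F (scl r \<rho> w) $ i \<and>
    euler (ck_op a a' H $ i) w = rad_op A F (scl r \<rho> w) $ i"
proof -
  have "\<forall>\<^sub>F w in nhds (0::real^'n). norm w < 1/8"
    unfolding eventually_nhds_metric by (intro exI[of _ "1/8"]) auto
  moreover have "\<forall>\<^sub>F w in nhds 0. \<forall>i j. dev j (H $ i) w = (if j = piv then r else r * \<rho>) * pd j F (scl r \<rho> w) $ i"
    by (rule dev_scl[OF F H])
  ultimately show ?thesis using small_box_nhds
  proof eventually_elim
    case (elim w)
    note dv = elim(2)[rule_format]
    have y: "scl r \<rho> w $ j = r * \<rho> * w $ j" if "j \<noteq> piv" for j using that by (simp add: scl_def)
    show ?case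
    proof (intro allI conjI)
      fix i
      show "euler (H $ i) w = rad F (scl r \<rho> w) $ i"
        unfolding euler_def rad_def sum_component vector_scaleR_component dv
        by (intro sum.cong refl) (simp add: y)
      have "euler (ck_op a a' H $ i) w = (\<Sum>j\<in>UNIV - {piv}. \<Sum>l\<in>UNIV. w $ j * (ev (a j i l) w * dev piv (H $ l) w))"
        by (rule euler_ck_op[OF elim(3)]) (rule a'[OF elim(1)])
      also have "\<dots> = (\<Sum>j\<in>UNIV - {piv}. \<Sum>l\<in>UNIV. scl r \<rho> w $ j * (A j (scl r \<rho> w) $ i $ l * pd piv F (scl r \<rho> w) $ l))"
        by (intro sum.cong refl) (simp add: a[OF small_box_qbox[OF elim(3)]] dv y)
      finally show "euler (ck_op a a' H $ i) w = rad_op A F (scl r \<rho> w) $ i"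
        by (simp add: rad_op_def sum_component matrix_vector_mult_def sum_distrib_left)
    qed
  qed
qed

lemma real_analytic_eventually_differentiable:
  fixes f :: "real^'n \<Rightarrow> 'b::euclidean_space"
  assumes "real_analytic_at f a"
  shows "\<forall>\<^sub>F y in nhds a. f differentiable (at y)"
  using real_analytic_near[OF assms] by eventually_elim (rule real_analytic_differentiable)

lemma dps_var: "j \<noteq> i \<Longrightarrow> dps j (var i) = 0"
proof (rule pseries_eqI)
  fix \<beta> :: "'a \<Rightarrow> nat"
  assume "j \<noteq> i"
  then have "(\<beta> + unit_idx j) j \<noteq> unit_idx i j" by (simp add: fun_algebra_apply unit_idx_def)
  then have "\<beta> + unit_idx j \<noteq> unit_idx i" by metis
  then show "pcoeff (dps j (var i)) \<beta> = pcoeff 0 \<beta>" by (simp add: pcoeff_dps pcoeff_var)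
qed

text \<open>The solution of the contraction equation with prescribed restriction to the pivot axis;
  only the first-order datum \<open>h\<close> at the origin is needed later.\<close>

lemma radial_ck_exists:
  fixes A :: "'n::finite \<Rightarrow> real^'n \<Rightarrow> real^'m^'m::finite" and h :: "real^'m"
  assumes A: "\<And>j. real_analytic_at (A j) 0"
  obtains F where "real_analytic_at F 0" "pd piv F 0 = h" "\<forall>\<^sub>F y in nhds 0. rad F y = rad_op A F y"
proof -
  obtain r \<rho> a a' and \<zeta> :: "'n pseries ^ 'm" where r: "r > 0" "\<rho> > 0"
    and a: "\<And>j i l w. w \<in> qbox \<Longrightarrow> ev (a j i l) w = \<rho> * A j (scl r \<rho> w) $ i $ l"
    and a': "\<And>j i l w. norm w < 1/8 \<Longrightarrow> dev piv (a j i l) w = ev (a' j i l) w"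
    and "\<And>i w. w \<in> qbox \<Longrightarrow> ev (\<zeta> $ i) w = (0 :: real^'m) $ i"
    and b: "(\<Sum>i\<in>UNIV. \<Sum>j\<in>UNIV - {piv}. \<Sum>l\<in>UNIV. norm (a j i l) + norm (a' j i l)) \<le> 1/2"
    by (rule ck_setup[OF A real_analytic_at_const[of 0 0]]) (rule that; assumption)
  define H0 :: "'n pseries ^ 'm" where "H0 = (\<chi> i. (r * h $ i) *\<^sub>R var piv)"
  obtain H where H: "H = H0 + ck_op a a' H" using ck_op_fixpoint(1)[OF b] by blast
  define F where "F = (\<lambda>y. \<chi> i. ev (H $ i) (scl (1/r) (1/\<rho>) y))"
  have s0: "scl (1/r) (1/\<rho>) (0::real^'n) = 0" by (rule linear_0[OF linear_scl])
  have scl_an: "real_analytic_at (scl (1/r) (1/\<rho>)) (0::real^'n)"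
    using real_analytic_at_linear[OF bounded_linear_scl real_analytic_at_ident] .
  have "real_analytic_at (\<lambda>y. ev (H $ i) (scl (1/r) (1/\<rho>) y)) 0" for i
  proof (rule real_analytic_at_compose_real[OF _ scl_an])
    show "real_analytic_at (ev (H $ i)) (scl (1/r) (1/\<rho>) 0)"
      unfolding s0 real_analytic_at_ev by (intro exI[of _ 1] conjI exI[of _ "H $ i"]) auto
  qed
  then have Fan: "real_analytic_at F 0" unfolding real_analytic_at_vec[of F] by (simp add: F_def)
  note Fd = real_analytic_eventually_differentiable[OF Fan]
  have HF: "ev (H $ i) w = F (scl r \<rho> w) $ i" for i w
    using r by (simp add: F_def scl_inverse)
  have es: "\<forall>\<^sub>F w in nhds 0. \<forall>i. euler (H $ i) w = rad F (scl r \<rho> w) $ i \<and>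
    euler (ck_op a a' H $ i) w = rad_op A F (scl r \<rho> w) $ i"
    by (rule euler_scl[OF Fd HF a a'])
  have "\<forall>\<^sub>F w in nhds 0. rad F (scl r \<rho> w) = rad_op A F (scl r \<rho> w)"
    using es small_box_nhds
  proof eventually_elim
    case (elim w)
    have "euler (H $ i) w = euler (ck_op a a' H $ i) w" for i
    proof -
      have "euler (H0 $ i) w = 0"
        unfolding euler_def H0_def vec_lambda_beta dev_def dps_scaleR
        by (rule sum.neutral) (simp add: dps_var)
      moreover have "euler (H $ i) w = euler (H0 $ i) w + euler (ck_op a a' H $ i) w"
        by (subst H) (simp add: euler_add[OF elim(2)])
      ultimately show ?thesis by simp
    qed
    then show ?case using elim(1) by (simp add: vec_eq_iff)
  qed
  from eventually_scl[OF this, of "1/r" "1/\<rho>"]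
  have eq: "\<forall>\<^sub>F y in nhds 0. rad F y = rad_op A F y" using r by (simp add: scl_inverse)
  have "pd piv F 0 $ i = h $ i" for i
  proof -
    have "dev piv (H $ i) 0 = r * pd piv F (scl r \<rho> 0) $ i"
      using eventually_nhds_x_imp_x[OF dev_scl[of F H r \<rho>, OF Fd HF]] by simp
    moreover have "dev piv (H $ i) 0 = pcoeff (H $ i) (unit_idx piv)"
      by (simp add: dev_def ev_at_0 pcoeff_dps fun_algebra_apply)
    moreover have "pcoeff (H $ i) (unit_idx piv) = r * h $ i"
      by (subst H) (simp add: H0_def pcoeff_var pcoeff_ck_op_0 rdeg_unit)
    ultimately show ?thesis using r by simp
  qed
  then show ?thesis using that[OF Fan _ eq] by (simp add: vec_eq_iff)
qed

text \<open>The expansion of \<open>Z\<close> is shown to be a fixed point of the contraction: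
  coefficients with \<open>rdeg \<gamma> = 0\<close> vanish by the condition on the pivot axis, and
  the others are determined by their image under \<open>R\<close>.\<close>

lemma radial_ck_unique:
  fixes A :: "'n::finite \<Rightarrow> real^'n \<Rightarrow> real^'m^'m::finite" and Z :: "real^'n \<Rightarrow> real^'m"
  assumes A: "\<And>j. real_analytic_at (A j) 0" and Z: "real_analytic_at Z 0"
    and eq: "\<forall>\<^sub>F y in nhds 0. rad Z y = rad_op A Z y"
    and ax: "\<forall>\<^sub>F y in nhds 0. (\<forall>j. j \<noteq> piv \<longrightarrow> y $ j = 0) \<longrightarrow> Z y = 0"
  shows "\<forall>\<^sub>F y in nhds 0. Z y = 0"
proof -
  obtain r \<rho> a a' and \<zeta> :: "'n pseries ^ 'm" where r: "r > 0" "\<rho> > 0"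
    and a: "\<And>j i l w. w \<in> qbox \<Longrightarrow> ev (a j i l) w = \<rho> * A j (scl r \<rho> w) $ i $ l"
    and a': "\<And>j i l w. norm w < 1/8 \<Longrightarrow> dev piv (a j i l) w = ev (a' j i l) w"
    and \<zeta>: "\<And>i w. w \<in> qbox \<Longrightarrow> ev (\<zeta> $ i) w = Z (scl r \<rho> w) $ i"
    and b: "(\<Sum>i\<in>UNIV. \<Sum>j\<in>UNIV - {piv}. \<Sum>l\<in>UNIV. norm (a j i l) + norm (a' j i l)) \<le> 1/2"
    by (rule ck_setup[OF A Z]) (rule that; assumption)
  note Zd = real_analytic_eventually_differentiable[OF Z]
  have es: "\<forall>\<^sub>F w in nhds 0. \<forall>i. euler (\<zeta> $ i) w = rad Z (scl r \<rho> w) $ i \<and>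
    euler (ck_op a a' \<zeta> $ i) w = rad_op A Z (scl r \<rho> w) $ i"
    by (rule euler_scl[OF Zd \<zeta> a a'])
  have "\<zeta> $ i = ck_op a a' \<zeta> $ i" for i
  proof (rule pseries_eqI)
    fix \<gamma> :: "'n \<Rightarrow> nat"
    show "pcoeff (\<zeta> $ i) \<gamma> = pcoeff (ck_op a a' \<zeta> $ i) \<gamma>"
    proof (cases "rdeg \<gamma> = 0")
      case True
      \<comment> \<open>Dilating the other variables by 0 restricts the series to the pivot axis and
        keeps precisely the coefficients with \<open>rdeg \<gamma> = 0\<close>.\<close>
      define s where "s = (\<lambda>k::'n. if k = piv then 1 else 0 :: real)"
      have s: "\<And>k. 0 \<le> s k \<and> s k \<le> 1" by (simp add: s_def)
      have "\<forall>\<^sub>F w in nhds 0. ev (dsc s (\<zeta> $ i)) w = 0"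
      proof -
        have "filterlim (\<lambda>w. scl r \<rho> (\<chi> k. s k * w $ k)) (nhds 0) (nhds (0::real^'n))"
        proof -
          have "linear (\<lambda>w::real^'n. \<chi> k. s k * w $ k)" by (rule linearI) (simp_all add: vec_eq_iff distrib_left)
          then have bl: "bounded_linear (\<lambda>w::real^'n. \<chi> k. s k * w $ k)" using linear_conv_bounded_linear by blast
          have z: "(\<chi> k. s k * (0::real^'n) $ k) = 0" by (simp add: vec_eq_iff)
          have "filterlim (\<lambda>w::real^'n. \<chi> k. s k * w $ k) (nhds 0) (nhds 0)"
            using isCont_nhds[OF linear_continuous_at[OF bl], of 0] z by simp
          from filterlim_compose[OF scl_tendsto this] show ?thesis .
        qed
        from eventually_compose_filterlim[OF ax this] small_box_nhds show ?thesis
        proof eventually_elim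
          case (elim w)
          have "(\<chi> k. s k * w $ k) \<in> qbox"
            using small_box_qbox[OF elim(2)] by (auto simp: qbox_def s_def)
          moreover have "Z (scl r \<rho> (\<chi> k. s k * w $ k)) = 0"
            using elim(1) by (auto simp: scl_def s_def)
          ultimately show ?case by (simp add: ev_dsc[of s, OF s] \<zeta>)
        qed
      qed
      then have "dsc s (\<zeta> $ i) = 0" by (rule ev_eq_0_imp)
      then have "mpow s \<gamma> * pcoeff (\<zeta> $ i) \<gamma> = 0" by (metis pcoeff_0 pcoeff_dsc[of s, OF s])
      moreover have "mpow s \<gamma> = 1"
      proof -
        have "\<gamma> k = 0" if "k \<noteq> piv" for k using True that by (simp add: rdeg_def)
        then have "s k ^ \<gamma> k = 1" for k by (cases "k = piv") (auto simp: s_def)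
        then show ?thesis by (simp add: mpow_def)
      qed
      ultimately show ?thesis using True by (simp add: pcoeff_ck_op_0)
    next
      case False
      define D where "D = \<zeta> $ i - ck_op a a' \<zeta> $ i"
      have "\<forall>\<^sub>F w in nhds 0. ev (radial D) (4 *\<^sub>R w) = 0"
        using es eventually_scl[OF eq, of r \<rho>] small_box_nhds
      proof eventually_elim
        case (elim w)
        have "euler D w = 0"
          unfolding D_def using elim by (simp add: euler_diff)
        then show ?case using euler_radial[OF elim(3), of D] by simp
      qed
      from eventually_scl[OF this, of "1/4" 1]
      have "\<forall>\<^sub>F w in nhds 0. ev (radial D) (4 *\<^sub>R scl (1/4) 1 w) = 0" .
      moreover have "4 *\<^sub>R scl (1/4) 1 w = w" for w :: "real^'n" by (simp add: scl_def vec_eq_iff)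
      ultimately have "\<forall>\<^sub>F w in nhds 0. ev (radial D) w = 0" by simp
      then have "radial D = 0" by (rule ev_eq_0_imp)
      then have "pcoeff (radial D) \<gamma> = 0" by simp
      then have "pcoeff D \<gamma> = 0" using False by (simp add: pcoeff_radial)
      then show ?thesis by (simp add: D_def)
    qed
  qed
  then have "\<zeta> = ck_op a a' \<zeta>" by (simp add: vec_eq_iff)
  then have \<zeta>0: "\<zeta> = 0" by (rule ck_op_fixpoint(2)[OF b])
  have "\<forall>\<^sub>F w in nhds 0. Z (scl r \<rho> w) = 0"
    using small_box_nhds
  proof eventually_elim
    case (elim w)
    show ?case using \<zeta>[OF small_box_qbox[OF elim]] by (simp add: \<zeta>0 vec_eq_iff)
  qed
  from eventually_scl[OF this, of "1/r" "1/\<rho>"] show ?thesis using r by (simp add: scl_inverse)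
qed

section \<open>Overdetermined linear systems\<close>

lemma bounded_bilinear_mv: "bounded_bilinear (\<lambda>(A::real^'n^'m) x. A *v x)"
proof -
  have "bilinear (\<lambda>(A::real^'n^'m) x. A *v x)"
    unfolding bilinear_def
    by (auto intro!: linearI simp: matrix_vector_right_distrib matrix_vector_mult_add_rdistrib
        vec.scale matrix_vector_mult_scaleR scaleR_matrix_vector_assoc[symmetric])
  then show ?thesis by (simp add: bilinear_conv_bounded_bilinear)
qed

lemma bounded_bilinear_mm: "bounded_bilinear (\<lambda>(A::real^'n^'m) (B::real^'k^'n). A ** B)"
proof -
  have "bilinear (\<lambda>(A::real^'n^'m) (B::real^'k^'n). A ** B)"
    unfolding bilinear_def
    by (auto intro!: linearI simp: vec_eq_iff matrix_matrix_mult_def sum.distrib distrib_left distrib_right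
        sum_distrib_left mult_ac)
  then show ?thesis by (simp add: bilinear_conv_bounded_bilinear)
qed

lemma real_analytic_at_mv:
  fixes A :: "real^'n \<Rightarrow> real^'k^'m"
  assumes "real_analytic_at A a" "real_analytic_at g a"
  shows "real_analytic_at (\<lambda>y. A y *v g y) a"
proof -
  have "real_analytic_at (\<lambda>y. A y $ i $ j) a" "real_analytic_at (\<lambda>y. g y $ j) a" for i j
    using assms unfolding real_analytic_at_vec[of A] real_analytic_at_vec[of "\<lambda>u. A u $ _"] real_analytic_at_vec[of g]
    by blast+
  then have "real_analytic_at (\<lambda>y. (A y *v g y) $ i) a" for i
    unfolding matrix_vector_mult_def vec_lambda_beta
    by (intro real_analytic_at_sum_real real_analytic_at_mult)
  then show ?thesis by (simp add: real_analytic_at_vec[of "\<lambda>y. A y *v g y"])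
qed

lemma real_analytic_at_mm:
  fixes A :: "real^'n \<Rightarrow> real^'k^'m" and B :: "real^'n \<Rightarrow> real^'l^'k"
  assumes "real_analytic_at A a" "real_analytic_at B a"
  shows "real_analytic_at (\<lambda>y. A y ** B y) a"
proof -
  have "real_analytic_at (\<lambda>y. A y $ i $ j) a" "real_analytic_at (\<lambda>y. B y $ j $ k) a" for i j k
    using assms unfolding real_analytic_at_vec[of A] real_analytic_at_vec[of "\<lambda>u. A u $ _"]
      real_analytic_at_vec[of B] real_analytic_at_vec[of "\<lambda>u. B u $ _"]
    by blast+
  then have "real_analytic_at (\<lambda>y. (A y ** B y) $ i $ j) a" for i j
    unfolding matrix_matrix_mult_def vec_lambda_beta
    by (intro real_analytic_at_sum_real real_analytic_at_mult)
  then show ?thesis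
    by (simp add: real_analytic_at_vec[of "\<lambda>y. A y ** B y"] real_analytic_at_vec[of "\<lambda>y. (A y ** B y) $ _"])
qed

lemma frechet_derivative_mv:
  fixes A :: "real^'n \<Rightarrow> real^'k^'m"
  assumes "A differentiable (at y)" "g differentiable (at y)"
  shows "(\<lambda>y. A y *v g y) differentiable (at y)"
    and "frechet_derivative (\<lambda>y. A y *v g y) (at y) v =
      frechet_derivative A (at y) v *v g y + A y *v frechet_derivative g (at y) v"
proof -
  have d: "((\<lambda>y. A y *v g y) has_derivative
      (\<lambda>v. A y *v frechet_derivative g (at y) v + frechet_derivative A (at y) v *v g y)) (at y)"
    using bounded_bilinear.FDERIV[OF bounded_bilinear_mv] assms unfolding frechet_derivative_works by blast
  then show "(\<lambda>y. A y *v g y) differentiable (at y)" unfolding differentiable_def by blast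
  from fun_cong[OF frechet_derivative_at[OF d], of v]
  show "frechet_derivative (\<lambda>y. A y *v g y) (at y) v =
      frechet_derivative A (at y) v *v g y + A y *v frechet_derivative g (at y) v" by (simp add: add.commute)
qed

lemma frechet_derivative_mm:
  fixes A :: "real^'n \<Rightarrow> real^'k^'m" and B :: "real^'n \<Rightarrow> real^'l^'k"
  assumes "A differentiable (at y)" "B differentiable (at y)"
  shows "(\<lambda>y. A y ** B y) differentiable (at y)"
    and "frechet_derivative (\<lambda>y. A y ** B y) (at y) v =
      frechet_derivative A (at y) v ** B y + A y ** frechet_derivative B (at y) v"
proof -
  have d: "((\<lambda>y. A y ** B y) has_derivative
      (\<lambda>v. A y ** frechet_derivative B (at y) v + frechet_derivative A (at y) v ** B y)) (at y)"
    using bounded_bilinear.FDERIV[OF bounded_bilinear_mm] assms unfolding frechet_derivative_works by blast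
  then show "(\<lambda>y. A y ** B y) differentiable (at y)" unfolding differentiable_def by blast
  from fun_cong[OF frechet_derivative_at[OF d], of v]
  show "frechet_derivative (\<lambda>y. A y ** B y) (at y) v =
      frechet_derivative A (at y) v ** B y + A y ** frechet_derivative B (at y) v" by (simp add: add.commute)
qed

lemma pd_diff:
  assumes "f differentiable (at y)" "g differentiable (at y)"
  shows "pd k (\<lambda>y. f y - g y) y = pd k f y - pd k g y"
proof -
  have "((\<lambda>y. f y - g y) has_derivative (\<lambda>v. frechet_derivative f (at y) v - frechet_derivative g (at y) v)) (at y)"
    using assms unfolding frechet_derivative_works by (rule has_derivative_diff)
  from fun_cong[OF frechet_derivative_at[OF this], of "axis k 1"] show ?thesis unfolding pd_def by (rule sym)
qed

lemma pd_sum: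
  assumes "\<And>i. i \<in> I \<Longrightarrow> f i differentiable (at y)"
  shows "pd k (\<lambda>y. \<Sum>i\<in>I. f i y) y = (\<Sum>i\<in>I. pd k (f i) y)"
proof -
  have "((\<lambda>y. \<Sum>i\<in>I. f i y) has_derivative (\<lambda>v. \<Sum>i\<in>I. frechet_derivative (f i) (at y) v)) (at y)"
    using assms unfolding frechet_derivative_works by (intro has_derivative_sum) auto
  from fun_cong[OF frechet_derivative_at[OF this], of "axis k 1"] show ?thesis unfolding pd_def by (rule sym)
qed

lemma nth_scaleR_has_derivative:
  fixes g :: "real^'n \<Rightarrow> 'b::real_normed_vector"
  assumes "g differentiable (at y)"
  shows "((\<lambda>y. y $ m *\<^sub>R g y) has_derivative (\<lambda>v. y $ m *\<^sub>R frechet_derivative g (at y) v + v $ m *\<^sub>R g y)) (at y)"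
proof -
  have "((\<lambda>y::real^'n. y $ m) has_derivative (\<lambda>v. v $ m)) (at y)"
    by (rule bounded_linear_imp_has_derivative[OF bounded_linear_vec_nth])
  then show ?thesis using assms unfolding frechet_derivative_works by (rule has_derivative_scaleR)
qed

lemma pd_nth_scaleR:
  fixes g :: "real^'n \<Rightarrow> 'b::real_normed_vector"
  assumes "g differentiable (at y)"
  shows "pd k (\<lambda>y. y $ m *\<^sub>R g y) y = (if k = m then g y else 0) + y $ m *\<^sub>R pd k g y"
  using fun_cong[OF frechet_derivative_at[OF nth_scaleR_has_derivative[OF assms, of m]], of "axis k 1"]
  by (auto simp: pd_def axis_def add.commute)

lemma pd_mv:
  fixes A :: "real^'n \<Rightarrow> real^'k^'m"
  assumes "A differentiable (at y)" "g differentiable (at y)"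
  shows "pd k (\<lambda>y. A y *v g y) y = pd k A y *v g y + A y *v pd k g y"
  unfolding pd_def by (rule frechet_derivative_mv(2)[OF assms])

lemma real_analytic_pd:
  fixes f :: "real^'n \<Rightarrow> 'b::euclidean_space"
  shows "real_analytic_at f a \<Longrightarrow> real_analytic_at (pd j f) a"
  unfolding pd_def by (rule real_analytic_deriv)

lemma pd_commute:
  fixes f :: "real^'n \<Rightarrow> 'b::euclidean_space"
  shows "real_analytic_at f a \<Longrightarrow> pd j (pd k f) a = pd k (pd j f) a"
  unfolding pd_def by (rule second_derivative_symmetric)

lemma pd_eq_0:
  assumes "\<forall>\<^sub>F u in nhds y. f u = 0"
  shows "pd k f y = 0"
proof -
  have "frechet_derivative f (at y) = frechet_derivative (\<lambda>_. 0) (at y)"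
    by (rule frechet_derivative_cong) (use assms in simp)
  then show ?thesis by (simp add: pd_def)
qed

text \<open>A variable is not a zero divisor among power series: multiplication by it shifts the
  coefficients injectively.\<close>

lemma real_analytic_nth_mult_eq_0:
  fixes f :: "real^'n \<Rightarrow> real"
  assumes f: "real_analytic_at f 0" and z: "\<forall>\<^sub>F y in nhds 0. y $ m * f y = 0"
  shows "\<forall>\<^sub>F y in nhds 0. f y = 0"
proof -
  obtain r C where r: "r > 0" and C: "\<And>w. w \<in> qbox \<Longrightarrow> f (0 + r *\<^sub>R w) = ev C w"
    using f unfolding real_analytic_at_ev by blast
  have s: "scl r 1 w = r *\<^sub>R w" for w :: "real^'n" by (simp add: scl_def vec_eq_iff)
  have "\<forall>\<^sub>F w in nhds 0. ev (var m * C) w = 0"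
    using eventually_scl[OF z, of r 1] small_box_nhds
  proof eventually_elim
    case (elim w)
    then show ?case using r C[OF small_box_qbox[OF elim(2)]] by (simp add: ev_mult[OF small_box_qbox[OF elim(2)]] s)
  qed
  then have "var m * C = 0" by (rule ev_eq_0_imp)
  then have "pcoeff (var m * C) (\<gamma> + unit_idx m) = 0" for \<gamma> by simp
  moreover have "idx_diff (\<gamma> + unit_idx m) m = \<gamma>" for \<gamma> :: "'n \<Rightarrow> nat"
    by (auto simp: idx_diff_def fun_algebra_apply fun_eq_iff)
  ultimately have "pcoeff C \<gamma> = 0" for \<gamma>
    by (metis (no_types, lifting) pcoeff_var_mult plus_fun_apply unit_idx_def add_is_0 zero_neq_one)
  then have C0: "C = 0" by (intro pseries_eqI) simp
  have "\<forall>\<^sub>F w in nhds 0. f (scl r 1 w) = 0"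
    using small_box_nhds
  proof eventually_elim
    case (elim w)
    then show ?case using C[OF small_box_qbox[OF elim]] by (simp add: C0 s)
  qed
  moreover have "scl r 1 (scl (1/r) 1 y) = y" for y :: "real^'n" using r by (simp add: scl_def vec_eq_iff)
  ultimately show ?thesis using eventually_scl[of "\<lambda>w. f (scl r 1 w) = 0" "1/r" 1] by simp
qed

lemma real_analytic_nth_scaleR_eq_0:
  fixes f :: "real^'n \<Rightarrow> real^'m"
  assumes f: "real_analytic_at f 0" and z: "\<forall>\<^sub>F y in nhds 0. y $ m *\<^sub>R f y = 0"
  shows "\<forall>\<^sub>F y in nhds 0. f y = 0"
proof -
  have "\<forall>\<^sub>F y in nhds 0. \<forall>i. f y $ i = 0"
  proof (rule eventually_all_finite, rule real_analytic_nth_mult_eq_0[where m=m])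
    fix i
    show "real_analytic_at (\<lambda>y. f y $ i) 0" using f unfolding real_analytic_at_vec[of f] by blast
    show "\<forall>\<^sub>F y in nhds 0. y $ m * f y $ i = 0"
      using z by eventually_elim (metis real_scaleR_def vector_scaleR_component zero_index)
  qed
  then show ?thesis by eventually_elim (simp add: vec_eq_iff)
qed

text \<open>Solve only the radial contraction and consider the defects \<open>E j\<close>.
  Cross-differentiation and integrability give a closed system for them; contracting it with
  \<open>y\<close> turns \<open>y\<^sub>j E\<^sub>j\<close> into a solution of the radial equation
  with zero data, so it vanishes by uniqueness.\<close>

theorem linear_system_solvable:
  fixes A :: "'n::finite \<Rightarrow> real^'n \<Rightarrow> real^'m^'m::finite" and h :: "real^'m"
  assumes A: "\<And>j. real_analytic_at (A j) 0"
    and comm: "\<forall>\<^sub>F y in nhds 0. \<forall>j k. A j y ** A k y = A k y ** A j y"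
    and compat: "\<forall>\<^sub>F y in nhds 0. \<forall>j k. pd j (A k) y - pd k (A j) y =
      A j y ** pd piv (A k) y - A k y ** pd piv (A j) y"
    and A1: "\<forall>\<^sub>F y in nhds 0. A piv y = mat 1"
  obtains F where "real_analytic_at F 0" "pd piv F 0 = h"
    "\<forall>\<^sub>F y in nhds 0. \<forall>j. pd j F y = A j y *v pd piv F y"
proof -
  obtain F where F: "real_analytic_at F 0" and Fh: "pd piv F 0 = h" and FR: "\<forall>\<^sub>F y in nhds 0. rad F y = rad_op A F y"
    by (rule radial_ck_exists[where h=h, OF A])
  define E where "E = (\<lambda>j y. pd j F y - A j y *v pd piv F y)"
  have Ean: "real_analytic_at (E j) 0" for j
    unfolding E_def by (intro real_analytic_at_diff real_analytic_pd real_analytic_at_mv A F)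
  have nearF: "\<forall>\<^sub>F y in nhds 0. real_analytic_at F y" by (rule real_analytic_near[OF F])
  have nearA: "\<forall>\<^sub>F y in nhds 0. \<forall>j. real_analytic_at (A j) y"
    by (intro eventually_all_finite real_analytic_near A)
  have nearE: "\<forall>\<^sub>F y in nhds 0. \<forall>j. real_analytic_at (E j) y"
    by (intro eventually_all_finite real_analytic_near Ean)
  have S: "\<forall>\<^sub>F y in nhds 0. (\<Sum>k\<in>UNIV - {piv}. y $ k *\<^sub>R E k y) = 0"
    using FR by eventually_elim (simp add: rad_def rad_op_def E_def scaleR_diff_right sum_subtractf)
  \<comment> \<open>Differentiating the contraction in the direction \<open>j\<close> gives
    \<open>\<Sum>\<^sub>k y\<^sub>k \<partial>\<^sub>jE\<^sub>k = - E\<^sub>j\<close>, and in the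
    pivot direction gives 0.\<close>
  have dS: "\<forall>\<^sub>F y in nhds 0. \<forall>i. (\<Sum>k\<in>UNIV - {piv}. (if i = k then E k y else 0) + y $ k *\<^sub>R pd i (E k) y) = 0"
    using nearE eventually_eventually[THEN iffD2, OF S]
  proof eventually_elim
    case (elim y)
    have Ed: "E k differentiable (at y)" for k using elim(1) real_analytic_differentiable by blast
    show ?case
    proof
      fix i
      have "pd i (\<lambda>y. \<Sum>k\<in>UNIV - {piv}. y $ k *\<^sub>R E k y) y = 0" by (rule pd_eq_0[OF elim(2)])
      moreover have "pd i (\<lambda>y. \<Sum>k\<in>UNIV - {piv}. y $ k *\<^sub>R E k y) y = (\<Sum>k\<in>UNIV - {piv}. pd i (\<lambda>y. y $ k *\<^sub>R E k y) y)"
        by (rule pd_sum) (use nth_scaleR_has_derivative[OF Ed] in \<open>auto simp: differentiable_def\<close>)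
      ultimately show "(\<Sum>k\<in>UNIV - {piv}. (if i = k then E k y else 0) + y $ k *\<^sub>R pd i (E k) y) = 0"
        by (simp add: pd_nth_scaleR[OF Ed])
    qed
  qed
  \<comment> \<open>Second derivatives of \<open>F\<close> cancel: the mixed ones by symmetry, those
    in the pivot direction because the coefficients commute. The compatibility condition removes the
    terms with derivatives of \<open>A\<close>.\<close>
  have cross: "\<forall>\<^sub>F y in nhds 0. \<forall>j k. pd k (E j) y = pd j (E k) y + A k y *v pd piv (E j) y - A j y *v pd piv (E k) y"
    using nearF nearA comm compat
  proof eventually_elim
    case (elim y)
    show ?case
    proof (intro allI)
      fix j k
      define D where "D = pd piv F"
      have dA: "A j differentiable (at y)" for j using elim(2) real_analytic_differentiable by blast
      have dF: "pd j F differentiable (at y)" for j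
        by (intro real_analytic_differentiable real_analytic_pd elim(1))
      have dD: "D differentiable (at y)" unfolding D_def by (rule dF)
      have pE: "pd i (E j) y = pd i (pd j F) y - (pd i (A j) y *v D y + A j y *v pd i D y)" for i j
        unfolding E_def D_def[symmetric]
        by (subst pd_diff[OF dF frechet_derivative_mv(1)[OF dA dD]]) (simp add: pd_mv[OF dA dD])
      have pD: "pd i D y = pd piv (E i) y + (pd piv (A i) y *v D y + A i y *v pd piv D y)" for i
        unfolding pE D_def by (simp add: pd_commute[OF elim(1)])
      have c: "pd j (A k) y = pd k (A j) y + (A j y ** pd piv (A k) y - A k y ** pd piv (A j) y)"
        using elim(4) by (metis add.commute diff_add_cancel)
      have cm: "A j y *v (A k y *v x) = A k y *v (A j y *v x)" for x
        using elim(3) by (simp add: matrix_vector_mul_assoc)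
      have "pd k (E j) y - pd j (E k) y =
          (pd j (A k) y *v D y - pd k (A j) y *v D y) + A k y *v pd j D y - A j y *v pd k D y"
        unfolding pE by (simp add: pd_commute[OF elim(1), of k j])
      also have "\<dots> = A k y *v pd piv (E j) y - A j y *v pd piv (E k) y"
        unfolding pD[of j] pD[of k] c
        by (simp add: matrix_vector_mult_add_rdistrib matrix_vector_mult_diff_rdistrib
            matrix_vector_right_distrib matrix_vector_mul_assoc[symmetric] cm)
      finally show "pd k (E j) y = pd j (E k) y + A k y *v pd piv (E j) y - A j y *v pd piv (E k) y"
        by (simp add: algebra_simps)
    qed
  qed
  have Ej: "\<forall>\<^sub>F y in nhds 0. E j y = 0" for j
  proof (cases "j = piv")
    case True
    show ?thesis using A1 by eventually_elim (simp add: E_def True)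
  next
    case j: False
    \<comment> \<open>Contraction gives \<open>R E\<^sub>j = - E\<^sub>j + \<Sum>\<^sub>k y\<^sub>k
      A\<^sub>k \<partial>\<^sub>p\<^sub>i\<^sub>vE\<^sub>j\<close>. The factor
      \<open>y\<^sub>j\<close> cancels the zeroth-order term and also makes the function vanish on
      the pivot axis.\<close>
    define Z where "Z = (\<lambda>y. y $ j *\<^sub>R E j y)"
    have "\<forall>\<^sub>F y in nhds 0. Z y = 0"
    proof (rule radial_ck_unique[OF A])
      show "real_analytic_at Z 0" unfolding Z_def
        by (intro real_analytic_at_scaleR real_analytic_at_nth Ean)
      show "\<forall>\<^sub>F y in nhds 0. (\<forall>k. k \<noteq> piv \<longrightarrow> y $ k = 0) \<longrightarrow> Z y = 0"
        using j by (simp add: Z_def)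
      show "\<forall>\<^sub>F y in nhds 0. rad Z y = rad_op A Z y"
        using nearE dS cross
      proof eventually_elim
        case (elim y)
        have Ed: "E k differentiable (at y)" for k using elim(1) real_analytic_differentiable by blast
        have pZ: "pd k Z y = (if k = j then E j y else 0) + y $ j *\<^sub>R pd k (E j) y" for k
          unfolding Z_def by (rule pd_nth_scaleR[OF Ed])
        let ?I = "UNIV - {piv} :: 'n set"
        have s1: "(\<Sum>k\<in>?I. y $ k *\<^sub>R pd j (E k) y) = - E j y"
        proof -
          have "(\<Sum>k\<in>?I. (if j = k then E k y else 0)) = E j y" using j by simp
          then show ?thesis using elim(2)[rule_format, of j] by (simp add: sum.distrib eq_neg_iff_add_eq_0 add.commute)
        qed
        have s2: "(\<Sum>k\<in>?I. y $ k *\<^sub>R pd piv (E k) y) = 0"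
        proof -
          have "(\<Sum>k\<in>?I. (if piv = k then E k y else 0)) = 0" by (rule sum.neutral) auto
          then show ?thesis using elim(2)[rule_format, of piv] by (simp add: sum.distrib)
        qed
        have s3: "(\<Sum>k\<in>?I. y $ k *\<^sub>R pd k (E j) y) = - E j y + (\<Sum>k\<in>?I. y $ k *\<^sub>R (A k y *v pd piv (E j) y))"
        proof -
          have "(\<Sum>k\<in>?I. y $ k *\<^sub>R pd k (E j) y) = (\<Sum>k\<in>?I. y $ k *\<^sub>R pd j (E k) y)
             + (\<Sum>k\<in>?I. y $ k *\<^sub>R (A k y *v pd piv (E j) y)) - (\<Sum>k\<in>?I. y $ k *\<^sub>R (A j y *v pd piv (E k) y))"
            unfolding sum.distrib[symmetric] sum_subtractf[symmetric]
            by (intro sum.cong refl, subst elim(3)[rule_format, of j]) (simp add: scaleR_add_right scaleR_diff_right)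
          moreover have "(\<Sum>k\<in>?I. y $ k *\<^sub>R (A j y *v pd piv (E k) y)) = A j y *v (\<Sum>k\<in>?I. y $ k *\<^sub>R pd piv (E k) y)"
            by (simp add: linear_sum[OF matrix_vector_mul_linear] matrix_vector_mult_scaleR)
          ultimately show ?thesis using s1 s2 by simp
        qed
        have "rad Z y = (\<Sum>k\<in>?I. (if k = j then y $ j *\<^sub>R E j y else 0)) + y $ j *\<^sub>R (\<Sum>k\<in>?I. y $ k *\<^sub>R pd k (E j) y)"
          unfolding rad_def pZ scaleR_sum_right sum.distrib[symmetric]
          by (intro sum.cong refl) (simp add: scaleR_add_right)
        also have "\<dots> = y $ j *\<^sub>R (\<Sum>k\<in>?I. y $ k *\<^sub>R (A k y *v pd piv (E j) y))"
          using j unfolding s3 by (simp add: scaleR_diff_right)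
        also have "\<dots> = rad_op A Z y"
          unfolding rad_op_def pZ scaleR_sum_right
          using j by (intro sum.cong refl) (simp add: matrix_vector_mult_scaleR)
        finally show ?case .
      qed
    qed
    then show ?thesis unfolding Z_def by (rule real_analytic_nth_scaleR_eq_0[OF Ean])
  qed
  have "\<forall>\<^sub>F y in nhds 0. \<forall>j. E j y = 0" by (intro eventually_all_finite Ej)
  then have "\<forall>\<^sub>F y in nhds 0. \<forall>j. pd j F y = A j y *v pd piv F y"
    unfolding E_def right_minus_eq .
  then show ?thesis by (rule that[OF F Fh])
qed

section \<open>The Cayley-Hamilton theorem\<close>

lemma mat_power_0 [simp]: "mat_power B 0 = mat 1"
  by (simp add: mat_power_def)

lemma mat_power_Suc: "mat_power B (Suc k) = B ** mat_power B k"
  by (simp add: mat_power_def)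

lemma mat_power_Suc2: "mat_power B (Suc k) = mat_power B k ** B"
proof (induction k)
  case (Suc k)
  have "mat_power B (Suc (Suc k)) = B ** (mat_power B k ** B)" by (simp only: mat_power_Suc Suc[symmetric])
  then show ?case by (simp add: mat_power_Suc matrix_mul_assoc)
qed (simp add: mat_power_Suc)

lemma mat_power_add: "mat_power B (j + k) = mat_power B j ** mat_power B k"
  by (induction j) (simp_all add: mat_power_Suc matrix_mul_assoc)

lemma matrix_add_rdistrib: "((B + C) ** (A :: real^'k^'n)) = (B ** A) + (C ** A)"
  by (simp add: bounded_bilinear.add_left[OF bounded_bilinear_mm])

lemma matrix_diff_rdistrib: "((B - C) ** (A :: real^'k^'n)) = (B ** A) - (C ** A)"
  by (simp add: bounded_bilinear.diff_left[OF bounded_bilinear_mm])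

lemma matrix_diff_ldistrib: "((A :: real^'k^'n) ** (B - C)) = (A ** B) - (A ** C)"
  by (simp add: bounded_bilinear.diff_right[OF bounded_bilinear_mm])

lemma matrix_sum_rdistrib: "(\<Sum>i\<in>I. f i) ** (A :: real^'k^'n) = (\<Sum>i\<in>I. f i ** A)"
  by (rule bounded_bilinear.sum_left[OF bounded_bilinear_mm])

lemma matrix_sum_ldistrib: "(A :: real^'k^'n) ** (\<Sum>i\<in>I. f i) = (\<Sum>i\<in>I. A ** f i)"
  by (rule bounded_bilinear.sum_right[OF bounded_bilinear_mm])

lemma matrix_scaleR_left: "(r *\<^sub>R B) ** (A :: real^'k^'n) = r *\<^sub>R (B ** A)"
  by (rule bounded_bilinear.scaleR_left[OF bounded_bilinear_mm])

lemma matrix_scaleR_right: "(A :: real^'k^'n) ** (r *\<^sub>R B) = r *\<^sub>R (A ** B)"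
  by (rule bounded_bilinear.scaleR_right[OF bounded_bilinear_mm])

lemma mv_sum_left: "(\<Sum>i\<in>I. f i) *v x = (\<Sum>i\<in>I. f i *v (x :: real^'n))"
  by (rule bounded_bilinear.sum_left[OF bounded_bilinear_mv])

lemma mv_sum_right: "A *v (\<Sum>i\<in>I. f i) = (\<Sum>i\<in>I. A *v (f i :: real^'n))"
  by (rule bounded_bilinear.sum_right[OF bounded_bilinear_mv])

lemma mv_scaleR_left: "(r *\<^sub>R A) *v x = r *\<^sub>R (A *v (x :: real^'n))"
  by (rule bounded_bilinear.scaleR_left[OF bounded_bilinear_mv])

lemma det_poly:
  fixes M :: "real \<Rightarrow> real^'n^'n"
  assumes "\<And>k l. \<exists>p. \<forall>t. M t $ k $ l = poly p t"
  shows "\<exists>p. \<forall>t. det (M t) = poly p t"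
proof -
  obtain p where p: "\<And>k l t. M t $ k $ l = poly (p k l) t" using assms by metis
  have "det (M t) = poly (\<Sum>\<sigma> | \<sigma> permutes UNIV. of_int (sign \<sigma>) * (\<Prod>i\<in>UNIV. p i (\<sigma> i))) t" for t
    by (simp add: det_def poly_sum poly_prod p)
  then show ?thesis by blast
qed

lemma poly_eq_infinite:
  fixes p q :: "real poly"
  assumes "infinite {t. poly p t = poly q t}"
  shows "p = q"
proof (rule ccontr)
  assume "p \<noteq> q"
  then have "finite {t. poly (p - q) t = 0}" by (intro poly_roots_finite) simp
  then show False using assms by simp
qed

text \<open>Being the coefficients is encoded by the Cayley-Hamilton identity, which can be
  differentiated and checked on a cyclic vector. For a gl-regular matrix it determines
  \<open>f 1\<close>, ..., \<open>f n\<close>.\<close>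

definition char_coeffs :: "(nat \<Rightarrow> real) \<Rightarrow> real^'n^'n \<Rightarrow> bool" where
  "char_coeffs f B \<longleftrightarrow> mat_power B CARD('n) = (\<Sum>i=1..CARD('n). f i *\<^sub>R mat_power B (CARD('n) - i))"

text \<open>The adjugate proof: Cramer's rule provides a polynomial matrix \<open>q\<close> with
  \<open>(t - B) q(t) = D(t)\<close>. Comparing coefficients and multiplying by powers of
  \<open>B\<close> gives a telescoping sum.\<close>

theorem cayley_hamilton:
  fixes B :: "real^'n^'n"
  assumes cp: "\<And>t. det (mat t - B) = t ^ CARD('n) - (\<Sum>i=1..CARD('n). f i * t ^ (CARD('n) - i))"
  shows "char_coeffs f B"
proof -
  let ?n = "CARD('n)"
  define D :: "real poly" where "D = monom 1 ?n - (\<Sum>i=1..?n. monom (f i) (?n - i))"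
  have D: "poly D t = det (mat t - B)" for t
    by (simp add: D_def cp poly_monom poly_sum)
  have cs: "coeff (\<Sum>i=1..?n. monom (f i) (?n - i)) k = (\<Sum>i=1..?n. if k = ?n - i then f i else 0)" for k
    unfolding coeff_sum by (intro sum.cong) auto
  have Dn: "coeff D ?n = 1"
  proof -
    have "(\<Sum>i=1..?n. if ?n = ?n - i then f i else 0) = 0" by (intro sum.neutral) auto
    then show ?thesis unfolding D_def coeff_diff cs by simp
  qed
  have entry: "\<exists>p. \<forall>t. (mat t - B) $ k $ l = poly p t" for k l
    by (rule exI[of _ "[: - B $ k $ l, if k = l then 1 else 0 :]"]) (simp add: mat_def)
  \<comment> \<open>\<open>t - B\<close> with column \<open>i\<close> replaced by the axis
    \<open>j\<close>; its determinant is the entry \<open>(i,j)\<close> of the adjugate.\<close>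
  define M where "M = (\<lambda>i j t. (\<chi> k l. if l = i then axis j 1 $ k else (mat t - B) $ k $ l) :: real^'n^'n)"
  have "\<exists>p. \<forall>t. det (M i j t) = poly p t" for i j
  proof (rule det_poly)
    fix k l
    show "\<exists>p. \<forall>t. M i j t $ k $ l = poly p t"
    proof (cases "l = i")
      case True
      then show ?thesis by (intro exI[of _ "[: axis j 1 $ k :]"]) (simp add: M_def)
    next
      case False
      then show ?thesis using entry[of k l] by (simp add: M_def)
    qed
  qed
  then obtain q where q: "\<And>i j t. det (M i j t) = poly (q i j) t" by metis
  have fin: "finite {t. poly D t = 0}" by (rule poly_roots_finite) (use Dn in auto)
  have inf: "infinite {t. poly D t \<noteq> 0}"
  proof -
    have "{t. poly D t \<noteq> 0} = UNIV - {t. poly D t = 0}" by auto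
    then show ?thesis using fin infinite_UNIV_char_0 by (metis Diff_infinite_finite)
  qed
  have adj: "(\<Sum>l\<in>UNIV. (mat t - B) $ i $ l * poly (q l j) t) = (if i = j then poly D t else 0)" if t: "poly D t \<noteq> 0" for t i j
  proof -
    have "det (mat t - B) \<noteq> 0" using t by (simp add: D)
    then have "invertible (mat t - B)" by (simp add: invertible_det_nz)
    then obtain R where R: "(mat t - B) ** R = mat 1" unfolding invertible_def by blast
    define x where "x = R *v axis j 1"
    have x: "(mat t - B) *v x = axis j 1" by (simp add: x_def matrix_vector_mul_assoc R)
    have "poly (q l j) t = x $ l * poly D t" for l
    proof -
      have "M l j t = (\<chi> i' j'. if j' = l then ((mat t - B) *v x) $ i' else (mat t - B) $ i' $ j')"
        unfolding M_def x by (simp add: vec_eq_iff)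
      then show ?thesis unfolding q[symmetric] D by (simp only: cramer_lemma)
    qed
    then have "(\<Sum>l\<in>UNIV. (mat t - B) $ i $ l * poly (q l j) t) = ((mat t - B) *v x) $ i * poly D t"
      by (simp add: matrix_vector_mult_def sum_distrib_right mult.assoc)
    then show ?thesis unfolding x by (simp add: axis_def)
  qed
  \<comment> \<open>The identity is known where \<open>D\<close> is nonzero, that is at all but
    finitely many \<open>t\<close>; this makes it an identity of polynomials.\<close>
  have pid: "pCons 0 (q i j) - (\<Sum>l\<in>UNIV. smult (B $ i $ l) (q l j)) = (if i = j then D else 0)" for i j
  proof (rule poly_eq_infinite, rule infinite_super[OF _ inf], safe)
    fix t assume "poly D t \<noteq> 0"
    from adj[OF this, of i j] have "t * poly (q i j) t - (\<Sum>l\<in>UNIV. B $ i $ l * poly (q l j) t) = (if i = j then poly D t else 0)"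
      by (simp add: left_diff_distrib sum_subtractf mat_def if_distrib[of "\<lambda>x. x * _"] cong: if_cong)
    then show "poly (pCons 0 (q i j) - (\<Sum>l\<in>UNIV. smult (B $ i $ l) (q l j))) t = poly (if i = j then D else 0) t"
      by (simp add: poly_sum)
  qed
  define Q where "Q = (\<lambda>k. (\<chi> i j. coeff (q i j) k) :: real^'n^'n)"
  define Q' where "Q' = (\<lambda>k. if k = 0 then 0 else Q (k - 1))"
  have rec: "Q' k - B ** Q k = coeff D k *\<^sub>R mat 1" for k
  proof -
    have "coeff (pCons 0 (q i j)) k - (\<Sum>l\<in>UNIV. B $ i $ l * coeff (q l j) k) = coeff (if i = j then D else 0) k" for i j
      using arg_cong[OF pid[of i j], of "\<lambda>p. coeff p k"] by (simp add: coeff_sum)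
    moreover have "Q' k $ i $ j = coeff (pCons 0 (q i j)) k" for i j
      by (cases k) (simp_all add: Q'_def Q_def)
    ultimately have "(Q' k - B ** Q k) $ i $ j = (coeff D k *\<^sub>R mat 1 :: real^'n^'n) $ i $ j" for i j
      by (simp add: Q_def matrix_matrix_mult_def mat_def)
    then show ?thesis by (simp add: vec_eq_iff)
  qed
  \<comment> \<open>Beyond all degrees in play, so the last term of the telescoping sum
    vanishes.\<close>
  define N where "N = Max (range (\<lambda>(i,j). degree (q i j))) + ?n + 1"
  have QN: "Q N = 0"
  proof -
    have "degree (q i j) < N" for i j
    proof -
      have "degree (q i j) \<le> Max (range (\<lambda>(i,j). degree (q i j)))" by (rule Max_ge) auto
      then show ?thesis by (simp add: N_def)
    qed
    then show ?thesis by (simp add: Q_def vec_eq_iff coeff_eq_0)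
  qed
  have tel: "(\<Sum>k\<le>m. coeff D k *\<^sub>R mat_power B k) = - (mat_power B (Suc m) ** Q m)" for m
  proof -
    have t: "coeff D k *\<^sub>R mat_power B k = mat_power B k ** Q' k - mat_power B (Suc k) ** Q k" for k
    proof -
      have "coeff D k *\<^sub>R mat_power B k = mat_power B k ** (coeff D k *\<^sub>R mat 1)"
        by (simp add: matrix_scaleR_right)
      then show ?thesis
        by (simp add: rec[symmetric] matrix_diff_ldistrib mat_power_Suc2 matrix_mul_assoc)
    qed
    show ?thesis
    proof (induction m)
      case 0
      then show ?case using rec[of 0] by (simp add: Q'_def mat_power_Suc)
    next
      case (Suc m)
      then show ?case by (simp add: t Q'_def)
    qed
  qed
  have deg: "coeff D k = 0" if "k > ?n" for k
  proof -
    have "(\<Sum>i=1..?n. if k = ?n - i then f i else 0) = 0" by (intro sum.neutral) (use that in auto)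
    then show ?thesis using that unfolding D_def coeff_diff cs by simp
  qed
  have "(\<Sum>k\<le>?n. coeff D k *\<^sub>R mat_power B k) = (\<Sum>k\<le>N. coeff D k *\<^sub>R mat_power B k)"
    by (rule sum.mono_neutral_left) (auto simp: N_def deg)
  also have "\<dots> = 0" by (simp add: tel QN)
  finally have z: "(\<Sum>k\<le>?n. coeff D k *\<^sub>R mat_power B k) = 0" .
  have "(\<Sum>k\<le>?n. coeff D k *\<^sub>R mat_power B k) = (\<Sum>k\<in>insert ?n {..<?n}. coeff D k *\<^sub>R mat_power B k)"
    by (rule sum.cong) auto
  also have "\<dots> = mat_power B ?n + (\<Sum>k<?n. coeff D k *\<^sub>R mat_power B k)"
    by (simp add: Dn)
  also have "(\<Sum>k<?n. coeff D k *\<^sub>R mat_power B k) = (\<Sum>i=1..?n. coeff D (?n - i) *\<^sub>R mat_power B (?n - i))"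
    by (rule sum.reindex_bij_witness[where i="\<lambda>i. ?n - i" and j="\<lambda>k. ?n - k"]) auto
  also have "\<dots> = (\<Sum>i=1..?n. - (f i *\<^sub>R mat_power B (?n - i)))"
  proof (rule sum.cong)
    fix i assume i: "i \<in> {1..?n}"
    have "(\<Sum>i'=1..?n. if ?n - i = ?n - i' then f i' else 0) = (\<Sum>i'=1..?n. if i' = i then f i else 0)"
      by (rule sum.cong) (use i in auto)
    then have "coeff D (?n - i) = - f i" using i unfolding D_def coeff_diff cs by auto
    then show "coeff D (?n - i) *\<^sub>R mat_power B (?n - i) = - (f i *\<^sub>R mat_power B (?n - i))" by simp
  qed simp
  finally show ?thesis using z by (simp add: char_coeffs_def sum_negf)
qed

section \<open>Cyclic vectors\<close>

text \<open>Phrased by invariant subspaces, so that a property of all vectors can be proved by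
  showing that it defines an invariant subspace containing \<open>\<xi>\<close>.\<close>

definition cyclic :: "real^'n^'n \<Rightarrow> real^'n \<Rightarrow> bool" where
  "cyclic B \<xi> \<longleftrightarrow> (\<forall>S. subspace S \<longrightarrow> \<xi> \<in> S \<longrightarrow> (\<forall>v\<in>S. B *v v \<in> S) \<longrightarrow> S = UNIV)"

text \<open>The module structure over the polynomial ring: the value \<open>p(B) v\<close>.\<close>

definition pact :: "real^'n^'n \<Rightarrow> real poly \<Rightarrow> real^'n \<Rightarrow> real^'n" where
  "pact B p v = (\<Sum>k\<le>degree p. coeff p k *\<^sub>R (mat_power B k *v v))"

lemma pact_bound: "degree p \<le> m \<Longrightarrow> pact B p v = (\<Sum>k\<le>m. coeff p k *\<^sub>R (mat_power B k *v v))"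
  unfolding pact_def by (rule sum.mono_neutral_left) (auto simp: coeff_eq_0)

lemma pact_add: "pact B (p + q) v = pact B p v + pact B q v"
proof -
  define m where "m = max (degree p) (degree q)"
  have "degree (p + q) \<le> m" "degree p \<le> m" "degree q \<le> m"
    by (auto simp: m_def degree_add_le)
  then show ?thesis by (simp add: pact_bound sum.distrib scaleR_add_left)
qed

lemma pact_smult: "pact B (smult a p) v = a *\<^sub>R pact B p v"
proof -
  have "degree (smult a p) \<le> degree p" by simp
  then show ?thesis by (simp add: pact_bound[of "smult a p" "degree p"] pact_def scaleR_sum_right)
qed

lemma pact_0 [simp]: "pact B 0 v = 0"
  by (simp add: pact_def)

lemma pact_pCons: "pact B (pCons a p) v = a *\<^sub>R v + B *v pact B p v"
proof -
  have d: "degree (pCons a p) \<le> Suc (degree p)" by (rule degree_pCons_le)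
  have "pact B (pCons a p) v = (\<Sum>k\<le>Suc (degree p). coeff (pCons a p) k *\<^sub>R (mat_power B k *v v))"
    by (rule pact_bound[OF d])
  also have "\<dots> = a *\<^sub>R v + (\<Sum>k\<le>degree p. coeff p k *\<^sub>R (mat_power B (Suc k) *v v))"
    by (subst sum.atMost_Suc_shift) simp
  also have "(\<Sum>k\<le>degree p. coeff p k *\<^sub>R (mat_power B (Suc k) *v v)) = B *v pact B p v"
    by (simp add: pact_def mv_sum_right mat_power_Suc matrix_vector_mul_assoc[symmetric] matrix_vector_mult_scaleR)
  finally show ?thesis .
qed

lemma pact_monom: "pact B (monom a k) v = a *\<^sub>R (mat_power B k *v v)"
proof -
  have "pact B (monom a k) v = (\<Sum>j\<le>k. coeff (monom a k) j *\<^sub>R (mat_power B j *v v))"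
    by (rule pact_bound[OF degree_monom_le])
  also have "\<dots> = (\<Sum>j\<le>k. if j = k then a *\<^sub>R (mat_power B k *v v) else 0)"
    by (rule sum.cong) auto
  finally show ?thesis by simp
qed

lemma pact_sum: "pact B (\<Sum>i\<in>I. p i) v = (\<Sum>i\<in>I. pact B (p i) v)"
  by (induction I rule: infinite_finite_induct) (auto simp: pact_add)

lemma pact_linear: "linear (pact B p)"
  unfolding pact_def
  by (intro linear_compose_sum ballI linear_compose_scale_right matrix_vector_mul_linear)

lemma pact_mult: "pact B (p * q) v = pact B p (pact B q v)"
proof (induction p)
  case (pCons a p)
  then show ?case
    by (simp add: mult_pCons_left pact_add pact_smult pact_pCons)
qed simp

lemma gl_regular_pact:
  fixes B :: "real^'n^'n"
  assumes gl: "gl_regular B" and deg: "degree p < CARD('n)" and z: "\<And>v. pact B p v = 0"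
  shows "p = 0"
proof -
  have s: "(\<Sum>k<CARD('n). coeff p k *\<^sub>R mat_power B k) *v v = pact B p v" for v
  proof -
    have "pact B p v = (\<Sum>k\<le>CARD('n) - 1. coeff p k *\<^sub>R (mat_power B k *v v))"
      by (rule pact_bound) (use deg in simp)
    also have "{..CARD('n) - 1} = {..<CARD('n)}" using deg by auto
    finally show ?thesis by (simp add: mv_sum_left mv_scaleR_left)
  qed
  have "(\<Sum>k<CARD('n). coeff p k *\<^sub>R mat_power B k) = 0"
    by (subst matrix_eq) (simp add: s z)
  then have "coeff p k = 0" if "k < CARD('n)" for k
    using gl that unfolding gl_regular_def by blast
  then show ?thesis using deg by (metis leading_coeff_0_iff)
qed

text \<open>Proper subspaces are null sets, and so is a finite union of them.\<close>

lemma finite_Union_proper_subspaces: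
  fixes \<V> :: "(real^'n) set set"
  assumes "finite \<V>" "\<And>V. V \<in> \<V> \<Longrightarrow> subspace V \<and> V \<noteq> UNIV"
  obtains \<xi> where "\<And>V. V \<in> \<V> \<Longrightarrow> \<xi> \<notin> V"
proof -
  have "negligible V" if "V \<in> \<V>" for V
  proof (rule negligible_lowdim)
    have "dim V \<noteq> DIM(real^'n)" using assms(2)[OF that] by (metis dim_eq_full span_eq_iff)
    then show "dim V < DIM(real^'n)" using dim_subset_UNIV[of V] by linarith
  qed
  then have "negligible (\<Union>\<V>)" by (intro negligible_Union assms(1))
  then have "\<Union>\<V> \<noteq> UNIV" using non_negligible_UNIV by metis
  then show ?thesis using that by blast
qed

text \<open>For a prime factor \<open>q\<close> of the characteristic polynomial \<open>D\<close>,
  gl-regularity makes the kernel of \<open>(D/q)(B)\<close> proper. A vector outside all these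
  kernels is annihilated by no nonzero polynomial of degree below \<open>n\<close>, so its first
  \<open>n\<close> iterates are independent.\<close>

lemma gl_regular_cyclic:
  fixes B :: "real^'n^'n"
  assumes gl: "gl_regular B" and ch: "char_coeffs f B"
  obtains \<xi> where "cyclic B \<xi>"
proof -
  let ?n = "CARD('n)"
  define D :: "real poly" where "D = monom 1 ?n - (\<Sum>i=1..?n. monom (f i) (?n - i))"
  have dS: "degree (\<Sum>i=1..?n. monom (f i) (?n - i)) < ?n"
    by (rule degree_sum_less) (auto intro: le_less_trans[OF degree_monom_le])
  have cDn: "coeff D ?n = 1" unfolding D_def coeff_diff using coeff_eq_0[OF dS] by simp
  have "degree D \<le> ?n" unfolding D_def
    by (rule degree_diff_le) (use dS in \<open>auto simp: degree_monom_eq\<close>)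
  moreover have "?n \<le> degree D" by (rule le_degree) (simp add: cDn)
  ultimately have degD: "degree D = ?n" by simp
  have D0: "D \<noteq> 0" using cDn by auto
  have Dz: "pact B D v = 0" for v
  proof -
    have "D = monom 1 ?n + smult (-1) (\<Sum>i=1..?n. monom (f i) (?n - i))" by (simp add: D_def)
    then have "pact B D v = mat_power B ?n *v v - (\<Sum>i=1..?n. f i *\<^sub>R (mat_power B (?n - i) *v v))"
      by (simp only: pact_add pact_smult pact_sum pact_monom) simp
    also have "mat_power B ?n *v v = (\<Sum>i=1..?n. f i *\<^sub>R (mat_power B (?n - i) *v v))"
      using ch by (simp add: char_coeffs_def mv_sum_left mv_scaleR_left)
    finally show ?thesis by simp
  qed
  define V where "V = (\<lambda>q. {v. pact B (D div q) v = 0})"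
  have proper: "subspace (V q) \<and> V q \<noteq> UNIV" if q: "q \<in> prime_factors D" for q
  proof
    show "subspace (V q)" unfolding V_def by (rule linear_subspace_kernel[OF pact_linear])
    have qD: "q * (D div q) = D" using q by auto
    have pq: "prime q" using q by auto
    then have "degree q \<noteq> 0" using is_unit_iff_degree[of q] by (auto simp: prime_def prime_elem_def)
    moreover have "degree D = degree q + degree (D div q)"
      using qD D0 by (metis degree_mult_eq mult_eq_0_iff)
    ultimately have "degree (D div q) < ?n" using degD by linarith
    moreover have "D div q \<noteq> 0" using qD D0 by auto
    ultimately have "\<exists>v. pact B (D div q) v \<noteq> 0" using gl_regular_pact[OF gl] by blast
    then show "V q \<noteq> UNIV" by (auto simp: V_def)
  qed
  obtain \<xi> where \<xi>: "\<And>W. W \<in> V ` prime_factors D \<Longrightarrow> \<xi> \<notin> W"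
    by (rule finite_Union_proper_subspaces[of "V ` prime_factors D"]) (use proper in auto)
  have ann: "degree p \<ge> ?n" if p: "p \<noteq> 0" "pact B p \<xi> = 0" for p
  proof (rule ccontr)
    assume "\<not> ?n \<le> degree p"
    \<comment> \<open>By Bezout the gcd with \<open>D\<close> annihilates \<open>\<xi>\<close> as
      well. It is a proper divisor of \<open>D\<close>, hence divides some \<open>D/q\<close>, which
      contradicts the choice of \<open>\<xi>\<close>.\<close>
    define g where "g = gcd p D"
    obtain a b where ab: "a * p + b * D = g"
      unfolding g_def by (metis bezout_coefficients_fst_snd)
    have pg: "pact B g \<xi> = 0"
      unfolding ab[symmetric] by (simp add: pact_add pact_mult p Dz linear_0[OF pact_linear])
    have "degree g \<le> degree p" unfolding g_def by (rule dvd_imp_degree_le) (use p in auto)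
    then have dg: "degree g < ?n" using \<open>\<not> ?n \<le> degree p\<close> by simp
    obtain h where h: "D = g * h" unfolding g_def by (metis dvdE gcd_dvd2)
    have "h \<noteq> 0" "g \<noteq> 0" using h D0 by auto
    then have "degree h \<noteq> 0" using h degD dg degree_mult_eq[of g h] by auto
    then have "\<not> is_unit h" using is_unit_iff_degree[OF \<open>h \<noteq> 0\<close>] by simp
    then obtain q where q: "q dvd h" "prime q" using prime_divisor_exists[OF \<open>h \<noteq> 0\<close>] by blast
    then obtain h' where h': "h = q * h'" by blast
    have "q \<in> prime_factors D" using q D0 h by (simp add: in_prime_factors_iff)
    moreover have "D div q = h' * g" using h h' q by (auto simp: mult_ac)
    then have "\<xi> \<in> V q" by (simp add: V_def pact_mult pg linear_0[OF pact_linear])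
    ultimately show False using \<xi>[of "V q"] by blast
  qed
  have "S = UNIV" if S: "subspace S" "\<xi> \<in> S" "\<forall>v\<in>S. B *v v \<in> S" for S
  proof (rule ccontr)
    assume ne: "S \<noteq> UNIV"
    obtain e :: "nat \<Rightarrow> 'n" where e: "bij_betw e {..<?n} UNIV"
      using ex_bij_betw_nat_finite[of "UNIV :: 'n set"] by (auto simp: atLeast0LessThan)
    have B\<xi>: "mat_power B k *v \<xi> \<in> S" for k
      by (induction k) (use S in \<open>auto simp: mat_power_Suc matrix_vector_mul_assoc[symmetric]\<close>)
    \<comment> \<open>All iterates lie in \<open>S\<close>. If \<open>S\<close> is proper,
      \<open>T\<close> is not injective, and a kernel vector lists the coefficients of an
      annihilating polynomial of degree below \<open>n\<close>.\<close>
    define T where "T = (\<lambda>c::real^'n. \<Sum>k<?n. c $ e k *\<^sub>R (mat_power B k *v \<xi>))"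
    have lin: "linear T" unfolding T_def
      by (rule linearI) (simp_all add: scaleR_add_left sum.distrib scaleR_sum_right)
    have "range T \<subseteq> S" unfolding T_def
      by (auto intro!: subspace_sum[OF S(1)] subspace_mul[OF S(1)] B\<xi>)
    then have "\<not> surj T" using ne by auto
    then have "\<not> inj T" using linear_injective_imp_surjective[OF lin] by blast
    then obtain c where c: "T c = 0" "c \<noteq> 0" using linear_injective_0[OF lin] by blast
    define p where "p = (\<Sum>k<?n. monom (c $ e k) k)"
    have "pact B p \<xi> = 0" using c by (simp add: p_def T_def pact_sum pact_monom)
    moreover have "p \<noteq> 0"
    proof
      assume "p = 0"
      have "c $ i = 0" for i
      proof -
        obtain k where k: "k < ?n" "e k = i" using e by (metis bij_betw_iff_bijections UNIV_I lessThan_iff)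
        have "coeff p k = (\<Sum>j<?n. if j = k then c $ e k else 0)"
          unfolding p_def coeff_sum by (rule sum.cong) auto
        then show ?thesis using k \<open>p = 0\<close> by simp
      qed
      then show False using c by (simp add: vec_eq_iff)
    qed
    moreover have "degree p < ?n"
      unfolding p_def by (rule degree_sum_less) (auto intro: le_less_trans[OF degree_monom_le])
    ultimately show False using ann[of p] by simp
  qed
  then show ?thesis by (intro that[of \<xi>]) (auto simp: cyclic_def)
qed

lemma subspace_all_axes:
  fixes S :: "(real^'n) set"
  assumes "subspace S" "\<And>i. axis i 1 \<in> S"
  shows "S = UNIV"
proof -
  have "v \<in> S" for v :: "real^'n"
  proof -
    have "v = (\<Sum>i\<in>UNIV. v $ i *\<^sub>R axis i 1)"
      by (simp add: vec_eq_iff axis_def if_distrib[of "\<lambda>x. _ * x"] cong: if_cong)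
    also have "\<dots> \<in> S" by (intro subspace_sum[OF assms(1)] subspace_mul[OF assms(1)] assms(2))
    finally show ?thesis .
  qed
  then show ?thesis by auto
qed

text \<open>The kernel of a matrix commuting with \<open>B\<close> is invariant under
  \<open>B\<close>.\<close>

lemma cyclic_commutant_eq_0:
  fixes B X :: "real^'n^'n"
  assumes c: "cyclic B \<xi>" and X: "X ** B = B ** X" "X *v \<xi> = 0"
  shows "X = 0"
proof -
  have "{v. X *v v = 0} = UNIV"
  proof (rule c[unfolded cyclic_def, rule_format])
    show "subspace {v. X *v v = 0}" by (rule linear_subspace_kernel[OF matrix_vector_mul_linear])
    fix v assume "v \<in> {v. X *v v = 0}"
    then show "B *v v \<in> {v. X *v v = 0}" using X(1) by (simp add: matrix_vector_mul_assoc) (metis matrix_vector_mul_assoc matrix_vector_mult_0_right)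
  qed (use X in simp)
  then show ?thesis by (subst matrix_eq) auto
qed

lemma mat_power_commute: "mat_power B j ** mat_power B k = mat_power B k ** mat_power B j"
  by (simp add: mat_power_add[symmetric] add.commute)

lemma mat_power_commute1: "mat_power B k ** B = B ** mat_power B k"
  by (metis mat_power_Suc mat_power_Suc2)

text \<open>The difference of the two sides commutes with \<open>B\<close>, so it vanishes once it
  kills the cyclic vector.\<close>

lemma char_coeffs_cyclicI:
  fixes B :: "real^'n^'n"
  assumes c: "cyclic B \<xi>"
    and h: "mat_power B CARD('n) *v \<xi> = (\<Sum>i=1..CARD('n). f i *\<^sub>R (mat_power B (CARD('n) - i) *v \<xi>))"
  shows "char_coeffs f B"
proof -
  have "mat_power B CARD('n) - (\<Sum>i=1..CARD('n). f i *\<^sub>R mat_power B (CARD('n) - i)) = 0"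
    by (rule cyclic_commutant_eq_0[OF c])
       (simp_all add: matrix_diff_rdistrib matrix_diff_ldistrib matrix_sum_rdistrib matrix_sum_ldistrib
          matrix_scaleR_left matrix_scaleR_right mat_power_commute1 matrix_vector_mult_diff_rdistrib
          mv_sum_left mv_scaleR_left h)
  then show ?thesis by (simp add: char_coeffs_def)
qed

lemma char_coeffs_mv:
  fixes B :: "real^'n^'n"
  shows "char_coeffs f B \<Longrightarrow>
    mat_power B CARD('n) *v v = (\<Sum>i=1..CARD('n). f i *\<^sub>R (mat_power B (CARD('n) - i) *v v))"
  by (simp add: char_coeffs_def mv_sum_left mv_scaleR_left)

section \<open>Krylov bases\<close>

text \<open>The columns are the iterates of \<open>\<xi>\<close>. The index type has no order, so
  the exponents \<open>0\<close>, ..., \<open>n - 1\<close> are distributed by an arbitrary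
  bijection \<open>idx\<close>.\<close>

definition krylov :: "('n::finite \<Rightarrow> nat) \<Rightarrow> real^'n^'n \<Rightarrow> real^'n \<Rightarrow> real^'n^'n" where
  "krylov idx B \<xi> = (\<chi> i j. (mat_power B (idx j) *v \<xi>) $ i)"

lemma krylov_mv: "krylov idx B \<xi> *v c = (\<Sum>j\<in>UNIV. c $ j *\<^sub>R (mat_power B (idx j) *v \<xi>))"
  by (simp add: krylov_def vec_eq_iff matrix_vector_mult_def mult.commute)

lemma krylov_axis: "krylov idx B \<xi> *v axis j 1 = mat_power B (idx j) *v \<xi>"
proof -
  have "krylov idx B \<xi> *v axis j 1 = (\<Sum>l\<in>UNIV. if l = j then mat_power B (idx j) *v \<xi> else 0)"
    unfolding krylov_mv by (rule sum.cong) (auto simp: axis_def)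
  then show ?thesis by simp
qed

text \<open>By the Cayley-Hamilton identity the span of the first \<open>n\<close> iterates is
  invariant, hence everything.\<close>

lemma cyclic_krylov:
  fixes B :: "real^'n^'n"
  assumes idx: "bij_betw idx (UNIV :: 'n set) {..<CARD('n)}" and c: "cyclic B \<xi>" and ch: "char_coeffs f B"
  shows "det (krylov idx B \<xi>) \<noteq> 0"
proof -
  let ?R = "range ((*v) (krylov idx B \<xi>))"
  have sub: "subspace ?R" by (rule linear_subspace_image[OF matrix_vector_mul_linear subspace_UNIV])
  have pw: "mat_power B k *v \<xi> \<in> ?R" if k: "k < CARD('n)" for k
  proof -
    obtain j where "idx j = k" using idx k by (metis bij_betw_iff_bijections lessThan_iff)
    then show ?thesis using krylov_axis[of idx B \<xi> j] by (metis rangeI)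
  qed
  have pn: "mat_power B k *v \<xi> \<in> ?R" if k: "k \<le> CARD('n)" for k
  proof (cases "k = CARD('n)")
    case True
    show ?thesis unfolding True char_coeffs_mv[OF ch]
      by (intro subspace_sum[OF sub] subspace_mul[OF sub] pw) auto
  qed (use k pw in auto)
  have "?R = UNIV"
  proof (rule c[unfolded cyclic_def, rule_format, OF sub])
    show "\<xi> \<in> ?R" using pn[of 0] by simp
    fix v assume "v \<in> ?R"
    then obtain x where "v = krylov idx B \<xi> *v x" by auto
    then have "B *v v = (\<Sum>j\<in>UNIV. x $ j *\<^sub>R (mat_power B (Suc (idx j)) *v \<xi>))"
      by (simp add: krylov_mv mv_sum_right matrix_vector_mult_scaleR mat_power_Suc matrix_vector_mul_assoc)
    also have "\<dots> \<in> ?R"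
    proof (intro subspace_sum[OF sub] subspace_mul[OF sub] pn)
      fix j :: 'n
      have "idx j \<in> {..<CARD('n)}" using idx by (auto dest: bij_betw_imp_surj_on)
      then show "Suc (idx j) \<le> CARD('n)" by simp
    qed
    finally show "B *v v \<in> ?R" .
  qed
  then have "surj ((*v) (krylov idx B \<xi>))" .
  then show ?thesis by (metis full_rank_surjective det_eq_0_rank less_irrefl)
qed

lemma krylov_cyclic:
  fixes B :: "real^'n^'n"
  assumes "det (krylov idx B \<xi>) \<noteq> 0"
  shows "cyclic B \<xi>"
  unfolding cyclic_def
proof (intro allI impI)
  fix S :: "(real^'n) set"
  assume S: "subspace S" "\<xi> \<in> S" "\<forall>v\<in>S. B *v v \<in> S"
  have p: "mat_power B k *v \<xi> \<in> S" for k
    by (induction k) (use S in \<open>auto simp: mat_power_Suc matrix_vector_mul_assoc[symmetric]\<close>)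
  have "invertible (krylov idx B \<xi>)" using assms by (simp add: invertible_det_nz)
  then obtain R where R: "krylov idx B \<xi> ** R = mat 1" unfolding invertible_def by blast
  have "v \<in> S" for v
  proof -
    have "v = krylov idx B \<xi> *v (R *v v)" by (simp add: matrix_vector_mul_assoc R)
    also have "\<dots> \<in> S" unfolding krylov_mv
      by (intro subspace_sum[OF S(1)] subspace_mul[OF S(1)] p)
    finally show ?thesis .
  qed
  then show "S = UNIV" by auto
qed

text \<open>Coordinates with respect to the Krylov basis, written by Cramer's rule so that their
  analytic dependence on \<open>B\<close> and \<open>v\<close> is visible.\<close>

definition kcoord :: "('n::finite \<Rightarrow> nat) \<Rightarrow> real^'n^'n \<Rightarrow> real^'n \<Rightarrow> real^'n \<Rightarrow> real^'n" where
  "kcoord idx B \<xi> v = (\<chi> j. det (\<chi> i l. if l = j then v $ i else krylov idx B \<xi> $ i $ l) / det (krylov idx B \<xi>))"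

lemma kcoord:
  assumes "det (krylov idx B \<xi>) \<noteq> 0"
  shows "krylov idx B \<xi> *v kcoord idx B \<xi> v = v" "kcoord idx B \<xi> (krylov idx B \<xi> *v c) = c"
  using cramer[OF assms] unfolding kcoord_def by metis+

lemma linear_kcoord:
  assumes d: "det (krylov idx B \<xi>) \<noteq> 0"
  shows "linear (kcoord idx B \<xi>)"
proof (rule linearI)
  fix x y r
  have "kcoord idx B \<xi> (krylov idx B \<xi> *v (kcoord idx B \<xi> x + kcoord idx B \<xi> y)) = kcoord idx B \<xi> x + kcoord idx B \<xi> y"
    by (rule kcoord(2)[OF d])
  then show "kcoord idx B \<xi> (x + y) = kcoord idx B \<xi> x + kcoord idx B \<xi> y"
    by (simp add: matrix_vector_right_distrib kcoord(1)[OF d])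
  have "kcoord idx B \<xi> (krylov idx B \<xi> *v (r *\<^sub>R kcoord idx B \<xi> x)) = r *\<^sub>R kcoord idx B \<xi> x"
    by (rule kcoord(2)[OF d])
  then show "kcoord idx B \<xi> (r *\<^sub>R x) = r *\<^sub>R kcoord idx B \<xi> x"
    by (simp add: matrix_vector_mult_scaleR kcoord(1)[OF d])
qed

text \<open>\<open>transfer_pol idx B \<xi> C v = q C\<close> for the polynomial \<open>q\<close> with \<open>v = q B \<xi>\<close>.\<close>

definition transfer_pol :: "('n::finite \<Rightarrow> nat) \<Rightarrow> real^'n^'n \<Rightarrow> real^'n \<Rightarrow> real^'n^'n \<Rightarrow> real^'n \<Rightarrow> real^'n^'n" where
  "transfer_pol idx B \<xi> C v = (\<Sum>j\<in>UNIV. kcoord idx B \<xi> v $ j *\<^sub>R mat_power C (idx j))"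

context
  fixes idx :: "'n::finite \<Rightarrow> nat" and B C :: "real^'n^'n" and \<xi> :: "real^'n" and f :: "nat \<Rightarrow> real"
  assumes idx: "bij_betw idx UNIV {..<CARD('n)}" and d: "det (krylov idx B \<xi>) \<noteq> 0"
    and chB: "char_coeffs f B" and chC: "char_coeffs f C"
begin

lemma linear_transfer_pol: "linear (transfer_pol idx B \<xi> C)"
  unfolding transfer_pol_def
proof (intro linear_compose_sum ballI)
  fix j
  show "linear (\<lambda>v. kcoord idx B \<xi> v $ j *\<^sub>R mat_power C (idx j))"
    by (rule linearI) (simp_all add: linear_add[OF linear_kcoord[OF d]] linear_scale[OF linear_kcoord[OF d]] scaleR_add_left)
qed

lemma transfer_pol_power: "transfer_pol idx B \<xi> C (mat_power B k *v \<xi>) = mat_power C k" if k: "k < CARD('n)"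
proof -
  obtain j where j: "idx j = k" using idx k by (metis bij_betw_iff_bijections lessThan_iff)
  have "kcoord idx B \<xi> (mat_power B k *v \<xi>) = axis j 1"
    using kcoord(2)[OF d, of "axis j 1"] by (simp add: krylov_axis j)
  then have "transfer_pol idx B \<xi> C (mat_power B k *v \<xi>) = (\<Sum>l\<in>UNIV. if l = j then mat_power C k else 0)"
    unfolding transfer_pol_def by (intro sum.cong) (auto simp: axis_def j)
  then show ?thesis by simp
qed

text \<open>At \<open>k = n\<close> the iterate is expanded by the identity for \<open>B\<close> and
  reassembled by the one for \<open>C\<close>: both matrices must have the same coefficients
  \<open>f\<close>. This boundary case makes the map intertwine \<open>B\<close> and
  \<open>C\<close>.\<close>

lemma transfer_pol_power_n: "transfer_pol idx B \<xi> C (mat_power B k *v \<xi>) = mat_power C k" if k: "k \<le> CARD('n)"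
proof (cases "k = CARD('n)")
  case True
  have "transfer_pol idx B \<xi> C (mat_power B k *v \<xi>) =
      (\<Sum>i=1..CARD('n). f i *\<^sub>R transfer_pol idx B \<xi> C (mat_power B (CARD('n) - i) *v \<xi>))"
    unfolding True char_coeffs_mv[OF chB]
    by (simp add: linear_sum[OF linear_transfer_pol] linear_scale[OF linear_transfer_pol])
  also have "\<dots> = (\<Sum>i=1..CARD('n). f i *\<^sub>R mat_power C (CARD('n) - i))"
    by (rule sum.cong) (auto simp: transfer_pol_power)
  also have "\<dots> = mat_power C k" using chC by (simp add: char_coeffs_def True)
  finally show ?thesis .
qed (use k in \<open>simp add: transfer_pol_power\<close>)

lemma transfer_pol_unit: "transfer_pol idx B \<xi> C \<xi> = mat 1"
  using transfer_pol_power[of 0] by simp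

lemma transfer_pol_mult: "transfer_pol idx B \<xi> C (B *v v) = C ** transfer_pol idx B \<xi> C v"
proof -
  define x where "x = kcoord idx B \<xi> v"
  have v: "v = (\<Sum>j\<in>UNIV. x $ j *\<^sub>R (mat_power B (idx j) *v \<xi>))"
    using kcoord(1)[OF d, of v] by (simp add: krylov_mv x_def)
  have le: "Suc (idx j) \<le> CARD('n)" for j
    using idx by (auto dest!: bij_betw_imp_surj_on simp: Suc_le_eq)
  have "B *v v = (\<Sum>j\<in>UNIV. x $ j *\<^sub>R (mat_power B (Suc (idx j)) *v \<xi>))"
    by (subst v) (simp add: mv_sum_right matrix_vector_mult_scaleR mat_power_Suc matrix_vector_mul_assoc)
  then have "transfer_pol idx B \<xi> C (B *v v) = (\<Sum>j\<in>UNIV. x $ j *\<^sub>R mat_power C (Suc (idx j)))"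
    by (simp add: linear_sum[OF linear_transfer_pol] linear_scale[OF linear_transfer_pol] transfer_pol_power_n[OF le])
  also have "\<dots> = C ** transfer_pol idx B \<xi> C v"
    by (simp add: transfer_pol_def x_def matrix_sum_ldistrib matrix_scaleR_right mat_power_Suc)
  finally show ?thesis .
qed

end

lemma transfer_pol_commute:
  "transfer_pol idx B \<xi> C v ** transfer_pol idx B \<xi> C w = transfer_pol idx B \<xi> C w ** transfer_pol idx B \<xi> C v"
proof -
  have "transfer_pol idx B \<xi> C v ** transfer_pol idx B \<xi> C w =
      (\<Sum>j\<in>UNIV. \<Sum>k\<in>UNIV. (kcoord idx B \<xi> v $ j * kcoord idx B \<xi> w $ k) *\<^sub>R (mat_power C (idx j) ** mat_power C (idx k)))" for v w
    unfolding transfer_pol_def matrix_sum_rdistrib matrix_sum_ldistrib matrix_scaleR_left matrix_scaleR_right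
      scaleR_sum_right scaleR_scaleR
    by (subst sum.swap) (simp add: mult.commute)
  note e = this
  show ?thesis
    unfolding e by (subst sum.swap) (simp add: mult.commute mat_power_commute)
qed

lemma transfer_pol_commute1: "transfer_pol idx B \<xi> C v ** C = C ** transfer_pol idx B \<xi> C v"
  by (simp add: transfer_pol_def matrix_sum_ldistrib matrix_sum_rdistrib matrix_scaleR_left matrix_scaleR_right
      mat_power_commute1)

section \<open>Pointwise algebra of the Nijenhuis condition\<close>

text \<open>The torsion of a field with value \<open>B\<close> and derivative \<open>D\<close> at a
  point, on constant vector fields; for these \<open>[L v, w] = - D w *v v\<close>.\<close>

definition nij_alg :: "real^'n^'n \<Rightarrow> (real^'n \<Rightarrow> real^'n^'n) \<Rightarrow> real^'n \<Rightarrow> real^'n \<Rightarrow> real^'n" where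
  "nij_alg B D v w = B *v (D w *v v) - B *v (D v *v w) + D (B *v v) *v w - D (B *v w) *v v"

text \<open>If a matrix-valued one-form \<open>A\<close> with \<open>A \<xi> = 1\<close> intertwines the operator \<open>B\<close> with the matrix
  \<open>C\<close>, then the vanishing of the torsion of \<open>B\<close> gives the integrability of the system
  \<open>dH = A \<partial>\<^sub>\<xi> H\<close>. Here \<open>D\<close>, \<open>E\<close> and \<open>a\<close> are the derivatives of \<open>B\<close>, \<open>C\<close> and \<open>A\<close>.\<close>

lemma integrability_alg:
  fixes B C :: "real^'n^'n" and D E A :: "real^'n \<Rightarrow> real^'n^'n" and a :: "real^'n \<Rightarrow> real^'n \<Rightarrow> real^'n^'n"
  assumes cyc: "cyclic B \<xi>" and N: "\<And>v w. nij_alg B D v w = 0"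
    and linD: "linear D" and linE: "linear E" and linA: "linear A"
    and lina: "\<And>w. linear (a w)" "\<And>v. linear (\<lambda>w. a w v)"
    and A1: "A \<xi> = mat 1" and a1: "\<And>w. a w \<xi> = 0"
    and AB: "\<And>v. A (B *v v) = C ** A v"
    and aB: "\<And>v w. a w (B *v v) + A (D w *v v) = E w ** A v + C ** a w v"
    and AC: "\<And>v. A v ** C = C ** A v" and AA: "\<And>v w. A v ** A w = A w ** A v"
    and H: "\<And>v w. (E (B *v v) - C ** E v) ** A w = (E (B *v w) - C ** E w) ** A v"
  shows "a v w - a w v = A v ** a \<xi> w - A w ** a \<xi> v"
proof -
  note lin = linear_add[OF linA] linear_diff[OF linA] linear_scale[OF linA]
    linear_add[OF lina(1)] linear_diff[OF lina(1)] linear_scale[OF lina(1)]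
    linear_add[OF lina(2)] linear_diff[OF lina(2)] linear_scale[OF lina(2)]
    linear_add[OF linD] linear_diff[OF linD] linear_scale[OF linD]
    linear_add[OF linE] linear_diff[OF linE] linear_scale[OF linE]
  note dist = matrix_add_rdistrib matrix_add_ldistrib matrix_diff_rdistrib matrix_diff_ldistrib
    matrix_vector_mult_add_rdistrib matrix_vector_mult_diff_rdistrib matrix_vector_right_distrib
    matrix_vector_mult_diff_distrib
  have aB': "a w (B *v v) = E w ** A v + C ** a w v - A (D w *v v)" for v w
    using aB[of w v] by (simp add: algebra_simps)
  \<comment> \<open>\<open>\<Omega>\<close> is the defect of integrability and \<open>X\<close> its
    failure to intertwine \<open>B\<close> and \<open>C\<close> in the first argument. Both vanish
    on \<open>\<xi>\<close>; cyclicity propagates this first to \<open>X\<close> through its second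
    argument, then to \<open>\<Omega>\<close> through its first.\<close>
  define \<Omega> where "\<Omega> = (\<lambda>v w. a v w - a w v - A v ** a \<xi> w + A w ** a \<xi> v)"
  define X where "X = (\<lambda>v w. \<Omega> (B *v v) w - C ** \<Omega> v w)"
  have linO: "linear (\<lambda>v. \<Omega> v w)" "linear (\<Omega> v)" for v w
    unfolding \<Omega>_def by (rule linearI; simp add: lin dist matrix_scaleR_left matrix_scaleR_right algebra_simps)+
  have linX: "linear (X v)" for v
    unfolding X_def using linear_add[OF linO(2)] linear_scale[OF linO(2)]
    by (intro linearI) (simp_all add: dist matrix_scaleR_right algebra_simps)
  have O1: "\<Omega> v \<xi> = 0" "\<Omega> \<xi> v = 0" for v
    by (simp_all add: \<Omega>_def A1 a1)
  have CA: "C ** (A w ** Z) = A w ** (C ** Z)" for w Z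
    by (simp add: matrix_mul_assoc AC)
  have X: "X v w = a (B *v v) w - C ** a v w - E w ** A v + A (D w *v v) + A w ** (E \<xi> ** A v) - A w ** A (D \<xi> *v v)" for v w
    unfolding X_def \<Omega>_def AB aB' dist by (simp add: CA matrix_mul_assoc[symmetric])
  \<comment> \<open>What remains after expansion is the image under \<open>A\<close> of the torsion
    identity and the hypothesis \<open>H\<close>; all other terms cancel because the values of
    \<open>A\<close> commute with \<open>C\<close>.\<close>
  have Xstep: "X v (B *v w) = C ** X v w" for v w
  proof -
    have n: "D (B *v v) *v w - B *v (D v *v w) = D (B *v w) *v v - B *v (D w *v v)"
      using N[of v w] by (simp add: nij_alg_def algebra_simps)
    have n': "A (D (B *v v) *v w) - C ** A (D v *v w) = A (D (B *v w) *v v) - C ** A (D w *v v)"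
      using arg_cong[OF n, of A] by (simp add: lin AB)
    have h: "E (B *v v) ** A w - C ** (E v ** A w) = E (B *v w) ** A v - C ** (E w ** A v)"
      using H[of v w] by (simp add: dist matrix_mul_assoc)
    have "X v (B *v w) - C ** X v w =
        (E (B *v v) ** A w - C ** (E v ** A w)) - (E (B *v w) ** A v - C ** (E w ** A v))
        - (A (D (B *v v) *v w) - C ** A (D v *v w)) + (A (D (B *v w) *v v) - C ** A (D w *v v))"
      unfolding X AB aB' dist by (simp add: CA matrix_mul_assoc[symmetric])
    then show ?thesis using h n' by simp
  qed
  have X0: "X v w = 0" for v w
  proof -
    have "{w. X v w = 0} = UNIV"
    proof (rule cyc[unfolded cyclic_def, rule_format])
      show "subspace {w. X v w = 0}" by (rule linear_subspace_kernel[OF linX])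
      show "\<xi> \<in> {w. X v w = 0}" by (simp add: X_def O1)
      fix w assume "w \<in> {w. X v w = 0}"
      then show "B *v w \<in> {w. X v w = 0}" by (simp add: Xstep)
    qed
    then show ?thesis by auto
  qed
  have "{v. \<Omega> v w = 0} = UNIV" for w
  proof (rule cyc[unfolded cyclic_def, rule_format])
    show "subspace {v. \<Omega> v w = 0}" by (rule linear_subspace_kernel[OF linO(1)])
    show "\<xi> \<in> {v. \<Omega> v w = 0}" by (simp add: O1)
    fix v assume "v \<in> {v. \<Omega> v w = 0}"
    then show "B *v v \<in> {v. \<Omega> v w = 0}" using X0[of v w] by (simp add: X_def)
  qed
  then have "\<Omega> v w = 0" by auto
  then show ?thesis by (simp add: \<Omega>_def algebra_simps)
qed

text \<open>The derivative of \<open>B\<^sup>k\<close> in the direction \<open>X\<close>.\<close>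

primrec dpow :: "real^'n^'n \<Rightarrow> nat \<Rightarrow> real^'n^'n \<Rightarrow> real^'n^'n" where
  "dpow B 0 X = 0"
| "dpow B (Suc k) X = B ** dpow B k X + X ** mat_power B k"

lemma dpow_mult: "dpow B k (B ** X) = B ** dpow B k X"
  by (induction k) (simp_all add: matrix_add_ldistrib matrix_mul_assoc)

lemma dpow_diff: "dpow B k (X - Y) = dpow B k X - dpow B k Y"
  by (induction k) (simp_all add: matrix_diff_ldistrib matrix_diff_rdistrib)

lemma dpow_commutator: "dpow B k (X ** B - B ** X) = X ** mat_power B k - mat_power B k ** X"
proof (induction k)
  case (Suc k)
  then show ?case
    by (simp add: matrix_diff_ldistrib matrix_diff_rdistrib mat_power_Suc matrix_mul_assoc)
qed simp

text \<open>Differentiating the Cayley-Hamilton identity of a Nijenhuis operator yields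
  \<open>B\<^sup>* df\<^sub>i = f\<^sub>i df\<^sub>1 + df\<^sub>i\<^sub>+\<^sub>1\<close>: the operator \<open>\<Phi>\<close> below kills commutators with \<open>B\<close>, and
  vanishing torsion says that \<open>D (B v) - B (D v)\<close> is such a commutator.\<close>

lemma char_coeffs_derivative:
  fixes B :: "real^'n^'n" and D :: "real^'n \<Rightarrow> real^'n^'n" and df :: "nat \<Rightarrow> real^'n \<Rightarrow> real"
  assumes gl: "gl_regular B" and ch: "char_coeffs f B" and N: "\<And>v w. nij_alg B D v w = 0" and linD: "linear D"
    and dch: "\<And>v. dpow B CARD('n) (D v) =
      (\<Sum>i=1..CARD('n). df i v *\<^sub>R mat_power B (CARD('n) - i) + f i *\<^sub>R dpow B (CARD('n) - i) (D v))"
    and i: "i \<in> {1..CARD('n)}"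
  shows "df i (B *v v) = f i * df 1 v + (if i < CARD('n) then df (i + 1) v else 0)"
proof -
  let ?n = "CARD('n)"
  \<comment> \<open>The derivative of the characteristic polynomial at \<open>B\<close> in direction
    \<open>X\<close>, with its coefficients frozen; on \<open>D v\<close> it must balance the
    variation of the coefficients.\<close>
  define \<Phi> where "\<Phi> = (\<lambda>X. dpow B ?n X - (\<Sum>i=1..?n. f i *\<^sub>R dpow B (?n - i) X))"
  have P1: "\<Phi> (D v) = (\<Sum>i=1..?n. df i v *\<^sub>R mat_power B (?n - i))" for v
    by (simp add: \<Phi>_def dch sum.distrib)
  have P2: "\<Phi> (B ** X) = B ** \<Phi> X" for X
    by (simp add: \<Phi>_def dpow_mult matrix_diff_ldistrib matrix_sum_ldistrib matrix_scaleR_right)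
  have P3: "\<Phi> (X - Y) = \<Phi> X - \<Phi> Y" for X Y
    by (simp add: \<Phi>_def dpow_diff scaleR_diff_right sum_subtractf)
  have P4: "\<Phi> (X ** B - B ** X) = 0" for X
  proof -
    have "\<Phi> (X ** B - B ** X) = X ** (mat_power B ?n - (\<Sum>i=1..?n. f i *\<^sub>R mat_power B (?n - i)))
        - (mat_power B ?n - (\<Sum>i=1..?n. f i *\<^sub>R mat_power B (?n - i))) ** X"
      by (simp add: \<Phi>_def dpow_commutator scaleR_diff_right sum_subtractf matrix_diff_ldistrib matrix_diff_rdistrib
          matrix_sum_ldistrib matrix_sum_rdistrib matrix_scaleR_left matrix_scaleR_right)
    then show ?thesis using ch by (simp add: char_coeffs_def)
  qed
  \<comment> \<open>The matrix of \<open>w \<mapsto> D w *v v\<close>, which exchanges the roles of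
    direction and argument. With it, vanishing torsion becomes the matrix equation
    \<open>D (B *v v) - B ** D v = S ** B - B ** S\<close>.\<close>
  define S where "S = (\<chi> i j. (D (axis j 1) *v v) $ i)"
  have Sw: "S *v w = D w *v v" for w
  proof -
    have "w = (\<Sum>j\<in>UNIV. w $ j *\<^sub>R axis j 1)"
      by (simp add: vec_eq_iff axis_def if_distrib[of "\<lambda>x. _ * x"] cong: if_cong)
    then have "D w = (\<Sum>j\<in>UNIV. w $ j *\<^sub>R D (axis j 1))"
      by (metis (no_types, lifting) linear_scale[OF linD] linear_sum[OF linD] sum.cong)
    then have "D w *v v = (\<Sum>j\<in>UNIV. w $ j *\<^sub>R (D (axis j 1) *v v))"
      by (simp add: mv_sum_left mv_scaleR_left)
    moreover have "(S *v w) $ i = (\<Sum>j\<in>UNIV. S $ i $ j * w $ j)" for i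
      by (simp add: matrix_vector_mult_def)
    ultimately show ?thesis by (simp add: vec_eq_iff S_def mult.commute)
  qed
  have "D (B *v v) - B ** D v = S ** B - B ** S"
  proof (subst matrix_eq, intro allI)
    fix w
    show "(D (B *v v) - B ** D v) *v w = (S ** B - B ** S) *v w"
      using N[of v w]
      by (simp add: nij_alg_def matrix_vector_mult_diff_rdistrib matrix_vector_mul_assoc[symmetric] Sw algebra_simps)
  qed
  then have "\<Phi> (D (B *v v)) = B ** \<Phi> (D v)"
    using P4[of S] by (metis P2 P3 right_minus_eq)
  then have key: "(\<Sum>i=1..?n. df i (B *v v) *\<^sub>R mat_power B (?n - i)) = (\<Sum>i=1..?n. df i v *\<^sub>R mat_power B (Suc (?n - i)))"
    unfolding P1 by (simp add: matrix_sum_ldistrib matrix_scaleR_right mat_power_Suc)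
  define g where "g = (\<lambda>i. f i * df 1 v + (if i < ?n then df (i + 1) v else 0))"
  \<comment> \<open>The term \<open>i = 1\<close> contains \<open>B\<^sup>n\<close> and is rewritten
    by Cayley-Hamilton; the others move down by one index. Independence of the powers then compares
    coefficients.\<close>
  have "(\<Sum>i=1..?n. df i v *\<^sub>R mat_power B (Suc (?n - i))) = df 1 v *\<^sub>R mat_power B ?n + (\<Sum>i=2..?n. df i v *\<^sub>R mat_power B (Suc (?n - i)))"
  proof -
    have "{1..?n} = insert 1 {2..?n}" by (auto simp: Suc_le_eq)
    then show ?thesis by (simp add: Suc_diff_le Suc_leI)
  qed
  also have "(\<Sum>i=2..?n. df i v *\<^sub>R mat_power B (Suc (?n - i))) = (\<Sum>i=1..<?n. df (i + 1) v *\<^sub>R mat_power B (?n - i))"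
    by (rule sum.reindex_bij_witness[where i="\<lambda>i. i + 1" and j="\<lambda>i. i - 1"]) (auto simp: Suc_diff_le)
  also have "\<dots> = (\<Sum>i=1..?n. (if i < ?n then df (i + 1) v else 0) *\<^sub>R mat_power B (?n - i))"
  proof (rule sum.mono_neutral_cong_left)
    show "{1..<?n} \<subseteq> {1..?n}" by auto
  qed auto
  also have "df 1 v *\<^sub>R mat_power B ?n = (\<Sum>i=1..?n. (f i * df 1 v) *\<^sub>R mat_power B (?n - i))"
    using ch by (simp add: char_coeffs_def scaleR_sum_right mult.commute)
  finally have "(\<Sum>i=1..?n. (df i (B *v v) - g i) *\<^sub>R mat_power B (?n - i)) = 0"
    using key by (simp add: g_def scaleR_diff_left scaleR_add_left sum_subtractf sum.distrib)
  moreover have "(\<Sum>i=1..?n. (df i (B *v v) - g i) *\<^sub>R mat_power B (?n - i)) =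
      (\<Sum>k<?n. (df (?n - k) (B *v v) - g (?n - k)) *\<^sub>R mat_power B k)"
    by (rule sum.reindex_bij_witness[where i="\<lambda>i. ?n - i" and j="\<lambda>i. ?n - i"]) auto
  ultimately have "\<forall>k<?n. df (?n - k) (B *v v) - g (?n - k) = 0"
    using gl[unfolded gl_regular_def, rule_format, of "\<lambda>k. df (?n - k) (B *v v) - g (?n - k)"] by auto
  moreover have "?n - i < ?n" "?n - (?n - i) = i" using i by auto
  ultimately have "df i (B *v v) - g i = 0" by metis
  then show ?thesis by (simp add: g_def)
qed

section \<open>Companion matrices\<close>

definition eidx :: "(nat \<Rightarrow> 'n::finite) \<Rightarrow> 'n \<Rightarrow> nat" where
  "eidx e = inv_into {1..CARD('n)} e"

definition comp1_mat :: "(nat \<Rightarrow> 'n::finite) \<Rightarrow> (nat \<Rightarrow> real) \<Rightarrow> real^'n^'n" where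
  "comp1_mat e f = (\<chi> i j. comp1_entry f (eidx e i) (eidx e j))"

definition comp2_mat :: "(nat \<Rightarrow> 'n::finite) \<Rightarrow> (nat \<Rightarrow> real) \<Rightarrow> real^'n^'n" where
  "comp2_mat e f = (\<chi> i j. comp2_entry CARD('n) f (eidx e i) (eidx e j))"

context
  fixes e :: "nat \<Rightarrow> 'n::finite"
  assumes e: "bij_betw e {1..CARD('n)} UNIV"
begin

lemma eidx: "i \<in> {1..CARD('n)} \<Longrightarrow> eidx e (e i) = i" "e (eidx e j) = j" "eidx e j \<in> {1..CARD('n)}"
proof -
  show "i \<in> {1..CARD('n)} \<Longrightarrow> eidx e (e i) = i"
    unfolding eidx_def by (rule inv_into_f_f[OF bij_betw_imp_inj_on[OF e]])
  have "j \<in> e ` {1..CARD('n)}" using bij_betw_imp_surj_on[OF e] by simp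
  then show "e (eidx e j) = j" "eidx e j \<in> {1..CARD('n)}"
    unfolding eidx_def by (rule f_inv_into_f, rule inv_into_into)
qed

lemma e_eq_iff: "i \<in> {1..CARD('n)} \<Longrightarrow> j \<in> {1..CARD('n)} \<Longrightarrow> e i = e j \<longleftrightarrow> i = j"
  using eidx(1) by metis

lemma sum_e: "(\<Sum>j\<in>UNIV. g j) = (\<Sum>i=1..CARD('n). g (e i))"
  by (rule sum.reindex_bij_betw[OF e, symmetric])

lemma vec_eq_e: "(\<And>i. i \<in> {1..CARD('n)} \<Longrightarrow> x $ e i = y $ e i) \<Longrightarrow> x = y"
  by (metis eidx(2,3) vec_eq_iff)

lemma axis_e: "i \<in> {1..CARD('n)} \<Longrightarrow> j \<in> {1..CARD('n)} \<Longrightarrow> axis (e j) 1 $ e i = (if i = j then 1 else 0 :: real)"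
  by (auto simp: axis_def e_eq_iff)

lemma comp1_mv:
  assumes i: "i \<in> {1..CARD('n)}"
  shows "(comp1_mat e f *v v) $ e i = f i * v $ e 1 + (if i < CARD('n) then v $ e (i + 1) else 0)"
proof -
  have "(comp1_mat e f *v v) $ e i = (\<Sum>j=1..CARD('n). comp1_entry f i j * v $ e j)"
    by (simp add: matrix_vector_mult_def sum_e comp1_mat_def eidx(1)[OF i] cong: sum.cong_simp)
      (intro sum.cong refl, simp add: eidx(1))
  also have "\<dots> = (\<Sum>j=1..CARD('n). (if j = 1 then f i * v $ e 1 else 0) + (if j = i + 1 then v $ e (i + 1) else 0))"
    by (intro sum.cong refl) (use i in \<open>auto simp: comp1_entry_def\<close>)
  also have "\<dots> = f i * v $ e 1 + (if i < CARD('n) then v $ e (i + 1) else 0)"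
    unfolding sum.distrib by (auto simp: Suc_le_eq)
  finally show ?thesis .
qed

lemma comp2_mv:
  assumes i: "i \<in> {1..CARD('n)}"
  shows "(comp2_mat e f *v v) $ e i =
    (if i = CARD('n) then (\<Sum>k=1..CARD('n). f (CARD('n) + 1 - k) * v $ e k) else v $ e (i + 1))"
proof -
  have "(comp2_mat e f *v v) $ e i = (\<Sum>j=1..CARD('n). comp2_entry CARD('n) f i j * v $ e j)"
    by (simp add: matrix_vector_mult_def sum_e comp2_mat_def eidx(1)[OF i] cong: sum.cong_simp)
      (intro sum.cong refl, simp add: eidx(1))
  also have "\<dots> = (if i = CARD('n) then (\<Sum>k=1..CARD('n). f (CARD('n) + 1 - k) * v $ e k) else v $ e (i + 1))"
  proof (cases "i = CARD('n)")
    case False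
    have "(\<Sum>j=1..CARD('n). comp2_entry CARD('n) f i j * v $ e j) = (\<Sum>j=1..CARD('n). if j = i + 1 then v $ e (i + 1) else 0)"
      by (intro sum.cong refl) (use False in \<open>auto simp: comp2_entry_def\<close>)
    then show ?thesis using False i by (auto simp: Suc_le_eq)
  qed (simp add: comp2_entry_def)
  finally show ?thesis .
qed

lemma sum_axis_e:
  assumes k: "k \<in> {1..CARD('n)}"
  shows "(\<Sum>i=1..CARD('n). g i *\<^sub>R axis (e i) (1::real)) $ e k = g k"
proof -
  have "(\<Sum>i=1..CARD('n). g i *\<^sub>R axis (e i) (1::real)) $ e k = (\<Sum>i=1..CARD('n). if i = k then g k else 0)"
    unfolding sum_component by (intro sum.cong refl) (use k in \<open>auto simp: axis_e\<close>)
  then show ?thesis using k by simp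
qed

lemma comp1_axis:
  assumes j: "j \<in> {1..CARD('n)}"
  shows "comp1_mat e f *v axis (e j) 1 =
    (if j = 1 then (\<Sum>i=1..CARD('n). f i *\<^sub>R axis (e i) 1) else axis (e (j - 1)) 1)"
proof (rule vec_eq_e)
  note One_nat_def [simp del]
  fix i assume i: "i \<in> {1..CARD('n)}"
  have 1: "1 \<in> {1..CARD('n)}" using j by auto
  show "(comp1_mat e f *v axis (e j) 1) $ e i =
    (if j = 1 then (\<Sum>i=1..CARD('n). f i *\<^sub>R axis (e i) 1) else axis (e (j - 1)) 1) $ e i"
  proof (cases "j = 1")
    case True
    have "f i * axis (e 1) 1 $ e 1 + (if i < CARD('n) then axis (e 1) 1 $ e (i + 1) else 0) = f i"
      using i 1 by (auto simp: axis_e)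
    then show ?thesis unfolding True comp1_mv[OF i] by (simp only: refl if_True sum_axis_e[OF i])
  next
    case False
    then have j': "j - 1 \<in> {1..CARD('n)}" using j by auto
    show ?thesis unfolding comp1_mv[OF i] using False j i
      by (auto simp: axis_e[OF 1 j] axis_e[OF i j'] axis_e[OF _ j])
  qed
qed

text \<open>The matrix sends the axis \<open>j\<close> to the axis \<open>j - 1\<close> for
  \<open>j > 1\<close>, so the last axis generates all others.\<close>

lemma comp1_cyclic: "cyclic (comp1_mat e f) (axis (e CARD('n)) 1)"
  unfolding cyclic_def
proof (intro allI impI)
  fix S :: "(real^'n) set"
  assume S: "subspace S" "axis (e CARD('n)) 1 \<in> S" "\<forall>v\<in>S. comp1_mat e f *v v \<in> S"
  have s: "axis (e (CARD('n) - k)) 1 \<in> S" if "k < CARD('n)" for k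
    using that
  proof (induction k)
    case (Suc k)
    then have "comp1_mat e f *v axis (e (CARD('n) - k)) 1 \<in> S" using S(3) by simp
    moreover have "CARD('n) - k \<in> {1..CARD('n)}" "CARD('n) - k \<noteq> 1" "CARD('n) - k - 1 = CARD('n) - Suc k"
      using Suc.prems by auto
    ultimately show ?case by (simp only: comp1_axis if_False)
  qed (use S in simp)
  show "S = UNIV"
  proof (rule subspace_all_axes[OF S(1)])
    fix j
    show "axis j 1 \<in> S" using s[of "CARD('n) - eidx e j"] eidx(2,3)[of j] by auto
  qed
qed

text \<open>On the cyclic last axis the \<open>k\<close>-th iterate is the axis
  \<open>n - k\<close>, and the \<open>n\<close>-th is the first column, which lists the
  coefficients.\<close>

lemma comp1_char_coeffs: "char_coeffs f (comp1_mat e f)"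
proof (rule char_coeffs_cyclicI[OF comp1_cyclic])
  have p: "mat_power (comp1_mat e f) k *v axis (e CARD('n)) 1 = axis (e (CARD('n) - k)) 1" if "k < CARD('n)" for k
    using that
  proof (induction k)
    case (Suc k)
    then show ?case by (simp add: mat_power_Suc matrix_vector_mul_assoc[symmetric] comp1_axis)
  qed simp
  obtain m where m: "CARD('n) = Suc m" by (metis zero_less_card_finite gr0_implies_Suc)
  have "mat_power (comp1_mat e f) CARD('n) *v axis (e CARD('n)) 1 = comp1_mat e f *v axis (e 1) 1"
    using p[of m] by (simp add: m mat_power_Suc matrix_vector_mul_assoc[symmetric])
  also have "\<dots> = (\<Sum>i=1..CARD('n). f i *\<^sub>R axis (e i) 1)"
    by (subst comp1_axis) (auto simp: Suc_le_eq)
  also have "\<dots> = (\<Sum>i=1..CARD('n). f i *\<^sub>R (mat_power (comp1_mat e f) (CARD('n) - i) *v axis (e CARD('n)) 1))"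
    by (intro sum.cong refl) (subst p, auto)
  finally show "mat_power (comp1_mat e f) CARD('n) *v axis (e CARD('n)) 1 =
      (\<Sum>i=1..CARD('n). f i *\<^sub>R (mat_power (comp1_mat e f) (CARD('n) - i) *v axis (e CARD('n)) 1))" .
qed

lemma comp2_transpose_axis:
  assumes j: "j \<in> {1..CARD('n)}"
  shows "transpose (comp2_mat e f) *v axis (e j) 1 =
    (if j = CARD('n) then (\<Sum>i=1..CARD('n). f (CARD('n) + 1 - i) *\<^sub>R axis (e i) 1) else axis (e (j + 1)) 1)"
proof (rule vec_eq_e)
  fix i assume i: "i \<in> {1..CARD('n)}"
  have "(transpose (comp2_mat e f) *v axis (e j) 1) $ e i = comp2_entry CARD('n) f j i"
  proof -
    have "(transpose (comp2_mat e f) *v axis (e j) 1) $ e i = (\<Sum>k\<in>UNIV. if k = e j then comp2_entry CARD('n) f j i else 0)"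
      unfolding matrix_vector_mult_def vec_lambda_beta
      by (intro sum.cong refl) (auto simp: transpose_def comp2_mat_def axis_def eidx(1)[OF i] eidx(1)[OF j])
    then show ?thesis by simp
  qed
  also have "\<dots> = (if j = CARD('n) then (\<Sum>i=1..CARD('n). f (CARD('n) + 1 - i) *\<^sub>R axis (e i) 1) else axis (e (j + 1)) 1) $ e i"
  proof (cases "j = CARD('n)")
    case True
    then show ?thesis by (simp add: comp2_entry_def sum_axis_e[OF i, of "\<lambda>i. f (CARD('n) + 1 - i)", simplified])
  next
    case False
    then have "j + 1 \<in> {1..CARD('n)}" using j by auto
    then show ?thesis using False i by (auto simp: comp2_entry_def axis_e)
  qed
  finally show "(transpose (comp2_mat e f) *v axis (e j) 1) $ e i =
    (if j = CARD('n) then (\<Sum>i=1..CARD('n). f (CARD('n) + 1 - i) *\<^sub>R axis (e i) 1) else axis (e (j + 1)) 1) $ e i" .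
qed

lemma comp2_transpose_cyclic: "cyclic (transpose (comp2_mat e f)) (axis (e 1) 1)"
  unfolding cyclic_def
proof (intro allI impI)
  fix S :: "(real^'n) set"
  assume S: "subspace S" "axis (e 1) 1 \<in> S" "\<forall>v\<in>S. transpose (comp2_mat e f) *v v \<in> S"
  have s: "axis (e (k + 1)) 1 \<in> S" if "k < CARD('n)" for k
    using that
  proof (induction k)
    case (Suc k)
    then have "transpose (comp2_mat e f) *v axis (e (k + 1)) 1 \<in> S" using S(3) by simp
    then show ?case using Suc.prems by (subst (asm) comp2_transpose_axis) auto
  qed (use S in simp)
  show "S = UNIV"
  proof (rule subspace_all_axes[OF S(1)])
    fix j
    show "axis j 1 \<in> S" using s[of "eidx e j - 1"] eidx(2,3)[of j] by auto
  qed
qed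

lemma mat_power_transpose: "mat_power (transpose (B :: real^'n^'n)) k = transpose (mat_power B k)"
proof (induction k)
  case (Suc k)
  then show ?case by (simp add: mat_power_Suc[of "transpose B"] mat_power_Suc2[of B] matrix_transpose_mul)
qed (simp add: transpose_mat)

text \<open>It is the transpose that shifts the axes cleanly, so the identity is checked there and
  transposed back.\<close>

lemma comp2_char_coeffs: "char_coeffs f (comp2_mat e f)"
proof -
  let ?B = "transpose (comp2_mat e f)"
  have "char_coeffs f ?B"
  proof (rule char_coeffs_cyclicI[OF comp2_transpose_cyclic])
    have p: "mat_power ?B k *v axis (e 1) 1 = axis (e (k + 1)) 1" if "k < CARD('n)" for k
      using that
    proof (induction k)
      case (Suc k)
      then show ?case by (simp add: mat_power_Suc matrix_vector_mul_assoc[symmetric] comp2_transpose_axis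
            del: transpose_matrix_vector)
    qed simp
    obtain m where m: "CARD('n) = Suc m" by (metis zero_less_card_finite gr0_implies_Suc)
    have "mat_power ?B CARD('n) *v axis (e 1) 1 = ?B *v axis (e CARD('n)) 1"
      using p[of m] by (simp add: m mat_power_Suc matrix_vector_mul_assoc[symmetric] del: transpose_matrix_vector)
    also have "\<dots> = (\<Sum>i=1..CARD('n). f (CARD('n) + 1 - i) *\<^sub>R axis (e i) 1)"
      by (subst comp2_transpose_axis) (auto simp: Suc_le_eq)
    also have "\<dots> = (\<Sum>i=1..CARD('n). f i *\<^sub>R axis (e (CARD('n) + 1 - i)) 1)"
      by (rule sum.reindex_bij_witness[where i="\<lambda>i. CARD('n) + 1 - i" and j="\<lambda>i. CARD('n) + 1 - i"]) auto
    also have "\<dots> = (\<Sum>i=1..CARD('n). f i *\<^sub>R (mat_power ?B (CARD('n) - i) *v axis (e 1) 1))"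
      by (intro sum.cong refl) (subst p, auto simp: Suc_diff_le)
    finally show "mat_power ?B CARD('n) *v axis (e 1) 1 =
        (\<Sum>i=1..CARD('n). f i *\<^sub>R (mat_power ?B (CARD('n) - i) *v axis (e 1) 1))" .
  qed
  then have "transpose (mat_power ?B CARD('n)) = transpose (\<Sum>i=1..CARD('n). f i *\<^sub>R mat_power ?B (CARD('n) - i))"
    by (simp add: char_coeffs_def)
  moreover have "transpose (\<Sum>i=1..CARD('n). f i *\<^sub>R mat_power ?B (CARD('n) - i)) =
      (\<Sum>i=1..CARD('n). f i *\<^sub>R transpose (mat_power ?B (CARD('n) - i)))"
    by (simp add: transpose_def vec_eq_iff)
  ultimately show ?thesis by (simp add: char_coeffs_def mat_power_transpose[symmetric] transpose_transpose)
qed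

lemma comp2_axis:
  assumes j: "j \<in> {2..CARD('n)}"
  shows "comp2_mat e f *v axis (e j) 1 = axis (e (j - 1)) 1 + f (CARD('n) + 1 - j) *\<^sub>R axis (e CARD('n)) 1"
proof (rule vec_eq_e)
  note One_nat_def [simp del]
  fix i assume i: "i \<in> {1..CARD('n)}"
  have j0: "j \<in> {1..CARD('n)}" and j1: "j - 1 \<in> {1..CARD('n)}" and n: "CARD('n) \<in> {1..CARD('n)}" using j by auto
  show "(comp2_mat e f *v axis (e j) 1) $ e i = (axis (e (j - 1)) 1 + f (CARD('n) + 1 - j) *\<^sub>R axis (e CARD('n)) 1) $ e i"
  proof (cases "i = CARD('n)")
    case True
    have "(\<Sum>k=1..CARD('n). f (CARD('n) + 1 - k) * axis (e j) 1 $ e k) = (\<Sum>k=1..CARD('n). if k = j then f (CARD('n) + 1 - j) else 0)"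
      by (intro sum.cong refl) (use j0 in \<open>auto simp: axis_e\<close>)
    then have "(comp2_mat e f *v axis (e j) 1) $ e i = f (CARD('n) + 1 - j)"
      unfolding comp2_mv[OF i] using True j0 by simp
    moreover have "axis (e (j - 1)) 1 $ e i = (0::real)" "axis (e CARD('n)) 1 $ e i = (1::real)"
      unfolding axis_e[OF i j1] axis_e[OF i n] using True j by auto
    ultimately show ?thesis by simp
  next
    case False
    then have "i + 1 \<in> {1..CARD('n)}" using i by auto
    then show ?thesis using False i j j0 j1 n by (auto simp: comp2_mv[OF i] axis_e)
  qed
qed

text \<open>The matrix itself also shifts axes downwards, up to a multiple of the last axis, which
  can be subtracted. The same cyclic vector thus serves both companion forms.\<close>

lemma comp2_cyclic: "cyclic (comp2_mat e f) (axis (e CARD('n)) 1)"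
  unfolding cyclic_def
proof (intro allI impI)
  fix S :: "(real^'n) set"
  assume S: "subspace S" "axis (e CARD('n)) 1 \<in> S" "\<forall>v\<in>S. comp2_mat e f *v v \<in> S"
  have s: "axis (e (CARD('n) - k)) 1 \<in> S" if "k < CARD('n)" for k
    using that
  proof (induction k)
    case (Suc k)
    let ?j = "CARD('n) - k"
    have j: "?j \<in> {2..CARD('n)}" using Suc.prems by auto
    have "comp2_mat e f *v axis (e ?j) 1 \<in> S" using S(3) Suc by simp
    then have "(axis (e (?j - 1)) 1 + f (CARD('n) + 1 - ?j) *\<^sub>R axis (e CARD('n)) 1) - f (CARD('n) + 1 - ?j) *\<^sub>R axis (e CARD('n)) 1 \<in> S"
      unfolding comp2_axis[OF j] by (rule subspace_diff[OF S(1) _ subspace_mul[OF S(1) S(2)]])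
    then show ?case by simp
  qed (use S in simp)
  show "S = UNIV"
  proof (rule subspace_all_axes[OF S(1)])
    fix j
    show "axis j 1 \<in> S" using s[of "CARD('n) - eidx e j"] eidx(2,3)[of j] by auto
  qed
qed

section \<open>Torsion of the companion forms\<close>

text \<open>Only the first column varies, with derivative \<open>dF\<close>. The torsion is
  \<open>v\<^sub>1 G(w) - w\<^sub>1 G(v)\<close> with \<open>G(w) = B dF(w) - dF(B w)\<close>, so it
  vanishes iff \<open>G\<close> kills the axes from 2 on; as \<open>B\<close> sends the axis
  \<open>j + 1\<close> to \<open>j\<close>, this is the PDE system.\<close>

lemma comp1_nij_iff:
  fixes D :: "real^'n \<Rightarrow> real^'n^'n" and df :: "nat \<Rightarrow> real^'n \<Rightarrow> real"
  assumes D: "\<And>w v. D w *v v = v $ e 1 *\<^sub>R (\<chi> i. df (eidx e i) w)" and lin: "\<And>i. i \<in> {1..CARD('n)} \<Longrightarrow> linear (df i)"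
  shows "(\<forall>v w. nij_alg (comp1_mat e f) D v w = 0) \<longleftrightarrow>
    (\<forall>j\<in>{1..CARD('n) - 1}. \<forall>i\<in>{1..CARD('n)}. df i (axis (e j) 1) =
      f i * df 1 (axis (e (j + 1)) 1) + (if i < CARD('n) then df (i + 1) (axis (e (j + 1)) 1) else 0))"
proof -
  note One_nat_def [simp del]
  let ?B = "comp1_mat e f"
  define dF where "dF = (\<lambda>w. (\<chi> i. df (eidx e i) w))"
  have dFeq: "(\<chi> i. df (eidx e i) w) = dF w" for w by (simp add: dF_def)
  have ldF: "linear dF"
    unfolding dF_def
    by (rule linearI) (simp_all add: vec_eq_iff linear_add[OF lin[OF eidx(3)]] linear_scale[OF lin[OF eidx(3)]])
  define G where "G = (\<lambda>w. ?B *v dF w - dF (?B *v w))"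
  have lG: "linear G"
    unfolding G_def
    by (rule linearI) (simp_all add: linear_add[OF ldF] linear_scale[OF ldF] matrix_vector_right_distrib
      matrix_vector_mult_scaleR scaleR_diff_right)
  have N: "nij_alg ?B D v w = v $ e 1 *\<^sub>R G w - w $ e 1 *\<^sub>R G v" for v w
    by (simp add: nij_alg_def D dFeq G_def matrix_vector_mult_scaleR scaleR_diff_right)
  have one: "1 \<in> {1..CARD('n)}" by (simp add: One_nat_def Suc_le_eq)
  have "(\<forall>v w. nij_alg ?B D v w = 0) \<longleftrightarrow> (\<forall>k\<in>{2..CARD('n)}. G (axis (e k) 1) = 0)"
  proof
    assume *: "\<forall>v w. nij_alg ?B D v w = 0"
    show "\<forall>k\<in>{2..CARD('n)}. G (axis (e k) 1) = 0"
    proof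
      fix k assume k: "k \<in> {2..CARD('n)}"
      then have "axis (e 1) 1 $ e 1 = (1::real)" "axis (e k) 1 $ e 1 = (0::real)" using one by (auto simp: axis_e)
      then show "G (axis (e k) 1) = 0" using *[rule_format, of "axis (e 1) 1" "axis (e k) 1"] by (simp add: N)
    qed
  next
    assume *: "\<forall>k\<in>{2..CARD('n)}. G (axis (e k) 1) = 0"
    have Gw: "G w = w $ e 1 *\<^sub>R G (axis (e 1) 1)" for w
    proof -
      have w: "w = (\<Sum>i=1..CARD('n). w $ e i *\<^sub>R axis (e i) 1)" by (rule vec_eq_e) (simp only: sum_axis_e)
      have "G w = (\<Sum>i=1..CARD('n). w $ e i *\<^sub>R G (axis (e i) 1))"
        using arg_cong[OF w, of G] by (simp only: linear_sum[OF lG] linear_scale[OF lG])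
      also have "\<dots> = (\<Sum>i\<in>{1}. w $ e i *\<^sub>R G (axis (e i) 1))"
        by (rule sum.mono_neutral_right) (use * one in \<open>auto simp: numeral_2_eq_2 Suc_le_eq\<close>)
      finally show ?thesis by simp
    qed
    show "\<forall>v w. nij_alg ?B D v w = 0"
    proof (intro allI)
      fix v w
      show "nij_alg ?B D v w = 0" unfolding N Gw[of v] Gw[of w] by (simp add: mult.commute)
    qed
  qed
  also have "\<dots> \<longleftrightarrow> (\<forall>j\<in>{1..CARD('n) - 1}. G (axis (e (j + 1)) 1) = 0)"
  proof -
    have "{2..CARD('n)} = (\<lambda>j. j + 1) ` {1..CARD('n) - 1}"
      by (auto simp: image_iff intro!: bexI[of _ "_ - 1"])
    then show ?thesis by (simp only: ball_simps)
  qed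
  also have "\<dots> \<longleftrightarrow> (\<forall>j\<in>{1..CARD('n) - 1}. \<forall>i\<in>{1..CARD('n)}. df i (axis (e j) 1) =
      f i * df 1 (axis (e (j + 1)) 1) + (if i < CARD('n) then df (i + 1) (axis (e (j + 1)) 1) else 0))"
  proof (rule ball_cong[OF refl])
    fix j assume j: "j \<in> {1..CARD('n) - 1}"
    then have j1: "j + 1 \<in> {1..CARD('n)}" by auto
    have dFe: "dF w $ e i = df i w" if "i \<in> {1..CARD('n)}" for i w using that by (simp add: dF_def eidx(1))
    have Ge: "G (axis (e (j + 1)) 1) $ e i = f i * df 1 (axis (e (j + 1)) 1) +
        (if i < CARD('n) then df (i + 1) (axis (e (j + 1)) 1) else 0) - df i (axis (e j) 1)"
      if i: "i \<in> {1..CARD('n)}" for i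
    proof -
      have "?B *v axis (e (j + 1)) 1 = axis (e j) 1" using j by (simp add: comp1_axis[OF j1])
      then have "G (axis (e (j + 1)) 1) $ e i = (?B *v dF (axis (e (j + 1)) 1)) $ e i - dF (axis (e j) 1) $ e i"
        by (simp add: G_def)
      also have "\<dots> = f i * dF (axis (e (j + 1)) 1) $ e 1 + (if i < CARD('n) then dF (axis (e (j + 1)) 1) $ e (i + 1) else 0) - df i (axis (e j) 1)"
        unfolding comp1_mv[OF i] dFe[OF i] ..
      also have "(if i < CARD('n) then dF (axis (e (j + 1)) 1) $ e (i + 1) else 0) = (if i < CARD('n) then df (i + 1) (axis (e (j + 1)) 1) else 0)"
        by (simp add: dFe)
      finally show ?thesis by (simp only: dFe[OF one])
    qed
    have G0: "G (axis (e (j + 1)) 1) = 0 \<longleftrightarrow> (\<forall>i\<in>{1..CARD('n)}. G (axis (e (j + 1)) 1) $ e i = 0)"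
      by (auto intro!: vec_eq_e)
    show "G (axis (e (j + 1)) 1) = 0 \<longleftrightarrow> (\<forall>i\<in>{1..CARD('n)}. df i (axis (e j) 1) =
      f i * df 1 (axis (e (j + 1)) 1) + (if i < CARD('n) then df (i + 1) (axis (e (j + 1)) 1) else 0))"
      unfolding G0 by (rule ball_cong[OF refl]) (simp only: Ge right_minus_eq, rule eq_commute)
  qed
  finally show ?thesis .
qed

text \<open>Only the last row varies, so the torsion lies in the span of the last axis and its image
  under the matrix. For \<open>n \<ge> 2\<close> these are independent, which separates the two
  symmetry conditions.\<close>

lemma comp2_nij_iff:
  fixes D :: "real^'n \<Rightarrow> real^'n^'n" and om :: "real^'n \<Rightarrow> real^'n \<Rightarrow> real"
  assumes n2: "CARD('n) \<ge> 2" and D: "\<And>w v. D w *v v = om w v *\<^sub>R axis (e CARD('n)) 1"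
  shows "(\<forall>v w. nij_alg (comp2_mat e f) D v w = 0) \<longleftrightarrow>
    (\<forall>v w. om v w = om w v) \<and> (\<forall>v w. om (comp2_mat e f *v v) w = om (comp2_mat e f *v w) v)"
proof -
  note One_nat_def [simp del]
  let ?B = "comp2_mat e f" and ?n = "CARD('n)"
  have n: "?n \<in> {1..?n}" "?n \<in> {2..?n}" "?n - 1 \<in> {1..?n}" "?n - 1 \<noteq> ?n" using n2 by auto
  have N: "nij_alg ?B D v w = (om w v - om v w) *\<^sub>R (?B *v axis (e ?n) 1) + (om (?B *v v) w - om (?B *v w) v) *\<^sub>R axis (e ?n) 1" for v w
    by (simp add: nij_alg_def D matrix_vector_mult_scaleR scaleR_diff_left)
  have N1: "nij_alg ?B D v w $ e (?n - 1) = om w v - om v w" for v w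
    unfolding N comp2_axis[OF n(2)] by (simp add: axis_e[OF n(3,1)] axis_e[OF n(3,3)] n(4))
  show ?thesis
  proof
    assume *: "\<forall>v w. nij_alg ?B D v w = 0"
    then have s: "om w v = om v w" for v w using N1[of v w] by simp
    then have "(om (?B *v v) w - om (?B *v w) v) *\<^sub>R axis (e ?n) (1::real) = 0" for v w using *[rule_format, of v w] by (simp add: N)
    moreover have "axis (e ?n) (1::real) \<noteq> 0" by (simp add: axis_eq_0_iff)
    ultimately have "om (?B *v v) w = om (?B *v w) v" for v w by simp
    then show "(\<forall>v w. om v w = om w v) \<and> (\<forall>v w. om (?B *v v) w = om (?B *v w) v)" using s by blast
  next
    assume *: "(\<forall>v w. om v w = om w v) \<and> (\<forall>v w. om (?B *v v) w = om (?B *v w) v)"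
    have "om w v - om v w = 0" "om (?B *v v) w - om (?B *v w) v = 0" for v w
      using *[THEN conjunct1, rule_format, of v w] *[THEN conjunct2, rule_format, of v w] by simp_all
    then show "\<forall>v w. nij_alg ?B D v w = 0" unfolding N by simp
  qed
qed

section \<open>Compatibility of the companion matrices\<close>

text \<open>The differential identities for the \<open>f\<^sub>i\<close> are the rows of this matrix
  equation; the extra integrability condition thereby becomes trivial for the first form.\<close>

lemma comp1_compat:
  fixes B :: "real^'n^'n" and df :: "nat \<Rightarrow> real^'n \<Rightarrow> real"
  assumes df: "\<And>i v. i \<in> {1..CARD('n)} \<Longrightarrow> df i (B *v v) = f i * df 1 v + (if i < CARD('n) then df (i + 1) v else 0)"
    and E: "\<And>w v. E w *v v = v $ e 1 *\<^sub>R (\<chi> i. df (eidx e i) w)"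
  shows "E (B *v v) = comp1_mat e f ** E v"
proof (subst matrix_eq, intro allI)
  fix x
  have one: "1 \<in> {1..CARD('n)}" by (simp add: Suc_le_eq)
  have "(\<chi> i. df (eidx e i) (B *v v)) = comp1_mat e f *v (\<chi> i. df (eidx e i) v)"
  proof (rule vec_eq_e)
    fix i assume i: "i \<in> {1..CARD('n)}"
    show "(\<chi> i. df (eidx e i) (B *v v)) $ e i = (comp1_mat e f *v (\<chi> i. df (eidx e i) v)) $ e i"
      unfolding comp1_mv[OF i] using df[OF i] i eidx(1)[OF one] by (simp add: eidx(1))
  qed
  then show "E (B *v v) *v x = comp1_mat e f ** E v *v x"
    by (simp add: matrix_vector_mul_assoc[symmetric] E matrix_vector_mult_scaleR)
qed

text \<open>Here the two sides need not vanish separately. The identities for the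
  \<open>f\<^sub>i\<close> say that \<open>om\<close> carries \<open>B\<close> in its first slot to
  the companion matrix in its second; by cyclicity every \<open>om v\<close> is
  \<open>om \<xi>\<close> composed with \<open>A v\<close>, and commutativity gives the
  symmetry.\<close>

lemma comp2_compat:
  fixes B :: "real^'n^'n" and df :: "nat \<Rightarrow> real^'n \<Rightarrow> real"
  assumes df: "\<And>i v. i \<in> {1..CARD('n)} \<Longrightarrow> df i (B *v v) = f i * df 1 v + (if i < CARD('n) then df (i + 1) v else 0)"
    and E: "\<And>w v. E w *v v = (\<Sum>k=1..CARD('n). df (CARD('n) + 1 - k) w * v $ e k) *\<^sub>R axis (e CARD('n)) 1"
    and lin: "\<And>i. i \<in> {1..CARD('n)} \<Longrightarrow> linear (df i)"
    and cyc: "cyclic B \<xi>" and linA: "linear A" and A1: "A \<xi> = mat 1"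
    and AB: "\<And>v. A (B *v v) = comp2_mat e f ** A v" and AC: "\<And>v. A v ** comp2_mat e f = comp2_mat e f ** A v"
    and AA: "\<And>v w. A v ** A w = A w ** A v"
  shows "(E (B *v v) - comp2_mat e f ** E v) ** A w = (E (B *v w) - comp2_mat e f ** E w) ** A v"
proof -
  note One_nat_def [simp del]
  let ?C = "comp2_mat e f" and ?n = "CARD('n)"
  define om where "om = (\<lambda>w v. \<Sum>k=1..?n. df (?n + 1 - k) w * v $ e k)"
  have lin': "linear (df (?n + 1 - k))" if "k \<in> {1..?n}" for k by (rule lin) (use that in auto)
  have omL: "linear (\<lambda>w. om w x)" for x
    unfolding om_def
  proof (rule linearI)
    fix y z :: "real^'n" and r :: real
    show "(\<Sum>k=1..?n. df (?n + 1 - k) (y + z) * x $ e k) = (\<Sum>k=1..?n. df (?n + 1 - k) y * x $ e k) + (\<Sum>k=1..?n. df (?n + 1 - k) z * x $ e k)"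
      unfolding sum.distrib[symmetric] by (intro sum.cong refl) (simp only: linear_add[OF lin'] distrib_right)
    show "(\<Sum>k=1..?n. df (?n + 1 - k) (r *\<^sub>R y) * x $ e k) = r *\<^sub>R (\<Sum>k=1..?n. df (?n + 1 - k) y * x $ e k)"
      unfolding scaleR_sum_right by (intro sum.cong refl) (simp only: linear_scale[OF lin'] real_scaleR_def mult.assoc)
  qed
  \<comment> \<open>The summand \<open>k = 1\<close> corresponds to \<open>i = n\<close>, where
    \<open>df (i + 1)\<close> is absent. The shift in the remaining ones matches the superdiagonal
    of the companion matrix, while the terms with \<open>df 1\<close> form its last row.\<close>
  have omC: "om (B *v w) x = om w (?C *v x)" for w x
  proof -
    have n1: "?n \<in> {1..?n}" by (simp add: One_nat_def Suc_le_eq)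
    have "om (B *v w) x = (\<Sum>k=1..?n. f (?n + 1 - k) * df 1 w * x $ e k + (if k \<noteq> 1 then df (?n + 2 - k) w * x $ e k else 0))"
      unfolding om_def
    proof (rule sum.cong[OF refl])
      fix k assume k: "k \<in> {1..?n}"
      then have i: "?n + 1 - k \<in> {1..?n}" by auto
      have 1: "?n + 1 - k < ?n \<longleftrightarrow> k \<noteq> 1" using k by auto
      have 2: "?n + 1 - k + 1 = ?n + 2 - k" using k by auto
      show "df (?n + 1 - k) (B *v w) * x $ e k = f (?n + 1 - k) * df 1 w * x $ e k + (if k \<noteq> 1 then df (?n + 2 - k) w * x $ e k else 0)"
        unfolding df[OF i] 1 2 by (simp add: algebra_simps)
    qed
    also have "\<dots> = df 1 w * (\<Sum>k=1..?n. f (?n + 1 - k) * x $ e k) + (\<Sum>k=1..?n. if k \<noteq> 1 then df (?n + 2 - k) w * x $ e k else 0)"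
      by (simp add: sum.distrib sum_distrib_left mult_ac)
    also have "(\<Sum>k=1..?n. if k \<noteq> 1 then df (?n + 2 - k) w * x $ e k else 0) = (\<Sum>k\<in>{2..?n}. df (?n + 2 - k) w * x $ e k)"
      by (rule sum.mono_neutral_cong_right) auto
    also have "\<dots> = (\<Sum>k\<in>{1..<?n}. df (?n + 1 - k) w * x $ e (k + 1))"
      by (rule sum.reindex_bij_witness[where i="\<lambda>k. k + 1" and j="\<lambda>k. k - 1"]) (auto simp: One_nat_def)
    also have "df 1 w * (\<Sum>k=1..?n. f (?n + 1 - k) * x $ e k) = df (?n + 1 - ?n) w * (?C *v x) $ e ?n"
      by (simp add: comp2_mv[OF n1])
    also have "(\<Sum>k\<in>{1..<?n}. df (?n + 1 - k) w * x $ e (k + 1)) = (\<Sum>k\<in>{1..<?n}. df (?n + 1 - k) w * (?C *v x) $ e k)"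
      by (intro sum.cong refl) (subst comp2_mv, auto)
    finally have "om (B *v w) x = df (?n + 1 - ?n) w * (?C *v x) $ e ?n + (\<Sum>k\<in>{1..<?n}. df (?n + 1 - k) w * (?C *v x) $ e k)" .
    also have "\<dots> = om w (?C *v x)"
    proof -
      have "{1..?n} = insert ?n {1..<?n}" using n1 by auto
      then show ?thesis unfolding om_def by simp
    qed
    finally show ?thesis .
  qed
  have omA: "om v x = om \<xi> (A v *v x)" for v x
  proof -
    have "{v. \<forall>x. om v x - om \<xi> (A v *v x) = 0} = UNIV"
    proof (rule cyc[unfolded cyclic_def, rule_format])
      have omR: "om \<xi> (y + z) = om \<xi> y + om \<xi> z" "om \<xi> (r *\<^sub>R y) = r * om \<xi> y" for y z r
        by (simp_all add: om_def distrib_left sum.distrib sum_distrib_left mult_ac)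
      have "om \<xi> 0 = 0" by (simp add: om_def)
      then show "subspace {v. \<forall>x. om v x - om \<xi> (A v *v x) = 0}"
        unfolding subspace_def
        by (auto simp: linear_0[OF omL] linear_add[OF omL] linear_scale[OF omL] linear_0[OF linA] linear_add[OF linA] linear_scale[OF linA]
            matrix_vector_mult_add_rdistrib mv_scaleR_left omR)
      show "\<xi> \<in> {v. \<forall>x. om v x - om \<xi> (A v *v x) = 0}" by (simp add: A1)
      fix v assume v: "v \<in> {v. \<forall>x. om v x - om \<xi> (A v *v x) = 0}"
      then show "B *v v \<in> {v. \<forall>x. om v x - om \<xi> (A v *v x) = 0}"
        by (auto simp: omC AB AC[symmetric] matrix_vector_mul_assoc[symmetric])
    qed
    then show ?thesis by (metis (mono_tags, lifting) UNIV_I mem_Collect_eq right_minus_eq)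
  qed
  have sym: "om v (A w *v x) = om w (A v *v x)" for v w x
    unfolding omA[of v] omA[of w] matrix_vector_mul_assoc by (simp add: AA)
  have sym2: "om (B *v v) (A w *v x) = om (B *v w) (A v *v x)" for v w x
    unfolding omC matrix_vector_mul_assoc AC[symmetric] by (simp only: matrix_vector_mul_assoc[symmetric] sym[of v w])
  show ?thesis
  proof (subst matrix_eq, intro allI)
    fix x
    have Ev: "E w *v v = om w v *\<^sub>R axis (e ?n) 1" for w v by (simp add: E om_def)
    show "((E (B *v v) - ?C ** E v) ** A w) *v x = ((E (B *v w) - ?C ** E w) ** A v) *v x"
      by (simp add: matrix_diff_rdistrib matrix_vector_mult_diff_rdistrib matrix_vector_mul_assoc[symmetric] Ev
          matrix_vector_mult_scaleR sym[of v w] sym2[of v w])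
  qed
qed

end

section \<open>Solving the intertwining equation\<close>

lemma real_analytic_at_mat:
  fixes A :: "real^'n \<Rightarrow> real^'k^'m"
  shows "real_analytic_at A a \<longleftrightarrow> (\<forall>i j. real_analytic_at (\<lambda>u. A u $ i $ j) a)"
  by (simp add: real_analytic_at_vec[of A] real_analytic_at_vec[of "\<lambda>u. A u $ _"])

lemma real_analytic_at_mat_power:
  fixes M :: "real^'n \<Rightarrow> real^'k^'k"
  assumes "real_analytic_at M a"
  shows "real_analytic_at (\<lambda>u. mat_power (M u) k) a"
proof (induction k)
  case (Suc k)
  then show ?case unfolding mat_power_Suc by (rule real_analytic_at_mm[OF assms])
qed (simp add: real_analytic_at_const)

lemma real_analytic_at_det:
  fixes M :: "real^'n \<Rightarrow> real^'k^'k"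
  assumes "\<And>i j. real_analytic_at (\<lambda>u. M u $ i $ j) a"
  shows "real_analytic_at (\<lambda>u. det (M u)) a"
  unfolding det_def
  by (rule real_analytic_at_sum_real, rule real_analytic_at_mult[OF real_analytic_at_const], rule real_analytic_at_prod, rule assms)

lemma frechet_derivative_mat_power:
  fixes M :: "real^'n \<Rightarrow> real^'k^'k"
  assumes "M differentiable (at u)"
  shows "(\<lambda>u. mat_power (M u) k) differentiable (at u)"
    and "frechet_derivative (\<lambda>u. mat_power (M u) k) (at u) v = dpow (M u) k (frechet_derivative M (at u) v)"
proof (induction k)
  case (Suc k)
  {
    case 1
    show ?case unfolding mat_power_Suc by (rule frechet_derivative_mm(1)[OF assms Suc(1)])
  next
    case 2
    show ?case unfolding mat_power_Suc frechet_derivative_mm(2)[OF assms Suc(1)] Suc(2)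
      by (simp add: add.commute)
  }
qed simp_all

lemma real_analytic_at_krylov:
  fixes M :: "real^'n \<Rightarrow> real^'k^'k"
  assumes "real_analytic_at M a"
  shows "real_analytic_at (\<lambda>u. krylov idx (M u) \<xi> $ i $ j) a"
  using real_analytic_at_mv[OF real_analytic_at_mat_power[OF assms, of "idx j"] real_analytic_at_const[of \<xi>]]
  by (simp add: krylov_def real_analytic_at_vec)

lemma real_analytic_at_kcoord:
  fixes M :: "real^'n \<Rightarrow> real^'k^'k"
  assumes M: "real_analytic_at M a" and d: "det (krylov idx (M a) \<xi>) \<noteq> 0" and v: "real_analytic_at v a"
  shows "real_analytic_at (\<lambda>u. kcoord idx (M u) \<xi> (v u) $ j) a"
  unfolding kcoord_def vec_lambda_beta
proof (rule real_analytic_at_divide)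
  show "real_analytic_at (\<lambda>u. det (krylov idx (M u) \<xi>)) a"
    by (rule real_analytic_at_det, rule real_analytic_at_krylov[OF M])
  show "real_analytic_at (\<lambda>u. det (\<chi> i l. if l = j then v u $ i else krylov idx (M u) \<xi> $ i $ l)) a"
  proof (rule real_analytic_at_det)
    show "real_analytic_at (\<lambda>u. (\<chi> i l. if l = j then v u $ i else krylov idx (M u) \<xi> $ i $ l) $ i $ l) a" for i l
      using v real_analytic_at_krylov[OF M, of idx \<xi> i l] by (cases "l = j") (simp_all add: real_analytic_at_vec)
  qed
qed (rule d)

lemma real_analytic_at_transfer_pol:
  fixes M :: "real^'n \<Rightarrow> real^'k^'k"
  assumes "real_analytic_at M a" "det (krylov idx (M a) \<xi>) \<noteq> 0" "real_analytic_at C a"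
  shows "real_analytic_at (\<lambda>u. transfer_pol idx (M u) \<xi> (C u) v) a"
  unfolding transfer_pol_def
  by (rule real_analytic_at_sum, rule real_analytic_at_scaleR[OF real_analytic_at_kcoord[OF assms(1,2) real_analytic_at_const]
    real_analytic_at_mat_power[OF assms(3)]])

lemma index_bij_exists:
  obtains idx where "bij_betw idx (UNIV :: 'n::finite set) {..<CARD('n)}"
  using ex_bij_betw_finite_nat[of "UNIV :: 'n set"] unfolding atLeast0LessThan by auto

lemma det_krylov_near:
  fixes M :: "real^'n \<Rightarrow> real^'k^'k"
  assumes M: "real_analytic_at M a" and d: "det (krylov idx (M a) \<xi>) \<noteq> 0"
  shows "\<forall>\<^sub>F u in nhds a. det (krylov idx (M u) \<xi>) \<noteq> 0"
proof -
  have "real_analytic_at (\<lambda>u. det (krylov idx (M u) \<xi>)) a"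
    by (rule real_analytic_at_det, rule real_analytic_at_krylov[OF M])
  then have "isCont (\<lambda>u. det (krylov idx (M u) \<xi>)) a" by (rule real_analytic_isCont)
  from filterlim_compose[OF filterlim_ident isCont_nhds[OF this]] show ?thesis
    using t1_space_nhds[OF d] by (auto simp: filterlim_iff)
qed

text \<open>The coefficients are given as mere functions. They are analytic because they are the
  Krylov coordinates of the \<open>n\<close>-th iterate, a quotient of determinants.\<close>

lemma real_analytic_at_char_coeff:
  fixes M :: "real^'n \<Rightarrow> real^'k^'k" and f :: "nat \<Rightarrow> real^'n \<Rightarrow> real"
  assumes M: "real_analytic_at M a" and ch: "\<forall>\<^sub>F u in nhds a. char_coeffs (\<lambda>i. f i u) (M u)"
    and c: "cyclic (M a) \<xi>" and i: "i \<in> {1..CARD('k)}"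
  shows "real_analytic_at (f i) a"
proof -
  obtain idx where idx: "bij_betw idx (UNIV :: 'k set) {..<CARD('k)}" by (rule index_bij_exists)
  have d: "det (krylov idx (M a) \<xi>) \<noteq> 0" by (rule cyclic_krylov[OF idx c eventually_nhds_x_imp_x[OF ch]])
  have "CARD('k) - i \<in> {..<CARD('k)}" using i by auto
  then obtain j where j: "idx j = CARD('k) - i" using bij_betw_imp_surj_on[OF idx] by (metis imageE)
  have "real_analytic_at (\<lambda>u. kcoord idx (M u) \<xi> (mat_power (M u) CARD('k) *v \<xi>) $ j) a"
    by (rule real_analytic_at_kcoord[OF M d real_analytic_at_mv[OF real_analytic_at_mat_power[OF M] real_analytic_at_const]])
  then show ?thesis
  proof (rule real_analytic_at_cong)
    show "\<forall>\<^sub>F u in nhds a. kcoord idx (M u) \<xi> (mat_power (M u) CARD('k) *v \<xi>) $ j = f i u"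
      using ch det_krylov_near[OF M d]
    proof eventually_elim
      case (elim u)
      let ?c = "\<chi> j. f (CARD('k) - idx j) u"
      have "mat_power (M u) CARD('k) *v \<xi> = (\<Sum>i=1..CARD('k). f i u *\<^sub>R (mat_power (M u) (CARD('k) - i) *v \<xi>))"
        by (rule char_coeffs_mv[OF elim(1)])
      also have "\<dots> = (\<Sum>l\<in>{..<CARD('k)}. f (CARD('k) - l) u *\<^sub>R (mat_power (M u) l *v \<xi>))"
        by (rule sum.reindex_bij_witness[where i="\<lambda>l. CARD('k) - l" and j="\<lambda>i. CARD('k) - i"]) auto
      also have "\<dots> = krylov idx (M u) \<xi> *v ?c"
        unfolding krylov_mv by (simp add: sum.reindex_bij_betw[OF idx, symmetric])
      finally have "kcoord idx (M u) \<xi> (mat_power (M u) CARD('k) *v \<xi>) = ?c" by (simp add: kcoord(2)[OF elim(2)])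
      then show ?case using i by (simp add: j)
    qed
  qed
qed

lemma cyclic_near:
  fixes M :: "real^'n \<Rightarrow> real^'k^'k"
  assumes M: "real_analytic_at M a" and ch: "char_coeffs f (M a)" and c: "cyclic (M a) \<xi>"
  shows "\<forall>\<^sub>F u in nhds a. cyclic (M u) \<xi>"
proof -
  obtain idx where idx: "bij_betw idx (UNIV :: 'k set) {..<CARD('k)}" by (rule index_bij_exists)
  show ?thesis using det_krylov_near[OF M cyclic_krylov[OF idx c ch]]
    by eventually_elim (rule krylov_cyclic)
qed

lemma frechet_derivative_sum_nth_scaleR:
  fixes g :: "real^'n \<Rightarrow> real^'k" and A :: "'k \<Rightarrow> real^'n \<Rightarrow> 'b::real_normed_vector"
  assumes g: "g differentiable (at u)" and A: "\<And>j. A j differentiable (at u)"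
  shows "frechet_derivative (\<lambda>u. \<Sum>j\<in>UNIV. g u $ j *\<^sub>R A j u) (at u) w =
    (\<Sum>j\<in>UNIV. frechet_derivative g (at u) w $ j *\<^sub>R A j u) + (\<Sum>j\<in>UNIV. g u $ j *\<^sub>R frechet_derivative (A j) (at u) w)"
proof -
  have "((\<lambda>u. g u $ j) has_derivative (\<lambda>w. frechet_derivative g (at u) w $ j)) (at u)" for j
    using g by (intro bounded_linear.has_derivative[OF bounded_linear_vec_nth]) (simp add: frechet_derivative_works)
  moreover have "(A j has_derivative frechet_derivative (A j) (at u)) (at u)" for j
    using A by (simp add: frechet_derivative_works)
  ultimately have "((\<lambda>u. \<Sum>j\<in>UNIV. g u $ j *\<^sub>R A j u) has_derivative
    (\<lambda>w. \<Sum>j\<in>UNIV. g u $ j *\<^sub>R frechet_derivative (A j) (at u) w + frechet_derivative g (at u) w $ j *\<^sub>R A j u)) (at u)"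
    by (intro has_derivative_sum has_derivative_scaleR)
  from fun_cong[OF frechet_derivative_at[OF this], of w] show ?thesis by (simp add: sum.distrib add.commute)
qed

lemma sum_nth_axis: "(\<Sum>j\<in>UNIV. v $ j *\<^sub>R axis j 1) = (v :: real^'n)"
  using basis_expansion[of v] by (simp add: scalar_mult_eq_scaleR)

lemma linear_sum_axis:
  assumes "linear h"
  shows "h v = (\<Sum>j\<in>UNIV. v $ j *\<^sub>R h (axis j 1))"
  using arg_cong[OF sum_nth_axis[of v], of h] by (simp add: linear_sum[OF assms] linear_scale[OF assms])

text \<open>The condition \<open>compat\<close> quantifies over every \<open>A\<close> with the
  algebraic properties of the transfer form, which lets one theorem serve both companion matrices
  although they satisfy it for different reasons.\<close>

theorem intertwiner_exists:
  fixes M C :: "real^'n \<Rightarrow> real^'n^'n"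
  assumes M: "real_analytic_at M 0" and C: "real_analytic_at C 0"
    and chM: "\<forall>\<^sub>F u in nhds 0. char_coeffs (f u) (M u)" and chC: "\<forall>\<^sub>F u in nhds 0. char_coeffs (f u) (C u)"
    and N: "\<forall>\<^sub>F u in nhds 0. \<forall>v w. nij_alg (M u) (frechet_derivative M (at u)) v w = 0"
    and cycM: "cyclic (M 0) (axis piv 1)" and cycC: "cyclic (C 0) h"
    and compat: "\<forall>\<^sub>F u in nhds 0. \<forall>A v w. linear A \<longrightarrow> A (axis piv 1) = mat 1 \<longrightarrow> (\<forall>v. A (M u *v v) = C u ** A v) \<longrightarrow>
      (\<forall>v. A v ** C u = C u ** A v) \<longrightarrow> (\<forall>v w. A v ** A w = A w ** A v) \<longrightarrow>
      (frechet_derivative C (at u) (M u *v v) - C u ** frechet_derivative C (at u) v) ** A w =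
      (frechet_derivative C (at u) (M u *v w) - C u ** frechet_derivative C (at u) w) ** A v"
  obtains H :: "real^'n \<Rightarrow> real^'n" where "real_analytic_at H 0" "bij (frechet_derivative H (at 0))"
    "\<forall>\<^sub>F u in nhds 0. \<forall>v. frechet_derivative H (at u) (M u *v v) = C u *v frechet_derivative H (at u) v"
proof -
  let ?\<xi> = "axis piv 1 :: real^'n"
  obtain idx where idx: "bij_betw idx (UNIV :: 'n set) {..<CARD('n)}" by (rule index_bij_exists)
  define T where "T = (\<lambda>u. transfer_pol idx (M u) ?\<xi> (C u))"
  define A where "A = (\<lambda>j u. T u (axis j 1))"
  define a where "a = (\<lambda>u w v. \<Sum>j\<in>UNIV. v $ j *\<^sub>R frechet_derivative (A j) (at u) w)"
  have d: "\<forall>\<^sub>F u in nhds 0. det (krylov idx (M u) ?\<xi>) \<noteq> 0"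
    by (rule det_krylov_near[OF M cyclic_krylov[OF idx cycM eventually_nhds_x_imp_x[OF chM]]])
  have lT: "\<forall>\<^sub>F u in nhds 0. linear (T u)"
    using d chM chC unfolding T_def by eventually_elim (rule linear_transfer_pol[OF idx])
  have TA: "\<forall>\<^sub>F u in nhds 0. \<forall>v. T u v = (\<Sum>j\<in>UNIV. v $ j *\<^sub>R A j u)"
    using lT unfolding A_def by eventually_elim (intro allI, rule linear_sum_axis)
  have T1: "\<forall>\<^sub>F u in nhds 0. T u ?\<xi> = mat 1"
    using d chM chC unfolding T_def by eventually_elim (rule transfer_pol_unit[OF idx])
  have TM: "\<forall>\<^sub>F u in nhds 0. \<forall>v. T u (M u *v v) = C u ** T u v"
    using d chM chC unfolding T_def by eventually_elim (intro allI, rule transfer_pol_mult[OF idx])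
  have TC: "\<forall>\<^sub>F u in nhds 0. \<forall>v. T u v ** C u = C u ** T u v"
    using d chM chC unfolding T_def by eventually_elim (intro allI, rule transfer_pol_commute1)
  have TT: "\<forall>\<^sub>F u in nhds 0. \<forall>v w. T u v ** T u w = T u w ** T u v"
    using d chM chC unfolding T_def by eventually_elim (intro allI, rule transfer_pol_commute)
  have anA: "real_analytic_at (A j) 0" for j
    unfolding A_def T_def by (rule real_analytic_at_transfer_pol[OF M eventually_nhds_x_imp_x[OF d] C])
  have anA': "\<forall>\<^sub>F u in nhds 0. \<forall>j. real_analytic_at (A j) u"
    by (rule eventually_all_finite[OF real_analytic_near[OF anA]])
  \<comment> \<open>The algebraic identities hold around every nearby point, not only at it, so they
    may be differentiated there.\<close>
  have near: "\<forall>\<^sub>F u in nhds 0. (\<forall>\<^sub>F u in nhds u. \<forall>v. T u v = (\<Sum>j\<in>UNIV. v $ j *\<^sub>R A j u)) \<and>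
      (\<forall>\<^sub>F u in nhds u. T u ?\<xi> = mat 1) \<and> (\<forall>\<^sub>F u in nhds u. \<forall>v. T u (M u *v v) = C u ** T u v)"
    using TA T1 TM by (simp add: eventually_conj_iff eventually_eventually)
  have lin: "linear (frechet_derivative g (at u))" if "g differentiable (at u)" for g :: "real^'n \<Rightarrow> real^'n^'n" and u
    by (rule linear_frechet_derivative[OF that])
  have a_axis: "a u w (axis k 1) = frechet_derivative (A k) (at u) w" for u w k
  proof -
    have "a u w (axis k 1) = (\<Sum>j\<in>UNIV. if j = k then frechet_derivative (A k) (at u) w else 0)"
      unfolding a_def by (intro sum.cong refl) (auto simp: axis_def)
    then show ?thesis by simp
  qed
  have integrable: "\<forall>\<^sub>F u in nhds 0. \<forall>v w. a u v w - a u w v = T u v ** a u ?\<xi> w - T u w ** a u ?\<xi> v"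
    using near anA' chM N lT T1 TA TM TC TT compat cyclic_near[OF M eventually_nhds_x_imp_x[OF chM] cycM]
      real_analytic_near[OF M] real_analytic_near[OF C]
  proof eventually_elim
    case (elim u)
    have nTA: "\<forall>\<^sub>F u in nhds u. \<forall>v. T u v = (\<Sum>j\<in>UNIV. v $ j *\<^sub>R A j u)" and nT1: "\<forall>\<^sub>F u in nhds u. T u ?\<xi> = mat 1"
      and nTM: "\<forall>\<^sub>F u in nhds u. \<forall>v. T u (M u *v v) = C u ** T u v"
      using elim(1) by blast+
    have dA: "A j differentiable (at u)" for j using elim(2) by (auto intro: real_analytic_differentiable)
    have dM: "M differentiable (at u)" and dC: "C differentiable (at u)"
      by (rule real_analytic_differentiable[OF elim(13)], rule real_analytic_differentiable[OF elim(14)])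
    let ?D = "frechet_derivative M (at u)" and ?E = "frechet_derivative C (at u)"
    have cT: "frechet_derivative (\<lambda>u. T u (g u)) (at u) w = T u (frechet_derivative g (at u) w) + a u w (g u)"
      if g: "g differentiable (at u)" for g w
    proof -
      have "frechet_derivative (\<lambda>u. T u (g u)) (at u) = frechet_derivative (\<lambda>u. \<Sum>j\<in>UNIV. g u $ j *\<^sub>R A j u) (at u)"
        by (rule frechet_derivative_cong) (use nTA in eventually_elim, simp)
      then show ?thesis
        unfolding frechet_derivative_sum_nth_scaleR[OF g dA, symmetric] by (simp add: frechet_derivative_sum_nth_scaleR[OF g dA] elim(7) a_def)
    qed
    have T0: "T u 0 = 0" by (rule linear_0[OF elim(5)])
    have cTc: "frechet_derivative (\<lambda>u. T u v) (at u) w = a u w v" for v w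
      using cT[of "\<lambda>u. v" w] by (simp add: T0)
    have dT: "(\<lambda>u. T u v) differentiable (at u)" for v
    proof -
      have "((\<lambda>u. \<Sum>j\<in>UNIV. v $ j *\<^sub>R A j u) has_derivative (\<lambda>w. \<Sum>j\<in>UNIV. v $ j *\<^sub>R frechet_derivative (A j) (at u) w)) (at u)"
        by (intro has_derivative_sum has_derivative_scaleR_right) (use dA in \<open>simp add: frechet_derivative_works\<close>)
      then have "((\<lambda>u. T u v) has_derivative (\<lambda>w. \<Sum>j\<in>UNIV. v $ j *\<^sub>R frechet_derivative (A j) (at u) w)) (at u)"
        by (rule has_derivative_transform_eventually)
          (use nTA elim(7) in \<open>auto simp: eventually_at_filter elim!: eventually_mono\<close>)
      then show ?thesis by (rule differentiableI)
    qed
    show ?case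
    proof (intro allI, rule integrability_alg[where B = "M u" and C = "C u" and D = ?D and E = ?E and A = "T u" and \<xi> = ?\<xi>])
      show "cyclic (M u) ?\<xi>" by (rule elim(12))
      show "nij_alg (M u) ?D v w = 0" for v w using elim(4) by blast
      show "linear ?D" "linear ?E" "linear (T u)" by (rule lin[OF dM], rule lin[OF dC], rule elim(5))
      show "linear (a u w)" for w
        unfolding a_def by (rule linearI) (simp_all add: scaleR_add_left sum.distrib scaleR_sum_right)
      show "linear (\<lambda>w. a u w v)" for v
        unfolding a_def by (rule linearI) (simp_all add: linear_add[OF lin[OF dA]] linear_scale[OF lin[OF dA]] scaleR_add_right sum.distrib scaleR_sum_right mult.commute)
      show "T u ?\<xi> = mat 1" by (rule elim(6))
      show "a u w ?\<xi> = 0" for w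
      proof -
        have "frechet_derivative (\<lambda>u. T u ?\<xi>) (at u) = frechet_derivative (\<lambda>u. mat 1) (at u)"
          by (rule frechet_derivative_cong[OF nT1])
        then show ?thesis using cTc[of ?\<xi> w] by simp
      qed
      show "T u (M u *v v) = C u ** T u v" for v using elim(8) by blast
      show "a u w (M u *v v) + T u (?D w *v v) = ?E w ** T u v + C u ** a u w v" for v w
      proof -
        have dMv: "(\<lambda>u. M u *v v) differentiable (at u)" and fMv: "frechet_derivative (\<lambda>u. M u *v v) (at u) w = ?D w *v v"
          using frechet_derivative_mv[OF dM differentiable_const, of v] by simp_all
        have "frechet_derivative (\<lambda>u. T u (M u *v v)) (at u) = frechet_derivative (\<lambda>u. C u ** T u v) (at u)"
          by (rule frechet_derivative_cong) (use nTM in eventually_elim, simp)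
        then have "frechet_derivative (\<lambda>u. T u (M u *v v)) (at u) w = frechet_derivative (\<lambda>u. C u ** T u v) (at u) w" by simp
        then show ?thesis unfolding cT[OF dMv] fMv frechet_derivative_mm(2)[OF dC dT] cTc by (simp add: add.commute)
      qed
      show "T u v ** C u = C u ** T u v" for v using elim(9) by blast
      show "T u v ** T u w = T u w ** T u v" for v w using elim(10) by blast
      show "(?E (M u *v v) - C u ** ?E v) ** T u w = (?E (M u *v w) - C u ** ?E w) ** T u v" for v w
        by (rule elim(11)[rule_format, of "T u"]) (use elim(5,6,8,9,10) in blast)+
    qed
  qed
  obtain H where H: "real_analytic_at H 0" "pd piv H 0 = h" "\<forall>\<^sub>F y in nhds 0. \<forall>j. pd j H y = A j y *v pd piv H y"
  proof (rule linear_system_solvable[OF anA, where h = h])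
    show "\<forall>\<^sub>F y in nhds 0. \<forall>j k. A j y ** A k y = A k y ** A j y"
      using TT unfolding A_def by eventually_elim blast
    show "\<forall>\<^sub>F y in nhds 0. \<forall>j k. pd j (A k) y - pd k (A j) y = A j y ** pd piv (A k) y - A k y ** pd piv (A j) y"
      using integrable
    proof eventually_elim
      case (elim u)
      have p: "pd j (A k) u = a u (axis j 1) (axis k 1)" for j k by (simp add: pd_def a_axis)
      have "A j u = T u (axis j 1)" for j by (simp add: A_def)
      then show ?case unfolding p using elim by simp
    qed
    show "\<forall>\<^sub>F y in nhds 0. A piv y = mat 1" using T1 by (simp add: A_def)
  qed (rule that; assumption)
  have dH: "\<forall>\<^sub>F u in nhds 0. \<forall>v. frechet_derivative H (at u) v = T u v *v pd piv H u"
    using H(3) TA real_analytic_near[OF H(1)]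
  proof eventually_elim
    case (elim u)
    have l: "linear (frechet_derivative H (at u))"
      by (rule linear_frechet_derivative[OF real_analytic_differentiable[OF elim(3)]])
    show ?case
    proof
      fix v :: "real^'n"
      have "frechet_derivative H (at u) v = (\<Sum>j\<in>UNIV. v $ j *\<^sub>R pd j H u)"
        unfolding pd_def by (rule linear_sum_axis[OF l])
      also have "\<dots> = T u v *v pd piv H u"
        unfolding elim(2)[rule_format, of v] mv_sum_left mv_scaleR_left by (intro sum.cong refl arg_cong2[where f = "(*\<^sub>R)"] elim(1)[rule_format])
      finally show "frechet_derivative H (at u) v = T u v *v pd piv H u" .
    qed
  qed
  have inter: "\<forall>\<^sub>F u in nhds 0. \<forall>v. frechet_derivative H (at u) (M u *v v) = C u *v frechet_derivative H (at u) v"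
    using dH TM by eventually_elim (simp add: matrix_vector_mul_assoc)
  have l: "linear (frechet_derivative H (at 0))"
    by (rule linear_frechet_derivative[OF real_analytic_differentiable[OF H(1)]])
  have "range (frechet_derivative H (at 0)) = UNIV"
  proof (rule cycC[unfolded cyclic_def, rule_format])
    show "subspace (range (frechet_derivative H (at 0)))" by (rule linear_subspace_image[OF l subspace_UNIV])
    show "h \<in> range (frechet_derivative H (at 0))" using H(2) by (auto simp: pd_def)
    show "C 0 *v v \<in> range (frechet_derivative H (at 0))" if "v \<in> range (frechet_derivative H (at 0))" for v
    proof -
      obtain w where "v = frechet_derivative H (at 0) w" using \<open>v \<in> _\<close> by blast
      then have "C 0 *v v = frechet_derivative H (at 0) (M 0 *v w)" using eventually_nhds_x_imp_x[OF inter] by simp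
      then show ?thesis by blast
    qed
  qed
  then have "bij (frechet_derivative H (at 0))"
    using linear_surjective_imp_injective[OF l] by (simp add: bij_def)
  then show thesis by (rule that[OF H(1) _ inter])
qed

section \<open>Coordinates in which the operator is a companion matrix\<close>

lemma frechet_derivative_mat_nth:
  fixes C :: "real^'n \<Rightarrow> real^'k^'m"
  assumes "C differentiable (at u)"
  shows "frechet_derivative C (at u) w $ i $ j = frechet_derivative (\<lambda>u. C u $ i $ j) (at u) w"
proof -
  have "((\<lambda>u. C u $ i $ j) has_derivative (\<lambda>w. frechet_derivative C (at u) w $ i $ j)) (at u)"
    using assms by (intro bounded_linear.has_derivative[OF bounded_linear_vec_nth]) (simp add: frechet_derivative_works)
  from fun_cong[OF frechet_derivative_at[OF this], of w] show ?thesis .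
qed

text \<open>The Cayley-Hamilton identity holds in a neighbourhood; its derivative is the hypothesis
  that the pointwise algebra requires.\<close>

lemma char_coeffs_pde:
  fixes M :: "real^'n \<Rightarrow> real^'n^'n" and f :: "nat \<Rightarrow> real^'n \<Rightarrow> real"
  assumes M: "real_analytic_at M a" and f: "\<And>i. i \<in> {1..CARD('n)} \<Longrightarrow> real_analytic_at (f i) a"
    and ch: "\<forall>\<^sub>F u in nhds a. char_coeffs (\<lambda>i. f i u) (M u)" and gl: "gl_regular (M a)"
    and N: "\<And>v w. nij_alg (M a) (frechet_derivative M (at a)) v w = 0" and i: "i \<in> {1..CARD('n)}"
  shows "frechet_derivative (f i) (at a) (M a *v v) = f i a * frechet_derivative (f 1) (at a) v +
    (if i < CARD('n) then frechet_derivative (f (i + 1)) (at a) v else 0)"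
proof (rule char_coeffs_derivative[where df = "\<lambda>i. frechet_derivative (f i) (at a)", OF gl eventually_nhds_x_imp_x[OF ch] N _ _ i])
  have dM: "M differentiable (at a)" by (rule real_analytic_differentiable[OF M])
  show "linear (frechet_derivative M (at a))" by (rule linear_frechet_derivative[OF dM])
  fix v
  let ?n = "CARD('n)" and ?D = "frechet_derivative M (at a) v"
  have "((\<lambda>u. mat_power (M u) k) has_derivative (\<lambda>v. dpow (M a) k (frechet_derivative M (at a) v))) (at a)" for k
    using frechet_derivative_mat_power[OF dM] by (metis (no_types, lifting) ext frechet_derivative_works)
  then have "((\<lambda>u. \<Sum>i=1..?n. f i u *\<^sub>R mat_power (M u) (?n - i)) has_derivative
    (\<lambda>v. \<Sum>i=1..?n. f i a *\<^sub>R dpow (M a) (?n - i) (frechet_derivative M (at a) v) + frechet_derivative (f i) (at a) v *\<^sub>R mat_power (M a) (?n - i))) (at a)"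
    by (intro has_derivative_sum has_derivative_scaleR real_analytic_has_derivative f)
  note D = fun_cong[OF frechet_derivative_at[OF this], of v]
  have "frechet_derivative (\<lambda>u. mat_power (M u) ?n) (at a) = frechet_derivative (\<lambda>u. \<Sum>i=1..?n. f i u *\<^sub>R mat_power (M u) (?n - i)) (at a)"
    by (rule frechet_derivative_cong) (use ch in \<open>simp add: char_coeffs_def\<close>)
  from fun_cong[OF this, of v] show "dpow (M a) ?n ?D = (\<Sum>i=1..?n. frechet_derivative (f i) (at a) v *\<^sub>R mat_power (M a) (?n - i) + f i a *\<^sub>R dpow (M a) (?n - i) ?D)"
    unfolding frechet_derivative_mat_power(2)[OF dM] D[symmetric] by (simp add: add.commute)
qed

section \<open>Companion matrices with variable coefficients\<close>

context
  fixes e :: "nat \<Rightarrow> 'n::finite"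
  assumes e: "bij_betw e {1..CARD('n)} UNIV"
begin

lemma comp1_analytic:
  fixes f :: "nat \<Rightarrow> real^'n \<Rightarrow> real"
  assumes f: "\<And>i. i \<in> {1..CARD('n)} \<Longrightarrow> real_analytic_at (f i) a"
  shows "real_analytic_at (\<lambda>u. comp1_mat e (\<lambda>i. f i u)) a"
  unfolding real_analytic_at_mat
proof (intro allI)
  fix i j
  show "real_analytic_at (\<lambda>u. comp1_mat e (\<lambda>i. f i u) $ i $ j) a"
    using f[OF eidx(3)[OF e, of i]]
    by (cases "eidx e j = 1") (simp_all add: comp1_mat_def comp1_entry_def real_analytic_at_const del: One_nat_def)
qed

lemma comp2_analytic:
  fixes f :: "nat \<Rightarrow> real^'n \<Rightarrow> real"
  assumes f: "\<And>i. i \<in> {1..CARD('n)} \<Longrightarrow> real_analytic_at (f i) a"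
  shows "real_analytic_at (\<lambda>u. comp2_mat e (\<lambda>i. f i u)) a"
  unfolding real_analytic_at_mat
proof (intro allI)
  fix i j
  have "CARD('n) + 1 - eidx e j \<in> {1..CARD('n)}" using eidx(3)[OF e, of j] by auto
  from f[OF this] show "real_analytic_at (\<lambda>u. comp2_mat e (\<lambda>i. f i u) $ i $ j) a"
    by (cases "eidx e i = CARD('n)") (simp_all add: comp2_mat_def comp2_entry_def real_analytic_at_const)
qed

lemma comp1_derivative:
  fixes f :: "nat \<Rightarrow> real^'n \<Rightarrow> real"
  assumes f: "\<And>i. i \<in> {1..CARD('n)} \<Longrightarrow> real_analytic_at (f i) a"
  shows "frechet_derivative (\<lambda>u. comp1_mat e (\<lambda>i. f i u)) (at a) w *v v =
    v $ e 1 *\<^sub>R (\<chi> i. frechet_derivative (f (eidx e i)) (at a) w)"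
proof -
  let ?D = "frechet_derivative (\<lambda>u. comp1_mat e (\<lambda>i. f i u)) (at a) w"
  have an: "real_analytic_at (\<lambda>u. comp1_mat e (\<lambda>i. f i u)) a" by (rule comp1_analytic) (rule f)
  have D: "?D $ i $ j = (if eidx e j = 1 then frechet_derivative (f (eidx e i)) (at a) w else 0)" for i j
    unfolding frechet_derivative_mat_nth[OF real_analytic_differentiable[OF an]]
    by (simp add: comp1_mat_def comp1_entry_def del: One_nat_def)
  have one: "1 \<in> {1..CARD('n)}" by (simp add: Suc_le_eq)
  have j: "eidx e j = 1 \<longleftrightarrow> j = e 1" for j using eidx(1)[OF e one] eidx(2)[OF e] by metis
  show ?thesis
  proof (rule iffD2[OF vec_eq_iff], rule allI)
    fix i
    have "(?D *v v) $ i = (\<Sum>j\<in>UNIV. if j = e 1 then frechet_derivative (f (eidx e i)) (at a) w * v $ e 1 else 0)"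
      unfolding matrix_vector_mult_def vec_lambda_beta by (intro sum.cong refl) (simp only: D j if_distrib[of "\<lambda>x. x * _"] mult_zero_left cong: if_cong)
    then show "(?D *v v) $ i = (v $ e 1 *\<^sub>R (\<chi> i. frechet_derivative (f (eidx e i)) (at a) w)) $ i" by simp
  qed
qed

lemma comp2_derivative:
  fixes f :: "nat \<Rightarrow> real^'n \<Rightarrow> real"
  assumes f: "\<And>i. i \<in> {1..CARD('n)} \<Longrightarrow> real_analytic_at (f i) a"
  shows "frechet_derivative (\<lambda>u. comp2_mat e (\<lambda>i. f i u)) (at a) w *v v =
    (\<Sum>k=1..CARD('n). frechet_derivative (f (CARD('n) + 1 - k)) (at a) w * v $ e k) *\<^sub>R axis (e CARD('n)) 1"
proof -
  let ?D = "frechet_derivative (\<lambda>u. comp2_mat e (\<lambda>i. f i u)) (at a) w"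
  have an: "real_analytic_at (\<lambda>u. comp2_mat e (\<lambda>i. f i u)) a" by (rule comp2_analytic) (rule f)
  have D: "?D $ i $ j = (if eidx e i = CARD('n) then frechet_derivative (f (CARD('n) + 1 - eidx e j)) (at a) w else 0)" for i j
    unfolding frechet_derivative_mat_nth[OF real_analytic_differentiable[OF an]]
    by (simp add: comp2_mat_def comp2_entry_def del: One_nat_def)
  have n: "CARD('n) \<in> {1..CARD('n)}" by (simp add: Suc_le_eq)
  show ?thesis
  proof (rule vec_eq_e[OF e])
    fix i assume i: "i \<in> {1..CARD('n)}"
    have "(?D *v v) $ e i = (\<Sum>k=1..CARD('n). ?D $ e i $ e k * v $ e k)"
      unfolding matrix_vector_mult_def vec_lambda_beta by (simp add: sum_e[OF e])
    also have "\<dots> = (\<Sum>k=1..CARD('n). (if i = CARD('n) then frechet_derivative (f (CARD('n) + 1 - k)) (at a) w * v $ e k else 0))"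
      by (intro sum.cong refl) (simp only: D eidx(1)[OF e i] eidx(1)[OF e] if_distrib[of "\<lambda>x. x * _"] mult_zero_left cong: if_cong)
    finally show "(?D *v v) $ e i = ((\<Sum>k=1..CARD('n). frechet_derivative (f (CARD('n) + 1 - k)) (at a) w * v $ e k) *\<^sub>R axis (e CARD('n)) 1) $ e i"
      by (simp add: axis_e[OF e i n])
  qed
qed

text \<open>Both forms are treated at once through \<open>K\<close>: they share the coefficients and
  the cyclic last axis, and differ only in the verification of the compatibility condition.\<close>

theorem companion_coordinates:
  fixes M :: "real^'n \<Rightarrow> real^'n^'n" and f :: "nat \<Rightarrow> real^'n \<Rightarrow> real"
  assumes M: "real_analytic_at M 0" and gl: "\<forall>\<^sub>F u in nhds 0. gl_regular (M u)"
    and ch: "\<forall>\<^sub>F u in nhds 0. char_coeffs (\<lambda>i. f i u) (M u)"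
    and N: "\<forall>\<^sub>F u in nhds 0. \<forall>v w. nij_alg (M u) (frechet_derivative M (at u)) v w = 0"
    and cyc: "cyclic (M 0) (axis piv 1)"
    and K: "K = comp1_mat e \<or> K = comp2_mat e"
  obtains H :: "real^'n \<Rightarrow> real^'n" where "real_analytic_at H 0" "bij (frechet_derivative H (at 0))"
    "\<forall>\<^sub>F u in nhds 0. \<forall>v. frechet_derivative H (at u) (M u *v v) = K (\<lambda>i. f i u) *v frechet_derivative H (at u) v"
proof -
  have f: "real_analytic_at (f i) 0" if "i \<in> {1..CARD('n)}" for i
    by (rule real_analytic_at_char_coeff[OF M ch cyc that])
  have f': "\<forall>\<^sub>F u in nhds 0. \<forall>i\<in>{1..CARD('n)}. real_analytic_at (f i) u"
    by (rule eventually_ball_finite) (auto intro!: real_analytic_near f simp del: One_nat_def)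
  have ch': "\<forall>\<^sub>F u in nhds 0. \<forall>\<^sub>F u in nhds u. char_coeffs (\<lambda>i. f i u) (M u)"
    unfolding eventually_eventually by (rule ch)
  have pde: "\<forall>\<^sub>F u in nhds 0. \<forall>i\<in>{1..CARD('n)}. \<forall>v. frechet_derivative (f i) (at u) (M u *v v) =
      f i u * frechet_derivative (f 1) (at u) v + (if i < CARD('n) then frechet_derivative (f (i + 1)) (at u) v else 0)"
    using f' real_analytic_near[OF M] gl N ch'
    by eventually_elim (intro ballI allI, rule char_coeffs_pde; blast)
  have cycM: "\<forall>\<^sub>F u in nhds 0. cyclic (M u) (axis piv 1)"
    by (rule cyclic_near[OF M eventually_nhds_x_imp_x[OF ch] cyc])
  have chc: "char_coeffs g (K g)" and cycc: "cyclic (K g) (axis (e CARD('n)) 1)" for g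
    using K comp1_char_coeffs[OF e, of g] comp2_char_coeffs[OF e, of g] comp1_cyclic[OF e, of g] comp2_cyclic[OF e, of g] by auto
  have compat: "\<forall>\<^sub>F u in nhds 0. \<forall>A v w. linear A \<longrightarrow> A (axis piv 1) = mat 1 \<longrightarrow> (\<forall>v. A (M u *v v) = K (\<lambda>i. f i u) ** A v) \<longrightarrow>
      (\<forall>v. A v ** K (\<lambda>i. f i u) = K (\<lambda>i. f i u) ** A v) \<longrightarrow> (\<forall>v w. A v ** A w = A w ** A v) \<longrightarrow>
      (frechet_derivative (\<lambda>u. K (\<lambda>i. f i u)) (at u) (M u *v v) - K (\<lambda>i. f i u) ** frechet_derivative (\<lambda>u. K (\<lambda>i. f i u)) (at u) v) ** A w =
      (frechet_derivative (\<lambda>u. K (\<lambda>i. f i u)) (at u) (M u *v w) - K (\<lambda>i. f i u) ** frechet_derivative (\<lambda>u. K (\<lambda>i. f i u)) (at u) w) ** A v"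
    using K
  proof
    assume K: "K = comp1_mat e"
    show ?thesis
      using f' pde
    proof eventually_elim
      case (elim u)
      have f: "real_analytic_at (f i) u" if "i \<in> {1..CARD('n)}" for i using elim(1) that by blast
      have "frechet_derivative (\<lambda>u. K (\<lambda>i. f i u)) (at u) (M u *v v) = K (\<lambda>i. f i u) ** frechet_derivative (\<lambda>u. K (\<lambda>i. f i u)) (at u) v" for v
        unfolding K
        by (rule comp1_compat[OF e, where df = "\<lambda>i. frechet_derivative (f i) (at u)"])
          (use elim(2) in blast, rule comp1_derivative, rule f)
      then show ?case by simp
    qed
  next
    assume K: "K = comp2_mat e"
    show ?thesis
      using f' pde cycM
    proof eventually_elim
      case (elim u)
      have f: "real_analytic_at (f i) u" if "i \<in> {1..CARD('n)}" for i using elim(1) that by blast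
      show ?case
        unfolding K
      proof (intro allI impI)
        fix A :: "real^'n \<Rightarrow> real^'n^'n" and v w
        assume A: "linear A" "A (axis piv 1) = mat 1" "\<forall>v. A (M u *v v) = comp2_mat e (\<lambda>i. f i u) ** A v"
          "\<forall>v. A v ** comp2_mat e (\<lambda>i. f i u) = comp2_mat e (\<lambda>i. f i u) ** A v" "\<forall>v w. A v ** A w = A w ** A v"
        show "(frechet_derivative (\<lambda>u. comp2_mat e (\<lambda>i. f i u)) (at u) (M u *v v) - comp2_mat e (\<lambda>i. f i u) ** frechet_derivative (\<lambda>u. comp2_mat e (\<lambda>i. f i u)) (at u) v) ** A w =
          (frechet_derivative (\<lambda>u. comp2_mat e (\<lambda>i. f i u)) (at u) (M u *v w) - comp2_mat e (\<lambda>i. f i u) ** frechet_derivative (\<lambda>u. comp2_mat e (\<lambda>i. f i u)) (at u) w) ** A v"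
        proof (rule comp2_compat[OF e, where df = "\<lambda>i. frechet_derivative (f i) (at u)"])
          show "frechet_derivative (f i) (at u) (M u *v v) =
              f i u * frechet_derivative (f 1) (at u) v + (if i < CARD('n) then frechet_derivative (f (i + 1)) (at u) v else 0)"
            if "i \<in> {1..CARD('n)}" for i v using elim(2) that by blast
          show "frechet_derivative (\<lambda>u. comp2_mat e (\<lambda>i. f i u)) (at u) w *v v =
            (\<Sum>k=1..CARD('n). frechet_derivative (f (CARD('n) + 1 - k)) (at u) w * v $ e k) *\<^sub>R axis (e CARD('n)) 1" for w v
            by (rule comp2_derivative) (rule f)
          show "linear (frechet_derivative (f i) (at u))" if "i \<in> {1..CARD('n)}" for i
            by (rule linear_frechet_derivative[OF real_analytic_differentiable[OF f[OF that]]])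
          show "cyclic (M u) (axis piv 1)" by (rule elim(3))
        qed (use A in blast)+
      qed
    qed
  qed
  show thesis
  proof (rule intertwiner_exists[OF M _ ch _ N cyc cycc compat])
    have "real_analytic_at (\<lambda>u. comp1_mat e (\<lambda>i. f i u)) 0" "real_analytic_at (\<lambda>u. comp2_mat e (\<lambda>i. f i u)) 0"
      by (rule comp1_analytic, rule f, assumption, rule comp2_analytic, rule f, assumption)
    then show "real_analytic_at (\<lambda>u. K (\<lambda>i. f i u)) 0" using K by auto
    show "\<forall>\<^sub>F u in nhds 0. char_coeffs (\<lambda>i. f i u) (K (\<lambda>i. f i u))" by (simp add: chc)
  qed (rule that; assumption)
qed

end

section \<open>Charts\<close>

lemma is_chart_props:
  assumes "is_chart x"
  shows "open (dom_of x)" "q \<in> dom_of x \<Longrightarrow> point_at x (coord x q) = q"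
    "open V \<Longrightarrow> open (coord x ` (V \<inter> dom_of x))"
    "open B \<Longrightarrow> open {q \<in> dom_of x. coord x q \<in> B}"
proof -
  have h: "homeomorphism (dom_of x) (coord x ` dom_of x) (coord x) (point_at x)" and o: "open (dom_of x)" "open (coord x ` dom_of x)"
    using assms unfolding is_chart_def by auto
  show "open (dom_of x)" by (rule o)
  show "q \<in> dom_of x \<Longrightarrow> point_at x (coord x q) = q" by (rule homeomorphism_apply1[OF h])
  show "open (coord x ` (V \<inter> dom_of x))" if "open V"
  proof -
    have "openin (top_of_set (coord x ` dom_of x)) (coord x ` (V \<inter> dom_of x))"
      by (rule homeomorphism_imp_open_map[OF h]) (use that in \<open>auto simp: openin_open\<close>)
    then show ?thesis using openin_open_trans o(2) by blast
  qed
  show "open {q \<in> dom_of x. coord x q \<in> B}" if "open B"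
    using continuous_on_open_vimage[OF o(1), of "coord x"] homeomorphism_cont1[OF h] that
    by (simp add: vimage_def Int_def conj_commute)
qed

text \<open>Turns statements about points of the manifold near \<open>q\<close> into eventual
  statements about their coordinates.\<close>

lemma chart_near:
  assumes x: "is_chart x" and q: "q \<in> V" "q \<in> dom_of x" and V: "open V"
  shows "\<forall>\<^sub>F u in nhds (coord x q). \<exists>q'. q' \<in> V \<and> q' \<in> dom_of x \<and> u = coord x q' \<and> point_at x u = q'"
  unfolding eventually_nhds
  by (rule exI[of _ "coord x ` (V \<inter> dom_of x)"]) (use is_chart_props(2,3)[OF x] V q in auto)

lemma frechet_derivative_chain:
  assumes f: "f differentiable (at a)" and g: "g differentiable (at (f a))"
  shows "frechet_derivative (\<lambda>u. g (f u)) (at a) v = frechet_derivative g (at (f a)) (frechet_derivative f (at a) v)"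
proof -
  have "((\<lambda>u. g (f u)) has_derivative (\<lambda>v. frechet_derivative g (at (f a)) (frechet_derivative f (at a) v))) (at a)"
    using f g has_derivative_compose[of f _ a UNIV g] by (simp add: frechet_derivative_works)
  from fun_cong[OF frechet_derivative_at[OF this], of v] show ?thesis by (rule sym)
qed

context
  fixes A :: "('m::{t2_space, second_countable_topology}, 'n::finite) chart set"
  assumes atlas: "analytic_atlas A"
begin

lemma cs_chart: "x \<in> coordinate_systems A \<Longrightarrow> is_chart x"
  by (simp add: coordinate_systems_def)

lemma atlas_chart_exists:
  obtains y where "y \<in> A" "y \<in> coordinate_systems A" "p \<in> dom_of y"
  using atlas unfolding analytic_atlas_def coordinate_systems_def by blast

lemma transition_near:
  assumes x: "x \<in> coordinate_systems A" and y: "is_chart y" and q: "q \<in> dom_of x" "q \<in> dom_of y"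
  shows "\<forall>\<^sub>F u in nhds (coord x q). in_coords y g (transition x y u) = in_coords x g u"
proof -
  have "\<forall>\<^sub>F u in nhds (coord x q). \<exists>q'. q' \<in> dom_of y \<and> q' \<in> dom_of x \<and> u = coord x q' \<and> point_at x u = q'"
    by (rule chart_near[OF cs_chart[OF x] q(2,1) is_chart_props(1)[OF y]])
  then show ?thesis
    by eventually_elim (auto simp: in_coords_def transition_def is_chart_props(2)[OF y])
qed

lemma transition_transition:
  assumes "x \<in> coordinate_systems A" "is_chart y" "q \<in> dom_of x" "q \<in> dom_of y"
  shows "\<forall>\<^sub>F u in nhds (coord x q). transition y z (transition x y u) = transition x z u"
proof -
  have "in_coords y (coord z) = transition y z" for y :: "('m, 'n) chart" by (simp only: in_coords_def transition_def)
  then show ?thesis using transition_near[OF assms, of "coord z"] by simp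
qed

lemma transition_at:
  "x \<in> coordinate_systems A \<Longrightarrow> q \<in> dom_of x \<Longrightarrow> transition x y (coord x q) = coord y q"
  by (simp add: transition_def is_chart_props(2)[OF cs_chart])

lemma in_coords_at: "x \<in> coordinate_systems A \<Longrightarrow> q \<in> dom_of x \<Longrightarrow> in_coords x g (coord x q) = g q"
  by (simp add: in_coords_def is_chart_props(2)[OF cs_chart])

text \<open>Two charts of the maximal atlas are known to be compatible only with members of
  \<open>A\<close>, so the transition is factored through a member of \<open>A\<close> around
  \<open>q\<close>.\<close>

lemma transition_analytic:
  assumes x: "x \<in> coordinate_systems A" and y: "y \<in> coordinate_systems A" and q: "q \<in> dom_of x" "q \<in> dom_of y"
  shows "real_analytic_at (transition x y) (coord x q)"
proof -
  obtain z where z: "z \<in> A" "z \<in> coordinate_systems A" "q \<in> dom_of z" by (rule atlas_chart_exists)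
  have "compatible x z" "compatible y z" using x y z(1) by (simp_all add: coordinate_systems_def)
  then have xz: "real_analytic_on (transition x z) (coord x ` (dom_of x \<inter> dom_of z))"
    and zy: "real_analytic_on (transition z y) (coord z ` (dom_of y \<inter> dom_of z))"
    unfolding compatible_def by simp_all
  have xz': "real_analytic_at (transition x z) (coord x q)"
    by (rule xz[unfolded real_analytic_on_def, rule_format], rule imageI) (use q z in simp)
  have "real_analytic_at (transition z y) (coord z q)"
    by (rule zy[unfolded real_analytic_on_def, rule_format], rule imageI) (use q z in simp)
  then have "real_analytic_at (transition z y) (transition x z (coord x q))"
    by (simp only: transition_at[OF x q(1)])
  then have "real_analytic_at (\<lambda>u. transition z y (transition x z u)) (coord x q)"
    by (rule real_analytic_at_compose_gen[OF _ xz'])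
  then show ?thesis
  proof (rule real_analytic_at_cong)
    show "\<forall>\<^sub>F u in nhds (coord x q). transition z y (transition x z u) = transition x y u"
      by (rule transition_transition[OF x cs_chart[OF z(2)] q(1) z(3)])
  qed
qed

lemma jacobian_linear:
  assumes "x \<in> coordinate_systems A" "y \<in> coordinate_systems A" "q \<in> dom_of x" "q \<in> dom_of y"
  shows "linear (jacobian x y q)"
  unfolding jacobian_def by (rule linear_frechet_derivative[OF real_analytic_differentiable[OF transition_analytic[OF assms]]])

lemma jacobian_chain:
  assumes x: "x \<in> coordinate_systems A" and y: "y \<in> coordinate_systems A" and z: "z \<in> coordinate_systems A"
    and q: "q \<in> dom_of x" "q \<in> dom_of y" "q \<in> dom_of z"
  shows "jacobian y z q (jacobian x y q v) = jacobian x z q v"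
proof -
  have "frechet_derivative (\<lambda>u. transition y z (transition x y u)) (at (coord x q)) = frechet_derivative (transition x z) (at (coord x q))"
    by (rule frechet_derivative_cong[OF transition_transition[OF x cs_chart[OF y] q(1,2)]])
  then show ?thesis
    using frechet_derivative_chain[OF real_analytic_differentiable[OF transition_analytic[OF x y q(1,2)]], of "transition y z" v]
      real_analytic_differentiable[OF transition_analytic[OF y z q(2,3)]]
    by (simp add: jacobian_def transition_at[OF x q(1)])
qed

lemma jacobian_refl:
  assumes x: "x \<in> coordinate_systems A" and q: "q \<in> dom_of x"
  shows "jacobian x x q v = v"
proof -
  have "\<forall>\<^sub>F u in nhds (coord x q). \<exists>q'. q' \<in> UNIV \<and> q' \<in> dom_of x \<and> u = coord x q' \<and> point_at x u = q'"
    by (rule chart_near[OF cs_chart[OF x]]) (use q in auto)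
  then have "\<forall>\<^sub>F u in nhds (coord x q). transition x x u = u"
    by eventually_elim (auto simp: transition_def)
  then have "frechet_derivative (transition x x) (at (coord x q)) = frechet_derivative (\<lambda>u. u) (at (coord x q))"
    by (rule frechet_derivative_cong)
  then show ?thesis by (simp add: jacobian_def)
qed

text \<open>The inverse function theorem makes the composition with \<open>\<phi>\<close> a chart on
  a smaller domain; its transitions to the atlas factor through \<open>x\<close> and the analytic
  inverse \<open>g\<close>.\<close>

lemma new_chart:
  assumes x: "x \<in> coordinate_systems A" and p: "p \<in> dom_of x" "p \<in> V" and V: "open V"
    and \<phi>: "real_analytic_at \<phi> (coord x p)" "inj (frechet_derivative \<phi> (at (coord x p)))"
  obtains z where "z \<in> coordinate_systems A" "p \<in> dom_of z" "dom_of z \<subseteq> V \<inter> dom_of x" "coord z = \<phi> \<circ> coord x"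
    "\<And>q v. q \<in> dom_of z \<Longrightarrow> jacobian x z q v = frechet_derivative \<phi> (at (coord x q)) v"
proof -
  note X = is_chart_props[OF cs_chart[OF x]]
  obtain W W' g where W: "open W" "coord x p \<in> W" "W \<subseteq> coord x ` (V \<inter> dom_of x)" "open W'" "homeomorphism W W' \<phi> g"
    "\<And>u. u \<in> W \<Longrightarrow> real_analytic_at \<phi> u" "\<And>y. y \<in> W' \<Longrightarrow> real_analytic_at g y"
  proof (rule analytic_inverse_function[OF \<phi> X(3)[OF V]])
    show "coord x p \<in> coord x ` (V \<inter> dom_of x)" using p by blast
  qed (rule that; assumption)
  define Z where "Z = {q \<in> dom_of x. coord x q \<in> W}"
  define z where "z = (Z, \<phi> \<circ> coord x)"
  have z: "dom_of z = Z" "coord z = \<phi> \<circ> coord x" by (simp_all add: z_def)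
  have Zx: "coord x ` Z = W" using W(3) by (auto simp: Z_def)
  have hx: "homeomorphism Z W (coord x) (point_at x)"
  proof -
    have "homeomorphism (dom_of x) (coord x ` dom_of x) (coord x) (point_at x)"
      using cs_chart[OF x] by (simp add: is_chart_def)
    then show ?thesis
      by (rule homeomorphism_of_subsets) (use Zx in \<open>auto simp: Z_def\<close>)
  qed
  have hz: "homeomorphism Z W' (\<phi> \<circ> coord x) (point_at x \<circ> g)"
    by (rule homeomorphism_compose[OF hx W(5)])
  have img: "coord z ` Z = W'" unfolding z(2) by (rule homeomorphism_image1[OF hz])
  \<comment> \<open>\<open>point_at\<close> is an inverse on the chart domain, which has shrunk, so
    it has to be identified anew.\<close>
  have pz: "point_at z u = point_at x (g u)" if "u \<in> W'" for u
  proof -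
    have i: "inj_on (coord z) Z" unfolding z(2) by (rule inj_on_inverseI[of Z "point_at x \<circ> g"]) (rule homeomorphism_apply1[OF hz])
    have "(point_at x \<circ> g) u \<in> Z" using homeomorphism_image2[OF hz] that by blast
    moreover have "coord z ((point_at x \<circ> g) u) = u" unfolding z(2) by (rule homeomorphism_apply2[OF hz that])
    ultimately show ?thesis unfolding z(1) using inv_into_f_eq[OF i] by simp
  qed
  have pz2: "point_at z ((\<phi> \<circ> coord x) q) = q" if "q \<in> Z" for q
    using that homeomorphism_image1[OF hz] homeomorphism_apply1[OF hz that] pz by fastforce
  have oZ: "open Z" unfolding Z_def by (rule X(4)[OF W(1)])
  have chz: "is_chart z"
    unfolding is_chart_def z(1) img
  proof (intro conjI oZ W(4))
    show "homeomorphism Z W' (coord z) (inv_into Z (coord z))"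
      unfolding z(2)
      using hz pz pz2 unfolding z
      by (simp add: homeomorphism_def cong: image_cong continuous_on_cong)
  qed
  have gq: "g (\<phi> (coord x q)) = coord x q" "coord x q \<in> W" "\<phi> (coord x q) \<in> W'" if "q \<in> Z" for q
    using that homeomorphism_apply1[OF W(5)] homeomorphism_image1[OF W(5)] by (auto simp: Z_def)
  have cz: "compatible z y" if y: "y \<in> A" for y
    unfolding compatible_def real_analytic_on_def z(1)
  proof (intro conjI ballI)
    have y': "y \<in> coordinate_systems A" using y atlas by (auto simp: coordinate_systems_def analytic_atlas_def)
    {
      fix u assume "u \<in> coord z ` (Z \<inter> dom_of y)"
      then obtain q where q: "q \<in> Z" "q \<in> dom_of y" "u = \<phi> (coord x q)" by (auto simp: z)
      have "real_analytic_at (\<lambda>u. transition x y (g u)) u"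
        unfolding q(3) by (rule real_analytic_at_compose_gen)
          (use q gq[OF q(1)] W(7) in \<open>auto simp: Z_def intro!: transition_analytic x y'\<close>)
      then show "real_analytic_at (transition z y) u"
      proof (rule real_analytic_at_cong)
        show "\<forall>\<^sub>F u in nhds u. transition x y (g u) = transition z y u"
          unfolding eventually_nhds by (rule exI[of _ W']) (use q gq[OF q(1)] W(4) pz in \<open>auto simp: transition_def\<close>)
      qed
    next
      fix u assume "u \<in> coord y ` (Z \<inter> dom_of y)"
      then obtain q where q: "q \<in> Z" "q \<in> dom_of y" "u = coord y q" by blast
      have qx: "q \<in> dom_of x" using q(1) by (simp add: Z_def)
      have "real_analytic_at (\<lambda>u. \<phi> (transition y x u)) u"
        unfolding q(3) by (rule real_analytic_at_compose_gen[OF _ transition_analytic[OF y' x q(2) qx]])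
          (use W(6) gq(2)[OF q(1)] in \<open>simp add: transition_at[OF y' q(2)]\<close>)
      then show "real_analytic_at (transition y z) u" by (simp add: transition_def[abs_def] z(2))
    }
  qed
  have zcs: "z \<in> coordinate_systems A" using chz cz by (simp add: coordinate_systems_def)
  show thesis
  proof (rule that[OF zcs])
    show "p \<in> dom_of z" using W(2) p by (simp add: z Z_def)
    show "dom_of z \<subseteq> V \<inter> dom_of x"
    proof
      fix q assume "q \<in> dom_of z"
      then have q: "q \<in> dom_of x" "coord x q \<in> coord x ` (V \<inter> dom_of x)" using W(3) by (auto simp: z Z_def)
      then obtain q' where q': "q' \<in> V" "q' \<in> dom_of x" "coord x q = coord x q'" by blast
      have "q = q'" by (rule trans[OF trans[OF X(2)[OF q(1), symmetric] arg_cong[OF q'(3), of "point_at x"]] X(2)[OF q'(2)]])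
      then show "q \<in> V \<inter> dom_of x" using q' by simp
    qed
    fix q v assume "q \<in> dom_of z"
    then have q: "q \<in> Z" "q \<in> dom_of x" by (auto simp: z Z_def)
    have "\<forall>\<^sub>F u in nhds (coord x q). transition x z u = \<phi> u"
      unfolding eventually_nhds
    proof (intro exI[of _ W] conjI ballI)
      fix u assume "u \<in> W"
      then obtain q' where "q' \<in> dom_of x" "u = coord x q'" using W(3) by blast
      then show "transition x z u = \<phi> u" by (simp only: transition_at[OF x] z(2) o_apply)
    qed (rule W(1), rule gq(2)[OF q(1)])
    from frechet_derivative_cong[OF this] show "jacobian x z q v = frechet_derivative \<phi> (at (coord x q)) v"
      by (simp add: jacobian_def)
  qed (rule z(2))
qed

end

section \<open>The torsion in coordinates\<close>

lemma frechet_derivative_apply_linear: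
  fixes T :: "real^'n \<Rightarrow> real^'k \<Rightarrow> 'b::real_normed_vector"
  assumes T: "\<forall>\<^sub>F u in nhds a. linear (T u)" and dT: "\<And>v. (\<lambda>u. T u v) differentiable (at a)" and g: "g differentiable (at a)"
  shows "frechet_derivative (\<lambda>u. T u (g u)) (at a) w =
    T a (frechet_derivative g (at a) w) + frechet_derivative (\<lambda>u. T u (g a)) (at a) w"
proof -
  have c: "frechet_derivative (\<lambda>u. T u (g u)) (at a) w = (\<Sum>j\<in>UNIV. frechet_derivative g (at a) w $ j *\<^sub>R T a (axis j 1)) +
      (\<Sum>j\<in>UNIV. g a $ j *\<^sub>R frechet_derivative (\<lambda>u. T u (axis j 1)) (at a) w)" if g: "g differentiable (at a)" for g
  proof -
    have "frechet_derivative (\<lambda>u. T u (g u)) (at a) = frechet_derivative (\<lambda>u. \<Sum>j\<in>UNIV. g u $ j *\<^sub>R T u (axis j 1)) (at a)"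
      by (rule frechet_derivative_cong) (use T in eventually_elim, rule linear_sum_axis)
    then show ?thesis by (simp only: frechet_derivative_sum_nth_scaleR[OF g dT])
  qed
  show ?thesis
    unfolding c[OF g] c[OF differentiable_const[of "g a"]] linear_sum_axis[OF eventually_nhds_x_imp_x[OF T], of "frechet_derivative g (at a) w"]
    by simp
qed

text \<open>Tensoriality of the torsion. Differentiating the intertwining relation expresses the
  derivative of \<open>P\<close> by that of \<open>M\<close> and the second derivative
  \<open>Q\<close> of \<open>\<phi>\<close>; the terms with \<open>Q\<close> cancel by its
  symmetry.\<close>

lemma nij_alg_transform:
  fixes \<phi> :: "real^'n \<Rightarrow> real^'n" and M P :: "real^'n \<Rightarrow> real^'n^'n"
  assumes \<phi>: "real_analytic_at \<phi> a" and M: "real_analytic_at M a" and P: "real_analytic_at P (\<phi> a)"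
    and eq: "\<forall>\<^sub>F u in nhds a. \<forall>v. P (\<phi> u) *v frechet_derivative \<phi> (at u) v = frechet_derivative \<phi> (at u) (M u *v v)"
  shows "nij_alg (P (\<phi> a)) (frechet_derivative P (at (\<phi> a))) (frechet_derivative \<phi> (at a) v) (frechet_derivative \<phi> (at a) w) =
    frechet_derivative \<phi> (at a) (nij_alg (M a) (frechet_derivative M (at a)) v w)"
proof -
  define J where "J = frechet_derivative \<phi> (at a)"
  define Q where "Q = (\<lambda>v w. frechet_derivative (\<lambda>u. frechet_derivative \<phi> (at u) v) (at a) w)"
  define D where "D = frechet_derivative M (at a)"
  define E where "E = frechet_derivative P (at (\<phi> a))"
  have Q: "Q v w = Q w v" for v w
    unfolding Q_def by (rule second_derivative_symmetric[OF \<phi>])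
  have lJ: "linear J" unfolding J_def by (rule linear_frechet_derivative[OF real_analytic_differentiable[OF \<phi>]])
  have PJ: "P (\<phi> a) *v J v = J (M a *v v)" for v
    using eventually_nhds_x_imp_x[OF eq] by (simp add: J_def)
  have dM: "M differentiable (at a)" and dP: "P differentiable (at (\<phi> a))" and d\<phi>: "\<phi> differentiable (at a)"
    using real_analytic_differentiable M P \<phi> by blast+
  have dJ: "(\<lambda>u. frechet_derivative \<phi> (at u) v) differentiable (at a)" for v
    by (rule real_analytic_differentiable[OF real_analytic_deriv[OF \<phi>]])
  have dP\<phi>: "(\<lambda>u. P (\<phi> u)) differentiable (at a)" by (rule differentiable_compose[OF dP d\<phi>])
  have lin: "\<forall>\<^sub>F u in nhds a. linear (frechet_derivative \<phi> (at u))"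
    using real_analytic_near[OF \<phi>] by eventually_elim (rule linear_frechet_derivative[OF real_analytic_differentiable])
  have EJ: "E (J w) *v J v = Q (M a *v v) w + J (D w *v v) - P (\<phi> a) *v Q v w" for v w
  proof -
    have "frechet_derivative (\<lambda>u. P (\<phi> u) *v frechet_derivative \<phi> (at u) v) (at a) w =
        E (J w) *v J v + P (\<phi> a) *v Q v w"
      unfolding frechet_derivative_mv(2)[OF dP\<phi> dJ] frechet_derivative_chain[OF d\<phi> dP] by (simp add: E_def J_def Q_def)
    moreover have "frechet_derivative (\<lambda>u. frechet_derivative \<phi> (at u) (M u *v v)) (at a) w = J (D w *v v) + Q (M a *v v) w"
      using frechet_derivative_apply_linear[OF lin dJ frechet_derivative_mv(1)[OF dM differentiable_const[of v]], of w]
        frechet_derivative_mv(2)[OF dM differentiable_const[of v], of w]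
      by (simp add: J_def D_def Q_def)
    moreover have "frechet_derivative (\<lambda>u. P (\<phi> u) *v frechet_derivative \<phi> (at u) v) (at a) =
        frechet_derivative (\<lambda>u. frechet_derivative \<phi> (at u) (M u *v v)) (at a)"
      by (rule frechet_derivative_cong) (use eq in eventually_elim, blast)
    ultimately show ?thesis by (simp add: algebra_simps)
  qed
  have "nij_alg (P (\<phi> a)) E (J v) (J w) = J (nij_alg (M a) D v w)"
    unfolding nij_alg_def PJ EJ linear_add[OF lJ] linear_diff[OF lJ] matrix_vector_right_distrib matrix_vector_mult_diff_distrib
    by (simp add: PJ Q)
  then show ?thesis by (simp add: J_def D_def E_def)
qed

lemma real_analytic_at_deriv_apply:
  fixes P :: "real^'n \<Rightarrow> 'b::euclidean_space"
  assumes P: "real_analytic_at P a" and g: "real_analytic_at g a"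
  shows "real_analytic_at (\<lambda>u. frechet_derivative P (at u) (g u)) a"
proof -
  have "real_analytic_at (\<lambda>u. g u $ j) a" for j using g by (simp add: real_analytic_at_vec)
  then have "real_analytic_at (\<lambda>u. \<Sum>j\<in>UNIV. g u $ j *\<^sub>R frechet_derivative P (at u) (axis j 1)) a"
    by (rule real_analytic_at_sum[OF real_analytic_at_scaleR[OF _ real_analytic_deriv[OF P]]])
  then show ?thesis
  proof (rule real_analytic_at_cong)
    show "\<forall>\<^sub>F u in nhds a. (\<Sum>j\<in>UNIV. g u $ j *\<^sub>R frechet_derivative P (at u) (axis j 1)) = frechet_derivative P (at u) (g u)"
      using real_analytic_near[OF P]
      by eventually_elim (rule linear_sum_axis[OF linear_frechet_derivative[OF real_analytic_differentiable], symmetric])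
  qed
qed

lemma real_analytic_at_nij_alg:
  fixes P :: "real^'n \<Rightarrow> real^'n^'n"
  assumes P: "real_analytic_at P a"
  shows "real_analytic_at (\<lambda>u. nij_alg (P u) (frechet_derivative P (at u)) v w) a"
  unfolding nij_alg_def
  by (rule real_analytic_at_diff real_analytic_at_add real_analytic_at_mv real_analytic_at_deriv_apply P real_analytic_at_const)+

definition torsion_at :: "('m, 'n::finite) opfield \<Rightarrow> ('m, 'n) chart \<Rightarrow> 'm \<Rightarrow> real^'n \<Rightarrow> real^'n \<Rightarrow> real^'n" where
  "torsion_at L x q = nij_alg (L x q) (frechet_derivative (in_coords x (L x)) (at (coord x q)))"

context
  fixes A :: "('m::{t2_space, second_countable_topology}, 'n::finite) chart set"
    and U :: "'m set" and L :: "('m, 'n) opfield"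
  assumes atlas: "analytic_atlas A" and U: "open U" and L: "operator_field_on A U L"
begin

lemma op_analytic:
  assumes "x \<in> coordinate_systems A" "q \<in> U" "q \<in> dom_of x"
  shows "real_analytic_at (in_coords x (L x)) (coord x q)"
  using L assms unfolding operator_field_on_def real_analytic_on_def by blast

lemma op_jacobian:
  assumes "x \<in> coordinate_systems A" "y \<in> coordinate_systems A" "q \<in> U" "q \<in> dom_of x" "q \<in> dom_of y"
  shows "L y q *v jacobian x y q v = jacobian x y q (L x q *v v)"
  using L assms unfolding operator_field_on_def by blast

text \<open>Expanding the brackets by the product rule, all derivatives of the two vector fields
  cancel; only their values at \<open>q\<close> remain.\<close>

lemma torsion_eq:
  assumes V: "V \<subseteq> U" and \<xi>: "vector_field_on A V \<xi>" and \<eta>: "vector_field_on A V \<eta>"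
    and x: "x \<in> coordinate_systems A" and q: "q \<in> V" "q \<in> dom_of x"
  shows "nijenhuis_torsion L \<xi> \<eta> x q = torsion_at L x q (\<xi> x q) (\<eta> x q)"
proof -
  let ?a = "coord x q"
  have at: "in_coords x g ?a = g q" for g :: "'m \<Rightarrow> 'b" by (rule in_coords_at[OF atlas x q(2)])
  have an: "in_coords x (\<zeta> x) differentiable (at ?a)" if "vector_field_on A V \<zeta>" for \<zeta>
    by (rule real_analytic_differentiable) (use that x q in \<open>unfold vector_field_on_def real_analytic_on_def, blast\<close>)
  have dL: "in_coords x (L x) differentiable (at ?a)"
    by (rule real_analytic_differentiable[OF op_analytic[OF x]]) (use q V in auto)
  have ap: "in_coords x (\<lambda>q. L x q *v \<zeta> x q) = (\<lambda>u. in_coords x (L x) u *v in_coords x (\<zeta> x) u)" for \<zeta>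
    by (simp only: in_coords_def)
  show ?thesis
    unfolding nijenhuis_torsion_def lie_bracket_def apply_op_def ap frechet_derivative_mv(2)[OF dL an[OF \<xi>]] frechet_derivative_mv(2)[OF dL an[OF \<eta>]] at torsion_at_def nij_alg_def
    by (simp add: matrix_vector_right_distrib matrix_vector_mult_diff_distrib)
qed

text \<open>Supplies the test fields with constant components in \<open>x\<close>. They exist only
  on the chart domain, which the definition of a Nijenhuis operator allows.\<close>

lemma constant_field:
  assumes x: "x \<in> coordinate_systems A" and V: "open V"
  shows "vector_field_on A (V \<inter> dom_of x) (\<lambda>y q. jacobian x y q v)"
  unfolding vector_field_on_def real_analytic_on_def
proof (intro conjI ballI)
  fix y u assume y: "y \<in> coordinate_systems A" and "u \<in> coord y ` (V \<inter> dom_of x \<inter> dom_of y)"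
  then obtain q where q: "q \<in> V" "q \<in> dom_of x" "q \<in> dom_of y" and u: "u = coord y q" by blast
  have "real_analytic_at (\<lambda>u. frechet_derivative (transition x y) (at u) v) (transition y x (coord y q))"
    unfolding transition_at[OF atlas y q(3)] by (rule real_analytic_deriv[OF transition_analytic[OF atlas x y q(2,3)]])
  then have "real_analytic_at (\<lambda>u. frechet_derivative (transition x y) (at (transition y x u)) v) u"
    unfolding u by (rule real_analytic_at_compose_gen[OF _ transition_analytic[OF atlas y x q(3,2)]])
  then show "real_analytic_at (in_coords y (\<lambda>q. jacobian x y q v)) u"
    by (simp only: in_coords_def jacobian_def transition_def)
next
  fix y z q assume "y \<in> coordinate_systems A" "z \<in> coordinate_systems A" "q \<in> V \<inter> dom_of x \<inter> dom_of y \<inter> dom_of z"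
  then show "jacobian x z q v = jacobian y z q (jacobian x y q v)"
    using jacobian_chain[OF atlas x, of y z q v] by simp
qed

lemma nijenhuis_on_iff:
  assumes V: "open V" "V \<subseteq> U"
  shows "nijenhuis_operator_on A V L \<longleftrightarrow> (\<forall>x\<in>coordinate_systems A. \<forall>q\<in>V \<inter> dom_of x. \<forall>v w. torsion_at L x q v w = 0)"
proof
  assume N: "nijenhuis_operator_on A V L"
  show "\<forall>x\<in>coordinate_systems A. \<forall>q\<in>V \<inter> dom_of x. \<forall>v w. torsion_at L x q v w = 0"
  proof (intro ballI allI)
    fix x q v w assume x: "x \<in> coordinate_systems A" and q: "q \<in> V \<inter> dom_of x"
    let ?W = "V \<inter> dom_of x"
    have W: "open ?W" by (rule open_Int[OF V(1) is_chart_props(1)[OF cs_chart[OF atlas x]]])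
    have "nijenhuis_torsion L (\<lambda>y q. jacobian x y q v) (\<lambda>y q. jacobian x y q w) x q = 0"
      by (rule N[unfolded nijenhuis_operator_on_def, rule_format, OF W _ constant_field[OF x V(1)] constant_field[OF x V(1)] x])
        (use q in auto)
    moreover have "?W \<subseteq> U" using V by blast
    ultimately show "torsion_at L x q v w = 0"
      using torsion_eq[OF _ constant_field[OF x V(1)] constant_field[OF x V(1)] x, of q v w] q
      by (simp add: jacobian_refl[OF atlas x])
  qed
next
  assume N: "\<forall>x\<in>coordinate_systems A. \<forall>q\<in>V \<inter> dom_of x. \<forall>v w. torsion_at L x q v w = 0"
  show "nijenhuis_operator_on A V L"
    unfolding nijenhuis_operator_on_def
  proof (intro allI impI ballI)
    fix W \<xi> \<eta> x q
    assume W: "W \<subseteq> V" and f: "vector_field_on A W \<xi>" "vector_field_on A W \<eta>" and x: "x \<in> coordinate_systems A" and q: "q \<in> W \<inter> dom_of x"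
    have "nijenhuis_torsion L \<xi> \<eta> x q = torsion_at L x q (\<xi> x q) (\<eta> x q)"
      by (rule torsion_eq[OF _ f x]) (use W V q in auto)
    then show "nijenhuis_torsion L \<xi> \<eta> x q = 0" using N x q W by auto
  qed
qed

lemma torsion_transform:
  assumes x: "x \<in> coordinate_systems A" and y: "y \<in> coordinate_systems A" and q: "q \<in> U" "q \<in> dom_of x" "q \<in> dom_of y"
  shows "torsion_at L y q (jacobian x y q v) (jacobian x y q w) = jacobian x y q (torsion_at L x q v w)"
proof -
  let ?a = "coord x q" and ?\<phi> = "transition x y"
  have \<phi>a: "?\<phi> ?a = coord y q" by (rule transition_at[OF atlas x q(2)])
  have "\<forall>\<^sub>F u in nhds ?a. \<exists>q'. q' \<in> U \<inter> dom_of y \<and> q' \<in> dom_of x \<and> u = coord x q' \<and> point_at x u = q'"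
    by (rule chart_near[OF cs_chart[OF atlas x]]) (use q U is_chart_props(1)[OF cs_chart[OF atlas y]] in auto)
  then have eq: "\<forall>\<^sub>F u in nhds ?a. \<forall>v. in_coords y (L y) (?\<phi> u) *v frechet_derivative ?\<phi> (at u) v =
      frechet_derivative ?\<phi> (at u) (in_coords x (L x) u *v v)"
  proof eventually_elim
    case (elim u)
    then obtain q' where q': "q' \<in> U" "q' \<in> dom_of y" "q' \<in> dom_of x" "u = coord x q'" by blast
    show ?case
      using op_jacobian[OF x y q'(1,3,2)]
      by (simp only: q'(4) jacobian_def transition_at[OF atlas x q'(3)] in_coords_at[OF atlas x q'(3)] in_coords_at[OF atlas y q'(2)] simp_thms)
  qed
  have P: "real_analytic_at (in_coords y (L y)) (?\<phi> ?a)" unfolding \<phi>a by (rule op_analytic[OF y q(1,3)])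
  show ?thesis
    using nij_alg_transform[OF transition_analytic[OF atlas x y q(2,3)] op_analytic[OF x q(1,2)] P eq, of v w]
    by (simp only: torsion_at_def jacobian_def \<phi>a in_coords_at[OF atlas x q(2)] in_coords_at[OF atlas y q(3)])
qed

lemma torsion_zero_transfer:
  assumes x: "x \<in> coordinate_systems A" and y: "y \<in> coordinate_systems A" and q: "q \<in> U" "q \<in> dom_of x" "q \<in> dom_of y"
    and z: "\<And>v w. torsion_at L x q v w = 0"
  shows "torsion_at L y q v w = 0"
proof -
  have j: "jacobian x y q (jacobian y x q v) = v" for v
    using jacobian_chain[OF atlas y x y q(3,2,3), of v] jacobian_refl[OF atlas y q(3)] by simp
  show ?thesis
    using torsion_transform[OF x y q, of "jacobian y x q v" "jacobian y x q w"]
    by (simp add: j z linear_0[OF jacobian_linear[OF atlas x y q(2,3)]])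
qed

text \<open>By the identity theorem, on a coordinate ball it suffices that the torsion vanishes near the centre.\<close>

lemma nijenhuis_local:
  assumes p: "p \<in> U"
  obtains U\<^sub>0 where "open U\<^sub>0" "p \<in> U\<^sub>0" "U\<^sub>0 \<subseteq> U"
    "\<And>V x. open V \<Longrightarrow> V \<subseteq> U\<^sub>0 \<Longrightarrow> x \<in> coordinate_systems A \<Longrightarrow> p \<in> dom_of x \<Longrightarrow> dom_of x \<subseteq> U \<Longrightarrow>
       \<forall>q\<in>dom_of x. \<forall>v w. torsion_at L x q v w = 0 \<Longrightarrow> nijenhuis_operator_on A V L"
proof -
  obtain y where y: "y \<in> coordinate_systems A" "p \<in> dom_of y" by (rule atlas_chart_exists[OF atlas])
  note Y = is_chart_props[OF cs_chart[OF atlas y(1)]]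
  have "coord y p \<in> coord y ` (U \<inter> dom_of y)" using p y by blast
  \<comment> \<open>The ball depends on neither the later \<open>V\<close> nor the chart
    \<open>x\<close>, whose domain may be tiny. It is connected and lies over \<open>U\<close>, so
    vanishing near \<open>p\<close> spreads over all of it; \<open>V\<close> itself need not be
    connected.\<close>
  then obtain r where r: "r > 0" "ball (coord y p) r \<subseteq> coord y ` (U \<inter> dom_of y)"
    using Y(3)[OF U] unfolding open_contains_ball by blast
  let ?B = "ball (coord y p) r"
  define U\<^sub>0 where "U\<^sub>0 = {q \<in> dom_of y. coord y q \<in> ?B}"
  have U0: "q \<in> U" if "q \<in> U\<^sub>0" for q
  proof -
    have q: "q \<in> dom_of y" "coord y q \<in> coord y ` (U \<inter> dom_of y)" using that r(2) by (auto simp: U\<^sub>0_def)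
    then obtain q' where q': "q' \<in> U" "q' \<in> dom_of y" "coord y q = coord y q'" by blast
    have "q = q'" by (rule trans[OF trans[OF Y(2)[OF q(1), symmetric] arg_cong[OF q'(3), of "point_at y"]] Y(2)[OF q'(2)]])
    then show ?thesis using q' by simp
  qed
  show thesis
  proof (rule that)
    show "open U\<^sub>0" unfolding U\<^sub>0_def by (rule Y(4)) simp
    show "p \<in> U\<^sub>0" using y r by (simp add: U\<^sub>0_def)
    show "U\<^sub>0 \<subseteq> U" using U0 by blast
    fix V x
    assume V: "open V" "V \<subseteq> U\<^sub>0" and x: "x \<in> coordinate_systems A" "p \<in> dom_of x" "dom_of x \<subseteq> U"
      and "\<forall>q\<in>dom_of x. \<forall>v w. torsion_at L x q v w = 0"
    then have z: "q \<in> dom_of x \<Longrightarrow> torsion_at L x q v w = 0" for q v w by blast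
    let ?N = "\<lambda>v w u. nij_alg (in_coords y (L y) u) (frechet_derivative (in_coords y (L y)) (at u)) v w"
    have N: "?N v w (coord y q) = torsion_at L y q v w" if "q \<in> dom_of y" for q v w
      unfolding torsion_at_def in_coords_at[OF atlas y(1) that] ..
    have "\<forall>\<^sub>F u in nhds (coord y p). \<exists>q'. q' \<in> dom_of x \<and> q' \<in> dom_of y \<and> u = coord y q' \<and> point_at y u = q'"
      by (rule chart_near[OF cs_chart[OF atlas y(1)] x(2) y(2) is_chart_props(1)[OF cs_chart[OF atlas x(1)]]])
    then have near: "\<forall>\<^sub>F u in nhds (coord y p). ?N v w u $ i = 0" for v w i
    proof eventually_elim
      case (elim u)
      then obtain q where q: "q \<in> dom_of x" "q \<in> dom_of y" "u = coord y q" by blast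
      have "torsion_at L y q v w = 0"
        by (rule torsion_zero_transfer[OF x(1) y(1) _ q(1,2) z]) (use q x in auto)
      then show ?case unfolding q(3) N[OF q(2)] by simp
    qed
    have zero: "?N v w u $ i = 0" if u: "u \<in> ?B" for v w u i
    proof (rule real_analytic_identity[of ?B "\<lambda>u. ?N v w u $ i" "coord y p"])
      fix u assume "u \<in> ?B"
      then obtain q where q: "q \<in> U" "q \<in> dom_of y" "u = coord y q" using r(2) by blast
      show "real_analytic_at (\<lambda>u. ?N v w u $ i) u"
        using real_analytic_at_nij_alg[OF op_analytic[OF y(1) q(1,2)]] unfolding q(3) real_analytic_at_vec by blast
    qed (use near u r in auto)
    show "nijenhuis_operator_on A V L"
    proof (subst nijenhuis_on_iff[OF V(1)])
      show "V \<subseteq> U" using V(2) U0 by blast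
      show "\<forall>x\<in>coordinate_systems A. \<forall>q\<in>V \<inter> dom_of x. \<forall>v w. torsion_at L x q v w = 0"
      proof (intro ballI allI)
        fix x' q v w assume x': "x' \<in> coordinate_systems A" and q: "q \<in> V \<inter> dom_of x'"
        have q0: "q \<in> U\<^sub>0" "q \<in> dom_of y" "coord y q \<in> ?B" using q V(2) by (auto simp: U\<^sub>0_def)
        have t: "torsion_at L y q v w = 0" for v w
          using zero[OF q0(3)] unfolding N[OF q0(2)] by (simp add: vec_eq_iff)
        show "torsion_at L x' q v w = 0"
          by (rule torsion_zero_transfer[OF y(1) x' U0[OF q0(1)] q0(2) _ t]) (use q in auto)
      qed
    qed
  qed
qed

end

section \<open>Companion charts\<close>

text \<open>Preimages of invariant subspaces under an intertwining map are invariant.\<close>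

lemma cyclic_transport:
  assumes R: "linear R" "surj R" "\<And>v. B' *v R v = R (B *v v)" and c: "cyclic B \<xi>"
  shows "cyclic B' (R \<xi>)"
  unfolding cyclic_def
proof (intro allI impI)
  fix S assume S: "subspace S" "R \<xi> \<in> S" "\<forall>v\<in>S. B' *v v \<in> S"
  have "R -` S = UNIV"
  proof (rule c[unfolded cyclic_def, rule_format])
    show "subspace (R -` S)" by (rule linear_subspace_vimage[OF R(1) S(1)])
    show "\<xi> \<in> R -` S" using S by simp
    show "B *v v \<in> R -` S" if "v \<in> R -` S" for v using S(3) that by (simp flip: R(3))
  qed
  then show "S = UNIV" using R(2) by (metis surj_image_vimage_eq)
qed

lemma cyclic_nonzero: "cyclic B \<xi> \<Longrightarrow> \<xi> \<noteq> (0 :: real^'n)"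
proof
  assume "cyclic B \<xi>" "\<xi> = 0"
  then have "{0 :: real^'n} = UNIV" unfolding cyclic_def 
    by (elim allE[of _ "{0}"]) (simp add: subspace_single_0)
  then have "axis undefined 1 = (0 :: real^'n)" by blast
  then show False by (simp add: axis_eq_0_iff)
qed

text \<open>A rotation onto the prescribed direction followed by a rescaling.\<close>

lemma linear_bij_exists:
  fixes \<xi> \<eta> :: "real^'n"
  assumes "\<xi> \<noteq> 0" "norm \<eta> = 1"
  obtains R where "linear R" "bij R" "R \<xi> = \<eta>"
proof -
  obtain T where T: "orthogonal_transformation T" "T \<xi> = norm \<xi> *\<^sub>R \<eta>"
    by (rule orthogonal_transformation_exists[of \<xi> "norm \<xi> *\<^sub>R \<eta>"]) (use assms in auto)
  show thesis
  proof (rule that[of "\<lambda>v. (1 / norm \<xi>) *\<^sub>R T v"])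
    have l: "linear T" by (rule orthogonal_transformation_linear[OF T(1)])
    show lin: "linear (\<lambda>v. (1 / norm \<xi>) *\<^sub>R T v)"
      by (rule linear_compose_scale_right[OF l])
    have "inj (\<lambda>v. (1 / norm \<xi>) *\<^sub>R T v)"
      using orthogonal_transformation_inj[OF T(1)] assms(1) by (simp add: inj_def)
    then show "bij (\<lambda>v. (1 / norm \<xi>) *\<^sub>R T v)"
      using linear_injective_imp_surjective[OF lin] by (simp add: bij_def)
    show "(1 / norm \<xi>) *\<^sub>R T \<xi> = \<eta>" using assms by (simp add: T(2))
  qed
qed

lemma partial_deriv_eq:
  assumes "in_coords x g differentiable (at (coord x q))"
  shows "partial_deriv e x j g q = frechet_derivative (in_coords x g) (at (coord x q)) (axis (e j) 1)"
proof -
  let ?a = "coord x q" and ?v = "axis (e j) (1::real)"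
  have l: "linear (frechet_derivative (in_coords x g) (at ?a))" by (rule linear_frechet_derivative[OF assms])
  have "((\<lambda>t. ?a + t *\<^sub>R ?v) has_derivative (\<lambda>t. t *\<^sub>R ?v)) (at 0)" by (auto intro!: derivative_eq_intros)
  moreover have "(in_coords x g has_derivative frechet_derivative (in_coords x g) (at ?a)) (at (?a + 0 *\<^sub>R ?v))"
    using assms by (simp add: frechet_derivative_works)
  ultimately have "((\<lambda>t. in_coords x g (?a + t *\<^sub>R ?v)) has_derivative (\<lambda>t. frechet_derivative (in_coords x g) (at ?a) (t *\<^sub>R ?v))) (at 0)"
    by (rule has_derivative_compose)
  then have "((\<lambda>t. in_coords x g (?a + t *\<^sub>R ?v)) has_field_derivative frechet_derivative (in_coords x g) (at ?a) ?v) (at 0)"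
    by (simp add: has_field_derivative_def linear_scale[OF l] mult_commute_abs)
  then show ?thesis unfolding partial_deriv_def by (rule DERIV_imp_deriv)
qed

context
  fixes A :: "('m::{t2_space, second_countable_topology}, 'n::finite) chart set"
    and U :: "'m set" and L :: "('m, 'n) opfield" and f :: "nat \<Rightarrow> 'm \<Rightarrow> real" and e :: "nat \<Rightarrow> 'n"
  assumes atlas: "analytic_atlas A" and U: "open U" and L: "operator_field_on A U L"
    and gl: "gl_regular_on A U L" and e: "bij_betw e {1..CARD('n)} UNIV"
    and char_poly: "\<forall>x\<in>coordinate_systems A. \<forall>q\<in>U \<inter> dom_of x. \<forall>t.
       det (mat t - L x q) = t ^ CARD('n) - (\<Sum>i=1..CARD('n). f i q * t ^ (CARD('n) - i))"
begin

lemma op_char_coeffs: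
  assumes "x \<in> coordinate_systems A" "q \<in> U" "q \<in> dom_of x"
  shows "char_coeffs (\<lambda>i. f i q) (L x q)"
  by (rule cayley_hamilton) (use char_poly assms in blast)

lemma op_near:
  assumes x: "x \<in> coordinate_systems A" and q: "q \<in> U" "q \<in> dom_of x"
  shows "\<forall>\<^sub>F u in nhds (coord x q). char_coeffs (\<lambda>i. in_coords x (f i) u) (in_coords x (L x) u)"
    and "\<forall>\<^sub>F u in nhds (coord x q). gl_regular (in_coords x (L x) u)"
proof -
  have n: "\<forall>\<^sub>F u in nhds (coord x q). \<exists>q'. q' \<in> U \<and> q' \<in> dom_of x \<and> u = coord x q' \<and> point_at x u = q'"
    by (rule chart_near[OF cs_chart[OF atlas x] q U])
  show "\<forall>\<^sub>F u in nhds (coord x q). char_coeffs (\<lambda>i. in_coords x (f i) u) (in_coords x (L x) u)"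
    using n by eventually_elim (use op_char_coeffs[OF x] in \<open>auto simp: in_coords_def\<close>)
  show "\<forall>\<^sub>F u in nhds (coord x q). gl_regular (in_coords x (L x) u)"
    using n by eventually_elim (use gl x in \<open>auto simp: in_coords_def gl_regular_on_def\<close>)
qed

text \<open>The \<open>f\<^sub>i\<close> are not assumed analytic. In a companion chart the last
  axis is cyclic at every point, and this yields their analyticity on the whole domain.\<close>

lemma companion_chart_derivative:
  assumes x: "x \<in> coordinate_systems A" and dom: "dom_of x \<subseteq> U" and K: "K = comp1_mat e \<or> K = comp2_mat e"
    and comp: "\<forall>q\<in>dom_of x. L x q = K (\<lambda>i. f i q)" and q: "q \<in> dom_of x"
  shows "i \<in> {1..CARD('n)} \<Longrightarrow> real_analytic_at (in_coords x (f i)) (coord x q)"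
    and "\<forall>\<^sub>F u in nhds (coord x q). in_coords x (L x) u = K (\<lambda>i. in_coords x (f i) u)"
    and "frechet_derivative (in_coords x (L x)) (at (coord x q)) =
      frechet_derivative (\<lambda>u. K (\<lambda>i. in_coords x (f i) u)) (at (coord x q))"
proof -
  have qU: "q \<in> U" using q dom by blast
  have "cyclic (in_coords x (L x) (coord x q)) (axis (e CARD('n)) 1)"
    unfolding in_coords_at[OF atlas x q] bspec[OF comp q] using K comp1_cyclic[OF e] comp2_cyclic[OF e] by auto
  then show "i \<in> {1..CARD('n)} \<Longrightarrow> real_analytic_at (in_coords x (f i)) (coord x q)"
    by (rule real_analytic_at_char_coeff[OF op_analytic[OF atlas U L x qU q] op_near(1)[OF x qU q]])
  have "\<forall>\<^sub>F u in nhds (coord x q). \<exists>q'. q' \<in> U \<and> q' \<in> dom_of x \<and> u = coord x q' \<and> point_at x u = q'"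
    by (rule chart_near[OF cs_chart[OF atlas x] qU q U])
  then show near: "\<forall>\<^sub>F u in nhds (coord x q). in_coords x (L x) u = K (\<lambda>i. in_coords x (f i) u)"
    by eventually_elim (use comp in \<open>auto simp: in_coords_def\<close>)
  show "frechet_derivative (in_coords x (L x)) (at (coord x q)) =
      frechet_derivative (\<lambda>u. K (\<lambda>i. in_coords x (f i) u)) (at (coord x q))"
    by (rule frechet_derivative_cong[OF near])
qed

lemma comp1_chart_torsion:
  assumes n2: "CARD('n) \<ge> 2" and x: "x \<in> coordinate_systems A" and dom: "dom_of x \<subseteq> U"
    and comp: "\<forall>q\<in>dom_of x. L x q = comp1_mat e (\<lambda>i. f i q)" and q: "q \<in> dom_of x"
  shows "(\<forall>v w. torsion_at L x q v w = 0) \<longleftrightarrow>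
    (\<forall>i\<in>{1..CARD('n) - 1}. \<forall>j\<in>{1..CARD('n) - 1}.
      partial_deriv e x j (f i) q = f i q * partial_deriv e x (j + 1) (f 1) q + partial_deriv e x (j + 1) (f (i + 1)) q \<and>
      partial_deriv e x j (f CARD('n)) q = f CARD('n) q * partial_deriv e x (j + 1) (f 1) q)"
proof -
  let ?n = "CARD('n)" and ?a = "coord x q"
  note C = companion_chart_derivative[OF x dom disjI1[OF refl] comp q]
  let ?df = "\<lambda>i. frechet_derivative (in_coords x (f i)) (at ?a)"
  have D: "frechet_derivative (in_coords x (L x)) (at ?a) w *v v = v $ e 1 *\<^sub>R (\<chi> i. ?df (eidx e i) w)" for v w
    unfolding C(3) by (rule comp1_derivative[OF e]) (rule C(1))
  have lin: "linear (?df i)" if "i \<in> {1..?n}" for i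
    by (rule linear_frechet_derivative[OF real_analytic_differentiable[OF C(1)[OF that]]])
  have pd: "?df i (axis (e j) 1) = partial_deriv e x j (f i) q" if "i \<in> {1..?n}" for i j
    by (rule partial_deriv_eq[OF real_analytic_differentiable[OF C(1)[OF that]], symmetric])
  have "(\<forall>v w. torsion_at L x q v w = 0) \<longleftrightarrow>
    (\<forall>j\<in>{1..?n - 1}. \<forall>i\<in>{1..?n}. ?df i (axis (e j) 1) =
      f i q * ?df 1 (axis (e (j + 1)) 1) + (if i < ?n then ?df (i + 1) (axis (e (j + 1)) 1) else 0))"
    unfolding torsion_at_def bspec[OF comp q] by (rule comp1_nij_iff[OF e D lin])
  also have "\<dots> \<longleftrightarrow> (\<forall>j\<in>{1..?n - 1}. \<forall>i\<in>{1..?n}. partial_deriv e x j (f i) q =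
      f i q * partial_deriv e x (j + 1) (f 1) q + (if i < ?n then partial_deriv e x (j + 1) (f (i + 1)) q else 0))"
    by (intro ball_cong refl) (simp add: pd)
  also have "\<dots> \<longleftrightarrow> (\<forall>i\<in>{1..?n - 1}. \<forall>j\<in>{1..?n - 1}.
      partial_deriv e x j (f i) q = f i q * partial_deriv e x (j + 1) (f 1) q + partial_deriv e x (j + 1) (f (i + 1)) q \<and>
      partial_deriv e x j (f ?n) q = f ?n q * partial_deriv e x (j + 1) (f 1) q)"
  proof -
    \<comment> \<open>The row \<open>i = n\<close> is split off. Its equation stands under the
      quantifier over \<open>i\<close> in \<open>{1..n-1}\<close>, which is nonempty because
      \<open>n \<ge> 2\<close>.\<close>
    have s: "{1..?n} = insert ?n {1..?n - 1}" and ne: "1 \<in> {1..?n - 1}" using n2 by auto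
    have lt: "i < ?n" if "i \<in> {1..?n - 1}" for i using that by auto
    show ?thesis unfolding s ball_simps(7) using ne lt by auto
  qed
  finally show ?thesis .
qed

text \<open>Differentiating \<open>\<omega>(L w)\<close> also differentiates \<open>L\<close>; this
  adds the last axis paired with \<open>\<omega>\<close>, which is \<open>f\<^sub>1\<close>. The
  second exterior derivative therefore differs from the algebraic symmetry condition only by a
  multiple of the first.\<close>

lemma comp2_chart_torsion:
  assumes n2: "CARD('n) \<ge> 2" and x: "x \<in> coordinate_systems A" and dom: "dom_of x \<subseteq> U"
    and comp: "\<forall>q\<in>dom_of x. L x q = comp2_mat e (\<lambda>i. f i q)" and q: "q \<in> dom_of x"
  shows "(\<forall>v w. torsion_at L x q v w = 0) \<longleftrightarrow>
    (\<forall>v w. ext_deriv (omega_form e x f) (coord x q) v w = 0) \<and>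
    (\<forall>v w. ext_deriv (pullback_op L x (omega_form e x f)) (coord x q) v w = 0)"
proof -
  let ?n = "CARD('n)" and ?a = "coord x q" and ?M = "in_coords x (L x)"
  note C = companion_chart_derivative[OF x dom disjI2[OF refl] comp q]
  let ?df = "\<lambda>i. frechet_derivative (in_coords x (f i)) (at ?a)"
  define om where "om = (\<lambda>w v. \<Sum>k=1..?n. ?df (?n + 1 - k) w * v $ e k)"
  have qU: "q \<in> U" using q dom by blast
  have Ma: "?M ?a = L x q" by (rule in_coords_at[OF atlas x q])
  have D: "frechet_derivative ?M (at ?a) w *v v = om w v *\<^sub>R axis (e ?n) 1" for v w
    unfolding C(3) om_def by (rule comp2_derivative[OF e]) (rule C(1))
  have f: "in_coords x (f (?n + 1 - k)) differentiable (at ?a)" if "k \<in> {1..?n}" for k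
    by (rule real_analytic_differentiable[OF C(1)]) (use that in auto)
  have dM: "?M differentiable (at ?a)" by (rule real_analytic_differentiable[OF op_analytic[OF atlas U L x qU q]])
  have dom1: "((\<lambda>u. omega_form e x f u (g u)) has_derivative (\<lambda>w. om w (g ?a) + omega_form e x f ?a (frechet_derivative g (at ?a) w))) (at ?a)"
    if g: "g differentiable (at ?a)" for g
  proof -
    have "((\<lambda>u. g u $ e k) has_derivative (\<lambda>w. frechet_derivative g (at ?a) w $ e k)) (at ?a)" for k
      using g by (intro bounded_linear.has_derivative[OF bounded_linear_vec_nth]) (simp add: frechet_derivative_works)
    then have "((\<lambda>u. \<Sum>k=1..?n. in_coords x (f (?n + 1 - k)) u * g u $ e k) has_derivative
      (\<lambda>w. \<Sum>k=1..?n. in_coords x (f (?n + 1 - k)) ?a * frechet_derivative g (at ?a) w $ e k + ?df (?n + 1 - k) w * g ?a $ e k)) (at ?a)"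
      by (intro has_derivative_sum has_derivative_mult) (use f in \<open>simp_all add: frechet_derivative_works\<close>)
    then show ?thesis by (simp add: omega_form_def om_def sum.distrib add.commute)
  qed
  have om0: "omega_form e x f ?a (r *\<^sub>R axis (e ?n) 1) = r * f 1 q" for r
  proof -
    have n: "?n \<in> {1..?n}" by (simp add: Suc_le_eq)
    have "omega_form e x f ?a (r *\<^sub>R axis (e ?n) 1) = (\<Sum>k=1..?n. if k = ?n then r * f 1 q else 0)"
      unfolding omega_form_def
      by (intro sum.cong refl) (use n in \<open>auto simp: axis_e[OF e] in_coords_at[OF atlas x q]\<close>)
    then show ?thesis using n by simp
  qed
  have "frechet_derivative (\<lambda>u. omega_form e x f u w) (at ?a) v = om v w" for v w
    using fun_cong[OF frechet_derivative_at[OF dom1[OF differentiable_const[of w]]], of v]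
    by (simp add: omega_form_def)
  then have E1: "ext_deriv (omega_form e x f) ?a v w = om v w - om w v" for v w by (simp add: ext_deriv_def)
  have "frechet_derivative (\<lambda>u. omega_form e x f u (?M u *v w)) (at ?a) v = om v (L x q *v w) + om v w * f 1 q" for v w
    using fun_cong[OF frechet_derivative_at[OF dom1[OF frechet_derivative_mv(1)[OF dM differentiable_const[of w]]]], of v]
    by (simp add: frechet_derivative_mv(2)[OF dM differentiable_const] D om0 Ma)
  then have E2: "ext_deriv (pullback_op L x (omega_form e x f)) ?a v w =
      om v (L x q *v w) - om w (L x q *v v) + f 1 q * (om v w - om w v)" for v w
    by (simp add: ext_deriv_def pullback_op_def algebra_simps)
  have "(\<forall>v w. torsion_at L x q v w = 0) \<longleftrightarrow> (\<forall>v w. om v w = om w v) \<and> (\<forall>v w. om (L x q *v v) w = om (L x q *v w) v)"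
    unfolding torsion_at_def bspec[OF comp q] by (rule comp2_nij_iff[OF e n2 D])
  also have "\<dots> \<longleftrightarrow> (\<forall>v w. om v w = om w v) \<and> (\<forall>v w. om v (L x q *v w) = om w (L x q *v v))"
    by metis
  finally show ?thesis unfolding E1 E2 by (auto simp: algebra_simps)
qed

text \<open>Two changes of coordinates: an affine one normalising the point and the cyclic vector,
  then the intertwiner \<open>H\<close>.\<close>

lemma companion_chart_exists:
  assumes V: "open V" "p \<in> V" "V \<subseteq> U" and N: "\<forall>x\<in>coordinate_systems A. \<forall>q\<in>V \<inter> dom_of x. \<forall>v w. torsion_at L x q v w = 0"
    and K: "K = comp1_mat e \<or> K = comp2_mat e"
  obtains x where "x \<in> coordinate_systems A" "p \<in> dom_of x" "dom_of x \<subseteq> V" "\<forall>q\<in>dom_of x. L x q = K (\<lambda>i. f i q)"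
proof -
  have pU: "p \<in> U" using V by blast
  obtain y where y: "y \<in> coordinate_systems A" "p \<in> dom_of y" by (rule atlas_chart_exists[OF atlas])
  have "gl_regular (L y p)" using gl y pU by (auto simp: gl_regular_on_def)
  then obtain \<xi> where \<xi>: "cyclic (L y p) \<xi>" by (rule gl_regular_cyclic[OF _ op_char_coeffs[OF y(1) pU y(2)]])
  obtain R :: "real^'n \<Rightarrow> real^'n" where R: "linear R" "bij R" "R \<xi> = axis piv 1"
    by (rule linear_bij_exists[OF cyclic_nonzero[OF \<xi>] norm_axis_1[of piv]]) (rule that; assumption)
  \<comment> \<open>Moves \<open>p\<close> to the origin, where the power series theory is set up,
    and the cyclic vector at \<open>p\<close> to the axis \<open>piv\<close>.\<close>
  let ?R = "\<lambda>u. R (u - coord y p)"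
  have dR: "frechet_derivative ?R (at u) = R" for u
  proof -
    have "((\<lambda>u. u - coord y p) has_derivative (\<lambda>v. v)) (at u)" by (auto intro!: derivative_eq_intros)
    then have "(?R has_derivative (\<lambda>v. R v)) (at u)"
      by (rule bounded_linear.has_derivative[OF linear_conv_bounded_linear[THEN iffD1, OF R(1)]])
    from frechet_derivative_at[OF this] show ?thesis by (rule sym)
  qed
  have anR: "real_analytic_at ?R (coord y p)"
    by (rule real_analytic_at_linear[OF linear_conv_bounded_linear[THEN iffD1, OF R(1)]
      real_analytic_at_diff[OF real_analytic_at_ident real_analytic_at_const]])
  have injR: "inj (frechet_derivative ?R (at (coord y p)))" unfolding dR by (rule bij_is_inj[OF R(2)])
  obtain z where z: "z \<in> coordinate_systems A" "p \<in> dom_of z" "dom_of z \<subseteq> V \<inter> dom_of y" "coord z = ?R \<circ> coord y"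
    "\<And>q v. q \<in> dom_of z \<Longrightarrow> jacobian y z q v = frechet_derivative ?R (at (coord y q)) v"
    by (rule new_chart[OF atlas y V(2,1) anR injR]) (rule that; assumption)
  have zp: "coord z p = 0" by (simp add: z(4) linear_0[OF R(1)])
  have Mp: "in_coords z (L z) 0 = L z p" using in_coords_at[OF atlas z(1,2), of "L z"] by (simp add: zp)
  have cyc: "cyclic (in_coords z (L z) 0) (axis piv 1)"
    unfolding Mp R(3)[symmetric]
    by (rule cyclic_transport[OF R(1) bij_is_surj[OF R(2)] _ \<xi>])
      (use op_jacobian[OF atlas U L y(1) z(1) pU y(2) z(2)] z(2,5) dR in simp)
  have "\<forall>\<^sub>F u in nhds (coord z p). \<exists>q'. q' \<in> V \<and> q' \<in> dom_of z \<and> u = coord z q' \<and> point_at z u = q'"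
    by (rule chart_near[OF cs_chart[OF atlas z(1)] V(2) z(2) V(1)])
  then have Nz: "\<forall>\<^sub>F u in nhds 0. \<forall>v w. nij_alg (in_coords z (L z) u) (frechet_derivative (in_coords z (L z)) (at u)) v w = 0"
    unfolding zp
  proof eventually_elim
    case (elim u)
    then obtain q where q: "q \<in> V" "q \<in> dom_of z" "u = coord z q" by blast
    have "torsion_at L z q v w = 0" for v w using N z(1) q(1,2) by blast
    then show ?case by (simp only: torsion_at_def q(3) in_coords_at[OF atlas z(1) q(2)] simp_thms)
  qed
  obtain H where H: "real_analytic_at H 0" "bij (frechet_derivative H (at 0))"
    "\<forall>\<^sub>F u in nhds 0. \<forall>v. frechet_derivative H (at u) (in_coords z (L z) u *v v) = K (\<lambda>i. in_coords z (f i) u) *v frechet_derivative H (at u) v"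
    by (rule companion_coordinates[OF e op_analytic[OF atlas U L z(1) pU z(2), unfolded zp] op_near(2)[OF z(1) pU z(2), unfolded zp]
        op_near(1)[OF z(1) pU z(2), unfolded zp] Nz cyc K]) (rule that; assumption)
  obtain S where S: "open S" "0 \<in> S" "\<And>u v. u \<in> S \<Longrightarrow>
      frechet_derivative H (at u) (in_coords z (L z) u *v v) = K (\<lambda>i. in_coords z (f i) u) *v frechet_derivative H (at u) v"
    using H(3) unfolding eventually_nhds by blast
  define V' where "V' = {q \<in> dom_of z. coord z q \<in> S}"
  have V': "open V'" "p \<in> V'" unfolding V'_def using is_chart_props(4)[OF cs_chart[OF atlas z(1)] S(1)] z(2) S(2) zp by auto
  have H': "real_analytic_at H (coord z p)" "inj (frechet_derivative H (at (coord z p)))"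
    using H(1) bij_is_inj[OF H(2)] by (simp_all add: zp)
  obtain x where x: "x \<in> coordinate_systems A" "p \<in> dom_of x" "dom_of x \<subseteq> V' \<inter> dom_of z"
    "\<And>q v. q \<in> dom_of x \<Longrightarrow> jacobian z x q v = frechet_derivative H (at (coord z q)) v"
    by (rule new_chart[OF atlas z(1,2) V'(2,1) H']) (rule that; assumption)
  show thesis
  proof (rule that[OF x(1,2)])
    show "dom_of x \<subseteq> V" using x(3) z(3) by blast
    show "\<forall>q\<in>dom_of x. L x q = K (\<lambda>i. f i q)"
    proof
      fix q assume q: "q \<in> dom_of x"
      then have qz: "q \<in> dom_of z" "coord z q \<in> S" "q \<in> U" using x(3) z(3) V(3) by (auto simp: V'_def)
      \<comment> \<open>Every vector is an image under the Jacobian, so the intertwining relation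
        determines the whole matrix \<open>L x q\<close>.\<close>
      have j: "jacobian z x q (jacobian x z q v) = v" for v
        using jacobian_chain[OF atlas x(1) z(1) x(1) q qz(1) q, of v] jacobian_refl[OF atlas x(1) q] by simp
      have "L x q *v jacobian z x q w = K (\<lambda>i. f i q) *v jacobian z x q w" for w
        using op_jacobian[OF atlas U L z(1) x(1) qz(3,1) q, of w] S(3)[OF qz(2), of w]
        by (simp only: x(4)[OF q] in_coords_at[OF atlas z(1) qz(1)])
      from this[of "jacobian x z q _"] show "L x q = K (\<lambda>i. f i q)"
        unfolding j matrix_eq by blast
    qed
  qed
qed

end

section \<open>Assembling the equivalence\<close>

lemma mat_eq_entries:
  assumes e: "bij_betw e {1..CARD('n)} (UNIV :: 'n::finite set)"
  shows "B = (\<chi> i j. k (eidx e i) (eidx e j)) \<longleftrightarrow> (\<forall>i\<in>{1..CARD('n)}. \<forall>j\<in>{1..CARD('n)}. B $ e i $ e j = k i j)"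
proof
  assume "B = (\<chi> i j. k (eidx e i) (eidx e j))"
  then show "\<forall>i\<in>{1..CARD('n)}. \<forall>j\<in>{1..CARD('n)}. B $ e i $ e j = k i j" by (simp add: eidx(1)[OF e])
next
  assume *: "\<forall>i\<in>{1..CARD('n)}. \<forall>j\<in>{1..CARD('n)}. B $ e i $ e j = k i j"
  have "B $ i $ j = k (eidx e i) (eidx e j)" for i j
    using *[rule_format, OF eidx(3)[OF e, of i] eidx(3)[OF e, of j]] by (simp add: eidx(2)[OF e])
  then show "B = (\<chi> i j. k (eidx e i) (eidx e j))" by (simp add: vec_eq_iff)
qed

text \<open>Sufficiently small means contained in \<open>U\<^sub>0\<close>, chosen before
  \<open>V\<close>: a chart as in (ii) or (iii) controls the torsion only on its own domain, whereas
  (i) speaks about all of \<open>V\<close>.\<close>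

theorem theorem1p1:
  fixes A :: "('m::{t2_space, second_countable_topology}, 'n::finite) chart set"
    and L :: "('m, 'n) opfield"
    and f :: "nat \<Rightarrow> 'm \<Rightarrow> real"
    and e :: "nat \<Rightarrow> 'n"
    and U :: "'m set" and p :: 'm and n :: nat
  assumes dim: "n = CARD('n)" "n \<ge> 2"
    and enum: "bij_betw e {1..n} UNIV"
    and atlas: "analytic_atlas A"
    and nbhd: "open U" "p \<in> U"
    and L: "operator_field_on A U L" "gl_regular_on A U L"
    and char_poly: "\<And>x q t. x \<in> coordinate_systems A \<Longrightarrow> q \<in> U \<inter> dom_of x \<Longrightarrow>
       det (mat t - L x q) = t ^ n - (\<Sum>i=1..n. f i q * t ^ (n - i))"
  shows "\<exists>U\<^sub>0. open U\<^sub>0 \<and> p \<in> U\<^sub>0 \<and> U\<^sub>0 \<subseteq> U \<and>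
    (\<forall>V. open V \<longrightarrow> p \<in> V \<longrightarrow> V \<subseteq> U\<^sub>0 \<longrightarrow>
      (nijenhuis_operator_on A V L \<longleftrightarrow>
        (\<exists>x\<in>coordinate_systems A. p \<in> dom_of x \<and> dom_of x \<subseteq> V \<and>
          (\<forall>q\<in>dom_of x.
            (\<forall>i\<in>{1..n}. \<forall>j\<in>{1..n}. L x q $ e i $ e j = comp1_entry (\<lambda>k. f k q) i j) \<and>
            (\<forall>i\<in>{1..n-1}. \<forall>j\<in>{1..n-1}.
               partial_deriv e x j (f i) q =
                 f i q * partial_deriv e x (j + 1) (f 1) q
                 + partial_deriv e x (j + 1) (f (i + 1)) q \<and>
               partial_deriv e x j (f n) q = f n q * partial_deriv e x (j + 1) (f 1) q)))) \<and>
      (nijenhuis_operator_on A V L \<longleftrightarrow>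
        (\<exists>x\<in>coordinate_systems A. p \<in> dom_of x \<and> dom_of x \<subseteq> V \<and>
          (\<forall>q\<in>dom_of x. \<forall>i\<in>{1..n}. \<forall>j\<in>{1..n}.
             L x q $ e i $ e j = comp2_entry n (\<lambda>k. f k q) i j) \<and>
          closed_form_on (omega_form e x f) (coord x ` dom_of x) \<and>
          closed_form_on (pullback_op L x (omega_form e x f)) (coord x ` dom_of x))))"
proof -
  let ?pde = "\<lambda>x q. \<forall>i\<in>{1..n-1}. \<forall>j\<in>{1..n-1}.
    partial_deriv e x j (f i) q =
      f i q * partial_deriv e x (j + 1) (f 1) q + partial_deriv e x (j + 1) (f (i + 1)) q \<and>
    partial_deriv e x j (f n) q = f n q * partial_deriv e x (j + 1) (f 1) q"
  let ?closed = "\<lambda>x. closed_form_on (omega_form e x f) (coord x ` dom_of x) \<and>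
    closed_form_on (pullback_op L x (omega_form e x f)) (coord x ` dom_of x)"
  note e = enum[unfolded dim(1)]
    and n2 = dim(2)[unfolded dim(1)]
  have cp: "\<forall>x\<in>coordinate_systems A. \<forall>q\<in>U \<inter> dom_of x. \<forall>t.
      det (mat t - L x q) = t ^ CARD('n) - (\<Sum>i=1..CARD('n). f i q * t ^ (CARD('n) - i))"
    using char_poly unfolding dim(1) by blast
  note comp1_torsion = comp1_chart_torsion[OF atlas nbhd(1) L e cp n2] and comp2_torsion = comp2_chart_torsion[OF atlas nbhd(1) L e cp n2]
    and exist = companion_chart_exists[OF atlas nbhd(1) L e cp]
  have entries1: "(\<forall>i\<in>{1..n}. \<forall>j\<in>{1..n}. B $ e i $ e j = comp1_entry g i j) \<longleftrightarrow> B = comp1_mat e g" for B g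
    unfolding comp1_mat_def dim(1) by (rule mat_eq_entries[OF e, symmetric])
  have entries2: "(\<forall>i\<in>{1..n}. \<forall>j\<in>{1..n}. B $ e i $ e j = comp2_entry n g i j) \<longleftrightarrow> B = comp2_mat e g" for B g
    unfolding comp2_mat_def dim(1) by (rule mat_eq_entries[OF e, symmetric])
  obtain U\<^sub>0 where U0: "open U\<^sub>0" "p \<in> U\<^sub>0" "U\<^sub>0 \<subseteq> U"
    "\<And>V x. open V \<Longrightarrow> V \<subseteq> U\<^sub>0 \<Longrightarrow> x \<in> coordinate_systems A \<Longrightarrow> p \<in> dom_of x \<Longrightarrow> dom_of x \<subseteq> U \<Longrightarrow>
       \<forall>q\<in>dom_of x. \<forall>v w. torsion_at L x q v w = 0 \<Longrightarrow> nijenhuis_operator_on A V L"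
    by (rule nijenhuis_local[OF atlas nbhd(1) L(1) nbhd(2)]) (rule that; assumption)
  show ?thesis
  proof (intro exI[of _ U\<^sub>0] conjI U0(1-3) allI impI)
    fix V assume V: "open V" "p \<in> V" "V \<subseteq> U\<^sub>0"
    have VU: "V \<subseteq> U" using V U0 by blast
    note tz = iffD1[OF nijenhuis_on_iff[OF atlas nbhd(1) L(1) V(1) VU]]
    show "nijenhuis_operator_on A V L \<longleftrightarrow>
        (\<exists>x\<in>coordinate_systems A. p \<in> dom_of x \<and> dom_of x \<subseteq> V \<and>
          (\<forall>q\<in>dom_of x.
            (\<forall>i\<in>{1..n}. \<forall>j\<in>{1..n}. L x q $ e i $ e j = comp1_entry (\<lambda>k. f k q) i j) \<and>
            ?pde x q))"
      unfolding entries1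
    proof
      assume N: "nijenhuis_operator_on A V L"
      obtain x where x: "x \<in> coordinate_systems A" "p \<in> dom_of x" "dom_of x \<subseteq> V"
        "\<forall>q\<in>dom_of x. L x q = comp1_mat e (\<lambda>i. f i q)"
        by (rule exist[OF V(1,2) VU tz[OF N] disjI1[OF refl]]) (assumption | rule that)+
      show "\<exists>x\<in>coordinate_systems A. p \<in> dom_of x \<and> dom_of x \<subseteq> V \<and>
          (\<forall>q\<in>dom_of x. L x q = comp1_mat e (\<lambda>i. f i q) \<and> ?pde x q)"
      proof (intro bexI[OF _ x(1)] conjI[OF x(2)] conjI[OF x(3)] ballI)
        fix q assume q: "q \<in> dom_of x"
        show "L x q = comp1_mat e (\<lambda>i. f i q) \<and> ?pde x q"
          unfolding dim(1)
          by (rule conjI[OF bspec[OF x(4) q] iffD1[OF comp1_torsion[OF x(1) subset_trans[OF x(3) VU] x(4) q]]])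
            (use tz[OF N] x(1) q x(3) in blast)
      qed
    next
      assume "\<exists>x\<in>coordinate_systems A. p \<in> dom_of x \<and> dom_of x \<subseteq> V \<and>
          (\<forall>q\<in>dom_of x. L x q = comp1_mat e (\<lambda>i. f i q) \<and> ?pde x q)"
      then obtain x where x: "x \<in> coordinate_systems A" "p \<in> dom_of x" "dom_of x \<subseteq> V"
        "\<forall>q\<in>dom_of x. L x q = comp1_mat e (\<lambda>i. f i q)"
        "\<And>q. q \<in> dom_of x \<Longrightarrow> ?pde x q" by blast
      have xU: "dom_of x \<subseteq> U" using x(3) VU by blast
      show "nijenhuis_operator_on A V L"
      \<comment> \<open>It suffices to kill the torsion on the domain of \<open>x\<close>; the
        choice of \<open>U\<^sub>0\<close> extends this to \<open>V\<close>.\<close>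
      proof (rule U0(4)[OF V(1,3) x(1,2) xU], intro ballI allI)
        fix q v w assume q: "q \<in> dom_of x"
        show "torsion_at L x q v w = 0"
          using iffD2[OF comp1_torsion[OF x(1) xU x(4) q] x(5)[OF q, unfolded dim(1)]] by blast
      qed
    qed
    show "nijenhuis_operator_on A V L \<longleftrightarrow>
        (\<exists>x\<in>coordinate_systems A. p \<in> dom_of x \<and> dom_of x \<subseteq> V \<and>
          (\<forall>q\<in>dom_of x. \<forall>i\<in>{1..n}. \<forall>j\<in>{1..n}.
             L x q $ e i $ e j = comp2_entry n (\<lambda>k. f k q) i j) \<and>
          ?closed x)"
      unfolding entries2
    proof
      assume N: "nijenhuis_operator_on A V L"
      obtain x where x: "x \<in> coordinate_systems A" "p \<in> dom_of x" "dom_of x \<subseteq> V"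
        "\<forall>q\<in>dom_of x. L x q = comp2_mat e (\<lambda>i. f i q)"
        by (rule exist[OF V(1,2) VU tz[OF N] disjI2[OF refl]]) (assumption | rule that)+
      have "(\<forall>v w. ext_deriv (omega_form e x f) (coord x q) v w = 0) \<and>
          (\<forall>v w. ext_deriv (pullback_op L x (omega_form e x f)) (coord x q) v w = 0)" if q: "q \<in> dom_of x" for q
        by (rule iffD1[OF comp2_torsion[OF x(1) subset_trans[OF x(3) VU] x(4) q]])
          (use tz[OF N] x(1) q x(3) in blast)
      then show "\<exists>x\<in>coordinate_systems A. p \<in> dom_of x \<and> dom_of x \<subseteq> V \<and>
          (\<forall>q\<in>dom_of x. L x q = comp2_mat e (\<lambda>i. f i q)) \<and> ?closed x"
        unfolding closed_form_on_def using x by blast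
    next
      assume "\<exists>x\<in>coordinate_systems A. p \<in> dom_of x \<and> dom_of x \<subseteq> V \<and>
          (\<forall>q\<in>dom_of x. L x q = comp2_mat e (\<lambda>i. f i q)) \<and> ?closed x"
      then obtain x where x: "x \<in> coordinate_systems A" "p \<in> dom_of x" "dom_of x \<subseteq> V"
        "\<forall>q\<in>dom_of x. L x q = comp2_mat e (\<lambda>i. f i q)"
        "closed_form_on (omega_form e x f) (coord x ` dom_of x)"
        "closed_form_on (pullback_op L x (omega_form e x f)) (coord x ` dom_of x)" by blast
      have xU: "dom_of x \<subseteq> U" using x(3) VU by blast
      show "nijenhuis_operator_on A V L"
      proof (rule U0(4)[OF V(1,3) x(1,2) xU], intro ballI allI)
        fix q v w assume q: "q \<in> dom_of x"
        have "(\<forall>v w. ext_deriv (omega_form e x f) (coord x q) v w = 0) \<and>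
          (\<forall>v w. ext_deriv (pullback_op L x (omega_form e x f)) (coord x q) v w = 0)"
          using x(5,6) q unfolding closed_form_on_def by blast
        then show "torsion_at L x q v w = 0"
          using comp2_torsion[OF x(1) xU x(4) q] by blast
      qed
    qed
  qed
qed

end
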